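(* Let $K\in\{0,\pm1\}$ and let $M^n=\partial\Omega$ be a smooth, closed, connected hypersurface in the space form $S_K^{n+1}$. Set $v_K(x):=h_K(\operatorname{arccot}_K(x))$. Then $\Omega$ is a geodesic ball if and only if the normalised mean curvature of $M$ satisfies $E_1\equiv c$ for a constant $c$ with $v_K(c)=\dfrac{|\Omega|}{|M|}$.
   Context: $S_K^{n+1}$ is the simply connected space form of curvature $K$: $\mathbb S^{n+1},\mathbb R^{n+1},\mathbb H^{n+1}$ for $K=1,0,-1$. Set $s_K(t)=\sin t,\ t,\ \sinh t$ and $c_K(t)=\cos t,\ 1,\ \cosh t$ respectively, and $\cot_K=c_K/s_K$. $\operatorname{arccot}_K$ is the inverse of $\cot_K$ on positive arguments: for $K=1$ it is $\operatorname{arccot}:\mathbb R\to(0,\pi)$, for $K=0$ it is $x\mapsto1/x$ on $(0,\infty)$, and for $K=-1$ it is $\operatorname{arccoth}$ on $(1,\infty)$. The condition $v_K(c)=|\Omega|/|M|$ includes that $c$ lies in the domain of $\operatorname{arccot}_K$. The function $$h_K(r)=\frac{\int_0^rs_K(t)^n\,dt}{s_K(r)^n}$$ is the ratio of the volume of a geodesic ball of radius $r$ in $S_K^{n+1}$ to the area of its boundary sphere. $\Omega$ is the bounded domain enclosed by $M$, $\nu$ the outward unit normal, $A(X,Y)=\langle\overline\nabla_X\nu,Y\rangle$ the second fundamental form, and $E_1=\frac1n\operatorname{tr}A$. $|\Omega|$ and $|M|$ are the volume and the area. *)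

theory Defs
  imports "HOL-Analysis.Analysis"
begin

section \<open>Generalised trigonometric functions\<close>

text \<open>Throughout, the curvature \<^term>\<open>K :: real\<close> is meant to be \<open>-1\<close>, \<open>0\<close> or \<open>1\<close>.\<close>

definition s_K :: "real \<Rightarrow> real \<Rightarrow> real" where
  "s_K K t = (if K = 1 then sin t else if K = 0 then t else sinh t)"

definition c_K :: "real \<Rightarrow> real \<Rightarrow> real" where
  "c_K K t = (if K = 1 then cos t else if K = 0 then 1 else cosh t)"

definition cot_K :: "real \<Rightarrow> real \<Rightarrow> real" where
  "cot_K K t = c_K K t / s_K K t"

definition radii :: "real \<Rightarrow> real set" where
  "radii K = (if K = 1 then {0<..<pi} else {0<..})"

definition arccot_dom :: "real \<Rightarrow> real set" where
  "arccot_dom K = (if K = 1 then UNIV else if K = 0 then {0<..} else {1<..})"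

text \<open>\<^term>\<open>cot_K K\<close> is a bijection from \<^term>\<open>radii K\<close> onto \<^term>\<open>arccot_dom K\<close>;
  outside of the latter set the value of \<open>arccot_K\<close> is meaningless.\<close>

definition arccot_K :: "real \<Rightarrow> real \<Rightarrow> real" where
  "arccot_K K = inv_into (radii K) (cot_K K)"

definition h_K :: "real \<Rightarrow> nat \<Rightarrow> real \<Rightarrow> real" where
  "h_K K n r = integral {0..r} (\<lambda>t. s_K K t ^ n) / s_K K r ^ n"

definition v_K :: "real \<Rightarrow> nat \<Rightarrow> real \<Rightarrow> real" where
  "v_K K n x = h_K K n (arccot_K K x)"

section \<open>The space forms\<close>

text \<open>
  All three space forms are realised as hypersurfaces of \<open>\<real> \<times> V\<close>, where \<open>V\<close> is a Euclidean
  space, with the metric induced by the bilinear form \<open>metric_K K\<close>: for \<open>K = 1\<close> this is the unit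
  sphere in Euclidean space, for \<open>K = 0\<close> the affine subspace \<open>{1} \<times> V\<close>, and for \<open>K = -1\<close> the
  upper sheet of the hyperboloid in Minkowski space. In each case the induced metric is positive
  definite, and the dimension is that of \<open>V\<close>.
\<close>

definition metric_K :: "real \<Rightarrow> real \<times> 'v::euclidean_space \<Rightarrow> real \<times> 'v \<Rightarrow> real" where
  "metric_K K v w = K * fst v * fst w + snd v \<bullet> snd w"

definition space_form :: "real \<Rightarrow> (real \<times> 'v::euclidean_space) set" where
  "space_form K = {(t, x). t\<^sup>2 + K * (norm x)\<^sup>2 = 1 \<and> (K \<le> 0 \<longrightarrow> t > 0)}"

definition tangent_space :: "'w::real_normed_vector set \<Rightarrow> 'w \<Rightarrow> 'w set" where
  "tangent_space N p = {X. \<exists>\<gamma> :: real \<Rightarrow> 'w.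
     (\<forall>t. \<gamma> t \<in> N) \<and> \<gamma> 0 = p \<and> (\<gamma> has_vector_derivative X) (at 0)}"

text \<open>The geodesic with initial point \<open>p\<close> and initial velocity a unit tangent vector \<open>v\<close>.\<close>

definition geodesic :: "real \<Rightarrow> real \<times> 'v::euclidean_space \<Rightarrow> real \<times> 'v \<Rightarrow> real \<Rightarrow> real \<times> 'v" where
  "geodesic K p v t = c_K K t *\<^sub>R p + s_K K t *\<^sub>R v"

definition geodesic_ball :: "real \<Rightarrow> real \<times> 'v::euclidean_space \<Rightarrow> real \<Rightarrow> (real \<times> 'v) set" where
  "geodesic_ball K p r = {geodesic K p v t | v t.
     v \<in> tangent_space (space_form K) p \<and> metric_K K v v = 1 \<and> 0 \<le> t \<and> t < r}"

definition is_geodesic_ball :: "real \<Rightarrow> (real \<times> 'v::euclidean_space) set \<Rightarrow> bool" where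
  "is_geodesic_ball K \<Omega> \<longleftrightarrow> (\<exists>p\<in>space_form K. \<exists>r>0. \<Omega> = geodesic_ball K p r)"

section \<open>Smooth submanifolds and their Riemannian measure\<close>

primrec Ck_on :: "nat \<Rightarrow> ('a::real_normed_vector \<Rightarrow> 'b::real_normed_vector) \<Rightarrow> 'a set \<Rightarrow> bool" where
  "Ck_on 0 f W \<longleftrightarrow> continuous_on W f"
| "Ck_on (Suc k) f W \<longleftrightarrow> (\<forall>x\<in>W. f differentiable (at x)) \<and>
     (\<forall>v. Ck_on k (\<lambda>x. frechet_derivative f (at x) v) W)"

text \<open>Only used for open sets \<open>W\<close>.\<close>

definition smooth_on :: "('a::real_normed_vector \<Rightarrow> 'b::real_normed_vector) \<Rightarrow> 'a set \<Rightarrow> bool" where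
  "smooth_on f W \<longleftrightarrow> (\<forall>k. Ck_on k f W)"

definition local_parametrization ::
    "'w::real_normed_vector set \<Rightarrow> (real^'k \<Rightarrow> 'w) \<Rightarrow> (real^'k) set \<Rightarrow> bool" where
  "local_parametrization N \<phi> W \<longleftrightarrow>
     open W \<and> smooth_on \<phi> W \<and> openin (top_of_set N) (\<phi> ` W) \<and>
     (\<exists>\<psi>. homeomorphism W (\<phi> ` W) \<phi> \<psi>) \<and>
     (\<forall>u\<in>W. inj (frechet_derivative \<phi> (at u)))"

text \<open>Embedded submanifolds without boundary; the dimension is the cardinality of the type \<open>'k\<close>.\<close>

definition smooth_submanifold :: "'k::finite itself \<Rightarrow> 'w::real_normed_vector set \<Rightarrow> bool" where
  "smooth_submanifold _ N \<longleftrightarrow>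
     (\<forall>p\<in>N. \<exists>(\<phi> :: real^'k \<Rightarrow> 'w) W. local_parametrization N \<phi> W \<and> p \<in> \<phi> ` W)"

text \<open>The density \<open>sqrt (det g\<^sub>i\<^sub>j)\<close> of the Riemannian measure in a local parametrization.\<close>

definition volume_density ::
    "real \<Rightarrow> (real^'k \<Rightarrow> real \<times> 'v::euclidean_space) \<Rightarrow> real^'k \<Rightarrow> real" where
  "volume_density K \<phi> u = sqrt (det (\<chi> i j. metric_K K
     (frechet_derivative \<phi> (at u) (axis i 1)) (frechet_derivative \<phi> (at u) (axis j 1)) :: real^'k^'k))"

text \<open>
  The Riemannian measure of a submanifold \<open>N\<close> of a space form: the unique Borel measure on \<open>N\<close>
  that is given by integrating the density in every local parametrization.
\<close>

definition riemannian_measure ::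
    "'k::finite itself \<Rightarrow> real \<Rightarrow> (real \<times> 'v::euclidean_space) set \<Rightarrow> (real \<times> 'v) measure" where
  "riemannian_measure _ K N = (THE \<mu>. sets \<mu> = sets (restrict_space borel N) \<and>
     (\<forall>(\<phi> :: real^'k \<Rightarrow> real \<times> 'v) W. local_parametrization N \<phi> W \<longrightarrow>
        (\<forall>B\<in>sets borel. B \<subseteq> W \<longrightarrow>
           emeasure \<mu> (\<phi> ` B) = (\<integral>\<^sup>+u\<in>B. ennreal (volume_density K \<phi> u) \<partial>lborel))))"

section \<open>Hypersurfaces bounding a domain\<close>

text \<open>
  From here on \<open>n\<close> is the cardinality of the type \<open>'n\<close> (so \<open>n \<ge> 1\<close>), and the space form has
  dimension \<open>n + 1\<close>, the cardinality of \<open>'n option\<close>.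
\<close>

definition domain_volume :: "real \<Rightarrow> (real \<times> (real^('n::finite option))) set \<Rightarrow> real" where
  "domain_volume K \<Omega> = measure (riemannian_measure TYPE('n option) K (space_form K)) \<Omega>"

definition boundary_area :: "real \<Rightarrow> (real \<times> (real^('n::finite option))) set \<Rightarrow> real" where
  "boundary_area K M = measure (riemannian_measure TYPE('n) K M) M"

text \<open>The outward unit normal \<open>\<nu>\<close> of \<open>M = \<partial>\<Omega>\<close>.\<close>

definition outward_normal ::
    "real \<Rightarrow> (real \<times> 'v::euclidean_space) set \<Rightarrow> (real \<times> 'v) set \<Rightarrow> real \<times> 'v \<Rightarrow> real \<times> 'v" where
  "outward_normal K \<Omega> M p = (THE v. v \<in> tangent_space (space_form K) p \<and> metric_K K v v = 1 \<and>
     (\<forall>X\<in>tangent_space M p. metric_K K v X = 0) \<and>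
     (\<exists>\<epsilon>>0. \<forall>t. 0 < t \<and> t < \<epsilon> \<longrightarrow> geodesic K p v t \<notin> \<Omega> \<and> geodesic K p v (- t) \<in> \<Omega>))"

text \<open>Orthogonal projection of \<open>\<real> \<times> V\<close> onto the tangent space of the space form at \<open>p\<close>; for
  \<open>K = 0\<close> it is the identity, which suffices because derivatives of fields tangent to \<open>{1} \<times> V\<close>
  are again tangent to it.\<close>

definition tangential :: "real \<Rightarrow> real \<times> 'v::euclidean_space \<Rightarrow> real \<times> 'v \<Rightarrow> real \<times> 'v" where
  "tangential K p w = w - (K * metric_K K w p) *\<^sub>R p"

text \<open>
  The Levi-Civita derivative in the space form, in direction \<open>X \<in> T\<^sub>pM\<close>, of a tangent
  field \<open>\<xi>\<close> along \<open>M\<close>: the tangential part of the flat derivative. A derivative within \<open>M\<close> is not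
  unique as a linear map on the ambient space, but its values on \<open>T\<^sub>pM\<close> are.
\<close>

definition covariant_derivative ::
    "real \<Rightarrow> (real \<times> 'v::euclidean_space) set \<Rightarrow> (real \<times> 'v \<Rightarrow> real \<times> 'v) \<Rightarrow>
     real \<times> 'v \<Rightarrow> real \<times> 'v \<Rightarrow> real \<times> 'v" where
  "covariant_derivative K M \<xi> p X = tangential K p (frechet_derivative \<xi> (at p within M) X)"

definition second_fundamental_form ::
    "real \<Rightarrow> (real \<times> 'v::euclidean_space) set \<Rightarrow> (real \<times> 'v) set \<Rightarrow>
     real \<times> 'v \<Rightarrow> real \<times> 'v \<Rightarrow> real \<times> 'v \<Rightarrow> real" where
  "second_fundamental_form K \<Omega> M p X Y =
     metric_K K (covariant_derivative K M (outward_normal K \<Omega> M) p X) Y"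

definition orthonormal_basis ::
    "real \<Rightarrow> (real \<times> 'v::euclidean_space) set \<Rightarrow> (real \<times> 'v) set \<Rightarrow> bool" where
  "orthonormal_basis K T B \<longleftrightarrow> finite B \<and> span B = T \<and>
     (\<forall>e\<in>B. \<forall>f\<in>B. metric_K K e f = (if e = f then 1 else 0))"

text \<open>The trace of a bilinear form on \<open>T\<close> with respect to the metric; it does not depend on the
  chosen basis.\<close>

definition trace_on ::
    "real \<Rightarrow> (real \<times> 'v::euclidean_space) set \<Rightarrow> (real \<times> 'v \<Rightarrow> real \<times> 'v \<Rightarrow> real) \<Rightarrow> real" where
  "trace_on K T A = (\<Sum>e\<in>(SOME B. orthonormal_basis K T B). A e e)"

text \<open>The normalised mean curvature \<open>E\<^sub>1\<close>.\<close>

definition mean_curvature ::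
    "real \<Rightarrow> (real \<times> (real^('n::finite option))) set \<Rightarrow> (real \<times> (real^('n option))) set \<Rightarrow>
     real \<times> (real^('n option)) \<Rightarrow> real" where
  "mean_curvature K \<Omega> M p =
     trace_on K (tangent_space M p) (second_fundamental_form K \<Omega> M p) / real CARD('n)"

end

theory Submission
  imports Defs
begin

text \<open>
  The theorem is the case of equality in the Heintze--Karcher inequality. Let \<open>G(p, t)\<close> be the point
  at distance \<open>t\<close> from \<open>p \<in> M\<close> on the inward normal, and let the mean curvature be constant, equal
  to \<open>cot\<^sub>K r\<close>. Every point of \<open>\<Omega>\<close> is of the form \<open>G(p, t)\<close> with \<open>t > 0\<close> and \<open>p\<close> a point of \<open>M\<close>
  nearest to it. Minimality of the distance makes \<open>c\<^sub>K(t) I - s\<^sub>K(t) S\<close> positive semidefinite, where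
  \<open>S\<close> is the shape operator at \<open>p\<close>. Its trace is \<open>n s\<^sub>K(r - t) / s\<^sub>K(r)\<close>, so \<open>t \<le> r\<close>, and by the
  inequality of arithmetic and geometric means its determinant, the Jacobian of \<open>G\<close>, is at most
  \<open>(s\<^sub>K(r - t) / s\<^sub>K(r))\<^sup>n\<close>. Integration gives \<open>|\<Omega>| \<le> |M| h\<^sub>K(r)\<close>.

  If equality holds, then every \<open>p \<in> M\<close> is nearest to \<open>G(p, t)\<close> for all \<open>t < r\<close>: the set of exceptions
  is open, and would contribute a positive loss. In the limit \<open>t = r\<close> the endomorphism is positive
  semidefinite with trace \<open>0\<close>, hence vanishes. It is the derivative of \<open>G(-, r)\<close>, which is therefore
  constant, and \<open>\<Omega>\<close> is the ball of radius \<open>r\<close> around its value. Conversely, for a ball all steps are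
  equalities.

  For the outward normal to exist, \<open>\<Omega>\<close> has to lie on one side of \<open>M\<close> only. Otherwise \<open>M\<close> would give
  rise to a connected double covering of the space form, which is simply connected.
\<close>

section \<open>Change of variables over arbitrary finite index types\<close>

text \<open>Distances are never defined. The squared chord \<open>qdist\<close> replaces them:
  between the ends of a geodesic of length t (at most pi when K = 1) it is 4 s_K(t/2)^2, an
  increasing function of t, and it is a quadratic polynomial in the ambient coordinates.
  Semidefiniteness at a nearest point is then the second derivative test for \<open>qdist\<close>
  along a curve in M. Trace and determinant of the shape operator are taken after the tangent space
  has been identified with R^n by the isometry of a \<open>shape_frame\<close>; the same
  factorization of the chart derivative carries the area density, which therefore splits off as a
  factor from the Jacobian of G. Since G need not be injective, even on nearest points, and the
  measures are given by a description, the integration rests on an area formula for countable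
  atlases cut into disjoint pieces. Equality is exploited in one chart only: an atlas can be chosen
  whose piece number 0 is an entire prescribed chart, and an open set of exceptions there already
  costs volume.\<close>

text \<open>The change of variables theorems of the library need a well-ordered index type; the following
  copy of a finite type provides one.\<close>

typedef 'a wo_index = "{..<CARD('a::finite)}"
  by (auto intro: exI[of _ 0])

setup_lifting type_definition_wo_index

instantiation wo_index :: (finite) wellorder
begin
lift_definition less_wo_index :: "'a wo_index \<Rightarrow> 'a wo_index \<Rightarrow> bool" is "(<)" .
lift_definition less_eq_wo_index :: "'a wo_index \<Rightarrow> 'a wo_index \<Rightarrow> bool" is "(\<le>)" .
instance
proof
  fix P :: "'a wo_index \<Rightarrow> bool" and a
  assume step: "\<And>x. (\<And>y. y < x \<Longrightarrow> P y) \<Longrightarrow> P x"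
  have "wf {(x, y :: 'a wo_index). x < y}"
    by (rule wf_subset[OF wf_measure[of Rep_wo_index]]) (auto simp: less_wo_index.rep_eq)
  then show "P a"
    by (induction a rule: wf_induct_rule) (auto intro: step)
qed (transfer; auto)+
end

lemma bij_betw_Rep_wo_index: "bij_betw Rep_wo_index (UNIV :: 'a::finite wo_index set) {..<CARD('a)}"
  by (metis type_definition_wo_index type_definition.Rep_inject type_definition.Rep_range
      bij_betw_def inj_def)

instance wo_index :: (finite) finite
  by standard (use bij_betw_finite[OF bij_betw_Rep_wo_index] in auto)

lemma ex_bij_wo_index: "\<exists>b :: 'a::finite wo_index \<Rightarrow> 'a. bij b"
  using bij_betw_same_card[OF bij_betw_Rep_wo_index[where 'a = 'a]]
  by (intro finite_same_card_bij) auto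

lemma Basis_vec_eq_range: "(Basis :: (real^'k::finite) set) = range (\<lambda>i. axis i 1)"
  by (auto simp: Basis_vec_def)

text \<open>Boxes pull back to boxes with permuted side lengths, and a measure with the right values
  on boxes is \<open>lborel\<close>. Domain and codomain may be different types, so that one
  statement covers both renaming of coordinates and splitting one coordinate off a vector.\<close>

lemma distr_lborel_linear_Basis:
  fixes T :: "'a::euclidean_space \<Rightarrow> 'b::euclidean_space"
  assumes T: "linear T" and bij: "bij_betw T Basis Basis"
  shows "distr lborel borel T = lborel"
proof (rule lborel_eqI[symmetric])
  have [measurable]: "T \<in> borel_measurable borel"
    using T by (intro borel_measurable_continuous_onI linear_continuous_on) (simp add: linear_conv_bounded_linear)
  have inner: "T x \<bullet> T b = x \<bullet> b" if "b \<in> Basis" for x b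
  proof -
    have "T x = T (\<Sum>c\<in>Basis. (x \<bullet> c) *\<^sub>R c)"
      by (simp add: euclidean_representation)
    also have "\<dots> = (\<Sum>c\<in>Basis. (x \<bullet> c) *\<^sub>R T c)"
      using T by (simp add: linear_sum linear_cmul)
    finally have "T x \<bullet> T b = (\<Sum>c\<in>Basis. (x \<bullet> c) * (T c \<bullet> T b))"
      by (simp add: inner_sum_left)
    also have "\<dots> = (\<Sum>c\<in>Basis. (x \<bullet> c) * (c \<bullet> b))"
    proof (intro sum.cong refl)
      fix c :: 'a assume "c \<in> Basis"
      then show "x \<bullet> c * (T c \<bullet> T b) = x \<bullet> c * (c \<bullet> b)"
        using bij that by (simp add: inner_Basis bij_betw_def inj_on_eq_iff image_iff)
           (metis bij bij_betwE inner_Basis inj_on_eq_iff bij_betw_def)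
    qed
    also have "\<dots> = x \<bullet> b"
      by (subst (3) euclidean_representation[symmetric]) (simp only: inner_sum_left inner_scaleR_left)
    finally show ?thesis .
  qed
  fix l u :: 'b assume le: "\<And>b. b \<in> Basis \<Longrightarrow> l \<bullet> b \<le> u \<bullet> b"
  define l' u' where "l' = (\<Sum>b\<in>Basis. (l \<bullet> T b) *\<^sub>R b)" and "u' = (\<Sum>b\<in>Basis. (u \<bullet> T b) *\<^sub>R b)"
  have TB: "T ` Basis = Basis"
    using bij by (simp add: bij_betw_def)
  have "T -` box l u = box l' u'"
    unfolding box_def l'_def u'_def TB[symmetric] by (auto simp: inner)
  then have "emeasure (distr lborel borel T) (box l u) = emeasure lborel (box l' u')"
    by (simp add: emeasure_distr)
  also have "\<dots> = (\<Prod>b\<in>Basis. (u' - l') \<bullet> b)"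
    using le TB by (subst emeasure_lborel_box) (auto simp: l'_def u'_def)
  also have "(\<Prod>b\<in>Basis. (u' - l') \<bullet> b) = (\<Prod>b\<in>Basis. (u - l) \<bullet> T b)"
    by (intro prod.cong refl) (simp add: inner_diff_left l'_def u'_def)
  also have "\<dots> = (\<Prod>b\<in>Basis. (u - l) \<bullet> b)"
    by (rule prod.reindex_bij_betw[OF bij])
  finally show "emeasure (distr lborel borel T) (box l u) = (\<Prod>b\<in>Basis. (u - l) \<bullet> b)" .
qed simp

text \<open>\<open>f\<close> may be merely Lebesgue measurable because indicators of images under
  differentiable maps will occur in it. It is replaced by an almost everywhere equal Borel function;
  the preimage under \<open>T\<close> of the exceptional null set is null again.\<close>

lemma nn_integral_lborel_linear_Basis:
  fixes T :: "'a::euclidean_space \<Rightarrow> 'b::euclidean_space" and f :: "'b \<Rightarrow> ennreal"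
  assumes T: "linear T" and bij: "bij_betw T Basis Basis" and f: "f \<in> borel_measurable lebesgue"
  shows "(\<integral>\<^sup>+x. f (T x) \<partial>lborel) = (\<integral>\<^sup>+y. f y \<partial>lborel)"
proof -
  have T': "T \<in> lborel \<rightarrow>\<^sub>M borel"
    using T by (auto intro!: borel_measurable_continuous_onI linear_continuous_on simp: linear_conv_bounded_linear)
  obtain g where g[measurable]: "g \<in> borel_measurable borel" and ae: "AE y in lborel. f y = g y"
    using completion_ex_borel_measurable[OF f] by auto
  have "AE y in distr lborel borel T. f y = g y"
    using ae by (subst distr_lborel_linear_Basis[OF T bij])
  then have "AE x in lborel. f (T x) = g (T x)"
    by (rule AE_distrD[OF T'])
  then have "(\<integral>\<^sup>+x. f (T x) \<partial>lborel) = (\<integral>\<^sup>+x. g (T x) \<partial>lborel)"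
    by (rule nn_integral_cong_AE)
  also have "\<dots> = (\<integral>\<^sup>+y. g y \<partial>distr lborel borel T)"
    by (rule nn_integral_distr[symmetric]) (use T' in auto)
  also have "\<dots> = (\<integral>\<^sup>+y. f y \<partial>lborel)"
    unfolding distr_lborel_linear_Basis[OF T bij] using ae by (intro nn_integral_cong_AE) auto
  finally show ?thesis .
qed

lemma borel_measurable_lebesgue:
  "f \<in> borel_measurable borel \<Longrightarrow> f \<in> borel_measurable lebesgue"
  by (rule measurable_completion) (simp add: measurable_lborel1)

text \<open>Conjugation by \<open>b\<close> maps the permutations of one index type onto those of
  the other and preserves signs, so the Leibniz sums agree term by term.\<close>

lemma det_reindex:
  fixes A :: "real^'n::finite^'n" and b :: "'m::finite \<Rightarrow> 'n"
  assumes b: "bij b"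
  shows "det (\<chi> i j. A $ b i $ b j :: real^'m^'m) = det A"
proof -
  have map: "map_permutation UNIV b p = b \<circ> p \<circ> inv b" for p
    using b by (auto simp: map_permutation_def restrict_id_def fun_eq_iff bij_is_surj)
  have "det A = (\<Sum>q\<in>{q. q permutes UNIV}. of_int (sign q) * (\<Prod>i\<in>UNIV. A $ i $ q i))"
    by (simp add: det_def)
  also have "\<dots> = (\<Sum>p\<in>{p::'m\<Rightarrow>'m. p permutes UNIV}. of_int (sign p) * (\<Prod>i\<in>UNIV. A $ b i $ b (p i)))"
  proof (rule sum.reindex_bij_witness[of _ "map_permutation UNIV b" "map_permutation UNIV (inv b)"])
    fix q :: "'n \<Rightarrow> 'n" assume q: "q \<in> {q. q permutes UNIV}"
    have ib: "bij (inv b)" using b by (rule bij_imp_bij_inv)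
    have mi: "map_permutation UNIV (inv b) q = inv b \<circ> q \<circ> b"
      using b ib by (auto simp: map_permutation_def restrict_id_def fun_eq_iff inv_inv_eq bij_is_surj)
    show "map_permutation UNIV b (map_permutation UNIV (inv b) q) = q"
      using b by (simp add: map mi fun_eq_iff bij_is_surj surj_f_inv_f)
    show "map_permutation UNIV (inv b) q \<in> {p. p permutes UNIV}"
      using q ib by (auto intro!: map_permutation_permutes)
    have "(\<Prod>i\<in>UNIV. A $ b i $ b ((inv b \<circ> q \<circ> b) i)) = (\<Prod>i\<in>UNIV. A $ b i $ q (b i))"
      using b by (simp add: bij_is_surj surj_f_inv_f)
    also have "\<dots> = (\<Prod>i\<in>UNIV. A $ i $ q i)"
      using b by (rule prod.reindex_bij_betw)
    finally show "of_int (sign (map_permutation UNIV (inv b) q)) *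
        (\<Prod>i\<in>UNIV. A $ b i $ b (map_permutation UNIV (inv b) q i)) =
        of_int (sign q) * (\<Prod>i\<in>UNIV. A $ i $ q i)"
      using q ib by (subst sign_map_permutation) (auto simp: mi bij_is_inj)
  next
    fix p :: "'m \<Rightarrow> 'm" assume p: "p \<in> {p. p permutes UNIV}"
    show "map_permutation UNIV b p \<in> {q. q permutes UNIV}"
      using p b by (auto intro!: map_permutation_permutes)
    show "map_permutation UNIV (inv b) (map_permutation UNIV b p) = p"
      using b p bij_imp_bij_inv[OF b]
      by (auto simp: map map_permutation_def restrict_id_def fun_eq_iff inv_inv_eq bij_is_surj bij_is_inj)
  qed
  also have "\<dots> = det (\<chi> i j. A $ b i $ b j :: real^'m^'m)"
    by (simp add: det_def)
  finally show ?thesis ..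
qed

text \<open>Change of variables for the gauge integral presupposes integrability. For a nonnegative
  integrand the remaining case is an infinite integral on the larger side, where there is nothing to
  prove, so the statements hold with values in [0, \<infinity>].\<close>

lemma nn_integral_image_wo_index:
  fixes g :: "real^'m::{finite,wellorder} \<Rightarrow> real^'m::_" and f :: "real^'m::_ \<Rightarrow> real"
  assumes S: "S \<in> sets borel"
    and der: "\<And>x. x \<in> S \<Longrightarrow> (g has_derivative g' x) (at x within S)"
    and f: "f \<in> borel_measurable borel" and nonneg: "\<And>y. 0 \<le> f y"
  shows nn_integral_image_le_wo_index:
      "(\<integral>\<^sup>+y. ennreal (f y) * indicator (g ` S) y \<partial>lborel)
       \<le> (\<integral>\<^sup>+x. ennreal (\<bar>det (matrix (g' x))\<bar> * f (g x)) * indicator S x \<partial>lborel)" (is "?l \<le> ?r")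
    and nn_integral_image_eq_wo_index: "inj_on g S \<Longrightarrow>
      (\<integral>\<^sup>+y. ennreal (f y) * indicator (g ` S) y \<partial>lborel)
       = (\<integral>\<^sup>+x. ennreal (\<bar>det (matrix (g' x))\<bar> * f (g x)) * indicator S x \<partial>lborel)"
    and image_sets_lebesgue: "g ` S \<in> sets lebesgue"
    and measurable_jacobian_integrand:
      "(\<lambda>x. ennreal (\<bar>det (matrix (g' x))\<bar> * f (g x)) * indicator S x) \<in> borel_measurable lebesgue"
proof -
  define h where "h = (\<lambda>x. \<bar>det (matrix (g' x))\<bar> * f (g x))"
  have SL: "S \<in> sets lebesgue" using S by auto
  have cont: "continuous_on S g"
    using der by (meson has_derivative_continuous continuous_on_eq_continuous_within)
  have gm: "g \<in> measurable (lebesgue_on S) borel"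
    by (rule continuous_imp_measurable_on_sets_lebesgue[OF cont SL])
  have "h \<in> borel_measurable (lebesgue_on S)"
    unfolding h_def
    by (intro borel_measurable_times borel_measurable_abs borel_measurable_det_Jacobian[OF SL der]
        measurable_compose[OF gm f]) auto
  then have hm: "(\<lambda>x. if x \<in> S then h x else 0) \<in> borel_measurable lebesgue"
    by (simp add: borel_measurable_if_I SL)
  have h0: "0 \<le> h x" for x using nonneg by (simp add: h_def)
  have eq: "ennreal (h x) * indicator S x = ennreal (if x \<in> S then h x else 0)" for x
    by auto
  show meas: "(\<lambda>x. ennreal (\<bar>det (matrix (g' x))\<bar> * f (g x)) * indicator S x) \<in> borel_measurable lebesgue"
    unfolding h_def[symmetric] fun_cong[OF h_def, symmetric] eq using hm by measurable
  show gS: "g ` S \<in> sets lebesgue"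
    by (rule differentiable_image_in_sets_lebesgue)
       (use der S in \<open>auto simp: differentiable_on_def differentiable_def\<close>)
  have ex_real: "(\<exists>r\<ge>0. X = ennreal r) \<longleftrightarrow> X < \<infinity>" for X :: ennreal
    by (cases X) auto
  have *: "h integrable_on S \<longleftrightarrow> (\<integral>\<^sup>+x. ennreal (h x) * indicator S x \<partial>lborel) < \<infinity>"
  proof -
    have "h integrable_on S \<longleftrightarrow> (\<lambda>x. if x \<in> S then h x else 0) integrable_on UNIV"
      by (simp add: integrable_restrict_UNIV)
    also have "\<dots> \<longleftrightarrow> (\<exists>r\<ge>0. (\<integral>\<^sup>+x. ennreal (if x \<in> S then h x else 0) \<partial>lebesgue) = ennreal r)"
      unfolding integrable_on_def using hm h0
      by (subst has_integral_iff_nn_integral_lebesgue) (auto simp: ac_simps)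
    also have "\<dots> \<longleftrightarrow> (\<integral>\<^sup>+x. ennreal (h x) * indicator S x \<partial>lborel) < \<infinity>"
      unfolding nn_integral_completion eq using ex_real by blast
    finally show ?thesis .
  qed
  show le: "?l \<le> ?r"
  proof (cases "?r = \<infinity>")
    case False
    then have int: "h integrable_on S" using * by (simp add: h_def less_top)
    have A: "f integrable_on g ` S \<and> integral (g ` S) f \<le> integral S h"
      using int der nonneg unfolding h_def by (intro integral_on_image_ubound_nonneg) auto
    have "?l = ennreal (integral (g ` S) f)"
      using A nonneg by (intro nn_integral_has_integral_lebesgue') (auto simp: integrable_integral)
    also have "\<dots> \<le> ennreal (integral S h)"
      using A by (intro ennreal_leI) auto
    also have "\<dots> = (\<integral>\<^sup>+x. ennreal (h x) * indicator S x \<partial>lborel)"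
      using int h0 by (intro nn_integral_has_integral_lebesgue'[symmetric]) (auto simp: integrable_integral)
    finally show ?thesis by (simp add: h_def)
  qed simp
  show "?l = ?r" if inj: "inj_on g S"
  proof (rule antisym[OF le])
    show "?r \<le> ?l"
    proof (cases "?l = \<infinity>")
      case False
      have fm: "(\<lambda>y. if y \<in> g ` S then f y else 0) \<in> borel_measurable lebesgue"
        using gS f by (intro borel_measurable_if_I measurable_restrict_space1 borel_measurable_lebesgue) auto
      have eq': "ennreal (f y) * indicator (g ` S) y = ennreal (if y \<in> g ` S then f y else 0)" for y
        by auto
      obtain r where r: "0 \<le> r" "?l = ennreal r" using False by (cases ?l) auto
      then have fi: "((\<lambda>y. if y \<in> g ` S then f y else 0) has_integral r) UNIV"
        using fm nonneg unfolding eq' by (subst has_integral_iff_nn_integral_lebesgue) (auto simp: nn_integral_completion)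
      then have "(f has_integral r) (g ` S)"
        by (simp add: has_integral_restrict_UNIV)
      then have "f absolutely_integrable_on g ` S" "integral (g ` S) f = r"
        using nonneg by (auto simp: absolutely_integrable_on_iff_nonneg has_integral_iff)
      \<comment> \<open>The version that transfers absolute integrability in both directions is for
        vector-valued functions, hence the detour through \<open>real^1\<close>.\<close>
      then have "h absolutely_integrable_on S \<and> integral S h = r"
        using has_absolute_integral_change_of_variables[OF SL der inj, of "\<lambda>x. vec (f x) :: real^1" "vec r"]
        unfolding absolutely_integrable_on_1_iff integral_on_1_eq h_def
        by (auto simp: o_def)
      then have "(h has_integral r) S"
        by (auto simp: has_integral_iff absolutely_integrable_on_def)
      then have "(\<integral>\<^sup>+x. ennreal (h x) * indicator S x \<partial>lborel) = ennreal r"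
        using h0 by (intro nn_integral_has_integral_lebesgue') auto
      then show ?thesis by (simp add: h_def r)
    qed simp
  qed
qed

text \<open>\<open>E\<close> renames coordinates, so conjugating \<open>g\<close> by it reduces to a
  well-ordered index type; the Jacobian determinant is unchanged by \<open>det_reindex\<close> and
  the integrals by \<open>nn_integral_lborel_linear_Basis\<close>.\<close>

lemma nn_integral_image:
  fixes g :: "real^'n::finite \<Rightarrow> real^'n" and f :: "real^'n \<Rightarrow> real"
  assumes S: "S \<in> sets borel"
    and der: "\<And>x. x \<in> S \<Longrightarrow> (g has_derivative g' x) (at x within S)"
    and f: "f \<in> borel_measurable borel" and nonneg: "\<And>y. 0 \<le> f y"
  shows nn_integral_image_le:
      "(\<integral>\<^sup>+y. ennreal (f y) * indicator (g ` S) y \<partial>lborel)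
       \<le> (\<integral>\<^sup>+x. ennreal (\<bar>det (matrix (g' x))\<bar> * f (g x)) * indicator S x \<partial>lborel)" (is "?l \<le> ?r")
    and nn_integral_image_eq: "inj_on g S \<Longrightarrow>
      (\<integral>\<^sup>+y. ennreal (f y) * indicator (g ` S) y \<partial>lborel)
       = (\<integral>\<^sup>+x. ennreal (\<bar>det (matrix (g' x))\<bar> * f (g x)) * indicator S x \<partial>lborel)"
proof -
  obtain b :: "'n wo_index \<Rightarrow> 'n" where b: "bij b" using ex_bij_wo_index by blast
  define E :: "real^'n \<Rightarrow> real^'n wo_index" where "E x = (\<chi> i. x $ b i)" for x
  define E' :: "real^'n wo_index \<Rightarrow> real^'n" where "E' x = (\<chi> i. x $ inv b i)" for x
  have EE': "E (E' x) = x" "E' (E y) = y" for x y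
    using b by (simp_all add: E_def E'_def vec_eq_iff bij_is_surj bij_is_inj surj_f_inv_f)
  have lin: "linear E" "linear E'"
    by (auto simp: E_def E'_def linear_iff vec_eq_iff)
  have bl: "bounded_linear E" "bounded_linear E'"
    using lin by (auto simp: linear_conv_bounded_linear)
  have Eaxis: "E (axis i 1) = axis (inv b i) 1" for i
    using b by (auto simp: E_def axis_def vec_eq_iff bij_inv_eq_iff)
  have E'axis: "E' (axis j 1) = axis (b j) 1" for j
    using b by (metis EE'(2) Eaxis bij_is_inj inv_f_f)
  have bij: "bij_betw E Basis Basis"
    unfolding Basis_vec_eq_range
  proof (rule bij_betw_imageI)
    show "inj_on E (range (\<lambda>i. axis i 1))"
      using EE' by (metis inj_onI)
    have "E ` range (\<lambda>i. axis i 1) = (\<lambda>i. axis (inv b i) 1) ` UNIV"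
      by (simp add: image_image Eaxis)
    also have "\<dots> = (\<lambda>i. axis i 1) ` range (inv b)" by auto
    also have "range (inv b) = UNIV" using b by (simp add: bij_imp_bij_inv bij_is_surj)
    finally show "E ` range (\<lambda>i. axis i 1) = range (\<lambda>i. axis i 1)" .
  qed
  have [measurable]: "E' \<in> borel_measurable borel"
    using bl by (intro borel_measurable_continuous_onI linear_continuous_on)
  define S2 where "S2 = E ` S"
  define g2 where "g2 = E \<circ> g \<circ> E'"
  define g2' where "g2' = (\<lambda>x. E \<circ> g' (E' x) \<circ> E')"
  define f2 where "f2 = f \<circ> E'"
  have S2eq: "S2 = E' -` S" unfolding S2_def using EE' by (auto intro!: image_eqI[where x = "E' _"])
  have S2: "S2 \<in> sets borel" unfolding S2eq using S by (intro measurable_sets_borel[of E' borel]) auto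
  have der2: "(g2 has_derivative g2' x) (at x within S2)" if "x \<in> S2" for x
  proof -
    have x: "E' x \<in> S" using that S2eq by auto
    have d: "(E' has_derivative E') (at x within S2)" and sub: "E' ` S2 \<subseteq> S"
      using bl S2eq by (auto intro: bounded_linear_imp_has_derivative)
    then have "(g \<circ> E' has_derivative g' (E' x) \<circ> E') (at x within S2)"
      by (intro diff_chain_within has_derivative_subset[OF der[OF x] sub] d)
    then show ?thesis
      unfolding g2_def g2'_def comp_assoc
      by (rule diff_chain_within[OF _ bounded_linear_imp_has_derivative[OF bl(1)]])
  qed
  have f2: "f2 \<in> borel_measurable borel" "0 \<le> f2 y" for y
    using f nonneg by (auto simp: f2_def)
  have detg: "det (matrix (g2' (E x))) = det (matrix (g' x))" for x
  proof -
    have "matrix (g2' (E x)) = (\<chi> i j. matrix (g' x) $ b i $ b j)"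
      by (simp add: matrix_def g2'_def EE' E'axis vec_eq_iff) (simp add: E_def)
    then show ?thesis by (simp add: det_reindex[OF b])
  qed
  have img: "g2 ` S2 = E ` (g ` S)"
    by (auto simp: g2_def S2_def EE' image_iff)
  have inE: "E y \<in> E ` X \<longleftrightarrow> y \<in> X" for y X using EE' by (metis imageE imageI)
  note [measurable] = f2(1)
  have L: "?l = (\<integral>\<^sup>+y. ennreal (f2 y) * indicator (g2 ` S2) y \<partial>lborel)"
  proof (subst nn_integral_lborel_linear_Basis[OF lin(1) bij, symmetric])
    have [measurable]: "g2 ` S2 \<in> sets lebesgue" by (rule image_sets_lebesgue[OF S2 der2 f2])
    have [measurable]: "f2 \<in> borel_measurable lebesgue" using f2 by (intro borel_measurable_lebesgue)
    show "(\<lambda>y. ennreal (f2 y) * indicator (g2 ` S2) y) \<in> borel_measurable lebesgue" by measurable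
  qed (simp add: f2_def EE' img indicator_def inE)
  have R: "?r = (\<integral>\<^sup>+x. ennreal (\<bar>det (matrix (g2' x))\<bar> * f2 (g2 x)) * indicator S2 x \<partial>lborel)"
  proof (subst nn_integral_lborel_linear_Basis[OF lin(1) bij, symmetric])
    show "(\<lambda>x. ennreal (\<bar>det (matrix (g2' x))\<bar> * f2 (g2 x)) * indicator S2 x) \<in> borel_measurable lebesgue"
      by (rule measurable_jacobian_integrand[OF S2 der2 f2])
  qed (simp add: f2_def g2_def EE' detg indicator_def S2_def inE)
  show "?l \<le> ?r" unfolding L R by (rule nn_integral_image_le_wo_index[OF S2 der2 f2])
  assume "inj_on g S"
  then have "inj_on g2 S2"
    unfolding g2_def S2_def by (auto simp: inj_on_def EE') (metis EE'(2))
  then show "?l = ?r"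
    unfolding L R by (intro nn_integral_image_eq_wo_index[OF S2 der2 f2])
qed

section \<open>The product decomposition of coordinates indexed by an option type\<close>

text \<open>\<open>Some\<close> indexes the coordinates along a hypersurface and \<open>None\<close>
  the transversal one, so that a chart domain times an interval is again a set of coordinate
  vectors.\<close>

definition cons_vec :: "real^'n::finite \<Rightarrow> real \<Rightarrow> real^('n option)" where
  "cons_vec u t = (\<chi> i. case i of None \<Rightarrow> t | Some j \<Rightarrow> u $ j)"

definition tail_vec :: "real^('n::finite option) \<Rightarrow> real^'n" where
  "tail_vec z = (\<chi> j. z $ Some j)"

lemma cons_vec_nth [simp]: "cons_vec u t $ None = t" "cons_vec u t $ Some j = u $ j"
  by (simp_all add: cons_vec_def)

lemma tail_vec_nth [simp]: "tail_vec z $ j = z $ Some j"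
  by (simp add: tail_vec_def)

lemma tail_cons_vec [simp]: "tail_vec (cons_vec u t) = u"
  by (simp add: vec_eq_iff)

lemma cons_tail_vec [simp]: "cons_vec (tail_vec z) (z $ None) = z"
  by (simp add: vec_eq_iff cons_vec_def split: option.splits)

lemma linear_cons_vec: "linear (\<lambda>(u, t). cons_vec u t)"
  by (auto simp: linear_iff vec_eq_iff cons_vec_def split: option.splits)

lemma bounded_linear_tail_vec: "bounded_linear tail_vec"
  unfolding linear_conv_bounded_linear[symmetric] by (auto simp: linear_iff vec_eq_iff)

lemma nn_integral_cons_vec:
  fixes f :: "real^('n::finite option) \<Rightarrow> ennreal"
  assumes f: "f \<in> borel_measurable borel"
  shows "(\<integral>\<^sup>+z. f z \<partial>lborel) = (\<integral>\<^sup>+u. (\<integral>\<^sup>+t. f (cons_vec u t) \<partial>lborel) \<partial>lborel)"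
proof -
  let ?T = "\<lambda>(u :: real^'n, t). cons_vec u t"
  have inj: "inj ?T" by (auto simp: inj_def) (metis tail_cons_vec, metis cons_vec_nth(1))
  have ax: "cons_vec (axis j 1) 0 = axis (Some j) 1" "cons_vec (0::real^'n) 1 = axis None 1" for j :: 'n
    by (auto simp: vec_eq_iff cons_vec_def axis_def split: option.splits)
  have "?T ` Basis = (\<lambda>i. axis i 1) ` (range Some \<union> {None})"
    unfolding Basis_prod_def Basis_vec_eq_range by (simp add: image_Un image_image ax image_insert)
  also have "range Some \<union> {None} = (UNIV :: 'n option set)"
    by (auto simp: UNIV_option_conv)
  finally have bij: "bij_betw ?T Basis Basis"
    unfolding Basis_vec_eq_range[where 'k = "'n option"] using inj by (auto intro!: bij_betw_imageI inj_on_subset[of _ UNIV])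
  have "(\<integral>\<^sup>+z. f z \<partial>lborel) = (\<integral>\<^sup>+x. f (?T x) \<partial>lborel)"
    using f by (intro nn_integral_lborel_linear_Basis[OF linear_cons_vec bij, symmetric]
        borel_measurable_lebesgue)
  also have "\<dots> = (\<integral>\<^sup>+x. f (?T x) \<partial>(lborel \<Otimes>\<^sub>M lborel))"
    by (simp add: lborel_prod)
  also have "\<dots> = (\<integral>\<^sup>+u. (\<integral>\<^sup>+t. f (cons_vec u t) \<partial>lborel) \<partial>lborel)"
  proof (subst lborel.nn_integral_fst[symmetric])
    have "?T \<in> borel_measurable borel"
      using linear_cons_vec by (intro borel_measurable_continuous_onI linear_continuous_on)
         (simp add: linear_conv_bounded_linear)
    then show "(\<lambda>x. f (?T x)) \<in> borel_measurable (lborel \<Otimes>\<^sub>M lborel)"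
      unfolding lborel_prod using f by auto
  qed simp
  finally show ?thesis .
qed

text \<open>In the Leibniz sum a permutation that moves \<open>None\<close> picks up a zero from row
  \<open>None\<close>; those fixing it are the permutations of \<open>'n\<close>, with the same
  sign.\<close>

lemma det_cons_block:
  fixes B :: "real^'n::finite^'n"
  shows "det (\<chi> i j. case i of None \<Rightarrow> (if j = None then 1 else 0)
            | Some i' \<Rightarrow> (case j of None \<Rightarrow> 0 | Some j' \<Rightarrow> B $ i' $ j') :: real^('n option)^('n option)) = det B"
    (is "det ?M = _")
proof -
  let ?U = "UNIV :: 'n option set" and ?m = "map_permutation (UNIV :: 'n set) Some"
  have mS: "?m p (Some i) = Some (p i)" "?m p None = None" for p :: "'n \<Rightarrow> 'n" and i
    by (auto simp: map_permutation_def restrict_id_def)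
  have mperm: "?m p permutes UNIV" if "p permutes UNIV" for p
    by (rule permutes_subset[OF map_permutation_permutes[OF _ that, of Some "range Some"]])
       (auto simp: bij_betw_def)
  have inj: "inj_on ?m {p. p permutes UNIV}"
    by (auto simp: inj_on_def fun_eq_iff) (metis mS(1) option.inject)
  have zero: "(\<Prod>i\<in>?U. ?M $ i $ q i) = 0" if q: "q permutes ?U" "q \<notin> ?m ` {p. p permutes UNIV}" for q
  proof (cases "q None = None")
    case False
    then have "?M $ None $ q None = 0" by simp
    then have "\<exists>i\<in>?U. ?M $ i $ q i = 0" by blast
    then show ?thesis by (intro prod_zero) simp_all
  next
    case True
    define p where "p = (\<lambda>i. the (q (Some i)))"
    have qS: "q (Some i) = Some (p i)" for i
    proof -
      have "q (Some i) \<noteq> None" using True permutes_inj[OF q(1)] by (metis injD option.distinct(1))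
      then show ?thesis by (simp add: p_def)
    qed
    have "inj p" using qS permutes_inj[OF q(1)] by (metis injD injI option.inject)
    then have "p permutes UNIV"
      by (intro bij_imp_permutes) (auto simp: bij_def finite_UNIV_inj_surj)
    moreover have "q = ?m p"
    proof
      show "q x = ?m p x" for x by (cases x) (simp_all add: mS qS True)
    qed
    ultimately show ?thesis using q(2) by blast
  qed
  have "det ?M = (\<Sum>q\<in>{q. q permutes ?U}. of_int (sign q) * (\<Prod>i\<in>?U. ?M $ i $ q i))"
    by (simp add: det_def)
  also have "\<dots> = (\<Sum>q\<in>?m ` {p. p permutes UNIV}. of_int (sign q) * (\<Prod>i\<in>?U. ?M $ i $ q i))"
    by (rule sum.mono_neutral_right) (use zero mperm finite_permutations[of ?U] in auto)
  also have "\<dots> = (\<Sum>p\<in>{p. p permutes UNIV}. of_int (sign (?m p)) * (\<Prod>i\<in>?U. ?M $ i $ ?m p i))"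
    by (rule sum.reindex[OF inj, unfolded o_def])
  also have "\<dots> = (\<Sum>p\<in>{p. p permutes UNIV}. of_int (sign p) * (\<Prod>i\<in>UNIV. B $ i $ p i))"
  proof (intro sum.cong refl)
    fix p :: "'n \<Rightarrow> 'n" assume p: "p \<in> {p. p permutes UNIV}"
    have "(\<Prod>i\<in>?U. ?M $ i $ ?m p i) = (\<Prod>i\<in>insert None (range Some). ?M $ i $ ?m p i)"
      by (simp add: UNIV_option_conv)
    also have "\<dots> = (\<Prod>i\<in>range Some. ?M $ i $ ?m p i)"
      by (subst prod.insert) (auto simp: mS)
    also have "\<dots> = (\<Prod>i\<in>UNIV. B $ i $ p i)"
      by (subst prod.reindex) (auto simp: mS)
    finally show "of_int (sign (?m p)) * (\<Prod>i\<in>?U. ?M $ i $ ?m p i) =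
        of_int (sign p) * (\<Prod>i\<in>UNIV. B $ i $ p i)"
      using p by (simp add: sign_map_permutation)
  qed
  finally show ?thesis by (simp add: det_def)
qed

section \<open>The Riemannian measure\<close>

text \<open>In the application \<open>f\<close> is a chart into a space of larger dimension, so
  \<open>g'\<close> is only a left inverse and \<open>g\<close> is continuous only along the image.
  Differentiability first yields a local lower Lipschitz bound for \<open>f\<close>, which converts
  the remainder of \<open>f\<close> into a remainder of \<open>g\<close>.\<close>

lemma has_derivative_inverse_within:
  fixes f :: "'a::real_normed_vector \<Rightarrow> 'b::real_normed_vector"
  assumes der: "(f has_derivative f') (at x within S)"
    and bl: "bounded_linear g'" and id: "g' \<circ> f' = id"
    and cont: "continuous (at (f x) within f ` S) g"
    and gf: "\<And>y. y \<in> S \<Longrightarrow> g (f y) = y" and x: "x \<in> S"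
  shows "(g has_derivative g') (at (f x) within f ` S)"
proof -
  interpret g': bounded_linear g' by fact
  obtain C where C: "C > 0" "\<And>v. norm (g' v) \<le> norm v * C"
    using g'.pos_bounded by blast
  have gf': "g' (f' v) = v" for v using id by (metis comp_apply id_apply)
  have key: "(y - x) - g' (f y - f x) = - g' (f y - f x - f' (y - x))" for y
    by (simp add: g'.diff gf')
  from der have der': "\<And>e. e > 0 \<Longrightarrow> \<exists>d>0. \<forall>y\<in>S. norm (y - x) < d \<longrightarrow> norm (f y - f x - f' (y - x)) \<le> e * norm (y - x)"
    unfolding has_derivative_within_alt by blast
  obtain d1 where d1: "d1 > 0" "\<And>y. \<lbrakk>y \<in> S; norm (y - x) < d1\<rbrakk> \<Longrightarrow> norm (f y - f x - f' (y - x)) \<le> (1/(2*C)) * norm (y - x)"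
    using der'[of "1/(2*C)"] C(1) by auto
  \<comment> \<open>The tolerance 1/(2C) was chosen so that the error term is at most half of the
    left side and can be absorbed.\<close>
  have lip: "norm (y - x) \<le> 2 * C * norm (f y - f x)" if "y \<in> S" "norm (y - x) < d1" for y
  proof -
    have "norm (y - x) \<le> norm (g' (f y - f x)) + norm ((y - x) - g' (f y - f x))"
      by (metis norm_triangle_sub)
    also have "\<dots> \<le> norm (f y - f x) * C + norm (f y - f x - f' (y - x)) * C"
      unfolding key norm_minus_cancel by (intro add_mono C)
    also have "\<dots> \<le> norm (f y - f x) * C + ((1/(2*C)) * norm (y - x)) * C"
      using d1(2)[OF that] C by (intro add_left_mono mult_right_mono) auto
    also have "\<dots> = norm (f y - f x) * C + norm (y - x) / 2"
      using C by simp
    finally show ?thesis by (simp add: mult.commute)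
  qed
  show ?thesis
    unfolding has_derivative_within_alt
  proof (intro conjI bl allI impI)
    fix e :: real assume e: "e > 0"
    define e2 where "e2 = e / (2 * C * C)"
    have "e2 > 0" using e C by (simp add: e2_def)
    then obtain d2 where d2: "d2 > 0" "\<And>y. \<lbrakk>y \<in> S; norm (y - x) < d2\<rbrakk> \<Longrightarrow> norm (f y - f x - f' (y - x)) \<le> e2 * norm (y - x)"
      using der' by blast
    obtain d where d: "d > 0" "\<And>w. \<lbrakk>w \<in> f ` S; dist w (f x) < d\<rbrakk> \<Longrightarrow> dist (g w) (g (f x)) < min d1 d2"
      using cont d1(1) d2(1) unfolding continuous_within_eps_delta by (metis min_less_iff_conj)
    show "\<exists>d>0. \<forall>w\<in>f ` S. norm (w - f x) < d \<longrightarrow> norm (g w - g (f x) - g' (w - f x)) \<le> e * norm (w - f x)"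
    proof (intro exI[of _ d] conjI ballI impI d(1))
      fix w assume "w \<in> f ` S" and w: "norm (w - f x) < d"
      then obtain y where y: "y \<in> S" "w = f y" by auto
      have n: "norm (y - x) < d1" "norm (y - x) < d2"
        using d(2)[OF \<open>w \<in> f ` S\<close>] w y gf[OF y(1)] gf[OF x] by (auto simp: dist_norm)
      have "norm (g w - g (f x) - g' (w - f x)) = norm (g' (f y - f x - f' (y - x)))"
        using y gf[OF y(1)] gf[OF x] key[of y] by simp
      also have "\<dots> \<le> norm (f y - f x - f' (y - x)) * C" by (rule C)
      also have "\<dots> \<le> (e2 * norm (y - x)) * C"
        using d2(2)[OF y(1) n(2)] C by (intro mult_right_mono) auto
      also have "\<dots> \<le> (e2 * (2 * C * norm (f y - f x))) * C"
        using lip[OF y(1) n(1)] C \<open>e2 > 0\<close> by (intro mult_right_mono mult_left_mono) auto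
      also have "\<dots> = e * norm (w - f x)"
        using C y by (simp add: e2_def field_simps)
      finally show "norm (g w - g (f x) - g' (w - f x)) \<le> e * norm (w - f x)" .
    qed
  qed
qed

subsection \<open>Local parametrizations\<close>

lemma local_parametrizationD:
  assumes "local_parametrization N \<phi> W"
  shows "open W" "smooth_on \<phi> W" "openin (top_of_set N) (\<phi> ` W)" "\<phi> ` W \<subseteq> N"
    "continuous_on W \<phi>" "inj_on \<phi> W"
    "\<And>u. u \<in> W \<Longrightarrow> (\<phi> has_derivative frechet_derivative \<phi> (at u)) (at u)"
    "\<And>u. u \<in> W \<Longrightarrow> inj (frechet_derivative \<phi> (at u))"
    "\<And>v. continuous_on W (\<lambda>u. frechet_derivative \<phi> (at u) v)"
proof -
  show "open W" and s: "smooth_on \<phi> W" and "openin (top_of_set N) (\<phi> ` W)" 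
    and "\<And>u. u \<in> W \<Longrightarrow> inj (frechet_derivative \<phi> (at u))"
    using assms by (auto simp: local_parametrization_def)
  then show "\<phi> ` W \<subseteq> N" using openin_imp_subset by blast
  show "inj_on \<phi> W" using assms
    by (auto simp: local_parametrization_def homeomorphism_def intro: inj_on_inverseI)
  have "Ck_on 0 \<phi> W" "Ck_on (Suc 0) \<phi> W" using s by (auto simp: smooth_on_def)
  then show "continuous_on W \<phi>" "\<And>v. continuous_on W (\<lambda>u. frechet_derivative \<phi> (at u) v)"
    "\<And>u. u \<in> W \<Longrightarrow> (\<phi> has_derivative frechet_derivative \<phi> (at u)) (at u)"
    by (auto simp: frechet_derivative_works[symmetric])
qed

definition chart_inv :: "('a \<Rightarrow> 'b) \<Rightarrow> 'a set \<Rightarrow> 'b \<Rightarrow> 'a" where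
  "chart_inv \<phi> W = inv_into W \<phi>"

lemma chart_inv:
  assumes "local_parametrization N \<phi> W"
  shows "\<And>u. u \<in> W \<Longrightarrow> chart_inv \<phi> W (\<phi> u) = u"
    "\<And>p. p \<in> \<phi> ` W \<Longrightarrow> \<phi> (chart_inv \<phi> W p) = p"
    "\<And>p. p \<in> \<phi> ` W \<Longrightarrow> chart_inv \<phi> W p \<in> W"
    "continuous_on (\<phi> ` W) (chart_inv \<phi> W)"
proof -
  show *: "\<And>u. u \<in> W \<Longrightarrow> chart_inv \<phi> W (\<phi> u) = u" "\<And>p. p \<in> \<phi> ` W \<Longrightarrow> \<phi> (chart_inv \<phi> W p) = p"
    "\<And>p. p \<in> \<phi> ` W \<Longrightarrow> chart_inv \<phi> W p \<in> W"
    using local_parametrizationD(6)[OF assms] unfolding chart_inv_def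
    by (auto simp: f_inv_into_f inv_into_into)
  obtain \<psi> where \<psi>: "homeomorphism W (\<phi> ` W) \<phi> \<psi>"
    using assms by (auto simp: local_parametrization_def)
  have c: "continuous_on (\<phi> ` W) \<psi>" and i: "\<And>u. u \<in> W \<Longrightarrow> \<psi> (\<phi> u) = u"
    using \<psi> by (auto simp: homeomorphism_def)
  show "continuous_on (\<phi> ` W) (chart_inv \<phi> W)"
    by (rule continuous_on_eq[OF c]) (use * i in auto)
qed

lemma local_parametrization_subset:
  assumes \<phi>: "local_parametrization N \<phi> W" and V: "open V" "V \<subseteq> W"
  shows "local_parametrization N \<phi> V"
proof -
  have op: "openin (top_of_set (\<phi> ` W)) (\<phi> ` V)"
  proof -
    have "\<phi> ` V = \<phi> ` W \<inter> chart_inv \<phi> W -` V"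
      using V chart_inv[OF \<phi>] by (auto simp: image_iff)
    then show ?thesis
      using continuous_openin_preimage_gen[OF chart_inv(4)[OF \<phi>] V(1)] by simp
  qed
  obtain \<psi> where \<psi>: "homeomorphism W (\<phi> ` W) \<phi> \<psi>"
    using \<phi> by (auto simp: local_parametrization_def)
  have Ck: "Ck_on k f W \<Longrightarrow> Ck_on k f V" for k and f :: "real^'b \<Rightarrow> 'a"
    by (induction k arbitrary: f) (use V continuous_on_subset in auto)
  show ?thesis
    unfolding local_parametrization_def
  proof (intro conjI)
    show "smooth_on \<phi> V" using \<phi> Ck by (auto simp: local_parametrization_def smooth_on_def)
    show "openin (top_of_set N) (\<phi> ` V)"
      using op local_parametrizationD(3)[OF \<phi>] openin_trans by blast
    show "\<exists>\<psi>. homeomorphism V (\<phi> ` V) \<phi> \<psi>"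
      using homeomorphism_of_subsets[OF \<psi> V(2)] V(2) by (intro exI[of _ \<psi>]) auto
  qed (use \<phi> V in \<open>auto simp: local_parametrization_def\<close>)
qed

text \<open>\<open>l\<close> is determined only on the tangent space, which suffices. The derivative
  can be taken within all of \<open>N\<close>, not only within the chart image, because the latter
  is relatively open in \<open>N\<close>.\<close>

lemma chart_inv_has_derivative:
  fixes \<phi> :: "real^'k::finite \<Rightarrow> 'w::euclidean_space"
  assumes \<phi>: "local_parametrization N \<phi> W" and u: "u \<in> W"
  obtains l where "linear l" "\<And>v. l (frechet_derivative \<phi> (at u) v) = v"
    "(chart_inv \<phi> W has_derivative l) (at (\<phi> u) within N)"
proof -
  let ?D = "frechet_derivative \<phi> (at u)"
  note D = local_parametrizationD[OF \<phi>]
  have linD: "linear ?D" using D(7)[OF u] has_derivative_linear by blast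
  then obtain l where l: "linear l" "l \<circ> ?D = id"
    using linear_injective_left_inverse[OF _ D(8)[OF u]] by blast
  have "(chart_inv \<phi> W has_derivative l) (at (\<phi> u) within \<phi> ` W)"
  proof (rule has_derivative_inverse_within[where f' = ?D])
    show "(\<phi> has_derivative ?D) (at u within W)"
      using D(7)[OF u] has_derivative_at_withinI by blast
    show "bounded_linear l" using l(1) by (simp add: linear_conv_bounded_linear)
    show "continuous (at (\<phi> u) within \<phi> ` W) (chart_inv \<phi> W)"
      using chart_inv(4)[OF \<phi>] u by (simp add: continuous_on_eq_continuous_within)
  qed (use l u chart_inv[OF \<phi>] in auto)
  moreover have "at (\<phi> u) within N = at (\<phi> u) within \<phi> ` W"
  proof -
    obtain T where "open T" "\<phi> ` W = N \<inter> T" using D(3) by (auto simp: openin_open)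
    then show ?thesis
      using u by (intro at_within_nhd[of _ T]) auto
  qed
  ultimately show ?thesis using that[of l] l by (metis comp_apply id_apply)
qed

subsection \<open>The volume density\<close>

lemma metric_K_bilinear:
  "metric_K K (a + b) w = metric_K K a w + metric_K K b w"
  "metric_K K w (a + b) = metric_K K w a + metric_K K w b"
  "metric_K K (a - b) w = metric_K K a w - metric_K K b w"
  "metric_K K w (a - b) = metric_K K w a - metric_K K w b"
  "metric_K K (c *\<^sub>R a) w = c * metric_K K a w"
  "metric_K K w (c *\<^sub>R a) = c * metric_K K w a"
  "metric_K K (- a) w = - metric_K K a w"
  "metric_K K w (- a) = - metric_K K w a"
  "metric_K K 0 w = 0" "metric_K K w 0 = 0"
  by (simp_all add: metric_K_def inner_simps algebra_simps)

lemma metric_K_sum: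
  "metric_K K (sum f A) w = (\<Sum>i\<in>A. metric_K K (f i) w)"
  "metric_K K w (sum f A) = (\<Sum>i\<in>A. metric_K K w (f i))"
  by (induction A rule: infinite_finite_induct) (auto simp: metric_K_bilinear)

lemma metric_K_commute: "metric_K K v w = metric_K K w v"
  by (simp add: metric_K_def inner_commute mult.commute)

lemma bounded_bilinear_metric_K:
  "bounded_bilinear (metric_K K :: real \<times> 'v::euclidean_space \<Rightarrow> _)"
  unfolding bilinear_conv_bounded_bilinear[symmetric] bilinear_def linear_iff
  by (simp add: metric_K_bilinear)

lemmas has_derivative_metric_K [derivative_intros] =
  bounded_bilinear.FDERIV[OF bounded_bilinear_metric_K]
lemmas continuous_on_metric_K [continuous_intros] =
  bounded_bilinear.continuous_on[OF bounded_bilinear_metric_K]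

text \<open>Square root of the Gram determinant: the factor by which \<open>D\<close> scales
  k-dimensional volume. It is separated from \<open>volume_density\<close> in order to apply to
  derivatives of maps that are not parametrizations.\<close>

definition lin_density :: "real \<Rightarrow> (real^'k \<Rightarrow> real \<times> 'v::euclidean_space) \<Rightarrow> real" where
  "lin_density K D = sqrt (det (\<chi> i j. metric_K K (D (axis i 1)) (D (axis j 1)) :: real^'k^'k))"

lemma volume_density_eq: "volume_density K \<phi> u = lin_density K (frechet_derivative \<phi> (at u))"
  by (simp add: volume_density_def lin_density_def)

text \<open>The Gram matrix of the composition is the product of the transpose of J, the Gram matrix
  of D, and J.\<close>

lemma lin_density_comp:
  fixes D :: "real^'k::finite \<Rightarrow> real \<times> 'v::euclidean_space" and J :: "real^'k \<Rightarrow> real^'k"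
  assumes D: "linear D" and J: "linear J"
  shows "lin_density K (\<lambda>h. D (J h)) = \<bar>det (matrix J)\<bar> * lin_density K D"
proof -
  define G where "G = (\<chi> i j. metric_K K (D (axis i 1)) (D (axis j 1)) :: real^'k^'k)"
  have exp: "D (J (axis i 1)) = (\<Sum>k\<in>UNIV. (matrix J $ k $ i) *\<^sub>R D (axis k 1))" for i
  proof -
    have "J (axis i 1) = (\<Sum>k\<in>UNIV. (matrix J $ k $ i) *\<^sub>R axis k 1)"
      by (simp add: vec_eq_iff matrix_def axis_def if_distrib[of "(*) _"] cong: if_cong)
    then show ?thesis
      using D by (simp add: linear_sum linear_cmul)
  qed
  have "(\<chi> i j. metric_K K (D (J (axis i 1))) (D (J (axis j 1)))) = transpose (matrix J) ** (G ** matrix J)"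
    unfolding exp vec_eq_iff matrix_matrix_mult_def transpose_def G_def
    apply (simp add: metric_K_sum metric_K_bilinear sum_distrib_left mult_ac)
    apply (intro allI)
    apply (subst sum.swap)
    apply (simp add: mult_ac)
    done
  then have "det (\<chi> i j. metric_K K (D (J (axis i 1))) (D (J (axis j 1)))) = (det (matrix J))\<^sup>2 * det G"
    by (simp add: det_mul power2_eq_square)
  then show ?thesis
    by (simp add: lin_density_def G_def real_sqrt_mult)
qed

lemma continuous_on_volume_density:
  assumes "local_parametrization N \<phi> W"
  shows "continuous_on W (volume_density K \<phi>)"
  unfolding volume_density_def[abs_def] det_def
  by (simp, intro continuous_intros local_parametrizationD(9)[OF assms])

text \<open>The property inside the description that defines \<open>riemannian_measure\<close>;
  existence and uniqueness are proved for it.\<close>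

definition is_riemannian_measure ::
    "'k::finite itself \<Rightarrow> real \<Rightarrow> (real \<times> 'v::euclidean_space) set \<Rightarrow> (real \<times> 'v) measure \<Rightarrow> bool" where
  "is_riemannian_measure _ K N \<mu> \<longleftrightarrow> sets \<mu> = sets (restrict_space borel N) \<and>
     (\<forall>(\<phi> :: real^'k \<Rightarrow> real \<times> 'v) W. local_parametrization N \<phi> W \<longrightarrow>
        (\<forall>B\<in>sets borel. B \<subseteq> W \<longrightarrow>
           emeasure \<mu> (\<phi> ` B) = (\<integral>\<^sup>+u\<in>B. ennreal (volume_density K \<phi> u) \<partial>lborel)))"

subsection \<open>Atlases\<close>

lemma continuous_on_measurable_restrict:
  fixes f :: "'a::topological_space \<Rightarrow> 'b::topological_space"
  assumes "continuous_on S f" "f ` S \<subseteq> T"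
  shows "f \<in> restrict_space borel S \<rightarrow>\<^sub>M restrict_space borel T"
  by (intro measurable_restrict_space2 borel_measurable_continuous_on_restrict)
     (use assms in \<open>auto simp: space_restrict_space\<close>)

lemma openin_sets_restrict: "openin (top_of_set N) A \<Longrightarrow> A \<in> sets (restrict_space borel N)"
  unfolding openin_open sets_restrict_space using borel_open by blast

text \<open>The image is a preimage under the continuous inverse chart, hence relatively Borel in
  the chart image, which is itself relatively open in \<open>N\<close>.\<close>

lemma chart_image_sets:
  assumes \<phi>: "local_parametrization N \<phi> W" and B: "B \<in> sets borel" "B \<subseteq> W"
  shows "\<phi> ` B \<in> sets (restrict_space borel N)"
proof -
  obtain U where U: "open U" "\<phi> ` W = N \<inter> U"
    using local_parametrizationD(3)[OF \<phi>] by (auto simp: openin_open)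
  have "chart_inv \<phi> W \<in> restrict_space borel (\<phi> ` W) \<rightarrow>\<^sub>M borel"
    by (rule borel_measurable_continuous_on_restrict[OF chart_inv(4)[OF \<phi>]])
  from measurable_sets[OF this B(1)]
  have "chart_inv \<phi> W -` B \<inter> \<phi> ` W \<in> sets (restrict_space borel (\<phi> ` W))"
    by (simp add: space_restrict_space)
  moreover have "chart_inv \<phi> W -` B \<inter> \<phi> ` W = \<phi> ` B"
    using B(2) chart_inv[OF \<phi>] by (auto simp: image_iff)
  ultimately obtain A where A: "A \<in> sets borel" "\<phi> ` B = \<phi> ` W \<inter> A"
    unfolding sets_restrict_space by auto
  then have "\<phi> ` B = N \<inter> (U \<inter> A)" "U \<inter> A \<in> sets borel" using U by auto
  then show ?thesis unfolding sets_restrict_space by blast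
qed

definition atlas :: "'w::real_normed_vector set \<Rightarrow> (nat \<Rightarrow> real^'k \<Rightarrow> 'w) \<Rightarrow> (nat \<Rightarrow> (real^'k) set) \<Rightarrow> bool" where
  "atlas N \<phi> W \<longleftrightarrow> (\<forall>i. local_parametrization N (\<phi> i) (W i)) \<and> (\<Union>i. \<phi> i ` W i) = N"

text \<open>The part of chart \<open>i\<close> not covered by charts of smaller index. The images of
  the pieces partition \<open>N\<close>, and piece 0 is all of \<open>W 0\<close>.\<close>

definition atlas_piece :: "(nat \<Rightarrow> real^'k \<Rightarrow> 'w) \<Rightarrow> (nat \<Rightarrow> (real^'k) set) \<Rightarrow> nat \<Rightarrow> (real^'k) set" where
  "atlas_piece \<phi> W i = {u \<in> W i. \<phi> i u \<in> disjointed (\<lambda>i. \<phi> i ` W i) i}"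

text \<open>Second countability in the form of Lindelof's theorem. The predicate \<open>R\<close>
  restricts to charts of a special kind, later those with an oriented normal; a prescribed chart
  gets number 0, so that its piece is not cut by any other chart.\<close>

lemma ex_atlas:
  fixes N :: "'w::euclidean_space set"
  assumes R: "\<And>\<phi> W. R \<phi> W \<Longrightarrow> local_parametrization N (\<phi> :: real^'k::finite \<Rightarrow> 'w) W"
    and N: "\<And>p. p \<in> N \<Longrightarrow> \<exists>\<phi> W. R \<phi> W \<and> p \<in> \<phi> ` W"
    and \<phi>0: "R \<phi>0 W0"
  obtains \<phi> W where "atlas N \<phi> W" "\<And>i. R (\<phi> i) (W i)" "\<phi> 0 = \<phi>0" "W 0 = W0"
proof -
  define C where "C = {(\<phi> :: real^'k \<Rightarrow> 'w, W). R \<phi> W}"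
  define im where "im = (\<lambda>(\<phi> :: real^'k \<Rightarrow> 'w, W). \<phi> ` W)"
  obtain F where F: "F \<subseteq> im ` C" "countable F" "\<Union>F = \<Union>(im ` C)"
  proof (rule Lindelof_openin[of "im ` C" N])
    fix S assume "S \<in> im ` C"
    then obtain \<phi> W where "R \<phi> W" "S = \<phi> ` W" by (auto simp: C_def im_def)
    with R have "local_parametrization N \<phi> W" "S = \<phi> ` W" by blast+
    then show "openin (top_of_set N) S" by (simp add: local_parametrizationD(3))
  qed
  then obtain C' where C': "C' \<subseteq> C" "countable C'" "F = im ` C'"
    by (meson countable_subset_image)
  define C'' where "C'' = insert (\<phi>0, W0) C'"
  have C'': "countable C''" "C'' \<subseteq> C" "C'' \<noteq> {}"
    using C' \<phi>0 by (auto simp: C''_def C_def)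
  have un: "\<Union>(im ` C'') = N"
  proof
    show "\<Union>(im ` C'') \<subseteq> N" using C'' by (auto simp: im_def C_def dest: local_parametrizationD(4)[OF R])
    have "N \<subseteq> \<Union>(im ` C)"
      using N by (fastforce simp: im_def C_def)
    then show "N \<subseteq> \<Union>(im ` C'')" using F C' by (auto simp: C''_def)
  qed
  define e where "e = (\<lambda>i. case i of 0 \<Rightarrow> (\<phi>0, W0) | Suc j \<Rightarrow> from_nat_into C'' j)"
  have "range (from_nat_into C'') = C''" by (rule range_from_nat_into[OF C''(3,1)])
  then have re: "range e = C''"
  proof -
    have "range e = insert (e 0) (range (\<lambda>j. e (Suc j)))"
      by (subst UNIV_nat_eq) (simp add: image_image)
    then show ?thesis
      using \<open>range (from_nat_into C'') = C''\<close> by (auto simp: e_def C''_def)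
  qed
  show ?thesis
  proof (rule that[of "\<lambda>i. fst (e i)" "\<lambda>i. snd (e i)"])
    have e: "e i \<in> C" for i using re C'' by blast
    then show "R (fst (e i)) (snd (e i))" for i by (auto simp: C_def split_beta)
    moreover have "(\<Union>i. im (e i)) = N" using un re by (metis image_image)
    ultimately show "atlas N (\<lambda>i. fst (e i)) (\<lambda>i. snd (e i))"
      using R by (auto simp: atlas_def im_def split_beta)
  qed (simp_all add: e_def)
qed

lemma ex_atlas_submanifold:
  fixes N :: "'w::euclidean_space set"
  assumes N: "smooth_submanifold TYPE('k::finite) N"
    and \<phi>0: "local_parametrization N (\<phi>0 :: real^'k \<Rightarrow> 'w) W0"
  obtains \<phi> :: "nat \<Rightarrow> real^'k \<Rightarrow> 'w" and W where "atlas N \<phi> W"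
proof (rule ex_atlas[of "local_parametrization N", OF _ _ \<phi>0])
  show "\<exists>(\<phi> :: real^'k \<Rightarrow> 'w) W. local_parametrization N \<phi> W \<and> p \<in> \<phi> ` W" if "p \<in> N" for p
    using N that by (simp add: smooth_submanifold_def)
qed

lemma atlas_pieces:
  assumes a: "atlas N \<phi> W"
  shows atlas_piece_image: "\<phi> i ` atlas_piece \<phi> W i = disjointed (\<lambda>i. \<phi> i ` W i) i"
    and atlas_piece_subset: "atlas_piece \<phi> W i \<subseteq> W i"
    and atlas_piece_borel: "A \<in> sets (restrict_space borel N) \<Longrightarrow> {u \<in> atlas_piece \<phi> W i. \<phi> i u \<in> A} \<in> sets borel"
    and atlas_piece_sets: "disjointed (\<lambda>i. \<phi> i ` W i) i \<in> sets (restrict_space borel N)"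
    and atlas_piece_UN: "(\<Union>i. disjointed (\<lambda>i. \<phi> i ` W i) i) = N"
    and "atlas_piece \<phi> W i \<in> sets borel"
proof -
  have lp: "local_parametrization N (\<phi> i) (W i)" for i using a by (simp add: atlas_def)
  show "\<phi> i ` atlas_piece \<phi> W i = disjointed (\<lambda>i. \<phi> i ` W i) i"
    using disjointed_subset[of "\<lambda>i. \<phi> i ` W i" i] by (auto simp: atlas_piece_def)
  show "atlas_piece \<phi> W i \<subseteq> W i" by (auto simp: atlas_piece_def)
  have "range (\<lambda>i. \<phi> i ` W i) \<subseteq> sets (restrict_space borel N)"
    using openin_sets_restrict[OF local_parametrizationD(3)[OF lp]] by auto
  then show S: "disjointed (\<lambda>i. \<phi> i ` W i) i \<in> sets (restrict_space borel N)"
    using sets.range_disjointed_sets by (metis range_subsetD)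
  show "(\<Union>i. disjointed (\<lambda>i. \<phi> i ` W i) i) = N"
    using a by (simp add: UN_disjointed_eq atlas_def)
  show B: "{u \<in> atlas_piece \<phi> W i. \<phi> i u \<in> A} \<in> sets borel" if "A \<in> sets (restrict_space borel N)" for A
  proof -
    have "\<phi> i \<in> restrict_space borel (W i) \<rightarrow>\<^sub>M restrict_space borel N"
      using local_parametrizationD[OF lp] by (intro continuous_on_measurable_restrict)
    from measurable_sets[OF this sets.Int[OF S that]]
    have "\<phi> i -` (disjointed (\<lambda>i. \<phi> i ` W i) i \<inter> A) \<inter> W i \<in> sets (restrict_space borel (W i))"
      by (simp add: space_restrict_space)
    moreover have "{u \<in> atlas_piece \<phi> W i. \<phi> i u \<in> A} = \<phi> i -` (disjointed (\<lambda>i. \<phi> i ` W i) i \<inter> A) \<inter> W i"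
      by (auto simp: atlas_piece_def)
    ultimately show ?thesis
      using local_parametrizationD(1)[OF lp] by (subst (asm) sets_restrict_space_iff) auto
  qed
  show "atlas_piece \<phi> W i \<in> sets borel"
  proof -
    have "disjointed (\<lambda>i. \<phi> i ` W i) i \<subseteq> N" using sets.sets_into_space[OF S] by (simp add: space_restrict_space)
    then have "{u \<in> atlas_piece \<phi> W i. \<phi> i u \<in> N} = atlas_piece \<phi> W i"
      by (auto simp: atlas_piece_def)
    moreover have "N \<in> sets (restrict_space borel N)" by (auto simp: sets_restrict_space)
    ultimately show ?thesis using B[of N] by simp
  qed
qed

text \<open>Densities are integrated over the disjoint pieces, so that overlaps of charts count
  once. The result turns out to be independent of the atlas.\<close>

definition atlas_measure ::
    "real \<Rightarrow> (real \<times> 'v::euclidean_space) set \<Rightarrow> (nat \<Rightarrow> real^'k \<Rightarrow> real \<times> 'v) \<Rightarrow> (nat \<Rightarrow> (real^'k) set) \<Rightarrow>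
      (real \<times> 'v) measure" where
  "atlas_measure K N \<phi> W = measure_of N (sets (restrict_space borel N))
     (\<lambda>A. \<Sum>i. \<integral>\<^sup>+u\<in>{u \<in> atlas_piece \<phi> W i. \<phi> i u \<in> A}. ennreal (volume_density K (\<phi> i) u) \<partial>lborel)"

lemma volume_density_borel:
  assumes "local_parametrization N \<phi> W" "B \<in> sets borel" "B \<subseteq> W"
  shows "(\<lambda>u. ennreal (volume_density K \<phi> u) * indicator B u) \<in> borel_measurable borel"
proof -
  have "(\<lambda>u. indicator B u *\<^sub>R volume_density K \<phi> u) \<in> borel_measurable borel"
    using continuous_on_subset[OF continuous_on_volume_density[OF assms(1)] assms(3)] assms(2)
    by (intro borel_measurable_continuous_on_indicator)
  then have "(\<lambda>u. ennreal (indicator B u *\<^sub>R volume_density K \<phi> u)) \<in> borel_measurable borel"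
    by measurable
  moreover have "ennreal (indicator B u *\<^sub>R volume_density K \<phi> u) = ennreal (volume_density K \<phi> u) * indicator B u" for u
    by (auto simp: indicator_def)
  ultimately show ?thesis by simp
qed

lemma atlas_measure:
  assumes a: "atlas N \<phi> W"
  shows sets_atlas_measure: "sets (atlas_measure K N \<phi> W) = sets (restrict_space borel N)"
    and emeasure_atlas_measure: "A \<in> sets (restrict_space borel N) \<Longrightarrow> emeasure (atlas_measure K N \<phi> W) A =
      (\<Sum>i. \<integral>\<^sup>+u\<in>{u \<in> atlas_piece \<phi> W i. \<phi> i u \<in> A}. ennreal (volume_density K (\<phi> i) u) \<partial>lborel)"
proof -
  let ?S = "sets (restrict_space borel N)"
  let ?m = "\<lambda>A. \<Sum>i. \<integral>\<^sup>+u\<in>{u \<in> atlas_piece \<phi> W i. \<phi> i u \<in> A}. ennreal (volume_density K (\<phi> i) u) \<partial>lborel"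
  have lp: "local_parametrization N (\<phi> i) (W i)" for i using a by (simp add: atlas_def)
  have sa: "sigma_algebra N ?S"
    using sets.sigma_algebra_axioms[of "restrict_space borel N"] by (simp add: space_restrict_space)
  then show "sets (atlas_measure K N \<phi> W) = ?S"
    unfolding atlas_measure_def by (simp add: sigma_algebra.sets_measure_of_eq)
  assume A: "A \<in> ?S"
  show "emeasure (atlas_measure K N \<phi> W) A = ?m A"
    unfolding atlas_measure_def
  proof (rule emeasure_measure_of_sigma[OF sa _ _ A])
    show "positive ?S ?m" by (simp add: positive_def)
    show "countably_additive ?S ?m"
      unfolding countably_additive_def
    proof (intro allI impI)
      fix B :: "nat \<Rightarrow> _" assume B: "range B \<subseteq> ?S" "disjoint_family B" "\<Union>(range B) \<in> ?S"
      let ?f = "\<lambda>k i. \<integral>\<^sup>+u\<in>{u \<in> atlas_piece \<phi> W i. \<phi> i u \<in> B k}. ennreal (volume_density K (\<phi> i) u) \<partial>lborel"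
      \<comment> \<open>Two sums over \<open>nat\<close> are exchanged by reading one of them as an
        integral over \<open>count_space\<close>.\<close>
      have "(\<Sum>k. ?m (B k)) = (\<Sum>k. \<integral>\<^sup>+i. ?f k i \<partial>count_space UNIV)"
        by (simp add: nn_integral_count_space_nat)
      also have "\<dots> = (\<integral>\<^sup>+i. (\<Sum>k. ?f k i) \<partial>count_space UNIV)"
        by (rule nn_integral_suminf[symmetric]) simp
      also have "\<dots> = (\<Sum>i. \<Sum>k. ?f k i)"
        by (simp add: nn_integral_count_space_nat)
      also have "(\<lambda>i. \<Sum>k. ?f k i) = (\<lambda>i. \<integral>\<^sup>+u\<in>{u \<in> atlas_piece \<phi> W i. \<phi> i u \<in> \<Union>(range B)}. ennreal (volume_density K (\<phi> i) u) \<partial>lborel)"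
      proof
        fix i
        have "(\<Sum>k. ?f k i) = (\<integral>\<^sup>+u. (\<Sum>k. ennreal (volume_density K (\<phi> i) u) *
            indicator {u \<in> atlas_piece \<phi> W i. \<phi> i u \<in> B k} u) \<partial>lborel)"
        proof (rule nn_integral_suminf[symmetric])
          show "(\<lambda>u. ennreal (volume_density K (\<phi> i) u) * indicator {u \<in> atlas_piece \<phi> W i. \<phi> i u \<in> B k} u)
              \<in> borel_measurable lborel" for k
            using B(1) atlas_piece_subset[OF a, of i]
            by (simp, intro volume_density_borel[OF lp] atlas_piece_borel[OF a]) auto
        qed
        also have "\<dots> = (\<integral>\<^sup>+u\<in>{u \<in> atlas_piece \<phi> W i. \<phi> i u \<in> \<Union>(range B)}. ennreal (volume_density K (\<phi> i) u) \<partial>lborel)"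
        proof (intro nn_integral_cong)
          fix u
          have "disjoint_family (\<lambda>k. {u \<in> atlas_piece \<phi> W i. \<phi> i u \<in> B k})"
            using B(2) by (auto simp: disjoint_family_on_def)
          from suminf_indicator[OF this, of u]
          have "(\<Sum>k. indicator {u \<in> atlas_piece \<phi> W i. \<phi> i u \<in> B k} u :: ennreal) =
            indicator {u \<in> atlas_piece \<phi> W i. \<phi> i u \<in> \<Union>(range B)} u"
            by (simp add: indicator_def)
          then show "(\<Sum>k. ennreal (volume_density K (\<phi> i) u) * indicator {u \<in> atlas_piece \<phi> W i. \<phi> i u \<in> B k} u)
            = ennreal (volume_density K (\<phi> i) u) * indicator {u \<in> atlas_piece \<phi> W i. \<phi> i u \<in> \<Union>(range B)} u"
            by (simp only: ennreal_suminf_cmult)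
        qed
        finally show "(\<Sum>k. ?f k i) = (\<integral>\<^sup>+u\<in>{u \<in> atlas_piece \<phi> W i. \<phi> i u \<in> \<Union>(range B)}. ennreal (volume_density K (\<phi> i) u) \<partial>lborel)" .
      qed
      finally show "(\<Sum>k. ?m (B k)) = ?m (\<Union>(range B))" .
    qed
  qed
qed

text \<open>Area formula for a map \<open>g\<close> into \<open>N\<close> from coordinates of the
  same dimension; the derivative of \<open>g\<close> may degenerate. Splitting \<open>Z\<close> by
  the piece that contains \<open>g z\<close> and composing with the inverse of that chart gives a
  map into coordinate space, where change of variables applies; \<open>lin_density_comp\<close>
  identifies its Jacobian times the chart density with \<open>lin_density K (g' z)\<close>. Used
  both for a further chart and for the normal map.\<close>

lemma atlas_measure_image:
  fixes g :: "real^'k::finite \<Rightarrow> real \<times> 'v::euclidean_space"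
  assumes a: "atlas N (\<phi> :: nat \<Rightarrow> real^'k \<Rightarrow> real \<times> 'v) W"
    and U: "open U" "g ` U \<subseteq> N"
    and g: "\<And>z. z \<in> U \<Longrightarrow> (g has_derivative g' z) (at z)"
    and Z: "Z \<in> sets borel" "Z \<subseteq> U"
    and d: "d \<in> borel_measurable borel"
    and A: "A \<in> sets (restrict_space borel N)"
  shows atlas_measure_image_le:
      "\<lbrakk>A \<subseteq> g ` Z; \<And>z. z \<in> Z \<Longrightarrow> lin_density K (g' z) \<le> d z\<rbrakk> \<Longrightarrow>
        emeasure (atlas_measure K N \<phi> W) A \<le> (\<integral>\<^sup>+z\<in>Z. ennreal (d z) \<partial>lborel)"
    and atlas_measure_image_eq:
      "\<lbrakk>A = g ` Z; inj_on g Z; \<And>z. z \<in> Z \<Longrightarrow> lin_density K (g' z) = d z\<rbrakk> \<Longrightarrow>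
        emeasure (atlas_measure K N \<phi> W) A = (\<integral>\<^sup>+z\<in>Z. ennreal (d z) \<partial>lborel)"
proof -
  have lp: "local_parametrization N (\<phi> i) (W i)" for i using a by (simp add: atlas_def)
  define P where "P = disjointed (\<lambda>i. \<phi> i ` W i)"
  define Zi where "Zi i = {z \<in> Z. g z \<in> P i}" for i
  define \<psi> where "\<psi> i = chart_inv (\<phi> i) (W i)" for i
  \<comment> \<open>Extended by 0 off \<open>W i\<close> to obtain a Borel function on the whole
    space. The truncation at 0 secures nonnegativity although \<open>metric_K\<close> may be
    indefinite on a general \<open>N\<close>; it is invisible to \<open>ennreal\<close>.\<close>
  define f where "f i u = (if u \<in> W i then max 0 (volume_density K (\<phi> i) u) else 0)" for i u
  have contg: "continuous_on U g"
    using g by (meson has_derivative_continuous continuous_at_imp_continuous_on)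
  have PW: "P i \<subseteq> \<phi> i ` W i" for i unfolding P_def by (rule disjointed_subset)
  have Zi: "Zi i \<in> sets borel" for i
  proof -
    have "g \<in> restrict_space borel U \<rightarrow>\<^sub>M restrict_space borel N"
      using contg U(2) by (rule continuous_on_measurable_restrict)
    from measurable_sets[OF this atlas_piece_sets[OF a, of i]]
    have "g -` P i \<inter> U \<in> sets borel"
      using U(1) by (auto simp: P_def space_restrict_space sets_restrict_space_iff)
    moreover have "Zi i = Z \<inter> (g -` P i \<inter> U)" using Z(2) by (auto simp: Zi_def)
    ultimately show ?thesis using Z(1) by auto
  qed
  have ex_J: "\<exists>J. (\<psi> i \<circ> g has_derivative J) (at z) \<and> linear J \<and> (\<forall>h. frechet_derivative (\<phi> i) (at (\<psi> i (g z))) (J h) = g' z h)"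
    if z: "z \<in> Zi i" for i z
  proof -
    have zU: "z \<in> U" using z Z(2) by (auto simp: Zi_def)
    define u where "u = \<psi> i (g z)"
    have gz: "g z \<in> \<phi> i ` W i" using z PW by (auto simp: Zi_def)
    then have u: "u \<in> W i" "\<phi> i u = g z"
      using chart_inv[OF lp[of i]] by (auto simp: u_def \<psi>_def)
    obtain l where l: "linear l" "(\<psi> i has_derivative l) (at (g z) within N)"
      using chart_inv_has_derivative[OF lp u(1)] u(2) unfolding \<psi>_def by metis
    have "(\<psi> i \<circ> g has_derivative l \<circ> g' z) (at z within U)"
      using g[OF zU] l(2) U(2)
      by (intro diff_chain_within) (auto intro: has_derivative_subset has_derivative_at_withinI)
    then have der: "(\<psi> i \<circ> g has_derivative l \<circ> g' z) (at z)"
      unfolding at_within_open[OF zU U(1)] .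
    have ch: "(\<phi> i \<circ> (\<psi> i \<circ> g) has_derivative frechet_derivative (\<phi> i) (at u) \<circ> (l \<circ> g' z)) (at z)"
      by (rule diff_chain_at[OF der]) (use local_parametrizationD(7)[OF lp u(1)] in \<open>simp add: u_def\<close>)
    have "openin (top_of_set U) (U \<inter> g -` (\<phi> i ` W i))"
      by (rule continuous_openin_preimage[OF contg _ local_parametrizationD(3)[OF lp]]) (use U(2) in auto)
    then have op: "open (U \<inter> g -` (\<phi> i ` W i))" using U(1) openin_open_eq by blast
    have "(g has_derivative frechet_derivative (\<phi> i) (at u) \<circ> (l \<circ> g' z)) (at z)"
      by (rule has_derivative_transform_within_open[OF ch op])
         (use zU gz chart_inv[OF lp[of i]] in \<open>auto simp: \<psi>_def\<close>)
    then have "frechet_derivative (\<phi> i) (at u) \<circ> (l \<circ> g' z) = g' z"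
      using g[OF zU] has_derivative_unique by blast
    then show ?thesis
      using der has_derivative_linear[OF der] by (intro exI[of _ "l \<circ> g' z"]) (auto simp: u_def fun_eq_iff)
  qed
  define J where "J i z = (SOME J. (\<psi> i \<circ> g has_derivative J) (at z) \<and> linear J \<and>
    (\<forall>h. frechet_derivative (\<phi> i) (at (\<psi> i (g z))) (J h) = g' z h))" for i z
  have J: "\<And>i z. z \<in> Zi i \<Longrightarrow> (\<psi> i \<circ> g has_derivative J i z) (at z)"
     "\<And>i z. z \<in> Zi i \<Longrightarrow> linear (J i z)"
     "\<And>i z h. z \<in> Zi i \<Longrightarrow> frechet_derivative (\<phi> i) (at (\<psi> i (g z))) (J i z h) = g' z h"
    unfolding J_def using someI_ex[OF ex_J] by blast+
  have \<psi>W: "\<psi> i (g z) \<in> W i" "\<phi> i (\<psi> i (g z)) = g z" if "z \<in> Zi i" for i z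
  proof -
    have "g z \<in> \<phi> i ` W i" using that PW[of i] by (auto simp: Zi_def)
    then show "\<psi> i (g z) \<in> W i" "\<phi> i (\<psi> i (g z)) = g z"
      using chart_inv(2,3)[OF lp[of i]] by (simp_all add: \<psi>_def)
  qed
  have fm: "f i \<in> borel_measurable borel" for i
    unfolding f_def using local_parametrizationD(1)[OF lp] continuous_on_volume_density[OF lp]
    by (intro borel_measurable_continuous_on_if continuous_intros) auto
  have dens: "ennreal (\<bar>det (matrix (J i z))\<bar> * f i ((\<psi> i \<circ> g) z)) = ennreal (lin_density K (g' z))" if "z \<in> Zi i" for i z
  proof -
    have "linear (frechet_derivative (\<phi> i) (at (\<psi> i (g z))))"
      using local_parametrizationD(7)[OF lp \<psi>W(1)[OF that]] has_derivative_linear by blast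
    from lin_density_comp[OF this J(2)[OF that], of K]
    have "lin_density K (g' z) = \<bar>det (matrix (J i z))\<bar> * volume_density K (\<phi> i) (\<psi> i (g z))"
      by (simp add: J(3)[OF that] volume_density_eq)
    moreover have "\<bar>c\<bar> * max 0 v = max 0 (\<bar>c\<bar> * v)" for c v :: real
      by (simp add: max_mult_distrib_left)
    ultimately show ?thesis using \<psi>W[OF that] by (simp add: f_def ennreal_max_0)
  qed
  have f0: "0 \<le> f i u" for i u by (simp add: f_def)
  note le = nn_integral_image_le[OF Zi has_derivative_at_withinI[OF J(1)] fm f0]
  note eq = nn_integral_image_eq[OF Zi has_derivative_at_withinI[OF J(1)] fm f0]
  have fv: "ennreal (volume_density K (\<phi> i) u) = ennreal (f i u)" if "u \<in> W i" for i u
    using that by (simp add: f_def ennreal_max_0)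
  have disj: "disjoint_family Zi"
    using disjoint_family_disjointed[of "\<lambda>i. \<phi> i ` W i"]
    by (auto simp: disjoint_family_on_def Zi_def P_def)
  have UNZ: "(\<Union>i. Zi i) = Z"
  proof -
    have "\<And>z. z \<in> Z \<Longrightarrow> g z \<in> (\<Union>i. P i)" using atlas_piece_UN[OF a] U(2) Z(2) by (auto simp: P_def)
    then show ?thesis by (auto simp: Zi_def)
  qed
  have sumd: "(\<Sum>i. \<integral>\<^sup>+z\<in>Zi i. ennreal (d z) \<partial>lborel) = (\<integral>\<^sup>+z\<in>Z. ennreal (d z) \<partial>lborel)"
  proof -
    have "(\<Sum>i. \<integral>\<^sup>+z\<in>Zi i. ennreal (d z) \<partial>lborel) = (\<integral>\<^sup>+z. (\<Sum>i. ennreal (d z) * indicator (Zi i) z) \<partial>lborel)"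
      using Zi d by (intro nn_integral_suminf[symmetric]) auto
    also have "\<dots> = (\<integral>\<^sup>+z. ennreal (d z) * indicator Z z \<partial>lborel)"
      by (simp add: ennreal_suminf_cmult suminf_indicator[OF disj] UNZ)
    finally show ?thesis .
  qed
  show "emeasure (atlas_measure K N \<phi> W) A \<le> (\<integral>\<^sup>+z\<in>Z. ennreal (d z) \<partial>lborel)"
    if AZ: "A \<subseteq> g ` Z" and dd: "\<And>z. z \<in> Z \<Longrightarrow> lin_density K (g' z) \<le> d z"
    unfolding emeasure_atlas_measure[OF a A] sumd[symmetric]
  proof (intro suminf_le summableI)
    fix i
    have sub: "{u \<in> atlas_piece \<phi> W i. \<phi> i u \<in> A} \<subseteq> (\<psi> i \<circ> g) ` Zi i"
    proof safe
      fix u assume u: "u \<in> atlas_piece \<phi> W i" "\<phi> i u \<in> A"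
      then obtain z where z: "z \<in> Z" "\<phi> i u = g z" using AZ by auto
      then have "z \<in> Zi i" "u = (\<psi> i \<circ> g) z"
        using u chart_inv(1)[OF lp[of i], of u] by (auto simp: Zi_def atlas_piece_def P_def \<psi>_def)
      then show "u \<in> (\<psi> i \<circ> g) ` Zi i" by blast
    qed
    have "(\<integral>\<^sup>+u\<in>{u \<in> atlas_piece \<phi> W i. \<phi> i u \<in> A}. ennreal (volume_density K (\<phi> i) u) \<partial>lborel)
      \<le> (\<integral>\<^sup>+u\<in>(\<psi> i \<circ> g) ` Zi i. ennreal (f i u) \<partial>lborel)"
      using sub fv atlas_piece_subset[OF a, of i]
      by (intro nn_integral_mono) (auto simp: indicator_def subset_iff)
    also have "\<dots> \<le> (\<integral>\<^sup>+z\<in>Zi i. ennreal (\<bar>det (matrix (J i z))\<bar> * f i ((\<psi> i \<circ> g) z)) \<partial>lborel)"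
      by (rule le)
    also have "\<dots> \<le> (\<integral>\<^sup>+z\<in>Zi i. ennreal (d z) \<partial>lborel)"
      using dens dd by (intro nn_integral_mono) (auto simp: indicator_def Zi_def intro!: ennreal_leI)
    finally show "(\<integral>\<^sup>+u\<in>{u \<in> atlas_piece \<phi> W i. \<phi> i u \<in> A}. ennreal (volume_density K (\<phi> i) u) \<partial>lborel)
      \<le> (\<integral>\<^sup>+z\<in>Zi i. ennreal (d z) \<partial>lborel)" .
  qed
  show "emeasure (atlas_measure K N \<phi> W) A = (\<integral>\<^sup>+z\<in>Z. ennreal (d z) \<partial>lborel)"
    if AZ: "A = g ` Z" and inj: "inj_on g Z" and dd: "\<And>z. z \<in> Z \<Longrightarrow> lin_density K (g' z) = d z"
    unfolding emeasure_atlas_measure[OF a A] sumd[symmetric]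
  proof (rule arg_cong[where f = suminf], rule ext)
    fix i
    have eqs: "{u \<in> atlas_piece \<phi> W i. \<phi> i u \<in> A} = (\<psi> i \<circ> g) ` Zi i"
    proof safe
      fix u assume u: "u \<in> atlas_piece \<phi> W i" "\<phi> i u \<in> A"
      then obtain z where z: "z \<in> Z" "\<phi> i u = g z" using AZ by auto
      then have "z \<in> Zi i" "u = (\<psi> i \<circ> g) z"
        using u chart_inv(1)[OF lp[of i], of u] by (auto simp: Zi_def atlas_piece_def P_def \<psi>_def)
      then show "u \<in> (\<psi> i \<circ> g) ` Zi i" by blast
    next
      fix z assume z: "z \<in> Zi i"
      then show "(\<psi> i \<circ> g) z \<in> atlas_piece \<phi> W i" "\<phi> i ((\<psi> i \<circ> g) z) \<in> A"
        using \<psi>W[OF z] AZ by (auto simp: atlas_piece_def Zi_def P_def)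
    qed
    have inj': "inj_on (\<psi> i \<circ> g) (Zi i)"
      using \<psi>W(2) inj by (auto simp: inj_on_def Zi_def) metis
    have "(\<integral>\<^sup>+u\<in>{u \<in> atlas_piece \<phi> W i. \<phi> i u \<in> A}. ennreal (volume_density K (\<phi> i) u) \<partial>lborel)
      = (\<integral>\<^sup>+u\<in>(\<psi> i \<circ> g) ` Zi i. ennreal (f i u) \<partial>lborel)"
      unfolding eqs using fv \<psi>W by (intro nn_integral_cong) (auto simp: indicator_def)
    also have "\<dots> = (\<integral>\<^sup>+z\<in>Zi i. ennreal (\<bar>det (matrix (J i z))\<bar> * f i ((\<psi> i \<circ> g) z)) \<partial>lborel)"
      by (rule eq[OF _ inj'])
    also have "\<dots> = (\<integral>\<^sup>+z\<in>Zi i. ennreal (d z) \<partial>lborel)"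
      using dens dd by (intro nn_integral_cong) (auto simp: indicator_def Zi_def)
    finally show "(\<integral>\<^sup>+u\<in>{u \<in> atlas_piece \<phi> W i. \<phi> i u \<in> A}. ennreal (volume_density K (\<phi> i) u) \<partial>lborel)
      = (\<integral>\<^sup>+z\<in>Zi i. ennreal (d z) \<partial>lborel)" .
  qed
qed

text \<open>A further chart is itself an injective map into \<open>N\<close>, so the area formula
  with equality evaluates the measure on it. This is where compatibility of charts enters.\<close>

lemma is_riemannian_measure_atlas_measure:
  fixes \<phi> :: "nat \<Rightarrow> real^'k::finite \<Rightarrow> real \<times> 'v::euclidean_space"
  assumes a: "atlas N \<phi> W"
  shows "is_riemannian_measure TYPE('k) K N (atlas_measure K N \<phi> W)"
  unfolding is_riemannian_measure_def
proof (intro conjI allI impI ballI sets_atlas_measure[OF a])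
  fix \<phi>1 :: "real^'k \<Rightarrow> real \<times> 'v" and W1 B
  assume lp: "local_parametrization N \<phi>1 W1" and B: "B \<in> sets borel" "B \<subseteq> W1"
  define d where "d u = indicator B u *\<^sub>R volume_density K \<phi>1 u" for u
  have "d \<in> borel_measurable borel"
    unfolding d_def
    using continuous_on_subset[OF continuous_on_volume_density[OF lp] B(2)] B(1)
    by (intro borel_measurable_continuous_on_indicator)
  moreover have "lin_density K (frechet_derivative \<phi>1 (at z)) = d z" if "z \<in> B" for z
    using that by (simp add: d_def volume_density_eq)
  ultimately have "emeasure (atlas_measure K N \<phi> W) (\<phi>1 ` B) = (\<integral>\<^sup>+z\<in>B. ennreal (d z) \<partial>lborel)"
    using local_parametrizationD[OF lp] B chart_image_sets[OF lp B]
    by (intro atlas_measure_image_eq[OF a, of W1 \<phi>1 "\<lambda>u. frechet_derivative \<phi>1 (at u)"])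
       (auto intro: inj_on_subset)
  also have "\<dots> = (\<integral>\<^sup>+z\<in>B. ennreal (volume_density K \<phi>1 z) \<partial>lborel)"
    by (intro nn_integral_cong) (auto simp: d_def indicator_def)
  finally show "emeasure (atlas_measure K N \<phi> W) (\<phi>1 ` B) = (\<integral>\<^sup>+z\<in>B. ennreal (volume_density K \<phi>1 z) \<partial>lborel)" .
qed

text \<open>The characterising property fixes the measure on subsets of each piece, and countably
  many disjoint pieces exhaust \<open>N\<close>.\<close>

lemma is_riemannian_measure_unique:
  fixes \<phi> :: "nat \<Rightarrow> real^'k::finite \<Rightarrow> real \<times> 'v::euclidean_space"
  assumes a: "atlas N \<phi> W" and \<mu>: "is_riemannian_measure TYPE('k) K N \<mu>"
  shows "\<mu> = atlas_measure K N \<phi> W"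
proof (rule measure_eqI)
  have lp: "local_parametrization N (\<phi> i) (W i)" for i using a by (simp add: atlas_def)
  show "sets \<mu> = sets (atlas_measure K N \<phi> W)"
    using \<mu> by (simp add: sets_atlas_measure[OF a] is_riemannian_measure_def)
  fix A assume "A \<in> sets \<mu>"
  then have A: "A \<in> sets (restrict_space borel N)" using \<mu> by (simp add: is_riemannian_measure_def)
  have piece: "emeasure m (A \<inter> disjointed (\<lambda>i. \<phi> i ` W i) i) =
     (\<integral>\<^sup>+u\<in>{u \<in> atlas_piece \<phi> W i. \<phi> i u \<in> A}. ennreal (volume_density K (\<phi> i) u) \<partial>lborel)"
    if m: "is_riemannian_measure TYPE('k) K N m" for m i
  proof -
    have "A \<inter> disjointed (\<lambda>i. \<phi> i ` W i) i = \<phi> i ` {u \<in> atlas_piece \<phi> W i. \<phi> i u \<in> A}"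
      unfolding atlas_piece_image[OF a, symmetric] by auto
    moreover have "{u \<in> atlas_piece \<phi> W i. \<phi> i u \<in> A} \<subseteq> W i" using atlas_piece_subset[OF a] by auto
    ultimately show ?thesis
      using m atlas_piece_borel[OF a A, of i] lp[of i] unfolding is_riemannian_measure_def by simp
  qed
  have tot: "emeasure m A = (\<Sum>i. emeasure m (A \<inter> disjointed (\<lambda>i. \<phi> i ` W i) i))"
    if m: "is_riemannian_measure TYPE('k) K N m" for m
  proof -
    have "range (\<lambda>i. A \<inter> disjointed (\<lambda>i. \<phi> i ` W i) i) \<subseteq> sets m"
      using m A atlas_piece_sets[OF a] by (auto simp: is_riemannian_measure_def)
    moreover have "disjoint_family (\<lambda>i. A \<inter> disjointed (\<lambda>i. \<phi> i ` W i) i)"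
      using disjoint_family_disjointed[of "\<lambda>i. \<phi> i ` W i"] by (auto simp: disjoint_family_on_def)
    moreover have "(\<Union>i. A \<inter> disjointed (\<lambda>i. \<phi> i ` W i) i) = A"
      using atlas_piece_UN[OF a] sets.sets_into_space[OF A] by (auto simp: space_restrict_space)
    ultimately show ?thesis by (simp add: suminf_emeasure)
  qed
  show "emeasure \<mu> A = emeasure (atlas_measure K N \<phi> W) A"
    using tot[OF \<mu>] tot[OF is_riemannian_measure_atlas_measure[OF a]] piece[OF \<mu>]
      piece[OF is_riemannian_measure_atlas_measure[OF a]] by simp
qed

lemma riemannian_measure_eq_atlas_measure:
  fixes \<phi> :: "nat \<Rightarrow> real^'k::finite \<Rightarrow> real \<times> 'v::euclidean_space"
  assumes a: "atlas N \<phi> W"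
  shows "riemannian_measure TYPE('k) K N = atlas_measure K N \<phi> W"
proof -
  have "riemannian_measure TYPE('k) K N = (THE \<mu>. is_riemannian_measure TYPE('k) K N \<mu>)"
    by (simp add: riemannian_measure_def is_riemannian_measure_def)
  also have "\<dots> = atlas_measure K N \<phi> W"
    by (rule the_equality)
       (use is_riemannian_measure_atlas_measure[OF a] is_riemannian_measure_unique[OF a] in auto)
  finally show ?thesis .
qed

lemma emeasure_riemannian_measure_UN_chart:
  fixes \<phi> :: "nat \<Rightarrow> real^'k::finite \<Rightarrow> real \<times> 'v::euclidean_space"
  assumes a: "atlas N \<phi> W"
  shows "emeasure (riemannian_measure TYPE('k) K N) N =
    (\<Sum>i. \<integral>\<^sup>+u\<in>atlas_piece \<phi> W i. ennreal (volume_density K (\<phi> i) u) \<partial>lborel)"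
proof -
  have "N \<in> sets (restrict_space borel N)" by (auto simp: sets_restrict_space)
  moreover have "{u \<in> atlas_piece \<phi> W i. \<phi> i u \<in> N} = atlas_piece \<phi> W i" for i
    using a atlas_piece_subset[OF a, of i] by (auto simp: atlas_def)
  ultimately show ?thesis
    by (simp add: riemannian_measure_eq_atlas_measure[OF a] emeasure_atlas_measure[OF a])
qed

lemma riemannian_measure_chart:
  fixes \<phi> :: "real^'k::finite \<Rightarrow> real \<times> 'v::euclidean_space"
  assumes N: "smooth_submanifold TYPE('k) N" and \<phi>: "local_parametrization N \<phi> W"
    and B: "B \<in> sets borel" "B \<subseteq> W"
  shows "emeasure (riemannian_measure TYPE('k) K N) (\<phi> ` B) =
    (\<integral>\<^sup>+u\<in>B. ennreal (volume_density K \<phi> u) \<partial>lborel)"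
proof -
  obtain \<phi>' :: "nat \<Rightarrow> real^'k \<Rightarrow> real \<times> 'v" and W' where a: "atlas N \<phi>' W'"
    by (rule ex_atlas_submanifold[OF N \<phi>])
  show ?thesis
    using is_riemannian_measure_atlas_measure[OF a, of K] \<phi> B
    by (simp add: riemannian_measure_eq_atlas_measure[OF a] is_riemannian_measure_def)
qed

lemma sets_riemannian_measure:
  assumes N: "smooth_submanifold TYPE('k::finite) N" "N \<noteq> {}"
  shows "sets (riemannian_measure TYPE('k) K N) = sets (restrict_space borel N)"
proof -
  obtain \<phi> :: "real^'k \<Rightarrow> _" and W where "local_parametrization N \<phi> W"
    using N unfolding smooth_submanifold_def by (meson ex_in_conv)
  then obtain \<phi>' :: "nat \<Rightarrow> real^'k \<Rightarrow> _" and W' where a: "atlas N \<phi>' W'" by (rule ex_atlas_submanifold[OF N(1)])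
  show ?thesis
    by (simp add: riemannian_measure_eq_atlas_measure[OF a] sets_atlas_measure[OF a])
qed

text \<open>The density is bounded on a closed ball in a chart, so every point has a neighbourhood
  of finite measure; finitely many of these cover \<open>N\<close>.\<close>

lemma riemannian_measure_compact_finite:
  fixes N :: "(real \<times> 'v::euclidean_space) set"
  assumes N: "smooth_submanifold TYPE('k::finite) N" "N \<noteq> {}" "compact N"
  shows "emeasure (riemannian_measure TYPE('k) K N) N < \<infinity>"
proof -
  let ?\<mu> = "riemannian_measure TYPE('k) K N"
  define C where "C = {A. openin (top_of_set N) A \<and> emeasure ?\<mu> A < \<infinity>}"
  have "N \<subseteq> \<Union>C"
  proof
    fix p assume "p \<in> N"
    then obtain \<phi> :: "real^'k \<Rightarrow> real \<times> 'v" and W where \<phi>: "local_parametrization N \<phi> W" and "p \<in> \<phi> ` W"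
      using N(1) by (auto simp: smooth_submanifold_def)
    then obtain u where u: "u \<in> W" "p = \<phi> u" by auto
    obtain e where e: "e > 0" "cball u e \<subseteq> W"
      using local_parametrizationD(1)[OF \<phi>] u(1) open_contains_cball by blast
    have "compact (volume_density K \<phi> ` cball u e)"
      by (intro compact_continuous_image continuous_on_subset[OF continuous_on_volume_density[OF \<phi>] e(2)]) simp
    then obtain b where b: "\<And>x. x \<in> cball u e \<Longrightarrow> volume_density K \<phi> x \<le> b"
      by (meson bounded_imp_bdd_above compact_imp_bounded bdd_above_def imageI)
    have sub: "ball u e \<subseteq> W" using e(2) ball_subset_cball by blast
    have "emeasure ?\<mu> (\<phi> ` ball u e) = (\<integral>\<^sup>+x\<in>ball u e. ennreal (volume_density K \<phi> x) \<partial>lborel)"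
      using sub by (intro riemannian_measure_chart[OF N(1) \<phi>]) auto
    also have "\<dots> \<le> (\<integral>\<^sup>+x. ennreal b * indicator (ball u e) x \<partial>lborel)"
      using b by (intro nn_integral_mono) (auto simp: indicator_def intro!: ennreal_leI)
    also have "\<dots> = ennreal b * emeasure lborel (ball u e)"
      by (intro nn_integral_cmult_indicator) auto
    also have "\<dots> < \<infinity>"
      using emeasure_lborel_ball_finite[of u e] by (simp add: ennreal_mult_less_top)
    finally have "\<phi> ` ball u e \<in> C"
      using local_parametrizationD(3)[OF local_parametrization_subset[OF \<phi> open_ball sub]]
      by (simp add: C_def)
    then show "p \<in> \<Union>C" using u e by (intro UnionI[of "\<phi> ` ball u e"]) auto
  qed
  moreover have "\<forall>c\<in>C. openin (top_of_set N) c" by (simp add: C_def)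
  ultimately obtain D where D: "D \<subseteq> C" "finite D" "N \<subseteq> \<Union>D"
    using N(3) unfolding compact_eq_openin_cover by meson
  have Ds: "D \<subseteq> sets ?\<mu>"
    using D(1) openin_sets_restrict by (auto simp: C_def sets_riemannian_measure[OF N(1,2)])
  have "N \<in> sets ?\<mu>" by (auto simp: sets_riemannian_measure[OF N(1,2)] sets_restrict_space)
  have "emeasure ?\<mu> N \<le> emeasure ?\<mu> (\<Union>A\<in>D. A)"
    using D Ds by (intro emeasure_mono) auto
  also have "\<dots> \<le> (\<Sum>A\<in>D. emeasure ?\<mu> A)"
    using D Ds by (intro emeasure_subadditive_finite) auto
  also have "\<dots> < \<infinity>" using D(1,2) by (auto simp: C_def)
  finally show ?thesis .
qed

section \<open>Generalised trigonometry\<close>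

lemma cs_K_0 [simp]: "s_K K 0 = 0" "c_K K 0 = 1"
  by (simp_all add: s_K_def c_K_def)

lemma cs_K_minus [simp]: "s_K K (- t) = - s_K K t" "c_K K (- t) = c_K K t"
  by (simp_all add: s_K_def c_K_def)

lemma cs_K_square: "K \<in> {-1, 0, 1} \<Longrightarrow> (c_K K t)\<^sup>2 + K * (s_K K t)\<^sup>2 = 1"
  by (auto simp: s_K_def c_K_def cosh_square_eq)

lemma s_K_diff: "K \<in> {-1, 0, 1} \<Longrightarrow> s_K K (a - b) = s_K K a * c_K K b - c_K K a * s_K K b"
  by (auto simp: s_K_def c_K_def sin_diff sinh_diff)

lemma c_K_diff: "K \<in> {-1, 0, 1} \<Longrightarrow> c_K K (a - b) = c_K K a * c_K K b + K * s_K K a * s_K K b"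
  by (auto simp: s_K_def c_K_def cos_diff cosh_diff)

lemma s_K_add: "K \<in> {-1, 0, 1} \<Longrightarrow> s_K K (a + b) = s_K K a * c_K K b + c_K K a * s_K K b"
  using s_K_diff[of K a "- b"] by simp

lemma c_K_add: "K \<in> {-1, 0, 1} \<Longrightarrow> c_K K (a + b) = c_K K a * c_K K b - K * s_K K a * s_K K b"
  using c_K_diff[of K a "- b"] by simp

lemma has_real_derivative_s_K [derivative_intros]:
  "(f has_real_derivative f') (at x within A) \<Longrightarrow> ((\<lambda>x. s_K K (f x)) has_real_derivative (c_K K (f x) * f')) (at x within A)"
  unfolding s_K_def c_K_def by (auto intro!: derivative_eq_intros)

lemma has_real_derivative_c_K [derivative_intros]:
  "K \<in> {-1, 0, 1} \<Longrightarrow> (f has_real_derivative f') (at x within A) \<Longrightarrow>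
    ((\<lambda>x. c_K K (f x)) has_real_derivative (- K * s_K K (f x) * f')) (at x within A)"
  unfolding s_K_def c_K_def by (auto intro!: derivative_eq_intros)

lemma continuous_on_cs_K [continuous_intros]:
  fixes f :: "'a::t2_space \<Rightarrow> real"
  assumes "continuous_on A f"
  shows "continuous_on A (\<lambda>x. s_K K (f x))" "continuous_on A (\<lambda>x. c_K K (f x))"
proof -
  have "continuous_on A (\<lambda>x. sin (f x))" "continuous_on A (\<lambda>x. cos (f x))"
    "continuous_on A (\<lambda>x. sinh (f x))" "continuous_on A (\<lambda>x. cosh (f x))"
    using assms by (auto intro!: continuous_intros)
  then show "continuous_on A (\<lambda>x. s_K K (f x))" "continuous_on A (\<lambda>x. c_K K (f x))"
    using assms by (cases "K = 1"; cases "K = 0"; simp add: s_K_def c_K_def)+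
qed

lemma s_K_pos: "t \<in> radii K \<Longrightarrow> 0 < s_K K t"
  by (auto simp: radii_def s_K_def sin_gt_zero split: if_splits)

lemma radii_mono: "r \<in> radii K \<Longrightarrow> 0 < t \<Longrightarrow> t \<le> r \<Longrightarrow> t \<in> radii K"
  by (auto simp: radii_def split: if_splits)

lemma radii_pos: "r \<in> radii K \<Longrightarrow> 0 < r"
  by (auto simp: radii_def split: if_splits)

lemma c_K_half: "K \<in> {-1, 0, 1} \<Longrightarrow> c_K K t = 1 - 2 * K * (s_K K (t / 2))\<^sup>2"
  using c_K_add[of K "t/2" "t/2"] cs_K_square[of K "t/2"] by (auto simp: power2_eq_square)

lemma s_K_half: "K \<in> {-1, 0, 1} \<Longrightarrow> s_K K t = 2 * s_K K (t / 2) * c_K K (t / 2)"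
  using s_K_add[of K "t/2" "t/2"] by simp

text \<open>The half angle matters for K = 1: \<open>s_K\<close> itself is not monotone on [0, pi],
  but s_K(t/2), half the length of the chord, is.\<close>

lemma s_K_half_less:
  assumes K: "K \<in> {-1, 0, 1}" and "0 \<le> a" "a < b" "K = 1 \<Longrightarrow> b \<le> pi"
  shows "s_K K (a / 2) < s_K K (b / 2)"
  using assms by (auto simp: s_K_def intro: sin_monotone_2pi_le sin_monotone_2pi)

lemma s_K_half_nonneg: "0 \<le> a \<Longrightarrow> (K = 1 \<Longrightarrow> a \<le> 2 * pi) \<Longrightarrow> 0 \<le> s_K K (a / 2)"
  by (auto simp: s_K_def intro: sin_ge_zero)

lemma cot_K_arccot_K:
  assumes K: "K \<in> {-1, 0, 1}" and x: "x \<in> arccot_dom K"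
  shows "arccot_K K x \<in> radii K" "cot_K K (arccot_K K x) = x"
proof -
  have "\<exists>r\<in>radii K. cot_K K r = x"
  proof -
    consider "K = 1" | "K = 0" | "K = -1" using K by auto
    then show ?thesis
    proof cases
      case 1
      have "cos (pi/2 - arctan x) / sin (pi/2 - arctan x) = x"
        using tan_arctan[of x] by (simp add: cos_diff sin_diff tan_def)
      then show ?thesis
        using 1 arctan_bounded[of x] by (intro bexI[of _ "pi/2 - arctan x"]) (auto simp: cot_K_def c_K_def s_K_def radii_def)
    next
      case 2
      then show ?thesis using x
        by (intro bexI[of _ "1/x"]) (auto simp: cot_K_def c_K_def s_K_def radii_def arccot_dom_def)
    next
      case 3
      then have x1: "x > 1" using x by (auto simp: arccot_dom_def)
      then have q: "x\<^sup>2 - 1 > 0" by (simp add: one_less_power)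
      \<comment> \<open>From coth r = x and cosh^2 - sinh^2 = 1 one gets sinh r = 1 / sqrt (x^2 -
        1).\<close>
      define r where "r = arsinh (1 / sqrt (x\<^sup>2 - 1))"
      have "sinh r > 0" using q by (simp add: r_def)
      then have "r > 0" by (simp add: sinh_real_pos_iff)
      moreover have "cosh r = x / sqrt (x\<^sup>2 - 1)"
      proof -
        have "(1 / sqrt (x\<^sup>2 - 1))\<^sup>2 + 1 = (x / sqrt (x\<^sup>2 - 1))\<^sup>2"
          using q by (simp add: power_divide field_simps)
        then show ?thesis using q x1 by (simp add: r_def cosh_arsinh_real real_sqrt_divide)
      qed
      then have "cosh r / sinh r = x" using q by (simp add: r_def)
      ultimately show ?thesis using 3
        by (intro bexI[of _ r]) (auto simp: cot_K_def c_K_def s_K_def radii_def)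
    qed
  qed
  then have "x \<in> cot_K K ` radii K" by auto
  then show "arccot_K K x \<in> radii K" "cot_K K (arccot_K K x) = x"
    by (auto simp: arccot_K_def inv_into_into f_inv_into_f)
qed

text \<open>The left side is the normalised trace of c I - s S when the mean curvature is
  \<open>cot_K K r\<close>; for a ball it is the only eigenvalue of this endomorphism.\<close>

lemma cot_K_diff:
  assumes K: "K \<in> {-1, 0, 1}" and r: "r \<in> radii K"
  shows "c_K K t - cot_K K r * s_K K t = s_K K (r - t) / s_K K r"
  using s_K_pos[OF r] by (simp add: s_K_diff[OF K] cot_K_def field_simps)

text \<open>Equal cotangents give s_K(a - b) = 0, and for K = 1 two radii differ by less than
  pi.\<close>

lemma arccot_K_cot_K:
  assumes K: "K \<in> {-1, 0, 1}" and r: "r \<in> radii K"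
  shows "cot_K K r \<in> arccot_dom K" "arccot_K K (cot_K K r) = r"
proof -
  have inj: "inj_on (cot_K K) (radii K)"
  proof (rule inj_onI)
    fix a b assume ab: "a \<in> radii K" "b \<in> radii K" "cot_K K a = cot_K K b"
    then have "s_K K (a - b) = 0"
      using s_K_pos[OF ab(1)] s_K_pos[OF ab(2)] by (simp add: s_K_diff[OF K] cot_K_def field_simps)
    then show "a = b"
      using ab(1,2) K sin_gt_zero[of "a - b"] sin_gt_zero[of "b - a"] sin_minus[of "a - b"]
      by (cases "a < b"; cases "b < a") (auto simp: s_K_def radii_def)
  qed
  then show "arccot_K K (cot_K K r) = r"
    using r by (simp add: arccot_K_def inv_into_f_f)
  show "cot_K K r \<in> arccot_dom K"
    using K r s_K_pos[OF r] by (auto simp: arccot_dom_def cot_K_def c_K_def s_K_def radii_def cosh_real_pos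
      intro: divide_pos_pos simp: less_divide_eq sinh_less_cosh_real)
qed

section \<open>Geometry of the space forms\<close>

text \<open>For K = -1 this is the Minkowski square of the chord; \<open>qdist_geodesic\<close>
  shows that between points of the space form it depends only on the length of the connecting
  geodesic.\<close>

definition qdist :: "real \<Rightarrow> real \<times> 'v::euclidean_space \<Rightarrow> real \<times> 'v \<Rightarrow> real" where
  "qdist K x y = metric_K K (x - y) (x - y)"

lemma qdist_commute: "qdist K x y = qdist K y x"
  by (simp add: qdist_def metric_K_def power2_eq_square[symmetric] power2_commute inner_diff inner_commute algebra_simps)

lemma space_form_iff:
  "p \<in> space_form K \<longleftrightarrow> (fst p)\<^sup>2 + K * (snd p \<bullet> snd p) = 1 \<and> (K \<le> 0 \<longrightarrow> fst p > 0)"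
  by (auto simp: space_form_def power2_norm_eq_inner)

lemma space_form_metric: "K \<in> {-1, 1} \<Longrightarrow> p \<in> space_form K \<Longrightarrow> metric_K K p p = K"
  by (auto simp: space_form_iff metric_K_def power2_eq_square)

lemma space_form_fst_0: "p \<in> space_form 0 \<Longrightarrow> fst p = 1"
  by (auto simp: space_form_iff power2_eq_1_iff)

text \<open>Obtained by differentiating the equation of the space form;
  \<open>tangent_space_space_form\<close> identifies it with the tangent space.\<close>

definition sf_tangent :: "real \<Rightarrow> real \<times> 'v::euclidean_space \<Rightarrow> (real \<times> 'v) set" where
  "sf_tangent K p = {X. fst p * fst X + K * (snd p \<bullet> snd X) = 0}"

lemma sf_tangent_metric: "K \<in> {-1, 1} \<Longrightarrow> X \<in> sf_tangent K p \<longleftrightarrow> metric_K K p X = 0"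
  by (auto simp: sf_tangent_def metric_K_def)

lemma sf_tangent_0: "p \<in> space_form 0 \<Longrightarrow> X \<in> sf_tangent 0 p \<longleftrightarrow> fst X = 0"
  by (auto simp: sf_tangent_def space_form_fst_0)

lemma sf_tangent_scaleR: "X \<in> sf_tangent K p \<Longrightarrow> c *\<^sub>R X \<in> sf_tangent K p"
  by (auto simp: sf_tangent_def algebra_simps) (metis mult.left_commute mult_zero_right distrib_left)

lemma sf_tangent_add: "X \<in> sf_tangent K p \<Longrightarrow> Y \<in> sf_tangent K p \<Longrightarrow> X + Y \<in> sf_tangent K p"
  by (auto simp: sf_tangent_def algebra_simps inner_simps)

text \<open>Cauchy-Schwarz in \<open>V\<close>. It makes the Minkowski form positive definite on
  tangent vectors of the hyperboloid, although the form is indefinite on the ambient space.\<close>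

lemma space_form_minus_one_bound:
  assumes p: "p \<in> space_form (-1)" and X: "X \<in> sf_tangent (-1) p"
  shows "(snd X \<bullet> snd X) \<le> (fst p)\<^sup>2 * metric_K (-1) X X"
proof -
  have "fst p * fst X = snd p \<bullet> snd X" using X by (simp add: sf_tangent_def)
  then have "(fst p)\<^sup>2 * (fst X)\<^sup>2 = (snd p \<bullet> snd X)\<^sup>2" by (metis power_mult_distrib)
  also have "\<dots> \<le> (snd p \<bullet> snd p) * (snd X \<bullet> snd X)" by (rule Cauchy_Schwarz_ineq)
  also have "snd p \<bullet> snd p = (fst p)\<^sup>2 - 1" using p by (simp add: space_form_iff)
  finally show ?thesis by (simp add: metric_K_def power2_eq_square algebra_simps)
qed

lemma metric_sf_tangent:
  assumes K: "K \<in> {-1, 0, 1}" and p: "p \<in> space_form K" and X: "X \<in> sf_tangent K p"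
  shows "0 \<le> metric_K K X X" "metric_K K X X = 0 \<longleftrightarrow> X = 0"
proof -
  consider "K = 1" | "K = 0" | "K = -1" using K by auto
  then have "0 \<le> metric_K K X X \<and> (metric_K K X X = 0 \<longrightarrow> X = 0)"
  proof cases
    case 1
    have "fst X * fst X \<ge> 0" "snd X \<bullet> snd X \<ge> 0" by auto
    then show ?thesis using 1 by (auto simp: metric_K_def prod_eq_iff add_nonneg_eq_0_iff)
  next
    case 2
    then show ?thesis using X p by (auto simp: metric_K_def prod_eq_iff sf_tangent_0)
  next
    case 3
    have le: "(snd X \<bullet> snd X) \<le> (fst p)\<^sup>2 * metric_K K X X"
      using space_form_minus_one_bound p X 3 by simp
    have p0: "fst p > 0" using p 3 by (simp add: space_form_iff)
    have "0 \<le> (fst p)\<^sup>2 * metric_K K X X" using le inner_ge_zero[of "snd X"] by linarith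
    then have "0 \<le> metric_K K X X" using p0 by (simp add: zero_le_mult_iff)
    moreover have "X = 0" if "metric_K K X X = 0"
    proof -
      have "snd X = 0" using le that inner_ge_zero[of "snd X"] by simp
      then show ?thesis using X p0 by (simp add: sf_tangent_def prod_eq_iff)
    qed
    ultimately show ?thesis by simp
  qed
  then show "0 \<le> metric_K K X X" "metric_K K X X = 0 \<longleftrightarrow> X = 0" by (auto simp: metric_K_bilinear)
qed

lemma geodesic_in_space_form:
  assumes K: "K \<in> {-1, 0, 1}" and p: "p \<in> space_form K"
    and v: "v \<in> sf_tangent K p" "metric_K K v v = 1"
  shows "geodesic K p v t \<in> space_form K"
proof -
  let ?c = "c_K K t" and ?s = "s_K K t"
  have cs: "?c\<^sup>2 + K * ?s\<^sup>2 = 1" by (rule cs_K_square[OF K])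
  have pp: "fst p * fst p + K * (snd p \<bullet> snd p) = 1"
    using p by (simp add: space_form_iff power2_eq_square)
  have pv: "fst p * fst v + K * (snd p \<bullet> snd v) = 0" using v by (simp add: sf_tangent_def)
  have vv: "fst v * fst v + K * (snd v \<bullet> snd v) = K"
    using K v(2) p v(1) by (auto simp: metric_K_def sf_tangent_0)
  have "(fst (geodesic K p v t))\<^sup>2 + K * (snd (geodesic K p v t) \<bullet> snd (geodesic K p v t)) =
     ?c\<^sup>2 * (fst p * fst p + K * (snd p \<bullet> snd p)) + 2 * ?c * ?s * (fst p * fst v + K * (snd p \<bullet> snd v))
     + ?s\<^sup>2 * (fst v * fst v + K * (snd v \<bullet> snd v))"
    by (simp add: geodesic_def inner_simps power2_eq_square algebra_simps inner_commute)
  also have "\<dots> = 1" using cs unfolding pp pv vv by (simp add: mult.commute)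
  moreover have "fst (geodesic K p v t) > 0" if "K \<le> 0"
  proof (cases "K = 0")
    case True
    then show ?thesis using p v by (auto simp: geodesic_def c_K_def space_form_fst_0 sf_tangent_0)
  next
    case False
    then have K1: "K = -1" using K that by auto
    have p0: "fst p > 0" using p K1 by (simp add: space_form_iff)
    have "snd v \<bullet> snd v = 1 + fst v * fst v" using v(2) K1 by (simp add: metric_K_def)
    then have "1 + fst v * fst v \<le> (fst p)\<^sup>2"
      using space_form_minus_one_bound[of p v] p v K1 by simp
    \<comment> \<open>Together with |sinh t| \<le> cosh t, this strict inequality keeps the geodesic
      on the upper sheet.\<close>
    then have lt: "\<bar>fst v\<bar> < fst p"
      using p0 by (metis abs_le_square_iff abs_of_pos add_le_same_cancel2 linorder_not_less
        not_one_le_zero order_trans power2_eq_square)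
    have "\<bar>sinh t\<bar> \<le> cosh t" using sinh_less_cosh_real[of t] sinh_less_cosh_real[of "-t"] by (auto simp: abs_if)
    then have "\<bar>sinh t * fst v\<bar> \<le> cosh t * \<bar>fst v\<bar>" by (simp add: abs_mult mult_right_mono)
    also have "\<dots> < cosh t * fst p" using lt by (simp add: cosh_real_pos)
    finally show ?thesis using K1 by (auto simp: geodesic_def c_K_def s_K_def abs_if split: if_splits)
  qed
  ultimately show ?thesis by (simp add: space_form_iff)
qed

lemma geodesic_0 [simp]: "geodesic K p v 0 = p"
  by (simp add: geodesic_def)

lemma geodesic_minus: "geodesic K p v (- t) = geodesic K p (- v) t"
  by (simp add: geodesic_def)

lemma geodesic_has_vector_derivative:
  assumes K: "K \<in> {-1, 0, 1}"
  shows "(geodesic K p v has_vector_derivative (- K * s_K K t) *\<^sub>R p + c_K K t *\<^sub>R v) (at t within A)"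
  unfolding geodesic_def[abs_def] using K
  by (auto intro!: derivative_eq_intros simp: has_real_derivative_iff_has_vector_derivative[symmetric])

lemma continuous_on_geodesic: "continuous_on A (geodesic K p v)"
  unfolding geodesic_def[abs_def] by (intro continuous_intros)

text \<open>With half angles, c_K(t) - 1 and s_K(t) both contain the factor s_K(t/2). The terms with
  \<open>metric_K K p p\<close> and \<open>metric_K K p v\<close> carry a factor K, so their values
  do not matter for K = 0.\<close>

lemma qdist_geodesic:
  assumes K: "K \<in> {-1, 0, 1}" and p: "p \<in> space_form K"
    and v: "v \<in> sf_tangent K p" "metric_K K v v = 1"
  shows "qdist K p (geodesic K p v t) = 4 * (s_K K (t / 2))\<^sup>2"
proof -
  define a where "a = s_K K (t/2)"
  define b where "b = c_K K (t/2)"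
  have ab: "b\<^sup>2 + K * a\<^sup>2 = 1" unfolding a_def b_def by (rule cs_K_square[OF K])
  have c: "c_K K t = 1 - 2 * K * a\<^sup>2" and s: "s_K K t = 2 * a * b"
    using c_K_half[OF K, of t] s_K_half[OF K, of t] by (simp_all add: a_def b_def)
  have eq: "p - geodesic K p v t = (2 * K * a\<^sup>2) *\<^sub>R p - (2 * a * b) *\<^sub>R v"
    unfolding geodesic_def c s by (simp add: algebra_simps)
  have "qdist K p (geodesic K p v t) =
     4 * K\<^sup>2 * a^4 * metric_K K p p - 8 * a^3 * b * (K * metric_K K p v) + 4 * a\<^sup>2 * b\<^sup>2 * metric_K K v v"
    unfolding qdist_def eq
    by (simp add: metric_K_bilinear metric_K_commute[of K v p] power2_eq_square power3_eq_cube power4_eq_xxxx algebra_simps)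
  also have "\<dots> = 4 * a\<^sup>2 * (K * a\<^sup>2 + b\<^sup>2)"
  proof (cases "K = 0")
    case False
    then have "metric_K K p p = K" "metric_K K p v = 0" "K\<^sup>2 = 1"
      using K p v by (auto simp: space_form_metric sf_tangent_metric)
    then show ?thesis using v by (simp add: power2_eq_square power4_eq_xxxx algebra_simps)
  qed (use v in simp)
  also have "\<dots> = 4 * a\<^sup>2" using ab by (simp add: add.commute)
  finally show ?thesis by (simp add: a_def)
qed

lemma ex_unit_sf_tangent:
  assumes K: "K \<in> {-1, 0, 1}" and p: "p \<in> space_form K"
  shows "\<exists>v. v \<in> sf_tangent K p \<and> metric_K K v v = 1"
proof -
  obtain b :: 'a where b: "b \<in> Basis" by (metis SOME_Basis)
  have "\<exists>X. X \<in> sf_tangent K p \<and> X \<noteq> 0"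
  proof (cases "fst p = 0")
    case True
    have "K = 1" using p True K by (auto simp: space_form_iff)
    then show ?thesis using True by (intro exI[of _ "(1, 0)"]) (simp add: sf_tangent_def zero_prod_def)
  next
    case False
    then show ?thesis
      using b by (intro exI[of _ "(- K * (snd p \<bullet> b) / fst p, b)"]) (auto simp: sf_tangent_def zero_prod_def)
  qed
  then obtain X where X: "X \<in> sf_tangent K p" "X \<noteq> 0" by auto
  then have q: "metric_K K X X > 0" using metric_sf_tangent[OF K p X(1)] by auto
  show ?thesis
    by (rule exI[of _ "(1 / sqrt (metric_K K X X)) *\<^sub>R X"])
       (use q X in \<open>auto simp: metric_K_bilinear intro!: sf_tangent_scaleR simp del: scaleR_Pair\<close>)
qed

text \<open>The plane spanned by \<open>p\<close> and \<open>v\<close> cuts the space form in a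
  circle, a straight line or a branch of a hyperbola, parametrized by c_K and s_K. The parameter is
  signed because \<open>v\<close> is prescribed.\<close>

lemma ex_polar_angle:
  assumes K: "K \<in> {-1, 0, 1}" and p: "p \<in> space_form K"
    and v: "v \<in> sf_tangent K p" "metric_K K v v = 1"
    and x: "a *\<^sub>R p + b *\<^sub>R v \<in> space_form K"
  shows "\<exists>t. a = c_K K t \<and> b = s_K K t \<and> (K = 1 \<longrightarrow> \<bar>t\<bar> \<le> pi)"
proof -
  let ?x = "a *\<^sub>R p + b *\<^sub>R v"
  have ab: "a\<^sup>2 + K * b\<^sup>2 = 1" if "K \<noteq> 0"
  proof -
    have m: "metric_K K p p = K" "metric_K K p v = 0" "metric_K K ?x ?x = K" "K * K = 1"
      using that K p v x by (auto simp: space_form_metric sf_tangent_metric)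
    have "metric_K K ?x ?x = a\<^sup>2 * metric_K K p p + 2 * a * b * metric_K K p v + b\<^sup>2 * metric_K K v v"
      by (simp only: metric_K_bilinear metric_K_commute[of K v p] power2_eq_square) (simp add: algebra_simps)
    then have "K = a\<^sup>2 * K + b\<^sup>2" using m v by simp
    then have "K * K = K * (a\<^sup>2 * K + b\<^sup>2)" by simp
    also have "\<dots> = (K * K) * a\<^sup>2 + K * b\<^sup>2" by (simp add: algebra_simps)
    finally show ?thesis using m(4) by simp
  qed
  consider "K = 1" | "K = 0" | "K = -1" using K by auto
  then show ?thesis
  proof cases
    case 1
    then have ab': "a\<^sup>2 + b\<^sup>2 = 1" using ab by simp
    then have a: "\<bar>a\<bar> \<le> 1" by (metis abs_square_le_1 le_add_same_cancel1 zero_le_power2)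
    have "sqrt (1 - a\<^sup>2) = \<bar>b\<bar>" using ab' by (metis add_diff_cancel_left' real_sqrt_abs)
    then have s: "sin (arccos a) = \<bar>b\<bar>" using a by (simp add: sin_arccos abs_le_iff)
    have "0 \<le> arccos a" "arccos a \<le> pi" using a by (auto simp: arccos_lbound arccos_ubound abs_le_iff)
    then show ?thesis using 1 a s
      by (intro exI[of _ "if b \<ge> 0 then arccos a else - arccos a"])
         (auto simp: c_K_def s_K_def cos_arccos_abs)
  next
    case 2
    then have "fst ?x = 1" using x space_form_fst_0 by blast
    then have "a = 1" using 2 p v by (simp add: sf_tangent_0 space_form_fst_0)
    then show ?thesis using 2 by (auto simp: c_K_def s_K_def)
  next
    case 3
    then have ab': "a\<^sup>2 = b\<^sup>2 + 1" using ab by simp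
    define t where "t = arsinh b"
    have t: "sinh t = b" by (simp add: t_def)
    have ch: "(cosh t)\<^sup>2 = a\<^sup>2" using ab' t by (simp add: cosh_square_eq)
    \<comment> \<open>Otherwise the point would be the negative of a point on the geodesic and lie
      on the lower sheet.\<close>
    have "a > 0"
    proof (rule ccontr)
      assume "\<not> a > 0"
      then have a: "a = - cosh t" using ch cosh_real_pos[of t] by (metis power2_eq_iff)
      have "?x = - geodesic K p v (- t)" using 3 a t by (simp add: geodesic_def c_K_def s_K_def)
      moreover have "fst (geodesic K p v (- t)) > 0"
        using geodesic_in_space_form[OF K p v, of "- t"] 3 by (simp add: space_form_iff)
      ultimately have "fst ?x < 0" by simp
      then show False using x 3 by (simp add: space_form_iff)
    qed
    then have "a = cosh t" using ch cosh_real_pos[of t] by (metis power2_eq_iff less_asym neg_less_0_iff_less)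
    then show ?thesis using 3 t by (auto simp: c_K_def s_K_def intro!: exI[of _ t])
  qed
qed

text \<open>The multiple of \<open>p\<close> whose removal leaves a tangent vector at
  \<open>p\<close>: determined by orthogonality to \<open>p\<close> for K = 1 and K = -1, and by the
  first coordinate for K = 0.\<close>

definition sf_coeff :: "real \<Rightarrow> real \<times> 'v::euclidean_space \<Rightarrow> real \<times> 'v \<Rightarrow> real" where
  "sf_coeff K p x = (if K = 0 then 1 else K * metric_K K x p)"

lemma sf_coeff:
  assumes K: "K \<in> {-1, 0, 1}" and p: "p \<in> space_form K" and x: "x \<in> space_form K"
  shows "x - sf_coeff K p x *\<^sub>R p \<in> sf_tangent K p"
proof (cases "K = 0")
  case True
  then show ?thesis using p x by (simp add: sf_tangent_0 sf_coeff_def space_form_fst_0)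
next
  case False
  then have K1: "K \<in> {-1, 1}" using K by auto
  then have "K * K = 1" by auto
  then have "metric_K K x p - K * metric_K K x p * K = 0" by algebra
  then show ?thesis using False
    by (simp add: sf_tangent_metric[OF K1] sf_coeff_def metric_K_bilinear space_form_metric[OF K1 p] metric_K_commute[of K p x])
qed

text \<open>Surjectivity of the exponential map: the tangent part of \<open>x\<close> gives the
  direction, the coefficients give the parameter, and a negative parameter is removed by reversing
  \<open>v\<close>.\<close>

lemma ex_geodesic:
  assumes K: "K \<in> {-1, 0, 1}" and p: "p \<in> space_form K" and x: "x \<in> space_form K"
  obtains v t where "v \<in> sf_tangent K p" "metric_K K v v = 1" "0 \<le> t" "K = 1 \<Longrightarrow> t \<le> pi"
    "x = geodesic K p v t"
proof -
  define w where "w = x - sf_coeff K p x *\<^sub>R p"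
  have w: "w \<in> sf_tangent K p" unfolding w_def by (rule sf_coeff[OF K p x])
  have "\<exists>v b. v \<in> sf_tangent K p \<and> metric_K K v v = 1 \<and> w = b *\<^sub>R v"
  proof (cases "w = 0")
    case True
    then show ?thesis using ex_unit_sf_tangent[OF K p] by (metis scaleR_zero_left)
  next
    case False
    then have q: "metric_K K w w > 0" using metric_sf_tangent[OF K p w] by auto
    have "metric_K K ((1 / sqrt (metric_K K w w)) *\<^sub>R w) ((1 / sqrt (metric_K K w w)) *\<^sub>R w) = 1"
      using q by (simp add: metric_K_bilinear)
    moreover have "w = sqrt (metric_K K w w) *\<^sub>R ((1 / sqrt (metric_K K w w)) *\<^sub>R w)" using q by simp
    ultimately show ?thesis using sf_tangent_scaleR[OF w] by blast
  qed
  then obtain v b where v: "v \<in> sf_tangent K p" "metric_K K v v = 1" "w = b *\<^sub>R v" by blast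
  have xe: "x = sf_coeff K p x *\<^sub>R p + b *\<^sub>R v" using v(3) by (simp add: w_def algebra_simps)
  then obtain t where t: "sf_coeff K p x = c_K K t" "b = s_K K t" "K = 1 \<longrightarrow> \<bar>t\<bar> \<le> pi"
    using ex_polar_angle[OF K p v(1,2)] x by metis
  then have xg: "x = geodesic K p v t" using xe by (simp add: geodesic_def)
  show ?thesis
  proof (cases "t \<ge> 0")
    case True
    then show ?thesis using that[of v t] v xg t by auto
  next
    case False
    have "- v \<in> sf_tangent K p" using sf_tangent_scaleR[OF v(1), of "-1"] by simp
    then show ?thesis
      using that[of "- v" "- t"] v xg t False by (auto simp: metric_K_bilinear geodesic_minus[symmetric])
  qed
qed

section \<open>Tangent spaces\<close>

text \<open>A curve in \<open>N\<close> can be pulled back by the inverse chart for small times;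
  conversely, images of straight lines in \<open>W\<close> realise all vectors in the range.\<close>

lemma tangent_space_chart:
  fixes \<phi> :: "real^'k::finite \<Rightarrow> 'w::euclidean_space"
  assumes \<phi>: "local_parametrization N \<phi> W" and u: "u \<in> W"
  shows "tangent_space N (\<phi> u) = range (frechet_derivative \<phi> (at u))"
proof -
  let ?D = "frechet_derivative \<phi> (at u)"
  note D = local_parametrizationD[OF \<phi>]
  show ?thesis
  proof safe
    fix X assume "X \<in> tangent_space N (\<phi> u)"
    then obtain \<gamma> where g: "\<And>t. \<gamma> t \<in> N" "\<gamma> 0 = \<phi> u" "(\<gamma> has_vector_derivative X) (at (0::real))"
      by (auto simp: tangent_space_def)
    obtain l where l: "(chart_inv \<phi> W has_derivative l) (at (\<phi> u) within N)"
      using chart_inv_has_derivative[OF \<phi> u] by metis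
    have dg: "(\<gamma> has_derivative (\<lambda>h. h *\<^sub>R X)) (at 0)" using g(3) by (simp add: has_vector_derivative_def)
    have "(chart_inv \<phi> W \<circ> \<gamma> has_derivative l \<circ> (\<lambda>h. h *\<^sub>R X)) (at 0 within UNIV)"
      by (rule diff_chain_within) (use dg l g in \<open>auto intro: has_derivative_subset\<close>)
    then have d: "(chart_inv \<phi> W \<circ> \<gamma> has_derivative l \<circ> (\<lambda>h. h *\<^sub>R X)) (at 0)" by simp
    have "(\<phi> \<circ> (chart_inv \<phi> W \<circ> \<gamma>) has_derivative ?D \<circ> (l \<circ> (\<lambda>h. h *\<^sub>R X))) (at 0)"
      by (rule diff_chain_at[OF d]) (use D(7)[OF u] g(2) chart_inv(1)[OF \<phi> u] in simp)
    moreover have "eventually (\<lambda>t. (\<phi> \<circ> (chart_inv \<phi> W \<circ> \<gamma>)) t = \<gamma> t) (at 0)"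
    proof -
      obtain T where T: "open T" "\<phi> ` W = N \<inter> T" using D(3) by (auto simp: openin_open)
      have "isCont \<gamma> 0" using dg has_derivative_continuous by blast
      then have "eventually (\<lambda>t. \<gamma> t \<in> T) (nhds 0)"
        using T u g(2) unfolding continuous_at_open eventually_nhds by blast
      then have "eventually (\<lambda>t. \<gamma> t \<in> T) (at 0)"
        by (auto simp: eventually_at_filter elim: eventually_mono)
      then show ?thesis
      proof eventually_elim
        case (elim t)
        then have "\<gamma> t \<in> \<phi> ` W" using g(1) T by auto
        then show ?case using chart_inv(2)[OF \<phi>] by simp
      qed
    qed
    ultimately have "(\<gamma> has_derivative ?D \<circ> (l \<circ> (\<lambda>h. h *\<^sub>R X))) (at 0)"
      by (rule has_derivative_transform_eventually)
         (use g(2) chart_inv(1)[OF \<phi> u] in auto)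
    then have "?D \<circ> (l \<circ> (\<lambda>h. h *\<^sub>R X)) = (\<lambda>h. h *\<^sub>R X)"
      using dg has_derivative_unique by blast
    from fun_cong[OF this, of 1] show "X \<in> range ?D" by (auto intro: range_eqI[of _ _ "l X"])
  next
    fix h :: "real^'k"
    \<comment> \<open>Frozen outside \<open>W\<close>, because \<open>tangent_space\<close> asks for
      curves that stay in \<open>N\<close> at all times.\<close>
    define \<gamma> where "\<gamma> t = (if u + t *\<^sub>R h \<in> W then \<phi> (u + t *\<^sub>R h) else \<phi> u)" for t
    have "((\<lambda>t. u + t *\<^sub>R h) has_derivative (\<lambda>t. t *\<^sub>R h)) (at 0)"
      by (auto intro!: derivative_eq_intros)
    moreover have "(\<phi> has_derivative ?D) (at (u + 0 *\<^sub>R h))" using D(7)[OF u] by simp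
    ultimately have "((\<lambda>t. \<phi> (u + t *\<^sub>R h)) has_derivative (\<lambda>t. ?D (t *\<^sub>R h))) (at 0)"
      using has_derivative_compose by blast
    moreover have "open ((\<lambda>t. u + t *\<^sub>R h) -` W)"
      using D(1) by (intro open_vimage continuous_intros)
    ultimately have "(\<gamma> has_derivative (\<lambda>t. ?D (t *\<^sub>R h))) (at 0)"
      by (rule has_derivative_transform_within_open)
         (use u in \<open>auto simp: \<gamma>_def\<close>)
    moreover have "(\<lambda>t. ?D (t *\<^sub>R h)) = (\<lambda>t. t *\<^sub>R ?D h)"
      using has_derivative_linear[OF D(7)[OF u]] by (auto simp: linear_cmul)
    ultimately have "(\<gamma> has_vector_derivative ?D h) (at 0)"
      by (simp add: has_vector_derivative_def)
    moreover have "\<gamma> t \<in> N" for t using D(4) u by (auto simp: \<gamma>_def)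
    moreover have "\<gamma> 0 = \<phi> u" by (simp add: \<gamma>_def)
    ultimately show "?D h \<in> tangent_space N (\<phi> u)" unfolding tangent_space_def by blast
  qed
qed

text \<open>Differentiating the equation along a curve gives one inclusion; for the other, a
  geodesic run at speed \<open>q\<close> has any prescribed nonzero tangent vector as its
  velocity.\<close>

lemma tangent_space_space_form:
  assumes K: "K \<in> {-1, 0, 1}" and p: "p \<in> space_form K"
  shows "tangent_space (space_form K) p = sf_tangent K p"
proof safe
  fix X assume "X \<in> tangent_space (space_form K) p"
  then obtain \<gamma> where g: "\<And>t. \<gamma> t \<in> space_form K" "\<gamma> 0 = p" "(\<gamma> has_vector_derivative X) (at (0::real))"
    by (auto simp: tangent_space_def)
  then have d: "(\<gamma> has_derivative (\<lambda>h. h *\<^sub>R X)) (at 0)" by (simp add: has_vector_derivative_def)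
  have D1: "((\<lambda>t. fst (\<gamma> t) * fst (\<gamma> t) + K * (snd (\<gamma> t) \<bullet> snd (\<gamma> t))) has_derivative
     (\<lambda>h. 2 * (fst p * (h * fst X)) + K * (2 * (snd p \<bullet> (h *\<^sub>R snd X))))) (at 0)"
    using d by (auto intro!: derivative_eq_intros simp: g(2) inner_commute)
  have e: "(\<lambda>t. fst (\<gamma> t) * fst (\<gamma> t) + K * (snd (\<gamma> t) \<bullet> snd (\<gamma> t))) = (\<lambda>t. 1)"
    using g(1) by (auto simp: space_form_iff power2_eq_square)
  have "(\<lambda>h::real. 2 * (fst p * (h * fst X)) + K * (2 * (snd p \<bullet> (h *\<^sub>R snd X)))) = (\<lambda>h. 0)"
    by (rule has_derivative_unique[OF D1[unfolded e] has_derivative_const])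
  from fun_cong[OF this, of 1] show "X \<in> sf_tangent K p" by (simp add: sf_tangent_def)
next
  fix X assume X: "X \<in> sf_tangent K p"
  show "X \<in> tangent_space (space_form K) p"
  proof (cases "X = 0")
    case True
    have "((\<lambda>t::real. p) has_vector_derivative X) (at 0)" using True by simp
    then show ?thesis unfolding tangent_space_def using p by (intro CollectI exI[of _ "\<lambda>t. p"]) auto
  next
    case False
    define q where "q = sqrt (metric_K K X X)"
    have q: "q > 0" using metric_sf_tangent[OF K p X] False by (simp add: q_def)
    define v where "v = (1 / q) *\<^sub>R X"
    have qq: "metric_K K X X = q * q" using metric_sf_tangent[OF K p X] by (simp add: q_def)
    have v: "v \<in> sf_tangent K p" "metric_K K v v = 1"
      using sf_tangent_scaleR[OF X] q by (auto simp: v_def metric_K_bilinear qq)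
    have "((\<lambda>t. q * t) has_vector_derivative q) (at 0)"
      by (auto intro!: derivative_eq_intros simp: has_real_derivative_iff_has_vector_derivative[symmetric])
    then have "((\<lambda>t. geodesic K p v (q * t)) has_vector_derivative q *\<^sub>R v) (at 0)"
      using vector_diff_chain_at[of "\<lambda>t. q * t" q 0 "geodesic K p v" v] geodesic_has_vector_derivative[OF K, of p v 0 UNIV]
      by (auto simp: o_def)
    then show ?thesis
      unfolding tangent_space_def using q geodesic_in_space_form[OF K p v]
      by (intro CollectI exI[of _ "\<lambda>t. geodesic K p v (q * t)"]) (auto simp: v_def)
  qed
qed

section \<open>Differentiability classes\<close>

text \<open>Since \<open>W\<close> is open, agreement on \<open>W\<close> implies agreement of the
  derivatives on \<open>W\<close>, which feeds the induction.\<close>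

lemma Ck_on_cong:
  assumes "open W" "\<And>x. x \<in> W \<Longrightarrow> f x = g x" "Ck_on k f W"
  shows "Ck_on k g W"
  using assms(2,3)
proof (induction k arbitrary: f g)
  case 0
  then show ?case by (simp add: continuous_on_eq)
next
  case (Suc k)
  have der: "(g has_derivative frechet_derivative f (at x)) (at x)" if "x \<in> W" for x
    using Suc.prems that assms(1) by (intro has_derivative_transform_within_open[of f _ x UNIV W g])
       (auto simp: frechet_derivative_works[symmetric])
  then have eq: "frechet_derivative g (at x) = frechet_derivative f (at x)" if "x \<in> W" for x
    using that frechet_derivative_at by metis
  show ?case
  proof (simp, intro conjI ballI allI)
    show "g differentiable at x" if "x \<in> W" for x using der[OF that] by (auto simp: differentiable_def)
    show "Ck_on k (\<lambda>x. frechet_derivative g (at x) v) W" for v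
      by (rule Suc.IH[of "\<lambda>x. frechet_derivative f (at x) v"]) (use eq Suc.prems in auto)
  qed
qed

lemma Ck_on_Suc_I:
  assumes W: "open W" and der: "\<And>x. x \<in> W \<Longrightarrow> (f has_derivative f' x) (at x)"
    and "\<And>v. Ck_on k (\<lambda>x. f' x v) W"
  shows "Ck_on (Suc k) f W"
proof (simp, intro conjI ballI allI)
  show "f differentiable at x" if "x \<in> W" for x using der[OF that] by (auto simp: differentiable_def)
  show "Ck_on k (\<lambda>x. frechet_derivative f (at x) v) W" for v
    by (rule Ck_on_cong[OF W _ assms(3)[of v]]) (use der frechet_derivative_at in metis)
qed

lemma Ck_on_SucD:
  assumes "Ck_on (Suc k) f W" "x \<in> W"
  shows "(f has_derivative frechet_derivative f (at x)) (at x)"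
  using assms by (simp add: frechet_derivative_works[symmetric])

lemma Ck_on_Suc_imp: "Ck_on (Suc k) f W \<Longrightarrow> Ck_on k f W"
proof (induction k arbitrary: f)
  case 0
  then show ?case
    using Ck_on_SucD[OF 0] by (simp only: Ck_on.simps) (meson continuous_at_imp_continuous_on has_derivative_continuous)
next
  case (Suc k)
  have "\<forall>x\<in>W. f differentiable at x" and "\<And>v. Ck_on (Suc k) (\<lambda>x. frechet_derivative f (at x) v) W"
    using Suc.prems unfolding Ck_on.simps(2)[of "Suc k" f W] by blast+
  then show ?case
    using Suc.IH unfolding Ck_on.simps(2)[of k f W] by blast
qed

lemma Ck_on_const: "open W \<Longrightarrow> Ck_on k (\<lambda>x. c) W"
proof (induction k arbitrary: c)
  case (Suc k)
  show ?case by (rule Ck_on_Suc_I[OF Suc.prems, where f' = "\<lambda>x v. 0"]) (use Suc in auto)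
qed simp

lemma Ck_on_bounded_linear:
  assumes "open W" "bounded_linear L"
  shows "Ck_on k L W"
proof (cases k)
  case 0
  then show ?thesis using assms by (simp add: linear_continuous_on)
next
  case (Suc j)
  show ?thesis unfolding Suc
    by (rule Ck_on_Suc_I[OF assms(1), where f' = "\<lambda>x. L"])
       (use assms in \<open>auto intro: Ck_on_const bounded_linear_imp_has_derivative\<close>)
qed

lemma Ck_on_add: "open W \<Longrightarrow> Ck_on k f W \<Longrightarrow> Ck_on k g W \<Longrightarrow> Ck_on k (\<lambda>x. f x + g x) W"
proof (induction k arbitrary: f g)
  case 0
  then show ?case by (auto intro: continuous_intros)
next
  case (Suc k)
  show ?case
  proof (rule Ck_on_Suc_I[OF Suc.prems(1), where f' = "\<lambda>x v. frechet_derivative f (at x) v + frechet_derivative g (at x) v"])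
    show "((\<lambda>x. f x + g x) has_derivative (\<lambda>v. frechet_derivative f (at x) v + frechet_derivative g (at x) v)) (at x)"
      if "x \<in> W" for x
      using Ck_on_SucD[OF Suc.prems(2) that] Ck_on_SucD[OF Suc.prems(3) that] by (rule has_derivative_add)
    show "Ck_on k (\<lambda>x. frechet_derivative f (at x) v + frechet_derivative g (at x) v) W" for v
      using Suc.prems by (intro Suc.IH) auto
  qed
qed

lemma Ck_on_bilinear:
  assumes B: "bounded_bilinear B" and W: "open W"
  shows "Ck_on k f W \<Longrightarrow> Ck_on k g W \<Longrightarrow> Ck_on k (\<lambda>x. B (f x) (g x)) W"
proof (induction k arbitrary: f g)
  case 0
  then show ?case using bounded_bilinear.continuous_on[OF B] by auto
next
  case (Suc k)
  show ?case
  proof (rule Ck_on_Suc_I[OF W, where f' = "\<lambda>x v. B (f x) (frechet_derivative g (at x) v) + B (frechet_derivative f (at x) v) (g x)"])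
    show "((\<lambda>x. B (f x) (g x)) has_derivative (\<lambda>v. B (f x) (frechet_derivative g (at x) v) + B (frechet_derivative f (at x) v) (g x))) (at x)"
      if "x \<in> W" for x
      using Ck_on_SucD[OF Suc.prems(1) that] Ck_on_SucD[OF Suc.prems(2) that] by (rule bounded_bilinear.FDERIV[OF B])
    fix v
    have "Ck_on k f W" "Ck_on k g W" using Suc.prems Ck_on_Suc_imp by blast+
    moreover have "Ck_on k (\<lambda>x. frechet_derivative f (at x) v) W" "Ck_on k (\<lambda>x. frechet_derivative g (at x) v) W"
      using Suc.prems by auto
    ultimately show "Ck_on k (\<lambda>x. B (f x) (frechet_derivative g (at x) v) + B (frechet_derivative f (at x) v) (g x)) W"
      by (intro Ck_on_add[OF W] Suc.IH)
  qed
qed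

text \<open>The derivative of 1/f is a product of 1/f, the derivative of f and 1/f, so the induction
  hypothesis for k covers it.\<close>

lemma Ck_on_inverse:
  fixes f :: "'a::real_normed_vector \<Rightarrow> real"
  assumes W: "open W" and nz: "\<And>x. x \<in> W \<Longrightarrow> f x \<noteq> 0"
  shows "Ck_on k f W \<Longrightarrow> Ck_on k (\<lambda>x. inverse (f x)) W"
proof (induction k)
  case 0
  then show ?case using nz by (auto intro!: continuous_intros)
next
  case (Suc k)
  show ?case
  proof (rule Ck_on_Suc_I[OF W, where f' = "\<lambda>x v. - 1 * (inverse (f x) * frechet_derivative f (at x) v * inverse (f x))"])
    show "((\<lambda>x. inverse (f x)) has_derivative (\<lambda>v. - 1 * (inverse (f x) * frechet_derivative f (at x) v * inverse (f x)))) (at x)"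
      if "x \<in> W" for x
      using Deriv.has_derivative_inverse[OF nz[OF that] Ck_on_SucD[OF Suc.prems that]] by simp
    fix v
    have "Ck_on k (\<lambda>x. inverse (f x)) W" using Suc Ck_on_Suc_imp by blast
    moreover have "Ck_on k (\<lambda>x. frechet_derivative f (at x) v) W" using Suc.prems by auto
    ultimately show "Ck_on k (\<lambda>x. - 1 * (inverse (f x) * frechet_derivative f (at x) v * inverse (f x))) W"
      by (intro Ck_on_bilinear[OF bounded_bilinear_mult W] Ck_on_const[OF W])
  qed
qed

section \<open>Stereographic charts\<close>

definition ster_den :: "real \<Rightarrow> 'v::euclidean_space \<Rightarrow> real" where
  "ster_den K y = 1 + K * (y \<bullet> y) / 4"

text \<open>One formula for three models: stereographic projection of the sphere, the trivial chart
  of {1} x V, and the Poincare ball of radius 2. The origin goes to the point with first coordinate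
  \<open>\<sigma>\<close>. The charts are conformal, which allows normals to be computed in
  Euclidean coordinates.\<close>

definition ster :: "real \<Rightarrow> real \<Rightarrow> 'v::euclidean_space \<Rightarrow> real \<times> 'v" where
  "ster K \<sigma> y = (\<sigma> * (2 / ster_den K y - 1), (1 / ster_den K y) *\<^sub>R y)"

definition ster_dom :: "real \<Rightarrow> 'v::euclidean_space set" where
  "ster_dom K = {y. ster_den K y > 0}"

definition ster_inv :: "real \<Rightarrow> real \<times> 'v::euclidean_space \<Rightarrow> 'v" where
  "ster_inv \<sigma> p = (2 / (1 + \<sigma> * fst p)) *\<^sub>R snd p"

definition ster_deriv :: "real \<Rightarrow> real \<Rightarrow> 'v::euclidean_space \<Rightarrow> 'v \<Rightarrow> real \<times> 'v" where
  "ster_deriv K \<sigma> y h = (- (\<sigma> * K * (y \<bullet> h)) / (ster_den K y)\<^sup>2,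
     (1 / ster_den K y) *\<^sub>R h - (K * (y \<bullet> h) / (2 * (ster_den K y)\<^sup>2)) *\<^sub>R y)"

text \<open>The sphere needs two charts, centred at the points with first coordinate \<open>1\<close> and \<open>-1\<close>.\<close>

definition ster_ok :: "real \<Rightarrow> real \<Rightarrow> bool" where
  "ster_ok K \<sigma> \<longleftrightarrow> K \<in> {-1, 0, 1} \<and> (\<sigma> = 1 \<or> \<sigma> = -1 \<and> K = 1)"

lemma ster_ok_sq: "ster_ok K \<sigma> \<Longrightarrow> \<sigma> * \<sigma> = 1"
  by (auto simp: ster_ok_def)

lemma open_ster_dom: "open (ster_dom K)"
  unfolding ster_dom_def ster_den_def by (intro open_Collect_less continuous_intros) auto

lemma has_derivative_ster:
  assumes "y \<in> ster_dom K"
  shows "(ster K \<sigma> has_derivative ster_deriv K \<sigma> y) (at y)"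
proof -
  have nz: "1 + K * (y \<bullet> y) / 4 \<noteq> 0" using assms by (auto simp: ster_dom_def ster_den_def)
  show ?thesis
    unfolding ster_def[abs_def] ster_deriv_def[abs_def] ster_den_def
    by (rule derivative_eq_intros refl nz | simp)+
      (auto simp: fun_eq_iff inner_commute power2_eq_square divide_simps nz algebra_simps)
qed

text \<open>Conformality: all terms but one cancel because K (y . y) = 4 (D - 1) and K^3 =
  K.\<close>

lemma ster_deriv_metric:
  assumes K: "K \<in> {-1, 0, 1}" and \<sigma>: "\<sigma> * \<sigma> = 1" and y: "y \<in> ster_dom K"
  shows "metric_K K (ster_deriv K \<sigma> y h) (ster_deriv K \<sigma> y k) = (h \<bullet> k) / (ster_den K y)\<^sup>2"
proof -
  define D where "D = ster_den K y"
  have D: "D \<noteq> 0" using y by (auto simp: ster_dom_def D_def)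
  define a where "a = y \<bullet> h"
  define b where "b = y \<bullet> k"
  have K3: "K * K * K = K" using K by auto
  have yy: "K * (y \<bullet> y) = 4 * (D - 1)" by (simp add: D_def ster_den_def)
  have "metric_K K (ster_deriv K \<sigma> y h) (ster_deriv K \<sigma> y k) =
     (\<sigma> * \<sigma>) * (K * K * K) * (a * b) / D^4 + (h \<bullet> k) / D\<^sup>2 - K * a * b / D^3 + K * (K * (y \<bullet> y)) * a * b / (4 * D^4)"
    unfolding metric_K_def ster_deriv_def D_def[symmetric] a_def b_def using D
    by (simp add: inner_simps inner_commute field_simps power2_eq_square power3_eq_cube power4_eq_xxxx)
  also have "\<dots> = (h \<bullet> k) / D\<^sup>2"
    unfolding yy K3 \<sigma> using D by (simp add: field_simps power2_eq_square power3_eq_cube power4_eq_xxxx)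
  finally show ?thesis by (simp add: D_def)
qed

lemma ster_image:
  fixes y :: "'v::euclidean_space" and p :: "real \<times> 'v"
  assumes ok: "ster_ok K \<sigma>"
  shows "ster K \<sigma> ` (ster_dom K :: 'v set) = space_form K \<inter> {p. 1 + \<sigma> * fst p > 0}"
    and "y \<in> ster_dom K \<Longrightarrow> ster_inv \<sigma> (ster K \<sigma> y) = y"
    and "p \<in> space_form K \<Longrightarrow> 1 + \<sigma> * fst p > 0 \<Longrightarrow> ster K \<sigma> (ster_inv \<sigma> p) = p \<and> ster_inv \<sigma> p \<in> ster_dom K"
proof -
  note \<sigma> = ster_ok_sq[OF ok]
  have K: "K \<in> {-1, 0, 1}" using ok by (auto simp: ster_ok_def)
  have A: "ster K \<sigma> y \<in> space_form K" "1 + \<sigma> * fst (ster K \<sigma> y) > 0" "ster_inv \<sigma> (ster K \<sigma> y) = y"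
    if y: "y \<in> ster_dom K" for y :: 'v
  proof -
    define D where "D = ster_den K y"
    have D: "D > 0" using y by (auto simp: ster_dom_def D_def)
    have yy: "K * (y \<bullet> y) = 4 * (D - 1)" by (simp add: D_def ster_den_def)
    have st: "ster K \<sigma> y = (\<sigma> * (2 / D - 1), (1 / D) *\<^sub>R y)" by (simp add: ster_def D_def)
    have "(fst (ster K \<sigma> y))\<^sup>2 + K * (snd (ster K \<sigma> y) \<bullet> snd (ster K \<sigma> y)) =
       (\<sigma> * \<sigma>) * (2 / D - 1)\<^sup>2 + (K * (y \<bullet> y)) / D\<^sup>2"
      unfolding st by (simp add: power2_eq_square)
    also have "\<dots> = 1" unfolding yy \<sigma> using D by (simp add: field_simps power2_eq_square)
    moreover have "fst (ster K \<sigma> y) > 0" if "K \<le> 0"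
    proof -
      have "\<sigma> = 1" using ok that by (auto simp: ster_ok_def)
      have "K * (y \<bullet> y) \<le> 0" using that by (simp add: mult_nonpos_nonneg)
      then have "D \<le> 1" using yy by simp
      then show ?thesis unfolding st using D \<open>\<sigma> = 1\<close> by (simp add: field_simps)
    qed
    ultimately show "ster K \<sigma> y \<in> space_form K" by (simp add: space_form_iff)
    have e: "1 + \<sigma> * fst (ster K \<sigma> y) = 2 / D"
      using \<sigma> by (simp add: st mult.assoc[symmetric])
    then show "1 + \<sigma> * fst (ster K \<sigma> y) > 0" using D by simp
    show "ster_inv \<sigma> (ster K \<sigma> y) = y"
      unfolding ster_inv_def e using D by (simp add: st)
  qed
  have B: "ster K \<sigma> (ster_inv \<sigma> p) = p \<and> ster_inv \<sigma> p \<in> ster_dom K"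
    if p: "p \<in> space_form K" "1 + \<sigma> * fst p > 0" for p :: "real \<times> 'v"
  proof -
    define e where "e = 1 + \<sigma> * fst p"
    have e: "e > 0" using p by (simp add: e_def)
    have f: "\<sigma> * fst p = e - 1" by (simp add: e_def)
    have "(fst p)\<^sup>2 = (\<sigma> * \<sigma>) * (fst p)\<^sup>2" using \<sigma> by simp
    also have "\<dots> = (\<sigma> * fst p)\<^sup>2" by (simp add: power2_eq_square)
    also have "\<dots> = (e - 1)\<^sup>2" by (simp add: f)
    finally have "K * (snd p \<bullet> snd p) = 1 - (e - 1)\<^sup>2"
      using p(1) by (simp add: space_form_iff)
    then have E: "K * (ster_inv \<sigma> p \<bullet> ster_inv \<sigma> p) / 4 = (1 - (e - 1)\<^sup>2) / e\<^sup>2"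
      unfolding ster_inv_def e_def[symmetric] using e by (simp add: field_simps power2_eq_square)
    have "ster_den K (ster_inv \<sigma> p) = 1 + (1 - (e - 1)\<^sup>2) / e\<^sup>2"
      by (simp only: ster_den_def E)
    also have "\<dots> = 2 / e" using e by (simp add: field_simps power2_eq_square)
    finally have D: "ster_den K (ster_inv \<sigma> p) = 2 / e" .
    have "\<sigma> * (e - 1) = fst p" using f \<sigma> by (metis mult.assoc mult_1)
    then show ?thesis
      using e by (simp add: ster_def D ster_dom_def prod_eq_iff) (simp add: ster_inv_def e_def[symmetric])
  qed
  show "y \<in> ster_dom K \<Longrightarrow> ster_inv \<sigma> (ster K \<sigma> y) = y" by (rule A)
  show "p \<in> space_form K \<Longrightarrow> 1 + \<sigma> * fst p > 0 \<Longrightarrow> ster K \<sigma> (ster_inv \<sigma> p) = p \<and> ster_inv \<sigma> p \<in> ster_dom K"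
    by (rule B)
  show "ster K \<sigma> ` (ster_dom K :: 'v set) = space_form K \<inter> {p. 1 + \<sigma> * fst p > 0}"
  proof (intro set_eqI iffI)
    fix p :: "real \<times> 'v" assume "p \<in> space_form K \<inter> {p. 1 + \<sigma> * fst p > 0}"
    then show "p \<in> ster K \<sigma> ` ster_dom K" using B[of p] by (metis IntE image_eqI mem_Collect_eq)
  qed (use A in auto)
qed

lemma Ck_on_ster: "Ck_on k (ster K \<sigma> :: real^'m::finite \<Rightarrow> _) (ster_dom K)"
proof -
  let ?W = "ster_dom K :: (real^'m) set"
  note W = open_ster_dom[of K, where 'a = "real^'m"]
  note id = Ck_on_bounded_linear[OF W bounded_linear_ident]
  have "Ck_on k (\<lambda>y. 1 + (K/4) * (y \<bullet> y)) ?W"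
    by (intro Ck_on_add[OF W] Ck_on_const[OF W] Ck_on_bilinear[OF bounded_bilinear_mult W]
        Ck_on_bilinear[OF bounded_bilinear_inner W] id)
  then have D: "Ck_on k (ster_den K) ?W"
    by (rule Ck_on_cong[OF W, rotated]) (simp add: ster_den_def)
  have i: "Ck_on k (\<lambda>y. inverse (ster_den K y)) ?W"
    by (rule Ck_on_inverse[OF W _ D]) (auto simp: ster_dom_def)
  have "Ck_on k (\<lambda>y. (\<sigma> * (2 * inverse (ster_den K y) + -1)) *\<^sub>R (1, 0::real^'m) + (inverse (ster_den K y)) *\<^sub>R (0, y)) ?W"
    by (intro Ck_on_add[OF W] Ck_on_bilinear[OF bounded_bilinear_scaleR W] Ck_on_bilinear[OF bounded_bilinear_mult W] i
        Ck_on_const[OF W] Ck_on_bounded_linear[OF W bounded_linear_Pair[OF bounded_linear_zero bounded_linear_ident]])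
  then show ?thesis
    by (rule Ck_on_cong[OF W, rotated]) (simp add: ster_def divide_inverse)
qed

lemma local_parametrization_ster:
  assumes ok: "ster_ok K \<sigma>"
  shows "local_parametrization (space_form K) (ster K \<sigma> :: real^'m::finite \<Rightarrow> _) (ster_dom K)"
  unfolding local_parametrization_def
proof (intro conjI ballI)
  have K: "K \<in> {-1, 0, 1}" using ok by (auto simp: ster_ok_def)
  show "open (ster_dom K :: (real^'m) set)" by (rule open_ster_dom)
  show "smooth_on (ster K \<sigma> :: real^'m \<Rightarrow> _) (ster_dom K)" by (simp add: smooth_on_def Ck_on_ster)
  have "open {p :: real \<times> (real^'m). 1 + \<sigma> * fst p > 0}" by (intro open_Collect_less continuous_intros)
  then show "openin (top_of_set (space_form K)) (ster K \<sigma> ` (ster_dom K :: (real^'m) set))"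
    unfolding ster_image(1)[OF ok] by (auto simp: openin_open)
  have "continuous_on (ster_dom K) (ster K \<sigma> :: real^'m \<Rightarrow> _)"
    using Ck_on_ster[of 0] by simp
  moreover have "continuous_on (ster K \<sigma> ` ster_dom K) (ster_inv \<sigma> :: _ \<Rightarrow> real^'m)"
    unfolding ster_image(1)[OF ok] ster_inv_def by (intro continuous_intros) auto
  ultimately show "\<exists>\<psi>. homeomorphism (ster_dom K) (ster K \<sigma> ` ster_dom K) (ster K \<sigma> :: real^'m \<Rightarrow> _) \<psi>"
    using ster_image(2)[OF ok] by (intro exI[of _ "ster_inv \<sigma>"]) (auto simp: homeomorphism_def image_iff)
  fix y :: "real^'m" assume y: "y \<in> ster_dom K"
  have fd: "frechet_derivative (ster K \<sigma>) (at y) = ster_deriv K \<sigma> y"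
    using has_derivative_ster[OF y] frechet_derivative_at by metis
  have lin: "linear (ster_deriv K \<sigma> y)" using has_derivative_ster[OF y] has_derivative_linear by blast
  have "h = 0" if "ster_deriv K \<sigma> y h = 0" for h
    using ster_deriv_metric[OF K ster_ok_sq[OF ok] y, of h h] that y by (simp add: metric_K_bilinear ster_dom_def)
  then show "inj (frechet_derivative (ster K \<sigma>) (at y))"
    unfolding fd using lin by (simp add: linear_injective_0)
qed

lemma ex_ster_chart:
  assumes "K \<in> {-1, 0, 1}" "p \<in> space_form K"
  shows "\<exists>\<sigma>. ster_ok K \<sigma> \<and> 1 + \<sigma> * fst p > 0"
  using assms by (cases "fst p \<ge> 0")
    (auto simp: ster_ok_def space_form_iff intro: exI[of _ 1] exI[of _ "-1"])

lemma smooth_submanifold_space_form: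
  assumes K: "K \<in> {-1, 0, 1}"
  shows "smooth_submanifold TYPE('m::finite) (space_form K :: (real \<times> (real^'m)) set)"
  unfolding smooth_submanifold_def
proof
  fix p :: "real \<times> (real^'m)" assume p: "p \<in> space_form K"
  then obtain \<sigma> where "ster_ok K \<sigma>" "1 + \<sigma> * fst p > 0" using ex_ster_chart[OF K] by blast
  then show "\<exists>\<phi> W. local_parametrization (space_form K) (\<phi> :: real^'m \<Rightarrow> _) W \<and> p \<in> \<phi> ` W"
    using local_parametrization_ster p ster_image(1) by blast
qed

section \<open>Tubes around a hypersurface\<close>

text \<open>The generalised cross product of the n vectors D e_i in R^(n+1). Being polynomial in the
  entries of \<open>D\<close>, it varies differentiably along a chart.\<close>

definition perp_vec :: "(real^'n::finite \<Rightarrow> real^('n option)) \<Rightarrow> real^('n option)" where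
  "perp_vec D = (\<chi> k. det (\<chi> r. if r = None then axis k 1 else D (axis (the r) 1)))"

lemma perp_vec_inner:
  fixes D :: "real^'n::finite \<Rightarrow> real^('n option)"
  shows "perp_vec D \<bullet> w = det (\<chi> r. if r = None then w else D (axis (the r) 1))"
proof -
  define f where "f w = det (\<chi> r. if r = None then w else D (axis (the r) 1))" for w
  have "linear f"
    unfolding linear_iff f_def scalar_mult_eq_scaleR[symmetric]
    by (simp add: det_row_add[of None "\<lambda>_. _" "\<lambda>_. _" "\<lambda>r. D (axis (the r) 1)"]
        det_row_mul[of None _ "\<lambda>_. _" "\<lambda>r. D (axis (the r) 1)"])
  then have "f (\<Sum>k\<in>UNIV. w $ k *\<^sub>R axis k 1) = (\<Sum>k\<in>UNIV. w $ k * f (axis k 1))"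
    by (simp add: linear_sum linear_cmul)
  moreover have "(\<Sum>k\<in>UNIV. w $ k *\<^sub>R axis k 1) = w"
    by (simp add: vec_eq_iff axis_def if_distrib[of "(*) _"] cong: if_cong)
  ultimately show ?thesis
    by (simp add: perp_vec_def inner_vec_def f_def mult.commute)
qed

lemma perp_vec_orthogonal:
  fixes D :: "real^'n::finite \<Rightarrow> real^('n option)"
  assumes D: "linear D"
  shows "perp_vec D \<bullet> D h = 0"
proof -
  have "perp_vec D \<bullet> D (axis i 1) = 0" for i
    unfolding perp_vec_inner
    by (rule det_identical_rows[of None "Some i"]) (auto simp: row_def vec_eq_iff)
  moreover have "D h = (\<Sum>i\<in>UNIV. h $ i *\<^sub>R D (axis i 1))"
  proof -
    have "h = (\<Sum>i\<in>UNIV. h $ i *\<^sub>R axis i 1)"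
      by (simp add: vec_eq_iff axis_def if_distrib[of "(*) _"] cong: if_cong)
    then have "D h = D (\<Sum>i\<in>UNIV. h $ i *\<^sub>R axis i 1)" by simp
    also have "\<dots> = (\<Sum>i\<in>UNIV. h $ i *\<^sub>R D (axis i 1))" using D by (simp add: linear_sum linear_cmul)
    finally show ?thesis .
  qed
  ultimately show ?thesis by (simp add: inner_sum_right)
qed

text \<open>If it vanished, so would the determinant with rows w and D e_i for every w; but for w
  outside the range of \<open>D\<close> these rows are independent.\<close>

lemma perp_vec_nonzero:
  fixes D :: "real^'n::finite \<Rightarrow> real^('n option)"
  assumes D: "linear D" "inj D"
  shows "perp_vec D \<noteq> 0"
proof
  assume 0: "perp_vec D = 0"
  have "dim (range D) \<le> CARD('n)"
    using dim_image_le[OF D(1), of UNIV] by simp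
  moreover have "dim (UNIV :: (real^('n option)) set) = Suc CARD('n)" by simp
  ultimately have "range D \<noteq> UNIV" by (metis not_less_eq_eq order_refl)
  then obtain w where w: "w \<notin> range D" by auto
  define A where "A = (\<chi> r. if r = None then w else D (axis (the r) 1))"
  have "\<forall>i. c i = 0" if c: "(\<Sum>i\<in>UNIV. c i *s row i A) = 0" for c
  proof -
    define h where "h = (\<chi> i. c (Some i))"
    have "D h = (\<Sum>i\<in>UNIV. c (Some i) *\<^sub>R D (axis i 1))"
    proof -
      have "h = (\<Sum>i\<in>UNIV. c (Some i) *\<^sub>R axis i 1)"
        by (simp add: h_def vec_eq_iff axis_def if_distrib[of "(*) _"] cong: if_cong)
      then show ?thesis using D(1) by (simp add: linear_sum linear_cmul)
    qed
    moreover have "row (Some i) A = D (axis i 1)" "row None A = w" for i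
      by (simp_all add: A_def row_def vec_eq_iff)
    ultimately have e: "c None *\<^sub>R w + D h = 0"
      using c by (simp add: UNIV_option_conv sum.reindex scalar_mult_eq_scaleR)
    have "c None = 0"
    proof (rule ccontr)
      assume n: "c None \<noteq> 0"
      have "w = D ((- 1 / c None) *\<^sub>R h)"
      proof -
        have "c None *\<^sub>R w = - D h" using e by (simp add: eq_neg_iff_add_eq_0)
        then have "(1 / c None) *\<^sub>R (c None *\<^sub>R w) = (1 / c None) *\<^sub>R (- D h)" by simp
        then show ?thesis using n D(1) by (simp add: linear_cmul linear_neg)
      qed
      then show False using w by blast
    qed
    then have "D h = 0" using e by simp
    then have "h = 0" using D linear_injective_0 by blast
    then show ?thesis
      using \<open>c None = 0\<close> by (intro allI) (metis h_def not_None_eq vec_lambda_beta zero_index)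
  qed
  then have "invertible A"
    unfolding invertible_right_inverse matrix_right_invertible_independent_rows by blast
  then have "det A \<noteq> 0" by (simp add: invertible_det_nz)
  then show False using 0 perp_vec_inner[of D w] by (simp add: A_def)
qed

lemma Ck_on_bounded_linear_comp:
  assumes "bounded_linear L" "open W" "Ck_on k f W"
  shows "Ck_on k (\<lambda>x. L (f x)) W"
proof -
  have "bounded_bilinear (\<lambda>(a::real) b. a *\<^sub>R L b)"
    by (rule bounded_bilinear.comp[OF bounded_bilinear_scaleR bounded_linear_ident assms(1)])
  from Ck_on_bilinear[OF this assms(2) Ck_on_const[OF assms(2)] assms(3), of 1] show ?thesis by simp
qed

lemma differentiable_Pair:
  "f differentiable (at x within S) \<Longrightarrow> g differentiable (at x within S) \<Longrightarrow>
    (\<lambda>x. (f x, g x)) differentiable (at x within S)"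
  unfolding differentiable_def by (elim exE) (rule exI, rule has_derivative_Pair)

lemma differentiable_prod:
  fixes f :: "'i \<Rightarrow> 'a::real_normed_vector \<Rightarrow> real"
  shows "(\<And>i. i \<in> I \<Longrightarrow> f i differentiable (at x within S)) \<Longrightarrow> (\<lambda>x. \<Prod>i\<in>I. f i x) differentiable (at x within S)"
  by (induction I rule: infinite_finite_induct) auto

lemma differentiable_vec:
  fixes f :: "'a::real_normed_vector \<Rightarrow> real^'m::finite"
  shows "f differentiable (at x within S) \<longleftrightarrow> (\<forall>i. (\<lambda>y. f y $ i) differentiable (at x within S))"
  by (subst differentiable_componentwise_within) (auto simp: Basis_vec_def inner_axis)

lemma differentiable_perp_vec:
  fixes D :: "'a::real_normed_vector \<Rightarrow> real^'n::finite \<Rightarrow> real^('n option)"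
  assumes "\<And>i. (\<lambda>u. D u (axis i 1)) differentiable (at x)"
  shows "(\<lambda>u. perp_vec (D u)) differentiable (at x)"
  unfolding differentiable_vec
proof
  fix k :: "'n option"
  have "(\<lambda>u. D u (axis i 1) $ j) differentiable (at x)" for i j
    using assms[of i] unfolding differentiable_vec by auto
  then have d: "(\<lambda>u. (if r = None then axis k 1 else D u (axis (the r) 1)) $ j) differentiable (at x)" for r :: "'n option" and j
    by (cases "r = None") auto
  then show "(\<lambda>u. perp_vec (D u) $ k) differentiable (at x)"
    unfolding perp_vec_def det_def vec_lambda_beta
    by (intro differentiable_sum ballI differentiable_mult differentiable_prod differentiable_const d
        finite_permutations finite_class.finite_UNIV)
qed

text \<open>Local picture of a hypersurface: it divides the neighbourhood \<open>U\<close> into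
  connected sides \<open>P\<close> and \<open>Q\<close>, and the unit normal \<open>m\<close> points
  into \<open>P\<close>. The sides are not yet related to any domain.\<close>

definition tube ::
  "real \<Rightarrow> (real \<times> (real^('n::finite option))) set \<Rightarrow> (real^'n \<Rightarrow> real \<times> (real^('n option))) \<Rightarrow> (real^'n) set \<Rightarrow>
   (real^'n \<Rightarrow> real \<times> (real^('n option))) \<Rightarrow> (real \<times> (real^('n option))) set \<Rightarrow>
   (real \<times> (real^('n option))) set \<Rightarrow> (real \<times> (real^('n option))) set \<Rightarrow> bool" where
  "tube K M \<phi> W m U P Q \<longleftrightarrow> local_parametrization M \<phi> W \<and> open U \<and> \<phi> ` W = M \<inter> U \<and>
    space_form K \<inter> U = \<phi> ` W \<union> P \<union> Q \<and> P \<inter> M = {} \<and> Q \<inter> M = {} \<and> P \<inter> Q = {} \<and> connected P \<and> connected Q \<and>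
    openin (top_of_set (space_form K)) P \<and> openin (top_of_set (space_form K)) Q \<and>
    (\<forall>u\<in>W. m differentiable (at u) \<and> m u \<in> sf_tangent K (\<phi> u) \<and> metric_K K (m u) (m u) = 1 \<and>
      (\<forall>h. metric_K K (m u) (frechet_derivative \<phi> (at u) h) = 0) \<and>
      (\<exists>\<epsilon>>0. \<forall>t. 0 < t \<and> t < \<epsilon> \<longrightarrow> geodesic K (\<phi> u) (m u) t \<in> P \<and> geodesic K (\<phi> u) (m u) (- t) \<in> Q))"

text \<open>In a conformal chart the hypersurface is thickened by translation in the fixed direction
  \<open>N u0\<close>. The derivative of (u, t) \<mapsto> \<psi>(u) + t N(u0) at (u0, 0) is
  injective, since \<open>N u0\<close> is orthogonal to the hypersurface there, so the inverse
  function theorem gives coordinates in which M is t = 0 and the sides are the two halves of a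
  box.\<close>

lemma ex_tube:
  fixes M :: "(real \<times> (real^('n::finite option))) set"
  assumes K: "K \<in> {-1, 0, 1}" and M: "smooth_submanifold TYPE('n) M" "M \<subseteq> space_form K" and p: "p \<in> M" "open A" "p \<in> A"
  shows "\<exists>\<phi> W m U P Q. tube K M \<phi> W m U P Q \<and> p \<in> \<phi> ` W \<and> U \<subseteq> A"
proof -
  obtain \<sigma> where ok: "ster_ok K \<sigma>" and p\<sigma>: "1 + \<sigma> * fst p > 0"
    using ex_ster_chart[OF K, of p] M(2) p(1) by blast
  let ?Y = "ster_dom K :: (real^('n option)) set"
  let ?\<chi> = "ster K \<sigma> :: real^('n option) \<Rightarrow> _"
  note lpS = local_parametrization_ster[OF ok, where 'm = "'n option"]
  note \<sigma>2 = ster_ok_sq[OF ok]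
  obtain \<phi> :: "real^'n \<Rightarrow> _" and W0 where \<phi>0: "local_parametrization M \<phi> W0" and pW0: "p \<in> \<phi> ` W0"
    using M(1) p(1) unfolding smooth_submanifold_def by blast
  define H where "H = {q :: real \<times> (real^('n option)). 1 + \<sigma> * fst q > 0}"
  have oH: "open H" unfolding H_def by (intro open_Collect_less continuous_intros)
  define W where "W = W0 \<inter> \<phi> -` H"
  have oW: "open W"
    unfolding W_def by (intro continuous_open_preimage local_parametrizationD(1,5)[OF \<phi>0] oH)
  have \<phi>: "local_parametrization M \<phi> W" using local_parametrization_subset[OF \<phi>0 oW] by (auto simp: W_def)
  note D\<phi> = local_parametrizationD[OF \<phi>]
  obtain u0 where u0: "u0 \<in> W" "\<phi> u0 = p" using pW0 p\<sigma> by (auto simp: W_def H_def)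
  have inS: "\<phi> u \<in> space_form K" "1 + \<sigma> * fst (\<phi> u) > 0" if "u \<in> W" for u
    using that D\<phi>(4) M(2) by (auto simp: W_def H_def)
  define \<psi> where "\<psi> u = ster_inv \<sigma> (\<phi> u)" for u
  have \<psi>Y: "\<psi> u \<in> ?Y" and \<chi>\<psi>: "?\<chi> (\<psi> u) = \<phi> u" if "u \<in> W" for u
    using ster_image(3)[OF ok inS[OF that]] by (auto simp: \<psi>_def)
  have Ck\<phi>: "Ck_on k \<phi> W" for k using D\<phi>(2) by (simp add: smooth_on_def)
  have Ck\<psi>: "Ck_on k \<psi> W" for k
  proof -
    have "Ck_on k (\<lambda>u. 1 + \<sigma> * fst (\<phi> u)) W"
      by (intro Ck_on_add[OF oW] Ck_on_const[OF oW] Ck_on_bilinear[OF bounded_bilinear_mult oW]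
          Ck_on_bounded_linear_comp[OF bounded_linear_fst oW] Ck\<phi>)
    then have "Ck_on k (\<lambda>u. inverse (1 + \<sigma> * fst (\<phi> u))) W"
      by (rule Ck_on_inverse[OF oW, rotated]) (use inS in force)
    then have "Ck_on k (\<lambda>u. (2 * inverse (1 + \<sigma> * fst (\<phi> u))) *\<^sub>R snd (\<phi> u)) W"
      by (intro Ck_on_bilinear[OF bounded_bilinear_scaleR oW] Ck_on_bilinear[OF bounded_bilinear_mult oW]
          Ck_on_const[OF oW] Ck_on_bounded_linear_comp[OF bounded_linear_snd oW] Ck\<phi>)
    then show ?thesis
      by (rule Ck_on_cong[OF oW, rotated]) (simp add: \<psi>_def ster_inv_def divide_inverse)
  qed
  define D where "D u = frechet_derivative \<psi> (at u)" for u
  have D: "(\<psi> has_derivative D u) (at u)" if "u \<in> W" for u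
    unfolding D_def by (rule Ck_on_SucD[OF Ck\<psi>[of "Suc 0"] that])
  have D2: "(\<lambda>u. D u v) differentiable (at u)" if "u \<in> W" for u v
    unfolding D_def using Ck\<psi>[of "Suc (Suc 0)"] that by simp
  have contD: "continuous_on W (\<lambda>u. D u v)" for v
    unfolding D_def using Ck\<psi>[of "Suc 0"] by simp
  have linD: "linear (D u)" if "u \<in> W" for u using D[OF that] has_derivative_linear by blast
  have d\<phi>: "frechet_derivative \<phi> (at u) h = ster_deriv K \<sigma> (\<psi> u) (D u h)" if "u \<in> W" for u h
  proof -
    have "(?\<chi> \<circ> \<psi> has_derivative ster_deriv K \<sigma> (\<psi> u) \<circ> D u) (at u)"
      using D[OF that] has_derivative_ster[OF \<psi>Y[OF that]] by (rule diff_chain_at)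
    then have "(\<phi> has_derivative ster_deriv K \<sigma> (\<psi> u) \<circ> D u) (at u)"
      by (rule has_derivative_transform_within_open[OF _ oW that]) (simp add: \<chi>\<psi>)
    then show ?thesis using frechet_derivative_at[of \<phi>] by (metis comp_apply)
  qed
  have linS: "linear (ster_deriv K \<sigma> y)" if "y \<in> ?Y" for y :: "real^('n option)"
    using has_derivative_ster[OF that] has_derivative_linear by blast
  have injD: "inj (D u)" if "u \<in> W" for u
    using D\<phi>(8)[OF that] d\<phi>[OF that] by (metis (mono_tags, lifting) injD injI)
  define N where "N u = perp_vec (D u)" for u
  have N0: "N u \<noteq> 0" and ND: "N u \<bullet> D u h = 0" if "u \<in> W" for u h
    using perp_vec_nonzero[OF linD injD] perp_vec_orthogonal[OF linD] that by (auto simp: N_def)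
  have diffN: "N differentiable (at u)" if "u \<in> W" for u
    unfolding N_def by (rule differentiable_perp_vec[OF D2[OF that]])
  \<comment> \<open>The chart is conformal with factor 1 / \<open>ster_den\<close>, hence this
    multiple of the image of \<open>N u\<close> has length 1.\<close>
  define m where "m u = (ster_den K (\<psi> u) / norm (N u)) *\<^sub>R ster_deriv K \<sigma> (\<psi> u) (N u)" for u
  have den: "ster_den K (\<psi> u) > 0" if "u \<in> W" for u using \<psi>Y[OF that] by (simp add: ster_dom_def)
  have mm: "metric_K K (m u) (m u) = 1" if "u \<in> W" for u
    using ster_deriv_metric[OF K \<sigma>2 \<psi>Y[OF that], of "N u" "N u"] den[OF that] N0[OF that]
    by (simp add: m_def metric_K_bilinear power2_norm_eq_inner[symmetric] power2_eq_square)
  have mD: "metric_K K (m u) (frechet_derivative \<phi> (at u) h) = 0" if "u \<in> W" for u h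
    using ster_deriv_metric[OF K \<sigma>2 \<psi>Y[OF that], of "N u" "D u h"] ND[OF that]
    by (simp add: m_def metric_K_bilinear d\<phi>[OF that])
  have mT: "m u \<in> sf_tangent K (\<phi> u)" if "u \<in> W" for u
  proof -
    have "frechet_derivative ?\<chi> (at (\<psi> u)) = ster_deriv K \<sigma> (\<psi> u)"
      using has_derivative_ster[OF \<psi>Y[OF that]] frechet_derivative_at by metis
    then have "ster_deriv K \<sigma> (\<psi> u) (N u) \<in> tangent_space (space_form K) (?\<chi> (\<psi> u))"
      using tangent_space_chart[OF lpS \<psi>Y[OF that]] by auto
    then show ?thesis
      using tangent_space_space_form[OF K inS(1)[OF that]] \<chi>\<psi>[OF that] by (simp add: m_def sf_tangent_scaleR)
  qed
  have diffm: "m differentiable (at u)" if u: "u \<in> W" for u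
  proof -
    have [simp]: "\<psi> differentiable (at u)" using D[OF u] by (auto simp: differentiable_def)
    note [simp] = diffN[OF u]
    have n[simp]: "(\<lambda>u. norm (N u)) differentiable (at u)"
      using differentiable_compose[of norm N u UNIV] differentiable_at_withinI N0[OF u] by (auto intro: differentiable_norm_at)
    have [simp]: "(\<lambda>u. ster_den K (\<psi> u)) differentiable (at u)" unfolding ster_den_def by simp
    show ?thesis
      unfolding m_def ster_deriv_def
      using den[OF u] N0[OF u]
      by (intro differentiable_scaleR differentiable_divide differentiable_Pair differentiable_diff differentiable_minus
          differentiable_mult differentiable_power differentiable_inner differentiable_const) auto
  qed
  define \<Psi> where "\<Psi> z = \<psi> (tail_vec z) + z $ None *\<^sub>R N u0" for z :: "real^('n option)"
  define Oz where "Oz = tail_vec -` W"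
  have oOz: "open Oz" unfolding Oz_def
    using bounded_linear_tail_vec oW by (intro open_vimage linear_continuous_on)
  define F where "F z h = D (tail_vec z) (tail_vec h) + h $ None *\<^sub>R N u0" for z h :: "real^('n option)"
  have derF: "(\<Psi> has_derivative F z) (at z)" if "z \<in> Oz" for z
  proof -
    have "(\<psi> \<circ> tail_vec has_derivative D (tail_vec z) \<circ> tail_vec) (at z)"
      using that by (intro diff_chain_at bounded_linear_imp_has_derivative bounded_linear_tail_vec D) (auto simp: Oz_def)
    then show ?thesis unfolding \<Psi>_def[abs_def] F_def o_def
      by (intro derivative_intros bounded_linear_imp_has_derivative[OF bounded_linear_vec_nth]) simp
  qed
  have blF: "bounded_linear (F z)" if "z \<in> Oz" for z using derF[OF that] has_derivative_bounded_linear by blast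
  define Fb where "Fb z = Blinfun (F z)" for z
  have Fb: "blinfun_apply (Fb z) = F z" if "z \<in> Oz" for z
    unfolding Fb_def using blF[OF that] by (rule bounded_linear_Blinfun_apply)
  have contFb: "continuous_on Oz Fb"
  proof (rule continuous_on_blinfun_componentwise)
    fix i :: "real^('n option)"
    have "continuous_on Oz (\<lambda>z. D (tail_vec z) (tail_vec i))"
      by (rule continuous_on_compose2[OF contD linear_continuous_on[OF bounded_linear_tail_vec]]) (auto simp: Oz_def)
    then have "continuous_on Oz (\<lambda>z. F z i)" unfolding F_def by (intro continuous_intros)
    then show "continuous_on Oz (\<lambda>z. blinfun_apply (Fb z) i)"
      by (rule continuous_on_eq) (simp add: Fb)
  qed
  define z0 where "z0 = cons_vec u0 0"
  have z0: "z0 \<in> Oz" using u0 by (simp add: z0_def Oz_def)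
  have "F z0 h = 0 \<Longrightarrow> h = 0" for h
  proof -
    assume h: "F z0 h = 0"
    then have "N u0 \<bullet> F z0 h = 0" by simp
    then have "h $ None = 0" using ND[OF u0(1)] N0[OF u0(1)] by (simp add: F_def z0_def inner_simps)
    moreover then have "D u0 (tail_vec h) = 0" using h by (simp add: F_def z0_def)
    then have "tail_vec h = 0" using linD injD u0(1) linear_injective_0 by blast
    ultimately show "h = 0" by (metis (full_types) cons_tail_vec linear_0[OF linear_cons_vec] case_prod_conv zero_prod_def)
  qed
  moreover have linF: "linear (F z0)" using blF[OF z0] by (simp add: linear_conv_bounded_linear)
  ultimately have "inj (F z0)" using linear_injective_0 by blast
  then obtain G where G: "linear G" "\<forall>x. G (F z0 x) = x" using linear_injective_isomorphism[OF linF] by blast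
  have Gb: "Blinfun G o\<^sub>L Fb z0 = id_blinfun"
    using G by (intro blinfun_eqI) (simp add: Fb[OF z0] bounded_linear_Blinfun_apply linear_conv_bounded_linear)
  obtain U' V g g' where U': "open U'" "U' \<subseteq> Oz" "z0 \<in> U'" and V: "open V" "\<Psi> z0 \<in> V"
    and hom: "homeomorphism U' V \<Psi> g"
    and dg: "\<And>y. y \<in> V \<Longrightarrow> (g has_derivative (g' y)) (at y)"
    and g': "\<And>y. y \<in> V \<Longrightarrow> g' y = inv (blinfun_apply (Fb (g y)))"
    and bijF: "\<And>y. y \<in> V \<Longrightarrow> bij (blinfun_apply (Fb (g y)))"
    by (rule inverse_function_theorem[OF oOz _ contFb z0 Gb, of \<Psi>]) (use derF Fb in auto)
  have g\<Psi>: "g (\<Psi> z) = z" "\<Psi> z \<in> V" if "z \<in> U'" for z using hom that by (auto simp: homeomorphism_def)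
  have \<Psi>g: "\<Psi> (g y) = y" "g y \<in> U'" if "y \<in> V" for y using hom that by (auto simp: homeomorphism_def)
  have contg: "continuous_on V g" and cont\<Psi>: "continuous_on U' \<Psi>" using hom by (auto simp: homeomorphism_def)
  have \<Psi>c: "\<Psi> (cons_vec u 0) = \<psi> u" for u by (simp add: \<Psi>_def)
  have contc: "continuous_on A (\<lambda>u. cons_vec u 0)" for A :: "(real^'n) set"
  proof -
    have "linear (\<lambda>u :: real^'n. cons_vec u 0)"
      by (auto simp: linear_iff vec_eq_iff cons_vec_def split: option.splits)
    then show ?thesis by (intro linear_continuous_on) (simp add: linear_conv_bounded_linear)
  qed
  define W1 where "W1 = W \<inter> (\<lambda>u. cons_vec u 0) -` U'"
  have oW1: "open W1" unfolding W1_def using oW U'(1)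
    by (intro continuous_open_preimage contc)
  have u01: "u0 \<in> W1" using u0 U'(3) by (simp add: W1_def z0_def)
  have \<phi>1: "local_parametrization M \<phi> W1" using local_parametrization_subset[OF \<phi> oW1] by (auto simp: W1_def)
  obtain O1 where O1: "open O1" "\<phi> ` W1 = M \<inter> O1"
    using local_parametrizationD(3)[OF \<phi>1] by (auto simp: openin_open)
  have cont\<chi>: "continuous_on ?Y ?\<chi>" using local_parametrizationD(5)[OF lpS] .
  \<comment> \<open>The preimage of \<open>O1\<close> keeps other parts of M out of the coordinate
    neighbourhood; \<open>A\<close> is the set in which \<open>U\<close> has to lie.\<close>
  define U1 where "U1 = U' \<inter> \<Psi> -` (?Y \<inter> ?\<chi> -` (O1 \<inter> A))"
  have oU1: "open U1" unfolding U1_def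
    by (intro continuous_open_preimage[OF cont\<Psi> U'(1)] continuous_open_preimage[OF cont\<chi> open_ster_dom] open_Int O1(1) p(2))
  have z01: "z0 \<in> U1"
    using U'(3) u0 \<psi>Y[OF u0(1)] \<chi>\<psi>[OF u0(1)] u01 O1 p(3) by (auto simp: U1_def z0_def \<Psi>c)
  have contN: "continuous_on W N"
    using diffN by (meson continuous_at_imp_continuous_on differentiable_imp_continuous_within)
  \<comment> \<open>Positivity of this inner product will ensure that the normal at u and the
    coordinate direction \<open>N u0\<close> point to the same side.\<close>
  have "open (W1 \<inter> (\<lambda>u. N u \<bullet> N u0) -` {0<..})"
    using contN oW1 by (intro continuous_open_preimage continuous_intros) (auto simp: W1_def intro: continuous_on_subset)
  moreover have "u0 \<in> W1 \<inter> (\<lambda>u. N u \<bullet> N u0) -` {0<..}" using u01 N0[OF u0(1)] by simp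
  ultimately obtain d1 where d1: "d1 > 0" "ball u0 d1 \<subseteq> W1 \<inter> (\<lambda>u. N u \<bullet> N u0) -` {0<..}"
    by (meson open_contains_ball)
  obtain d2 where d2: "d2 > 0" "ball z0 d2 \<subseteq> U1" using oU1 z01 by (meson open_contains_ball)
  define \<delta> where "\<delta> = min d1 (d2 / 2)"
  have \<delta>: "\<delta> > 0" "\<delta> \<le> d1" "2 * \<delta> \<le> d2" using d1 d2 by (auto simp: \<delta>_def)
  define Bx where "Bx = {z :: real^('n option). tail_vec z \<in> ball u0 \<delta> \<and> \<bar>z $ None\<bar> < \<delta>}"
  have "Bx = tail_vec -` ball u0 \<delta> \<inter> (\<lambda>z. z $ None) -` {- \<delta> <..< \<delta>}" by (auto simp: Bx_def)
  then have oBx: "open Bx"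
    using bounded_linear_tail_vec by (auto intro!: open_Int open_vimage linear_continuous_on continuous_intros)
  \<comment> \<open>\<open>d2\<close> is at least twice \<open>\<delta>\<close> because the norm is
    estimated by the sum of the norms of the two parts of the vector.\<close>
  have BxU1: "Bx \<subseteq> U1"
  proof
    fix z assume z: "z \<in> Bx"
    have "norm (cons_vec u t) \<le> norm u + \<bar>t\<bar>" for u :: "real^'n" and t
    proof -
      have "cons_vec u t \<bullet> cons_vec u t = u \<bullet> u + t * t"
        by (simp add: inner_vec_def UNIV_option_conv sum.reindex)
      then have "norm (cons_vec u t) ^ 2 = norm u ^ 2 + \<bar>t\<bar> ^ 2"
        by (simp add: power2_norm_eq_inner) (simp add: power2_eq_square)
      also have "\<dots> \<le> (norm u + \<bar>t\<bar>)\<^sup>2" by (simp add: power2_sum)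
      finally show ?thesis by (rule power2_le_imp_le) simp
    qed
    moreover have "z - z0 = cons_vec (tail_vec z - u0) (z $ None)"
      by (simp add: vec_eq_iff z0_def cons_vec_def split: option.split)
    ultimately have "norm (z - z0) \<le> norm (tail_vec z - u0) + \<bar>z $ None\<bar>" by metis
    also have "\<dots> < d2" using z \<delta> by (simp add: Bx_def dist_norm norm_minus_commute)
    finally show "z \<in> U1" using d2 by (auto simp: dist_norm norm_minus_commute)
  qed
  have BxU': "Bx \<subseteq> U'" using BxU1 by (auto simp: U1_def)
  have Bx\<chi>: "\<Psi> z \<in> ?Y" "?\<chi> (\<Psi> z) \<in> O1" "?\<chi> (\<Psi> z) \<in> A" if "z \<in> Bx" for z
    using BxU1 that by (auto simp: U1_def)
  define Wb where "Wb = ball u0 \<delta>"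
  have Wb: "open Wb" "Wb \<subseteq> W1" "Wb \<subseteq> W" "u0 \<in> Wb" "\<And>u. u \<in> Wb \<Longrightarrow> N u \<bullet> N u0 > 0"
  proof -
    have "Wb \<subseteq> ball u0 d1" using \<delta> by (auto simp: Wb_def)
    then show "Wb \<subseteq> W1" "\<And>u. u \<in> Wb \<Longrightarrow> N u \<bullet> N u0 > 0" using d1 by auto
    then show "Wb \<subseteq> W" by (auto simp: W1_def)
  qed (use \<delta> in \<open>auto simp: Wb_def\<close>)
  define T where "T z = ?\<chi> (\<Psi> z)" for z
  have T_inj: "z = z'" if "z \<in> Bx" "z' \<in> U'" "\<Psi> z' \<in> ?Y" "T z = T z'" for z z'
  proof -
    have "\<Psi> z = \<Psi> z'" using that Bx\<chi>(1)[OF that(1)] ster_image(2)[OF ok] unfolding T_def by metis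
    then show ?thesis using g\<Psi>(1) that BxU' by (metis subsetD)
  qed
  have cT: "continuous_on Bx T"
    unfolding T_def
    by (rule continuous_on_compose2[OF cont\<chi> continuous_on_subset[OF cont\<Psi>]]) (use BxU' Bx\<chi> in auto)
  have oT: "openin (top_of_set (space_form K)) (T ` X)" if X: "open X" "X \<subseteq> Bx" for X
  proof -
    have "\<Psi> ` X = V \<inter> g -` X"
      using g\<Psi> \<Psi>g BxU' X(2) by (auto simp: image_iff) (metis subsetD)+
    then have o: "open (\<Psi> ` X)" using continuous_open_preimage[OF contg V(1) X(1)] by simp
    have "openin (top_of_set (space_form K)) (?\<chi> ` (\<Psi> ` X))"
      by (rule local_parametrizationD(3)[OF local_parametrization_subset[OF lpS o]]) (use Bx\<chi> X in auto)
    then show ?thesis by (simp add: T_def image_image)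
  qed
  obtain U0 where U0: "open U0" "T ` Bx = space_form K \<inter> U0"
    using oT[OF oBx] by (auto simp: openin_open)
  define U where "U = U0 \<inter> A"
  have U: "open U" "T ` Bx = space_form K \<inter> U" "U \<subseteq> A"
  proof -
    have "T ` Bx \<subseteq> A" using Bx\<chi>(3) by (force simp: T_def)
    then show "T ` Bx = space_form K \<inter> U" "U \<subseteq> A" using U0(2) by (auto simp: U_def)
  qed (use U0 p(2) in \<open>simp add: U_def open_Int\<close>)
  define Bp where "Bp = Bx \<inter> {z. z $ None > 0}"
  define Bn where "Bn = Bx \<inter> {z. z $ None < 0}"
  define P where "P = T ` Bp"
  define Q where "Q = T ` Bn"
  have cxB: "convex (Bx \<inter> {z. z $ None > 0})" "convex (Bx \<inter> {z. z $ None < 0})"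
  proof -
    have lin: "linear tail_vec" "linear (\<lambda>z :: real^('n option). z $ None)"
      by (auto simp: linear_iff vec_eq_iff)
    have "convex (tail_vec -` ball u0 \<delta> \<inter> (\<lambda>z :: real^('n option). z $ None) -` S)" if "convex S" for S
      using that by (intro convex_Int convex_linear_vimage lin convex_ball)
    from this[of "{0<..<\<delta>}"] this[of "{-\<delta><..<0}"]
    have "convex (tail_vec -` ball u0 \<delta> \<inter> (\<lambda>z :: real^('n option). z $ None) -` {0<..<\<delta>})"
      "convex (tail_vec -` ball u0 \<delta> \<inter> (\<lambda>z :: real^('n option). z $ None) -` {-\<delta><..<0})"
      by (auto simp: convex_real_interval)
    moreover have "Bx \<inter> {z. z $ None > 0} = tail_vec -` ball u0 \<delta> \<inter> (\<lambda>z. z $ None) -` {0<..<\<delta>}"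
      "Bx \<inter> {z. z $ None < 0} = tail_vec -` ball u0 \<delta> \<inter> (\<lambda>z. z $ None) -` {-\<delta><..<0}"
      using \<delta> by (auto simp: Bx_def)
    ultimately show "convex (Bx \<inter> {z. z $ None > 0})" "convex (Bx \<inter> {z. z $ None < 0})" by auto
  qed
  have conn: "connected P" "connected Q"
    unfolding P_def Q_def Bp_def Bn_def
    by (intro connected_continuous_image continuous_on_subset[OF cT] convex_connected[OF cxB(1)]
        convex_connected[OF cxB(2)] Int_lower1)+
  have oPQ: "openin (top_of_set (space_form K)) P" "openin (top_of_set (space_form K)) Q"
    unfolding P_def Q_def Bp_def Bn_def
    by (intro oT open_Int oBx open_Collect_less continuous_intros Int_lower1)+
  have Tc: "T (cons_vec u 0) = \<phi> u" if "u \<in> W" for u using \<chi>\<psi>[OF that] by (simp add: T_def \<Psi>c)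
  \<comment> \<open>A point of M in the box comes from the chart by the choice of \<open>O1\<close>,
    and injectivity of \<open>T\<close> puts it on the slice t = 0.\<close>
  have MB: "z \<in> (\<lambda>u. cons_vec u 0) ` Wb" if z: "z \<in> Bx" "T z \<in> M" for z
  proof -
    have "T z \<in> \<phi> ` W1" using O1(2) Bx\<chi>(2)[OF z(1)] z(2) by (simp add: T_def)
    then obtain u where u: "u \<in> W1" "T z = \<phi> u" by auto
    have "T z = T (cons_vec u 0)" using u Tc by (auto simp: W1_def)
    then have "z = cons_vec u 0"
      using u z \<psi>Y by (intro T_inj) (auto simp: W1_def \<Psi>c)
    then show ?thesis using z(1) by (auto simp: Bx_def Wb_def)
  qed
  have WbB: "cons_vec u 0 \<in> Bx" if "u \<in> Wb" for u using that \<delta> by (simp add: Bx_def Wb_def)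
  have \<phi>W: "\<phi> ` Wb = M \<inter> U"
  proof
    show "\<phi> ` Wb \<subseteq> M \<inter> U"
    proof
      fix q assume "q \<in> \<phi> ` Wb"
      then obtain u where u: "u \<in> Wb" "q = \<phi> u" by auto
      then have uW: "u \<in> W" using Wb by auto
      then have "q \<in> M" using D\<phi>(4) u by auto
      moreover have "q \<in> T ` Bx" using WbB[OF u(1)] Tc[OF uW] u by (metis image_eqI)
      ultimately show "q \<in> M \<inter> U" using U by auto
    qed
    show "M \<inter> U \<subseteq> \<phi> ` Wb"
    proof
      fix q assume q: "q \<in> M \<inter> U"
      then have "q \<in> T ` Bx" using U M(2) by auto
      then obtain z where "z \<in> Bx" "q = T z" by auto
      then show "q \<in> \<phi> ` Wb" using MB[of z] q Tc Wb by auto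
    qed
  qed
  have nM: "T z \<notin> M" if "z \<in> Bx" "z $ None \<noteq> 0" for z using MB[of z] that by auto
  have PM: "P \<inter> M = {}"
    unfolding P_def Bp_def disjoint_iff by (intro allI impI) (use nM in \<open>force simp del: split_paired_All\<close>)
  have QM: "Q \<inter> M = {}"
    unfolding Q_def Bn_def disjoint_iff by (intro allI impI) (use nM in \<open>force simp del: split_paired_All\<close>)
  have PQ: "P \<inter> Q = {}"
  proof -
    have False if "z \<in> Bp" "z' \<in> Bn" "T z = T z'" for z z'
      using T_inj[of z z'] that BxU' Bx\<chi> by (auto simp: Bp_def Bn_def)
    then show ?thesis unfolding P_def Q_def by blast
  qed
  have SU: "space_form K \<inter> U = \<phi> ` Wb \<union> P \<union> Q"
  proof -
    have "Bx = (\<lambda>u. cons_vec u 0) ` Wb \<union> Bp \<union> Bn"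
    proof (intro set_eqI iffI)
      fix z assume z: "z \<in> Bx"
      show "z \<in> (\<lambda>u. cons_vec u 0) ` Wb \<union> Bp \<union> Bn"
      proof (cases "z $ None = 0")
        case True
        then have "z = cons_vec (tail_vec z) 0" by (metis cons_tail_vec)
        moreover have "tail_vec z \<in> Wb" using z by (simp add: Bx_def Wb_def)
        ultimately show ?thesis by blast
      qed (use z in \<open>auto simp: Bp_def Bn_def\<close>)
    qed (use WbB in \<open>auto simp: Bp_def Bn_def\<close>)
    moreover have "T ` (\<lambda>u. cons_vec u 0) ` Wb = \<phi> ` Wb"
      using Tc Wb(3) by (auto simp: image_image intro!: image_cong)
    ultimately show ?thesis unfolding U(2)[symmetric] P_def Q_def by (metis image_Un)
  qed
  \<comment> \<open>The transversal coordinate \<open>\<tau>\<close> along the normal geodesic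
    vanishes at time 0 and has positive derivative there, so the geodesic passes from
    \<open>Q\<close> to \<open>P\<close>.\<close>
  have side: "\<exists>\<epsilon>>0. \<forall>t. 0 < t \<and> t < \<epsilon> \<longrightarrow> geodesic K (\<phi> u) (m u) t \<in> P \<and> geodesic K (\<phi> u) (m u) (- t) \<in> Q"
    if u: "u \<in> Wb" for u
  proof -
    have uW: "u \<in> W" using u Wb by auto
    have uV: "\<psi> u \<in> V" "g (\<psi> u) = cons_vec u 0"
      using g\<Psi>[of "cons_vec u 0"] WbB[OF u] BxU' by (auto simp: \<Psi>c)
    let ?c = "geodesic K (\<phi> u) (m u)"
    let ?i = "chart_inv ?\<chi> ?Y"
    have cS: "?c t \<in> space_form K" for t
      by (rule geodesic_in_space_form[OF K inS(1)[OF uW] mT[OF uW] mm[OF uW]])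
    obtain l where l: "linear l" "\<And>v. l (ster_deriv K \<sigma> (\<psi> u) v) = v"
      "(?i has_derivative l) (at (\<phi> u) within space_form K)"
      using chart_inv_has_derivative[OF lpS \<psi>Y[OF uW]] \<chi>\<psi>[OF uW]
        frechet_derivative_at[OF has_derivative_ster[OF \<psi>Y[OF uW]]] by metis
    have lm: "l (m u) = (ster_den K (\<psi> u) / norm (N u)) *\<^sub>R N u"
      unfolding m_def using l by (simp add: linear_cmul)
    have dc: "(?c has_derivative (\<lambda>t. t *\<^sub>R m u)) (at 0)"
      using geodesic_has_vector_derivative[OF K, of "\<phi> u" "m u" 0 UNIV] by (simp add: has_vector_derivative_def)
    have "(?i \<circ> ?c has_derivative l \<circ> (\<lambda>t. t *\<^sub>R m u)) (at 0 within UNIV)"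
      by (rule diff_chain_within) (use dc l(3) cS in \<open>auto intro: has_derivative_subset\<close>)
    then have d1: "(?i \<circ> ?c has_derivative l \<circ> (\<lambda>t. t *\<^sub>R m u)) (at 0)" by simp
    have i0: "(?i \<circ> ?c) 0 = \<psi> u" using chart_inv(1)[OF lpS \<psi>Y[OF uW]] \<chi>\<psi>[OF uW] by simp
    have d2: "(g \<circ> (?i \<circ> ?c) has_derivative g' (\<psi> u) \<circ> (l \<circ> (\<lambda>t. t *\<^sub>R m u))) (at 0)"
      by (rule diff_chain_at[OF d1]) (use dg[OF uV(1)] i0 in simp)
    \<comment> \<open>Coordinates of the normal vector. Pairing F x = N u with N u removes the part
      along the hypersurface and leaves x_None (N u . N u0) = |N u|^2 > 0.\<close>
    define x where "x = g' (\<psi> u) (N u)"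
    have Fx: "F (cons_vec u 0) x = N u"
      unfolding x_def using g'[OF uV(1)] bijF[OF uV(1)] uV(2) Fb[of "cons_vec u 0"] uW
      by (simp add: Oz_def bij_is_surj surj_f_inv_f)
    have "N u \<bullet> N u = N u \<bullet> F (cons_vec u 0) x" using Fx by simp
    also have "\<dots> = x $ None * (N u \<bullet> N u0)" using ND[OF uW] by (simp add: F_def inner_simps)
    finally have "0 < x $ None * (N u \<bullet> N u0)" using N0[OF uW] by (metis inner_gt_zero_iff)
    then have x0: "x $ None > 0" using Wb(5)[OF u] by (simp add: zero_less_mult_iff)
    define \<tau> where "\<tau> t = g (?i (?c t)) $ None" for t
    define a where "a = ster_den K (\<psi> u) / norm (N u)"
    have a: "a > 0" using den[OF uW] N0[OF uW] by (simp add: a_def)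
    have lg: "linear (g' (\<psi> u))" using dg[OF uV(1)] has_derivative_linear by blast
    have "(\<tau> has_derivative (\<lambda>t. (g' (\<psi> u) (l (t *\<^sub>R m u))) $ None)) (at 0)"
      using bounded_linear.has_derivative[OF bounded_linear_vec_nth d2] by (simp add: \<tau>_def[abs_def] o_def)
    moreover have "(\<lambda>t. (g' (\<psi> u) (l (t *\<^sub>R m u))) $ None) = (*) (a * x $ None)"
      using l(1) lg by (auto simp: linear_cmul lm a_def x_def)
    ultimately have "DERIV \<tau> 0 :> a * x $ None" by (simp add: has_field_derivative_def)
    moreover have "\<tau> 0 = 0" using i0 uV(2) by (simp add: \<tau>_def)
    moreover have "a * x $ None > 0" using a x0 by simp
    ultimately have "\<exists>e>0. \<forall>h>0. h < e \<longrightarrow> 0 < \<tau> h" "\<exists>e>0. \<forall>h>0. h < e \<longrightarrow> \<tau> (- h) < 0"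
      by (metis DERIV_pos_inc_right add_0, metis DERIV_pos_inc_left diff_0)
    then obtain e1 e2 where e: "e1 > 0" "\<And>h. 0 < h \<Longrightarrow> h < e1 \<Longrightarrow> \<tau> h > 0"
        "e2 > 0" "\<And>h. 0 < h \<Longrightarrow> h < e2 \<Longrightarrow> \<tau> (- h) < 0"
      by metis
    have "open (?c -` U)" by (intro open_vimage U(1) continuous_on_geodesic)
    moreover have "?c 0 \<in> U" using \<phi>W u by auto
    ultimately obtain e3 where e3: "e3 > 0" "ball 0 e3 \<subseteq> ?c -` U" by (metis open_contains_ball vimageI)
    have key: "?c t \<in> T ` {z \<in> Bx. z $ None = \<tau> t}" if "\<bar>t\<bar> < e3" for t
    proof -
      have "t \<in> ball 0 e3" using that by simp
      then have "?c t \<in> T ` Bx" using e3 U(2) cS[of t] by auto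
      then obtain z where z: "z \<in> Bx" "?c t = T z" by auto
      have "?i (?c t) = \<Psi> z" using chart_inv(1)[OF lpS Bx\<chi>(1)[OF z(1)]] z(2) by (simp add: T_def)
      moreover have "z \<in> U'" using z(1) BxU' by blast
      ultimately have "\<tau> t = z $ None" using g\<Psi>(1)[of z] by (simp add: \<tau>_def)
      then show ?thesis using z by auto
    qed
    show ?thesis
    proof (intro exI[of _ "min e1 (min e2 e3)"] conjI allI impI)
      fix t assume t: "0 < t \<and> t < min e1 (min e2 e3)"
      have "\<tau> t > 0" "\<tau> (- t) < 0" using e t by auto
      moreover have "\<bar>t\<bar> < e3" "\<bar>- t\<bar> < e3" using t by auto
      ultimately show "?c t \<in> P" "?c (- t) \<in> Q"
        using key[of t] key[of "- t"] by (auto simp: P_def Q_def Bp_def Bn_def)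
    qed (use e e3 in auto)
  qed
  have "tube K M \<phi> Wb m U P Q"
    unfolding tube_def
    using local_parametrization_subset[OF \<phi> Wb(1,3)] U(1) \<phi>W SU PM QM PQ conn oPQ diffm mT mm mD side Wb(3) by auto
  then show ?thesis using u0(2) Wb(4) U(3) by blast
qed

section \<open>One-sidedness of the boundary\<close>

text \<open>Stands for R^(k+1): the number k comes from a compactness argument and is not the size
  of a type, so bounded sequences vanishing beyond k are used.\<close>

definition coord_vec :: "nat \<Rightarrow> (nat \<Rightarrow> real) \<Rightarrow> (nat \<Rightarrow>\<^sub>C real)" where
  "coord_vec k c = Bcontfun (\<lambda>j. if j \<le> k then c j else 0)"

lemma coord_vec_nth [simp]: "apply_bcontfun (coord_vec k c) j = (if j \<le> k then c j else 0)"
proof -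
  have "finite (range (\<lambda>j. if j \<le> k then c j else 0))"
    by (rule finite_subset[of _ "insert 0 (c ` {..k})"]) auto
  then have "(\<lambda>j. if j \<le> k then c j else 0) \<in> bcontfun"
    by (simp add: bcontfun_def finite_imp_bounded)
  then show ?thesis by (simp add: coord_vec_def Bcontfun_inverse)
qed

lemma continuous_on_bcontfun_eval:
  "continuous_on A (\<lambda>v :: 'a::topological_space \<Rightarrow>\<^sub>C 'b::metric_space. apply_bcontfun v j)"
  unfolding continuous_on_iff by (metis dist_bounded order.strict_trans1)

lemma continuous_on_coord_vec:
  fixes c :: "'a::topological_space \<Rightarrow> nat \<Rightarrow> real"
  assumes "\<And>j. j \<le> k \<Longrightarrow> continuous_on A (\<lambda>x. c x j)"
  shows "continuous_on A (\<lambda>x. coord_vec k (c x))"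
proof -
  have E: "coord_vec k c = (\<Sum>i\<le>k. c i *\<^sub>R coord_vec k (\<lambda>j. if j = i then 1 else 0))" for c
  proof (rule bcontfun_eqI)
    fix j
    have "apply_bcontfun (\<Sum>i\<in>I. c i *\<^sub>R coord_vec k (\<lambda>j. if j = i then 1 else 0)) j =
        (\<Sum>i\<in>I. c i * (if j \<le> k \<and> j = i then 1 else 0))" if "finite I" for I
      using that by (induction I) auto
    from this[of "{..k}"]
    show "apply_bcontfun (coord_vec k c) j = apply_bcontfun (\<Sum>i\<le>k. c i *\<^sub>R coord_vec k (\<lambda>j. if j = i then 1 else 0)) j"
      by (simp add: if_distrib[of "(*) _"] cong: if_cong)
  qed
  have "continuous_on A (\<lambda>x. \<Sum>i\<le>k. c x i *\<^sub>R coord_vec k (\<lambda>j. if j = i then 1 else 0))"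
    by (intro continuous_intros assms) auto
  then show ?thesis by (rule continuous_on_eq) (rule E[symmetric])
qed

text \<open>If a hypersurface with connected complement were two-sided everywhere, gluing two copies of the
  complement crosswise along it would give a connected double covering. Here the covering space is
  realised by sign functions \<open>\<epsilon> i\<close> that are defined on the members of an open cover up to the
  hypersurface and jump across it, weighted by the distance functions \<open>\<rho> i\<close>.\<close>

lemma no_two_sided_hypersurface:
  fixes S \<Omega> M :: "'a::euclidean_space set" and U P Q :: "nat \<Rightarrow> 'a set"
  assumes S: "simply_connected S" "locally path_connected S" "closed S" "z0 \<notin> S"
    and \<Omega>: "openin (top_of_set S) \<Omega>" "connected \<Omega>" "S \<subseteq> closure \<Omega>"
    and M: "M = S - \<Omega>" "M \<noteq> {}"
    and U: "\<And>i. 1 \<le> i \<Longrightarrow> i \<le> k \<Longrightarrow> open (U i)" "M \<subseteq> (\<Union>i\<in>{1..k}. U i)"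
    and PQ: "\<And>i. 1 \<le> i \<Longrightarrow> i \<le> k \<Longrightarrow> \<Omega> \<inter> U i = P i \<union> Q i \<and> P i \<inter> Q i = {} \<and>
        openin (top_of_set S) (P i) \<and> openin (top_of_set S) (Q i)"
    and cl: "\<And>i x. 1 \<le> i \<Longrightarrow> i \<le> k \<Longrightarrow> x \<in> M \<inter> U i \<Longrightarrow> x \<in> closure (P i) \<and> x \<in> closure (Q i)"
    and loc: "\<And>x N. x \<in> M \<Longrightarrow> open N \<Longrightarrow> x \<in> N \<Longrightarrow>
        \<exists>N' A B. N' \<subseteq> N \<and> open N' \<and> x \<in> N' \<and> connected A \<and> connected B \<and> \<Omega> \<inter> N' = A \<union> B"
  shows False
proof -
  have \<Omega>S: "\<Omega> \<subseteq> S" using \<Omega>(1) openin_imp_subset by blast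
  have "closedin (top_of_set S) M" using \<Omega>(1) by (simp add: M(1) closedin_diff)
  then have clM: "closed M" using S(3) closedin_closed_trans by blast
  \<comment> \<open>Index 0 is the complement of M with constant sign 1; it trivialises the covering
    over \<open>\<Omega>\<close>.\<close>
  define V where "V i = (if i = 0 then - M else U i)" for i
  define \<epsilon> where "\<epsilon> i y = (if i = 0 then 1 else if y \<in> Q i then -1 else 1 :: real)" for i y
  have oV: "open (V i)" if "i \<le> k" for i using that U clM by (auto simp: V_def open_Compl)
  have \<epsilon>2: "\<epsilon> i y * \<epsilon> i y = 1" "\<epsilon> i y \<in> {1, -1}" for i y by (auto simp: \<epsilon>_def)
  have dense: "\<Omega> \<inter> N \<noteq> {}" if "x \<in> S" "open N" "x \<in> N" for x N
    using that \<Omega>(3) by (meson closure_iff_nhds_not_empty subsetD order_refl)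
  have onV: "\<exists>N s. open N \<and> x \<in> N \<and> (\<forall>y\<in>\<Omega> \<inter> N. \<epsilon> i y = s)" if x: "x \<in> \<Omega>" "x \<in> V i" and i: "i \<le> k" for x i
  proof (cases "i = 0")
    case False
    then have i1: "1 \<le> i" by simp
    have "x \<in> P i \<union> Q i" using x False PQ[OF i1 i] by (auto simp: V_def)
    then consider "x \<in> P i" | "x \<in> Q i" by blast
    then show ?thesis
    proof cases
      case 1
      obtain T where "open T" "P i = S \<inter> T" using PQ[OF i1 i] by (auto simp: openin_open)
      then show ?thesis using 1 PQ[OF i1 i] \<Omega>S by (intro exI[of _ T] exI[of _ 1]) (auto simp: \<epsilon>_def)
    next
      case 2
      obtain T where "open T" "Q i = S \<inter> T" using PQ[OF i1 i] by (auto simp: openin_open)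
      then show ?thesis using 2 False \<Omega>S by (intro exI[of _ T] exI[of _ "-1"]) (auto simp: \<epsilon>_def)
    qed
  qed (auto simp: \<epsilon>_def)
  \<comment> \<open>At a point of M both signs jump between the local sides A and B, so their
    product is the same on both.\<close>
  have LC: "\<exists>N s. open N \<and> x \<in> N \<and> N \<subseteq> V i \<inter> V j \<and> s \<in> {1, -1} \<and> (\<forall>y\<in>\<Omega> \<inter> N. \<epsilon> i y * \<epsilon> j y = s)"
    if x: "x \<in> S" "x \<in> V i" "x \<in> V j" and ij: "i \<le> k" "j \<le> k" for x i j
  proof (cases "x \<in> \<Omega>")
    case True
    obtain N1 s1 where 1: "open N1" "x \<in> N1" "\<forall>y\<in>\<Omega> \<inter> N1. \<epsilon> i y = s1" using onV[OF True x(2) ij(1)] by auto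
    obtain N2 s2 where 2: "open N2" "x \<in> N2" "\<forall>y\<in>\<Omega> \<inter> N2. \<epsilon> j y = s2" using onV[OF True x(3) ij(2)] by auto
    have "s1 = \<epsilon> i x" "s2 = \<epsilon> j x" using 1 2 True by auto
    then have "s1 * s2 \<in> {1, -1}" using \<epsilon>2(2)[of i x] \<epsilon>2(2)[of j x] by auto
    then show ?thesis
      using 1 2 x oV ij by (intro exI[of _ "N1 \<inter> N2 \<inter> (V i \<inter> V j)"] exI[of _ "s1 * s2"]) (auto simp: open_Int)
  next
    case False
    then have xM: "x \<in> M" using x M by auto
    have i1: "1 \<le> i" "1 \<le> j" using x xM by (auto simp: V_def split: if_splits)
    obtain N A B where N: "N \<subseteq> V i \<inter> V j" "open N" "x \<in> N" "connected A" "connected B" "\<Omega> \<inter> N = A \<union> B"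
      using loc[OF xM, of "V i \<inter> V j"] oV ij x by (metis IntI open_Int)
    have *: "\<exists>s\<in>{1, -1}. (\<forall>y\<in>A. \<epsilon> l y = s) \<and> (\<forall>y\<in>B. \<epsilon> l y = - s)" if l: "1 \<le> l" "l \<le> k" "N \<subseteq> V l" for l
    proof -
      have pq: "\<Omega> \<inter> U l = P l \<union> Q l" "P l \<inter> Q l = {}" "openin (top_of_set S) (P l)" "openin (top_of_set S) (Q l)"
        using PQ[OF l(1,2)] by auto
      have Ul: "V l = U l" using l by (simp add: V_def)
      have AB: "A \<union> B \<subseteq> P l \<union> Q l" using N(6) l(3) pq(1) Ul by auto
      have split: "C \<subseteq> P l \<or> C \<subseteq> Q l" if "connected C" "C \<subseteq> P l \<union> Q l" for C
      proof -
        obtain T1 where T1: "open T1" "P l = S \<inter> T1" using pq(3) by (auto simp: openin_open)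
        obtain T2 where T2: "open T2" "Q l = S \<inter> T2" using pq(4) by (auto simp: openin_open)
        have "C \<subseteq> S" using that(2) T1 T2 by auto
        moreover have "C \<subseteq> T1 \<union> T2" "T1 \<inter> T2 \<inter> C = {}" using that(2) T1 T2 pq(2) \<open>C \<subseteq> S\<close> by auto
        ultimately have "T1 \<inter> C = {} \<or> T2 \<inter> C = {}" using connectedD[OF that(1) T1(1) T2(1)] by blast
        then show ?thesis using that(2) T1 T2 by blast
      qed
      have xU: "x \<in> M \<inter> U l" using xM N(3) l(3) Ul by auto
      have "P l \<inter> N \<noteq> {}" "Q l \<inter> N \<noteq> {}"
        using cl[OF l(1,2) xU] N(2,3) by (auto simp: closure_iff_nhds_not_empty)
      then obtain a b where ab: "a \<in> P l" "a \<in> N" "b \<in> Q l" "b \<in> N" by blast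
      then have "a \<in> A \<union> B" "b \<in> A \<union> B" using pq(1) N(6) by blast+
      then have "A \<subseteq> P l \<and> B \<subseteq> Q l \<or> A \<subseteq> Q l \<and> B \<subseteq> P l"
        using split[OF N(4)] split[OF N(5)] AB ab pq(2) by (metis IntI Un_iff emptyE le_sup_iff subsetD)
      then show ?thesis
      proof
        assume "A \<subseteq> P l \<and> B \<subseteq> Q l"
        then have "\<forall>y\<in>A. \<epsilon> l y = 1" "\<forall>y\<in>B. \<epsilon> l y = - 1" using l pq(2) by (auto simp: \<epsilon>_def)
        then show ?thesis by blast
      next
        assume "A \<subseteq> Q l \<and> B \<subseteq> P l"
        then have "\<forall>y\<in>A. \<epsilon> l y = - 1" "\<forall>y\<in>B. \<epsilon> l y = - (- 1)" using l pq(2) by (auto simp: \<epsilon>_def)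
        then show ?thesis by blast
      qed
    qed
    obtain s where s: "s \<in> {1, -1}" "\<forall>y\<in>A. \<epsilon> i y = s" "\<forall>y\<in>B. \<epsilon> i y = - s"
      using *[OF i1(1) ij(1)] N(1) by blast
    obtain t where t: "t \<in> {1, -1}" "\<forall>y\<in>A. \<epsilon> j y = t" "\<forall>y\<in>B. \<epsilon> j y = - t"
      using *[OF i1(2) ij(2)] N(1) by blast
    have "\<forall>y\<in>\<Omega> \<inter> N. \<epsilon> i y * \<epsilon> j y = s * t" unfolding N(6) using s t by auto
    moreover have "s * t \<in> {1, -1}" using s(1) t(1) by auto
    ultimately show ?thesis using N(1-3) by blast
  qed
  \<comment> \<open>The locally constant extension of \<epsilon>_i \<epsilon>_j to the points of
    \<open>S\<close> in \<open>V i\<close> and \<open>V j\<close>, unique because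
    \<open>\<Omega>\<close> is dense in \<open>S\<close>.\<close>
  define g where "g i j x = (if \<exists>N. open N \<and> x \<in> N \<and> (\<forall>y\<in>\<Omega> \<inter> N. \<epsilon> i y * \<epsilon> j y = 1) then 1 else -1 :: real)" for i j x
  have gI: "g i j x = s" if a: "x \<in> S" "open N" "x \<in> N" "s \<in> {1, -1}" "\<forall>y\<in>\<Omega> \<inter> N. \<epsilon> i y * \<epsilon> j y = s" for i j x N s
  proof (cases "s = 1")
    case True
    then show ?thesis using that by (auto simp: g_def)
  next
    case False
    have "\<not> (\<exists>N. open N \<and> x \<in> N \<and> (\<forall>y\<in>\<Omega> \<inter> N. \<epsilon> i y * \<epsilon> j y = 1))"
    proof
      assume "\<exists>N. open N \<and> x \<in> N \<and> (\<forall>y\<in>\<Omega> \<inter> N. \<epsilon> i y * \<epsilon> j y = 1)"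
      then obtain N' where N': "open N'" "x \<in> N'" "\<forall>y\<in>\<Omega> \<inter> N'. \<epsilon> i y * \<epsilon> j y = 1" by blast
      obtain y where "y \<in> \<Omega> \<inter> (N \<inter> N')" using dense[OF a(1), of "N \<inter> N'"] a N' by auto
      then show False using a(5) N'(3) False by auto
    qed
    then show ?thesis using False that(4) by (auto simp: g_def)
  qed
  have gN: "\<exists>N s. open N \<and> x \<in> N \<and> N \<subseteq> V i \<inter> V j \<and> s \<in> {1, -1} \<and> (\<forall>y\<in>\<Omega> \<inter> N. \<epsilon> i y * \<epsilon> j y = s) \<and>
      (\<forall>x'\<in>S \<inter> N. g i j x' = s)"
    if a: "x \<in> S" "x \<in> V i" "x \<in> V j" "i \<le> k" "j \<le> k" for x i j
  proof -
    obtain N s where N: "open N" "x \<in> N" "N \<subseteq> V i \<inter> V j" "s \<in> {1, -1}" "\<forall>y\<in>\<Omega> \<inter> N. \<epsilon> i y * \<epsilon> j y = s"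
      using LC[OF a] by blast
    then have "g i j x' = s" if "x' \<in> S \<inter> N" for x' using gI[of x' N s i j] that by blast
    then show ?thesis using N by blast
  qed
  have g1: "g i i x = 1" "g i j x \<in> {1, -1}" for i j x by (auto simp: g_def \<epsilon>2)
  have gm: "g i j x * g j l x = g i l x"
    if x: "x \<in> S" "x \<in> V i" "x \<in> V j" "x \<in> V l" and le: "i \<le> k" "j \<le> k" "l \<le> k" for i j l x
  proof -
    obtain N1 s1 where 1: "open N1" "x \<in> N1" "\<forall>y\<in>\<Omega> \<inter> N1. \<epsilon> i y * \<epsilon> j y = s1" "g i j x = s1"
      using gN[OF x(1,2,3) le(1,2)] x(1) by blast
    obtain N2 s2 where 2: "open N2" "x \<in> N2" "\<forall>y\<in>\<Omega> \<inter> N2. \<epsilon> j y * \<epsilon> l y = s2" "g j l x = s2"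
      using gN[OF x(1,3,4) le(2,3)] x(1) by blast
    obtain N3 s3 where 3: "open N3" "x \<in> N3" "\<forall>y\<in>\<Omega> \<inter> N3. \<epsilon> i y * \<epsilon> l y = s3" "g i l x = s3"
      using gN[OF x(1,2,4) le(1,3)] x(1) by blast
    obtain y where y: "y \<in> \<Omega> \<inter> (N1 \<inter> N2 \<inter> N3)"
      using dense[OF x(1), of "N1 \<inter> N2 \<inter> N3"] 1 2 3 by auto
    have "s1 * s2 = (\<epsilon> i y * \<epsilon> j y) * (\<epsilon> j y * \<epsilon> l y)" using y 1 2 by auto
    also have "\<dots> = \<epsilon> i y * (\<epsilon> j y * \<epsilon> j y) * \<epsilon> l y" by (simp only: mult.assoc)
    also have "\<dots> = s3" using y 3 \<epsilon>2 by auto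
    finally show ?thesis using 1 2 3 by simp
  qed
  have g\<Omega>: "g i j y = \<epsilon> i y * \<epsilon> j y" if "y \<in> \<Omega>" "y \<in> V i" "y \<in> V j" "i \<le> k" "j \<le> k" for i j y
  proof -
    have "y \<in> S" using that \<Omega>S by auto
    from gN[OF this that(2-5)] obtain N s where "y \<in> N" "\<forall>y\<in>\<Omega> \<inter> N. \<epsilon> i y * \<epsilon> j y = s" "\<forall>x'\<in>S \<inter> N. g i j x' = s"
      by blast
    then show ?thesis using that(1) \<open>y \<in> S\<close> by auto
  qed
  \<comment> \<open>The point \<open>z0\<close> outside \<open>S\<close> keeps the set nonempty,
    since \<open>infdist\<close> to the empty set is 0; this matters when \<open>V i\<close> is the
    whole space.\<close>
  define \<rho> where "\<rho> i x = infdist x (insert z0 (- V i))" for i x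
  have \<rho>0: "\<rho> i x = 0" if "x \<notin> V i" for i x using that by (simp add: \<rho>_def)
  have \<rho>p: "\<rho> i x > 0" if "x \<in> V i" "x \<in> S" "i \<le> k" for i x
    unfolding \<rho>_def using that S(4) oV[OF that(3)]
    by (intro infdist_pos_not_in_closed) (auto simp: closed_Compl)
  have c\<rho>: "continuous_on X (\<rho> i)" for i X unfolding \<rho>_def by (intro continuous_intros)
  \<comment> \<open>The weighted vector of all transition signs seen from index i. By the cocycle
    relation, changing i multiplies it by a single sign. The weight \<open>\<rho> j\<close> vanishes
    off \<open>V j\<close>, where \<open>g i j\<close> is not controlled, and so makes the vector
    continuous.\<close>
  define w where "w i x = coord_vec k (\<lambda>j. \<rho> j x * g i j x)" for i x
  have cw: "continuous_on (S \<inter> V i) (w i)" if i: "i \<le> k" for i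
    unfolding w_def
  proof (rule continuous_on_coord_vec)
    fix j assume j: "j \<le> k"
    show "continuous_on (S \<inter> V i) (\<lambda>x. \<rho> j x * g i j x)"
      unfolding continuous_on_eq_continuous_within
    proof
      fix x assume x: "x \<in> S \<inter> V i"
      have lim: "(\<rho> j \<longlongrightarrow> \<rho> j x) (at x within S \<inter> V i)"
        using c\<rho>[of "S \<inter> V i" j] x by (auto simp: continuous_on_def)
      show "continuous (at x within S \<inter> V i) (\<lambda>x. \<rho> j x * g i j x)"
      proof (cases "x \<in> V j")
        case True
        obtain N s where N: "open N" "x \<in> N" "\<forall>x'\<in>S \<inter> N. g i j x' = s"
          using gN[of x i j] x True i j by blast
        have "eventually (\<lambda>y. y \<in> N \<inter> (S \<inter> V i)) (at x within S \<inter> V i)"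
          using N(1,2) by (auto simp: eventually_at_topological)
        then have ev: "eventually (\<lambda>y. \<rho> j y * s = \<rho> j y * g i j y) (at x within S \<inter> V i)"
          by eventually_elim (use N(3) in auto)
        have "((\<lambda>y. \<rho> j y * s) \<longlongrightarrow> \<rho> j x * s) (at x within S \<inter> V i)"
          using lim by (intro tendsto_intros)
        then have "((\<lambda>y. \<rho> j y * g i j y) \<longlongrightarrow> \<rho> j x * s) (at x within S \<inter> V i)"
          using ev by (rule Lim_transform_eventually)
        moreover have "g i j x = s" using N x by auto
        ultimately show ?thesis by (simp add: continuous_within)
      next
        case False
        have "((\<lambda>y. \<rho> j y * g i j y) \<longlongrightarrow> 0) (at x within S \<inter> V i)"
        proof (rule Lim_null_comparison)
          have "\<bar>g i j y\<bar> = 1" for y using g1(2)[of i j y] by auto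
          then have "norm (\<rho> j y * g i j y) \<le> \<rho> j y" for y
            by (simp add: abs_mult \<rho>_def infdist_nonneg)
          then show "\<forall>\<^sub>F y in at x within S \<inter> V i. norm (\<rho> j y * g i j y) \<le> \<rho> j y" by simp
          show "(\<rho> j \<longlongrightarrow> 0) (at x within S \<inter> V i)" using lim \<rho>0[OF False] by simp
        qed
        then show ?thesis by (simp add: continuous_within \<rho>0[OF False])
      qed
    qed
  qed
  have wi: "apply_bcontfun (w i x) i = \<rho> i x" if "i \<le> k" for i x using that g1 by (simp add: w_def)
  have wj: "w j x = g j i x *\<^sub>R w i x" if x: "x \<in> S" "x \<in> V i" "x \<in> V j" and ij: "i \<le> k" "j \<le> k" for i j x
  proof (rule bcontfun_eqI)
    fix l
    show "apply_bcontfun (w j x) l = apply_bcontfun (g j i x *\<^sub>R w i x) l"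
      using gm[OF x(1,3,2) _ ij(2,1), of l] \<rho>0[of x l] by (cases "x \<in> V l") (auto simp: w_def)
  qed
  \<comment> \<open>The double covering: the fibre over x consists of w and -w, for any index i with
    x in \<open>V i\<close>.\<close>
  define C where "C = {(x, s *\<^sub>R w i x) | x s i. x \<in> S \<inter> V i \<and> i \<le> k \<and> s \<in> {1, -1::real}}"
  have cover: "\<exists>i\<le>k. x \<in> V i" if "x \<in> S" for x
  proof (cases "x \<in> M")
    case True
    then obtain i where "i \<in> {1..k}" "x \<in> U i" using U(2) by blast
    then show ?thesis by (intro exI[of _ i]) (auto simp: V_def)
  qed (auto simp: V_def intro: exI[of _ 0])
  have fibre: "\<exists>s\<in>{1, -1}. v = s *\<^sub>R w i x" if a: "(x, v) \<in> C" "x \<in> V i" "i \<le> k" for x v i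
  proof -
    obtain s j where j: "x \<in> S" "x \<in> V j" "j \<le> k" "s \<in> {1, -1}" "v = s *\<^sub>R w j x"
      using a(1) unfolding C_def by blast
    then have "v = (s * g j i x) *\<^sub>R w i x" using wj[of x i j] a by simp
    moreover have "s * g j i x \<in> {1, -1}" using j(4) g1(2)[of j i x] by auto
    ultimately show ?thesis by blast
  qed
  have cov: "covering_space C fst S"
  proof (rule covering_spaceI)
    show "continuous_on C fst" by (intro continuous_intros)
    show "fst ` C = S"
    proof (intro equalityI subsetI)
      fix x assume x: "x \<in> S"
      obtain i where "i \<le> k" "x \<in> V i" using cover[OF x] by auto
      then have "(x, 1 *\<^sub>R w i x) \<in> C" using x unfolding C_def by blast
      then show "x \<in> fst ` C" by (metis fst_conv image_eqI)
    qed (auto simp: C_def)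
    fix x assume x: "x \<in> S"
    obtain i where i: "i \<le> k" "x \<in> V i" using cover[OF x] by auto
    define T where "T = S \<inter> V i"
    define A where "A s = (\<lambda>x. (x, s *\<^sub>R w i x)) ` T" for s :: real
    \<comment> \<open>The sheets over \<open>V i\<close> are told apart by the sign of coordinate i,
      which is plus or minus \<rho>_i and nonzero there; so both are open.\<close>
    have Aeq: "A s = C \<inter> {z. fst z \<in> V i \<and> s * apply_bcontfun (snd z) i > 0}" if s: "s \<in> {1, -1}" for s
    proof (intro equalityI subsetI)
      fix z assume "z \<in> A s"
      then obtain y where y: "y \<in> S" "y \<in> V i" "z = (y, s *\<^sub>R w i y)" by (auto simp: A_def T_def)
      then show "z \<in> C \<inter> {z. fst z \<in> V i \<and> s * apply_bcontfun (snd z) i > 0}"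
        using s i(1) \<rho>p[of y i] wi[OF i(1), of y] unfolding C_def by auto
    next
      fix z assume z: "z \<in> C \<inter> {z. fst z \<in> V i \<and> s * apply_bcontfun (snd z) i > 0}"
      then obtain y v where yv: "z = (y, v)" "(y, v) \<in> C" "y \<in> V i" "s * apply_bcontfun v i > 0" by (cases z) auto
      obtain t where t: "t \<in> {1, -1}" "v = t *\<^sub>R w i y" using fibre[OF yv(2,3) i(1)] by blast
      have yS: "y \<in> S" using yv(2) by (auto simp: C_def)
      have "s * t * \<rho> i y > 0" using yv(4) t(2) wi[OF i(1), of y] by simp
      then have "s = t" using s t(1) \<rho>p[OF yv(3) yS i(1)] by auto
      then show "z \<in> A s" using yv t yS by (auto simp: A_def T_def)
    qed
    show "\<exists>T. x \<in> T \<and> openin (top_of_set S) T \<and>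
        (\<exists>v. \<Union>v = C \<inter> fst -` T \<and> (\<forall>u\<in>v. openin (top_of_set C) u) \<and> pairwise disjnt v \<and> (\<forall>u\<in>v. \<exists>q. homeomorphism u T fst q))"
    proof (intro exI[of _ T] conjI exI[of _ "{A 1, A (-1)}"])
      show "x \<in> T" using x i by (simp add: T_def)
      show "openin (top_of_set S) T" using oV[OF i(1)] by (auto simp: T_def openin_open)
      show "\<Union>{A 1, A (-1)} = C \<inter> fst -` T"
      proof (intro equalityI subsetI)
        fix z assume z: "z \<in> C \<inter> fst -` T"
        then have "(fst z, snd z) \<in> C" "fst z \<in> V i" by (auto simp: T_def)
        then obtain s where "s \<in> {1, -1}" "snd z = s *\<^sub>R w i (fst z)"
          using fibre[OF _ _ i(1)] by blast
        then show "z \<in> \<Union>{A 1, A (-1)}" using z by (cases z) (auto simp: A_def)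
      next
        fix z assume "z \<in> \<Union>{A 1, A (-1)}"
        then obtain s :: real where s: "s \<in> {1, -1}" "z \<in> A s" by auto
        then have "z \<in> C" using Aeq by blast
        then show "z \<in> C \<inter> fst -` T" using s(2) by (auto simp: A_def)
      qed
      have "open {z :: 'a \<times> (nat \<Rightarrow>\<^sub>C real). fst z \<in> V i \<and> s * apply_bcontfun (snd z) i > 0}" for s :: real
      proof -
        have "{z :: 'a \<times> (nat \<Rightarrow>\<^sub>C real). fst z \<in> V i \<and> s * apply_bcontfun (snd z) i > 0} =
          fst -` V i \<inter> {z. s * apply_bcontfun (snd z) i > 0}" by auto
        moreover have "continuous_on UNIV (\<lambda>z :: 'a \<times> (nat \<Rightarrow>\<^sub>C real). apply_bcontfun (snd z) i)"
          by (rule continuous_on_compose2[OF continuous_on_bcontfun_eval[of UNIV] continuous_on_snd[OF continuous_on_id]]) simp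
        ultimately show ?thesis
          using oV[OF i(1)] by (auto intro!: open_Int open_vimage open_Collect_less continuous_intros)
      qed
      then have "openin (top_of_set C) (A s)" if "s \<in> {1, -1}" for s
        unfolding Aeq[OF that] by (rule openin_open_Int)
      then show "\<forall>u\<in>{A 1, A (-1)}. openin (top_of_set C) u" by auto
      have "A 1 \<inter> A (-1) = {}" using Aeq by auto
      then show "pairwise disjnt {A 1, A (-1)}" by (auto simp: pairwise_def disjnt_def)
      have "homeomorphism (A s) T fst (\<lambda>x. (x, s *\<^sub>R w i x))" for s
        unfolding homeomorphism_def A_def using cw[OF i(1)]
        by (auto simp: image_image T_def intro!: continuous_intros)
      then show "\<forall>u\<in>{A 1, A (-1)}. \<exists>q. homeomorphism u T fst q" by blast
    qed
  qed
  \<comment> \<open>Simple connectedness of \<open>S\<close> gives a global section of the covering,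
    by lifting the identity.\<close>
  obtain h where h: "continuous_on S h" "h \<in> S \<rightarrow> C" "\<And>y. y \<in> S \<Longrightarrow> fst (h y) = y"
    using covering_space_lift[OF cov S(1,2) continuous_on_id] by auto
  define e where "e i x = apply_bcontfun (snd (h x)) i" for i x
  have ce: "continuous_on S (e i)" for i
    unfolding e_def
    by (rule continuous_on_compose2[OF continuous_on_bcontfun_eval[of UNIV] continuous_on_snd[OF h(1)]]) simp
  have hx: "\<exists>s\<in>{1, -1}. snd (h x) = s *\<^sub>R w i x" if "x \<in> S" "x \<in> V i" "i \<le> k" for x i
    using fibre[of x "snd (h x)" i] h(2,3) that by (metis Pi_mem prod.collapse)
  have \<Omega>V: "\<Omega> \<subseteq> S \<inter> V 0" using \<Omega>S M by (auto simp: V_def)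
  have val: "\<exists>s\<in>{1, -1}. snd (h x) = s *\<^sub>R w 0 x \<and> e 0 x = s * \<rho> 0 x \<and> \<rho> 0 x > 0" if "x \<in> \<Omega>" for x
  proof -
    have x: "x \<in> S" "x \<in> V 0" using that \<Omega>V by blast+
    show ?thesis using hx[OF x] \<rho>p[OF x(2,1)] wi[of 0 x] by (auto simp: e_def)
  qed
  have e0: "e 0 x \<noteq> 0" if "x \<in> \<Omega>" for x using val[OF that] by auto
  \<comment> \<open>Over the connected set \<open>\<Omega>\<close> the section is a constant sign
    times \<open>w 0\<close>, because its coordinate 0 never vanishes.\<close>
  have "\<exists>s\<in>{1, -1}. \<forall>x\<in>\<Omega>. snd (h x) = s *\<^sub>R w 0 x"
  proof -
    have conn: "connected (e 0 ` \<Omega>)" using ce[of 0] \<Omega>S \<Omega>(2) by (intro connected_continuous_image) (auto intro: continuous_on_subset)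
    have sgn: "(\<forall>x\<in>\<Omega>. e 0 x > 0) \<or> (\<forall>x\<in>\<Omega>. e 0 x < 0)"
    proof (rule ccontr)
      assume "\<not> ?thesis"
      then obtain a b where ab: "a \<in> \<Omega>" "b \<in> \<Omega>" "e 0 a \<le> 0" "0 \<le> e 0 b" by (meson linorder_not_less)
      then have "0 \<in> e 0 ` \<Omega>" using connectedD_interval[OF conn, of "e 0 a" "e 0 b" 0] by blast
      then show False using e0 by auto
    qed
    from sgn show ?thesis
    proof
      assume *: "\<forall>x\<in>\<Omega>. e 0 x > 0"
      have "snd (h x) = 1 *\<^sub>R w 0 x" if "x \<in> \<Omega>" for x using val[OF that] *[rule_format, OF that] by auto
      then show ?thesis by blast
    next
      assume *: "\<forall>x\<in>\<Omega>. e 0 x < 0"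
      have "snd (h x) = (-1) *\<^sub>R w 0 x" if "x \<in> \<Omega>" for x using val[OF that] *[rule_format, OF that] by auto
      then show ?thesis by blast
    qed
  qed
  then obtain s0 where s0: "s0 \<in> {1, -1}" "\<And>x. x \<in> \<Omega> \<Longrightarrow> snd (h x) = s0 *\<^sub>R w 0 x" by blast
  obtain p where p: "p \<in> M" using M(2) by blast
  then obtain i where "i \<in> {1..k}" "p \<in> U i" using U(2) by blast
  then have i: "1 \<le> i" "i \<le> k" "p \<in> U i" by auto
  have pV: "p \<in> V i" "p \<in> S" using i p M by (auto simp: V_def)
  have ep: "e i p \<noteq> 0" using hx[OF pV(2,1) i(2)] \<rho>p[OF pV i(2)] wi[OF i(2)] by (auto simp: e_def)
  \<comment> \<open>On \<open>\<Omega>\<close>, coordinate i of the section is s0 \<rho>_i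
    \<epsilon>_i, with opposite signs on the two sides of M, although it is continuous and nonzero
    at p.\<close>
  have eval: "e i y = s0 * \<rho> i y * \<epsilon> i y" if "y \<in> \<Omega>" "y \<in> V i" for y
    using s0(2)[OF that(1)] g\<Omega>[of y 0 i] that i \<Omega>V by (auto simp: e_def w_def \<epsilon>_def)
  have eU: "\<exists>N. open N \<and> p \<in> N \<and> (\<forall>y\<in>S \<inter> N. e i y * e i p > 0)"
  proof -
    have "openin (top_of_set S) (S \<inter> (\<lambda>y. e i y * e i p) -` {0<..})"
      by (intro continuous_openin_preimage_gen continuous_intros ce)
    then obtain N where "open N" "S \<inter> (\<lambda>y. e i y * e i p) -` {0<..} = S \<inter> N" by (auto simp: openin_open)
    moreover have "e i p * e i p > 0" using ep by (metis not_real_square_gt_zero)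
    ultimately show ?thesis using pV(2) by (intro exI[of _ N]) auto
  qed
  then obtain N where N: "open N" "p \<in> N" "\<And>y. y \<in> S \<Longrightarrow> y \<in> N \<Longrightarrow> e i y * e i p > 0" by blast
  have "P i \<inter> N \<noteq> {}" "Q i \<inter> N \<noteq> {}"
    using cl[OF i(1,2), of p] p i(3) N(1,2) by (auto simp: closure_iff_nhds_not_empty)
  then obtain a b where ab: "a \<in> P i" "a \<in> N" "b \<in> Q i" "b \<in> N" by blast
  have a\<Omega>: "a \<in> \<Omega>" "a \<in> V i" "b \<in> \<Omega>" "b \<in> V i" using ab PQ[OF i(1,2)] i by (auto simp: V_def)
  have "\<epsilon> i a = 1" "\<epsilon> i b = -1" using ab PQ[OF i(1,2)] i by (auto simp: \<epsilon>_def)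
  then have "e i a = s0 * \<rho> i a" "e i b = - (s0 * \<rho> i b)" using eval a\<Omega> by auto
  moreover have "\<rho> i a > 0" "\<rho> i b > 0" using \<rho>p a\<Omega> \<Omega>S i by auto
  moreover have "e i a * e i p > 0" "e i b * e i p > 0" using N(3) ab a\<Omega> \<Omega>S by auto
  ultimately show False using s0(1) by (auto simp: zero_less_mult_iff mult_less_0_iff)
qed

section \<open>Topology of the space forms, sides of a tube, and normal directions\<close>

lemma closed_space_form: "closed (space_form K :: (real \<times> 'v::euclidean_space) set)"
proof -
  have "space_form K = {p :: real \<times> 'v. (fst p)\<^sup>2 + K * (snd p \<bullet> snd p) = 1} \<inter> {p. K \<le> 0 \<longrightarrow> fst p \<ge> 0}"
  proof (intro set_eqI iffI)
    fix p :: "real \<times> 'v" assume p: "p \<in> {p. (fst p)\<^sup>2 + K * (snd p \<bullet> snd p) = 1} \<inter> {p. K \<le> 0 \<longrightarrow> fst p \<ge> 0}"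
    \<comment> \<open>For K \<le> 0 the equation forces (fst p)^2 \<ge> 1, so the strict inequality
      can be replaced by a closed condition.\<close>
    have "fst p > 0" if "K \<le> 0"
    proof -
      have "K * (snd p \<bullet> snd p) \<le> 0" using that by (simp add: mult_nonpos_nonneg)
      then have "(fst p)\<^sup>2 \<noteq> 0" using p by auto
      then show ?thesis using p that by auto
    qed
    then show "p \<in> space_form K" using p by (simp add: space_form_iff)
  qed (auto simp: space_form_iff)
  moreover have "closed {p :: real \<times> 'v. (fst p)\<^sup>2 + K * (snd p \<bullet> snd p) = 1}"
    by (intro closed_Collect_eq continuous_intros)
  moreover have "closed {p :: real \<times> 'v. K \<le> 0 \<longrightarrow> fst p \<ge> 0}"
    by (cases "K \<le> 0") (auto intro!: closed_Collect_le continuous_intros)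
  ultimately show ?thesis by (simp add: closed_Int)
qed

lemma space_form_1: "space_form 1 = (sphere 0 1 :: (real \<times> 'v::euclidean_space) set)"
  by (auto simp: space_form_def norm_Pair)

lemma space_form_nonpos:
  "K \<le> 0 \<Longrightarrow> space_form K = range (\<lambda>x :: 'v::euclidean_space. (sqrt (1 - K * (x \<bullet> x)), x))"
proof (intro set_eqI iffI)
  fix p :: "real \<times> 'v" assume K: "K \<le> 0" and p: "p \<in> space_form K"
  then have "(fst p)\<^sup>2 = 1 - K * (snd p \<bullet> snd p)" "fst p > 0" by (auto simp: space_form_iff)
  then have "fst p = sqrt (1 - K * (snd p \<bullet> snd p))" by (metis less_imp_le real_sqrt_abs abs_of_nonneg)
  then have "p = (sqrt (1 - K * (snd p \<bullet> snd p)), snd p)" by (simp add: prod_eq_iff)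
  then show "p \<in> range (\<lambda>x. (sqrt (1 - K * (x \<bullet> x)), x))" by (rule range_eqI)
next
  fix p :: "real \<times> 'v" assume K: "K \<le> 0" and p: "p \<in> range (\<lambda>x :: 'v. (sqrt (1 - K * (x \<bullet> x)), x))"
  then obtain x where x: "p = (sqrt (1 - K * (x \<bullet> x)), x)" by auto
  have "K * (x \<bullet> x) \<le> 0" using K by (simp add: mult_nonpos_nonneg)
  then show "p \<in> space_form K" by (simp add: x space_form_iff)
qed

lemma connected_space_form:
  assumes "K \<in> {-1, 0, 1}"
  shows "connected (space_form K :: (real \<times> (real^('m::finite))) set)"
proof (cases "K \<le> 0")
  case True
  show ?thesis unfolding space_form_nonpos[OF True]
    by (intro connected_continuous_image continuous_intros connected_UNIV)
next
  case False
  then have "K = 1" using assms by auto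
  then show ?thesis by (simp add: space_form_1 connected_sphere)
qed

text \<open>Reversing the normal exchanges the sides, so that statements need a proof for one side
  only.\<close>

lemma tube_flip:
  assumes "tube K M \<phi> W m U P Q"
  shows "tube K M \<phi> W (\<lambda>u. - m u) U Q P"
proof -
  have neg: "- X \<in> sf_tangent K p" if "X \<in> sf_tangent K p" for X p
    using sf_tangent_scaleR[OF that, of "-1"] by simp
  have "(\<lambda>u. - m u) differentiable (at u) \<and> - m u \<in> sf_tangent K (\<phi> u) \<and> metric_K K (- m u) (- m u) = 1 \<and>
      (\<forall>h. metric_K K (- m u) (frechet_derivative \<phi> (at u) h) = 0) \<and>
      (\<exists>\<epsilon>>0. \<forall>t. 0 < t \<and> t < \<epsilon> \<longrightarrow> geodesic K (\<phi> u) (- m u) t \<in> Q \<and> geodesic K (\<phi> u) (- m u) (- t) \<in> P)"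
    if u: "u \<in> W" for u
  proof -
    have m: "m differentiable (at u)" "m u \<in> sf_tangent K (\<phi> u)" "metric_K K (m u) (m u) = 1"
      "\<forall>h. metric_K K (m u) (frechet_derivative \<phi> (at u) h) = 0"
      "\<exists>\<epsilon>>0. \<forall>t. 0 < t \<and> t < \<epsilon> \<longrightarrow> geodesic K (\<phi> u) (m u) t \<in> P \<and> geodesic K (\<phi> u) (m u) (- t) \<in> Q"
      using assms u unfolding tube_def by blast+
    have g: "geodesic K (\<phi> u) (- m u) t = geodesic K (\<phi> u) (m u) (- t)"
      "geodesic K (\<phi> u) (- m u) (- t) = geodesic K (\<phi> u) (m u) t" for t
      by (simp_all add: geodesic_def)
    show ?thesis unfolding g using m(1,3,4,5) neg[OF m(2)] by (simp add: metric_K_bilinear) blast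
  qed
  then show ?thesis
    using assms unfolding tube_def by (simp add: Un_commute Un_left_commute Int_commute[of Q P])
qed

lemma tube_closure:
  assumes \<tau>: "tube K M \<phi> W m U P Q" and u: "u \<in> W"
  shows "\<phi> u \<in> closure P" "\<phi> u \<in> closure Q"
proof -
  have *: "\<phi> u \<in> closure P" if \<tau>: "tube K M \<phi> W m U P Q" for m P Q
  proof (subst closure_iff_nhds_not_empty, intro allI impI)
    fix A V assume V: "V \<subseteq> A" "open V" "\<phi> u \<in> V"
    obtain e where e: "e > 0" "\<And>t. 0 < t \<Longrightarrow> t < e \<Longrightarrow> geodesic K (\<phi> u) (m u) t \<in> P"
      using \<tau> u unfolding tube_def by blast
    have "open (geodesic K (\<phi> u) (m u) -` V)" by (intro open_vimage V continuous_on_geodesic)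
    moreover have "0 \<in> geodesic K (\<phi> u) (m u) -` V" using V by simp
    ultimately obtain d where d: "d > 0" "ball 0 d \<subseteq> geodesic K (\<phi> u) (m u) -` V" by (meson open_contains_ball)
    define t where "t = min e d / 2"
    have "t > 0" "t < e" "t \<in> ball 0 d" using e d by (auto simp: t_def min_def)
    then show "P \<inter> A \<noteq> {}" using e(2) d(2) V(1) by blast
  qed
  show "\<phi> u \<in> closure P" by (rule *[OF \<tau>])
  show "\<phi> u \<in> closure Q" by (rule *[OF tube_flip[OF \<tau>]])
qed

text \<open>A dimension count: a chart of the space form identifies its tangent space with
  \<open>real^('n option)\<close>, and (h, b) \<mapsto> D h + b m is injective because
  \<open>m\<close> is orthogonal to the range of \<open>D\<close>.\<close>

lemma sf_tangent_decomp:
  fixes \<phi> :: "real^'n::finite \<Rightarrow> real \<times> (real^('n option))"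
  assumes K: "K \<in> {-1, 0, 1}" and p: "p \<in> space_form K"
    and D: "linear D" "inj D" "range D \<subseteq> sf_tangent K p"
    and m: "m \<in> sf_tangent K p" "metric_K K m m = 1" "\<And>h. metric_K K m (D h) = 0"
    and w: "w \<in> sf_tangent K p"
  shows "\<exists>(h :: real^'n) b. w = D h + b *\<^sub>R (m :: real \<times> (real^('n option)))"
proof -
  obtain \<sigma> where ok: "ster_ok K \<sigma>" "1 + \<sigma> * fst p > 0" using ex_ster_chart[OF K p] by blast
  define X0 where "X0 = (ster K \<sigma> :: real^('n option) \<Rightarrow> _)"
  note lp = local_parametrization_ster[OF ok(1), where 'm = "'n option", folded X0_def]
  define y where "y = ster_inv \<sigma> p"
  have y: "y \<in> ster_dom K" "X0 y = p" using ster_image(3)[OF ok(1) p ok(2)] by (auto simp: y_def X0_def)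
  obtain l where l: "linear l" "\<And>v. l (frechet_derivative X0 (at y) v) = v"
    using chart_inv_has_derivative[OF lp y(1)] by metis
  have T: "sf_tangent K p = range (frechet_derivative X0 (at y))"
    using tangent_space_chart[OF lp y(1)] tangent_space_space_form[OF K p] y(2) by simp
  have l0: "frechet_derivative X0 (at y) (l X) = X" if "X \<in> sf_tangent K p" for X
    using that l(2) unfolding T by auto
  define B where "B z = l (D (tail_vec z) + z $ None *\<^sub>R m)" for z :: "real^('n option)"
  have lt: "linear tail_vec" using bounded_linear_tail_vec by (simp add: linear_conv_bounded_linear)
  have linB: "linear B"
    unfolding B_def linear_iff using l(1) D(1) lt
    by (simp add: linear_add[OF lt] linear_cmul[OF lt] linear_add[OF l(1)] linear_cmul[OF l(1)]
        linear_add[OF D(1)] linear_cmul[OF D(1)] algebra_simps)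
  have X: "D (tail_vec z) + z $ None *\<^sub>R m \<in> sf_tangent K p" for z
    using D(3) m(1) by (auto intro!: sf_tangent_add sf_tangent_scaleR)
  have "z = 0" if "B z = 0" for z
  proof -
    have "D (tail_vec z) + z $ None *\<^sub>R m = 0"
      using l0[OF X[of z]] that linear_0[OF has_derivative_linear[OF local_parametrizationD(7)[OF lp y(1)]]]
      by (simp add: B_def)
    moreover then have "metric_K K m (D (tail_vec z) + z $ None *\<^sub>R m) = 0" by (simp add: metric_K_bilinear)
    then have "z $ None = 0" by (simp add: metric_K_bilinear m)
    ultimately have "D (tail_vec z) = 0" by simp
    then have "tail_vec z = 0" using D linear_injective_0 by blast
    then show "z = 0" using \<open>z $ None = 0\<close>
      by (metis (full_types) cons_tail_vec linear_0[OF linear_cons_vec] case_prod_conv zero_prod_def)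
  qed
  then have "inj B" using linear_injective_0[OF linB] by blast
  then have "surj B" using linear_injective_imp_surjective[OF linB] by blast
  then obtain z where "l w = B z" unfolding surj_def by blast
  then have "frechet_derivative X0 (at y) (l w) = frechet_derivative X0 (at y) (l (D (tail_vec z) + z $ None *\<^sub>R m))"
    by (simp only: B_def)
  then have "w = D (tail_vec z) + z $ None *\<^sub>R m" unfolding l0[OF w] l0[OF X[of z]] .
  then show ?thesis by blast
qed

section \<open>Bounded domains with smooth boundary\<close>

locale bounded_domain =
  fixes K :: real and \<Omega> M :: "(real \<times> (real^('n::finite option))) set"
  assumes K: "K \<in> {-1, 0, 1}"
    and domain: "openin (top_of_set (space_form K)) \<Omega>" "connected \<Omega>" "bounded \<Omega>"
    and boundary: "M = (top_of_set (space_form K)) frontier_of \<Omega>"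
    and hypersurface: "smooth_submanifold TYPE('n) M" "compact M" "connected M" "M \<noteq> {}"
begin

lemma M_eq: "M = space_form K \<inter> closure \<Omega> - \<Omega>"
proof -
  have "(top_of_set (space_form K)) closure_of \<Omega> = space_form K \<inter> closure \<Omega>"
    using openin_imp_subset[OF domain(1)] by (simp add: closure_of_subtopology Int_absorb1)
  then show ?thesis
    unfolding boundary frontier_of_def using domain(1) by (simp add: interior_of_openin)
qed

lemma \<Omega>_subset: "\<Omega> \<subseteq> space_form K"
  using openin_imp_subset[OF domain(1)] .

lemma M_subset: "M \<subseteq> space_form K" and M_disjoint: "M \<inter> \<Omega> = {}"
  and closure_\<Omega>: "space_form K \<inter> closure \<Omega> = \<Omega> \<union> M"
  using \<Omega>_subset closure_subset[of \<Omega>] by (auto simp: M_eq)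

lemma \<Omega>_nonempty: "\<Omega> \<noteq> {}"
  using hypersurface(4) by (auto simp: M_eq)

text \<open>Outside M the space form is the disjoint union of two relatively open sets, the domain
  and the complement of its closure.\<close>

lemma connected_dichotomy:
  assumes C: "connected C" "C \<subseteq> space_form K" "C \<inter> M = {}"
  shows "C \<subseteq> \<Omega> \<or> C \<inter> \<Omega> = {}"
proof -
  obtain T where T: "open T" "\<Omega> = space_form K \<inter> T" using domain(1) by (auto simp: openin_open)
  have "T \<inter> C = {} \<or> (- closure \<Omega>) \<inter> C = {}"
    using C closure_\<Omega> T closure_subset[of \<Omega>] by (intro connectedD[OF C(1)]) auto
  then show ?thesis using C closure_\<Omega> T by blast
qed

text \<open>The sides are connected and avoid M, so each is inside the domain or disjoint from it.
  Both cannot be disjoint from it, since M lies in its closure.\<close>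

lemma tube_sides:
  assumes \<tau>: "tube K M \<phi> W m U P Q"
  shows "P \<subseteq> space_form K" "Q \<subseteq> space_form K" "P \<subseteq> \<Omega> \<or> P \<inter> \<Omega> = {}" "Q \<subseteq> \<Omega> \<or> Q \<inter> \<Omega> = {}"
    and "u \<in> W \<Longrightarrow> P \<inter> \<Omega> = {} \<Longrightarrow> Q \<subseteq> \<Omega>"
proof -
  show S: "P \<subseteq> space_form K" "Q \<subseteq> space_form K" using \<tau> by (auto simp: tube_def)
  show "P \<subseteq> \<Omega> \<or> P \<inter> \<Omega> = {}"
    using connected_dichotomy[OF _ S(1)] \<tau> by (simp add: tube_def)
  show q: "Q \<subseteq> \<Omega> \<or> Q \<inter> \<Omega> = {}"
    using connected_dichotomy[OF _ S(2)] \<tau> by (simp add: tube_def)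
  assume u: "u \<in> W" and P: "P \<inter> \<Omega> = {}"
  have "\<phi> u \<in> M \<inter> U" using \<tau> u unfolding tube_def by blast
  then have "\<phi> u \<in> closure \<Omega>" "\<phi> u \<in> U" using M_eq by auto
  moreover have "open U" using \<tau> by (simp add: tube_def)
  ultimately have "\<Omega> \<inter> U \<noteq> {}" by (meson closure_iff_nhds_not_empty order_refl)
  moreover have "\<Omega> \<inter> U \<subseteq> P \<union> Q" using \<tau> \<Omega>_subset M_disjoint unfolding tube_def by blast
  ultimately show "Q \<subseteq> \<Omega>" using P q by blast
qed

lemma tube_Int:
  assumes \<tau>: "tube K M \<phi> W m U P Q" and "P \<subseteq> \<Omega>" "Q \<subseteq> \<Omega>"
  shows "\<Omega> \<inter> U = P \<union> Q"
proof -
  have SU: "space_form K \<inter> U = M \<inter> U \<union> P \<union> Q" using \<tau> by (simp add: tube_def)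
  have "\<Omega> \<inter> U = \<Omega> \<inter> (space_form K \<inter> U)" using \<Omega>_subset by auto
  also have "\<dots> = (\<Omega> \<inter> M) \<inter> U \<union> (\<Omega> \<inter> P) \<union> (\<Omega> \<inter> Q)" unfolding SU by auto
  also have "\<dots> = P \<union> Q" using M_disjoint assms(2,3) by (simp add: Int_commute[of \<Omega> M] Int_absorb1)
  finally show ?thesis .
qed

text \<open>The case to be excluded, in which the domain lies on both sides of M near p; not the
  usual two-sidedness of a hypersurface.\<close>

definition two_sided :: "real \<times> (real^('n option)) \<Rightarrow> bool" where
  "two_sided p \<longleftrightarrow> (\<exists>U. open U \<and> p \<in> U \<and> space_form K \<inter> U \<subseteq> \<Omega> \<union> M)"

lemma not_two_sided_tube:
  assumes \<tau>: "tube K M \<phi> W m U P Q" and P: "P \<inter> \<Omega> = {}" and u: "u \<in> W"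
  shows "\<not> two_sided (\<phi> u)"
proof
  assume "two_sided (\<phi> u)"
  then obtain V where V: "open V" "\<phi> u \<in> V" "space_form K \<inter> V \<subseteq> \<Omega> \<union> M" by (auto simp: two_sided_def)
  then have "P \<inter> V \<noteq> {}" using tube_closure(1)[OF \<tau> u] by (meson closure_iff_nhds_not_empty order_refl)
  moreover have "P \<inter> M = {}" using \<tau> by (simp add: tube_def)
  ultimately show False using V(3) P tube_sides(1)[OF \<tau>] by blast
qed

lemma two_sided_tube:
  assumes \<tau>: "tube K M \<phi> W m U P Q" and u: "u \<in> W" "two_sided (\<phi> u)"
  shows "P \<subseteq> \<Omega>" "Q \<subseteq> \<Omega>"
  using tube_sides(3,4)[OF \<tau>] not_two_sided_tube[OF \<tau> _ u(1)] not_two_sided_tube[OF tube_flip[OF \<tau>] _ u(1)] u(2)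
  by blast+

text \<open>Within one tube the alternative does not depend on the point, so both alternatives are
  open conditions on the connected set M.\<close>

lemma two_sided_all_or_none: "(\<forall>p\<in>M. two_sided p) \<or> (\<forall>p\<in>M. \<not> two_sided p)"
proof -
  define A where "A = \<Union>{U. open U \<and> space_form K \<inter> U \<subseteq> \<Omega> \<union> M}"
  define B where "B = \<Union>{U. open U \<and> (\<forall>p\<in>M \<inter> U. \<not> two_sided p)}"
  have "open A" "open B" by (auto simp: A_def B_def)
  have two: "p \<in> A \<longleftrightarrow> two_sided p" for p by (auto simp: A_def two_sided_def)
  have B: "p \<in> B" if p: "p \<in> M" "\<not> two_sided p" for p
  proof -
    obtain \<phi> W m U P Q where \<tau>: "tube K M \<phi> W m U P Q" and pW: "p \<in> \<phi> ` W"
      using ex_tube[OF K hypersurface(1) M_subset p(1) open_UNIV UNIV_I] by blast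
    have U: "open U" "\<phi> ` W = M \<inter> U" "space_form K \<inter> U = \<phi> ` W \<union> P \<union> Q" using \<tau> by (auto simp: tube_def)
    have "\<not> (P \<subseteq> \<Omega> \<and> Q \<subseteq> \<Omega>)"
    proof
      assume "P \<subseteq> \<Omega> \<and> Q \<subseteq> \<Omega>"
      then have "space_form K \<inter> U \<subseteq> \<Omega> \<union> M" unfolding U(3) U(2) by auto
      moreover have "p \<in> U" using pW U(2) by auto
      ultimately show False using p(2) U(1) unfolding two_sided_def by auto
    qed
    then have "P \<inter> \<Omega> = {} \<or> Q \<inter> \<Omega> = {}" using tube_sides(3,4)[OF \<tau>] by blast
    then have "\<forall>u\<in>W. \<not> two_sided (\<phi> u)"
      using not_two_sided_tube[OF \<tau>] not_two_sided_tube[OF tube_flip[OF \<tau>]] by blast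
    then have "\<forall>q\<in>M \<inter> U. \<not> two_sided q" unfolding U(2)[symmetric] by blast
    then show ?thesis using U pW by (auto simp: B_def)
  qed
  have "A \<inter> M = {} \<or> B \<inter> M = {}"
  proof (rule connectedD[OF hypersurface(3) \<open>open A\<close> \<open>open B\<close>])
    show "A \<inter> B \<inter> M = {}" using two by (auto simp: B_def)
    show "M \<subseteq> A \<union> B" using two B by blast
  qed
  then show ?thesis using two B by blast
qed

text \<open>Otherwise the union of the domain and M would be relatively open and closed, hence the
  whole space form. For K \<le> 0 this contradicts boundedness; on the sphere it contradicts
  \<open>no_two_sided_hypersurface\<close>, applied to finitely many tubes that cover M.\<close>

lemma not_all_two_sided: "\<not> (\<forall>p\<in>M. two_sided p)"
proof
  assume all: "\<forall>p\<in>M. two_sided p"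
  have cS: "connected (space_form K :: (real \<times> (real^('n option))) set)" by (rule connected_space_form[OF K])
  have S: "space_form K \<subseteq> closure \<Omega>"
  proof -
    define A where "A = \<Union>{U. open U \<and> space_form K \<inter> U \<subseteq> \<Omega> \<union> M}"
    have "open A" by (auto simp: A_def)
    have "\<Omega> \<subseteq> A" using domain(1) by (fastforce simp: A_def openin_open)
    then have sub: "\<Omega> \<union> M \<subseteq> A" using all by (auto simp: A_def two_sided_def)
    have sA: "space_form K \<inter> A \<subseteq> \<Omega> \<union> M" by (auto simp: A_def)
    have "A \<inter> space_form K = {} \<or> (- closure \<Omega>) \<inter> space_form K = {}"
    proof (rule connectedD[OF cS \<open>open A\<close>])
      show "A \<inter> - closure \<Omega> \<inter> space_form K = {}" using sA closure_\<Omega> by blast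
      show "space_form K \<subseteq> A \<union> - closure \<Omega>" using sub closure_\<Omega> by blast
      show "open (- closure \<Omega>)" by (simp add: open_Compl)
    qed
    then show ?thesis using \<Omega>_nonempty \<Omega>_subset sub by blast
  qed
  then have S_eq: "space_form K = \<Omega> \<union> M" using closure_\<Omega> by blast
  show False
  proof (cases "K \<le> 0")
    case True
    have "bounded (\<Omega> \<union> M)" using domain(3) compact_imp_bounded[OF hypersurface(2)] by simp
    then have "bounded (snd ` (space_form K :: (real \<times> (real^('n option))) set))"
      unfolding S_eq by (rule bounded_snd)
    moreover have "snd ` (space_form K :: (real \<times> (real^('n option))) set) = UNIV"
      unfolding space_form_nonpos[OF True] by (force simp: image_image)
    ultimately show False using not_bounded_UNIV by metis
  next
    case False
    then have K1: "K = 1" using K by auto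
    define tb where "tb p \<tau> \<longleftrightarrow> (case \<tau> of (\<phi>, W, m, U, P, Q) \<Rightarrow> tube K M \<phi> W m U P Q \<and> p \<in> \<phi> ` W)" for p \<tau>
    have "\<forall>p\<in>M. \<exists>\<tau>. tb p \<tau>"
    proof
      fix p assume p: "p \<in> M"
      obtain \<phi> W m U P Q where "tube K M \<phi> W m U P Q" "p \<in> \<phi> ` W"
        using ex_tube[OF K hypersurface(1) M_subset p open_UNIV UNIV_I] by blast
      then have "tb p (\<phi>, W, m, U, P, Q)" by (simp add: tb_def)
      then show "\<exists>\<tau>. tb p \<tau>" by blast
    qed
    then obtain \<tau> where "\<forall>p\<in>M. tb p (\<tau> p)" by metis
    then have \<tau>: "\<And>p. p \<in> M \<Longrightarrow> tb p (\<tau> p)" by blast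
    define UU where "UU p = (case \<tau> p of (\<phi>, W, m, U, P, Q) \<Rightarrow> U)" for p
    define PP where "PP p = (case \<tau> p of (\<phi>, W, m, U, P, Q) \<Rightarrow> P)" for p
    define QQ where "QQ p = (case \<tau> p of (\<phi>, W, m, U, P, Q) \<Rightarrow> Q)" for p
    have dec: "\<exists>\<phi> W m. tube K M \<phi> W m (UU p) (PP p) (QQ p) \<and> p \<in> \<phi> ` W" if "p \<in> M" for p
      using \<tau>[OF that] unfolding tb_def UU_def PP_def QQ_def by (auto split: prod.splits)
    have UU: "open (UU p)" "p \<in> UU p" "\<Omega> \<inter> UU p = PP p \<union> QQ p" "PP p \<inter> QQ p = {}"
      "openin (top_of_set (space_form K)) (PP p)" "openin (top_of_set (space_form K)) (QQ p)"
      "\<And>x. x \<in> M \<inter> UU p \<Longrightarrow> x \<in> closure (PP p) \<and> x \<in> closure (QQ p)" if p: "p \<in> M" for p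
    proof -
      obtain \<phi> W m where t: "tube K M \<phi> W m (UU p) (PP p) (QQ p)" and pW: "p \<in> \<phi> ` W" using dec[OF p] by blast
      show "open (UU p)" "p \<in> UU p" "PP p \<inter> QQ p = {}"
        "openin (top_of_set (space_form K)) (PP p)" "openin (top_of_set (space_form K)) (QQ p)"
        using t pW unfolding tube_def by blast+
      obtain u where u: "u \<in> W" "p = \<phi> u" using pW by blast
      have "PP p \<subseteq> \<Omega>" "QQ p \<subseteq> \<Omega>" using two_sided_tube[OF t u(1)] all p u(2) by auto
      then show "\<Omega> \<inter> UU p = PP p \<union> QQ p" by (rule tube_Int[OF t])
      show "x \<in> closure (PP p) \<and> x \<in> closure (QQ p)" if "x \<in> M \<inter> UU p" for x
      proof -
        have "\<phi> ` W = M \<inter> UU p" using t by (simp add: tube_def)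
        then obtain v where "v \<in> W" "x = \<phi> v" using \<open>x \<in> M \<inter> UU p\<close> by blast
        then show ?thesis using tube_closure[OF t] by auto
      qed
    qed
    have "M \<subseteq> \<Union>(UU ` M)" using UU(2) by blast
    then obtain D where D: "D \<subseteq> M" "finite D" "M \<subseteq> \<Union>(UU ` D)"
      using compactE_image[OF hypersurface(2), of M UU] UU(1) by metis
    obtain b where b: "bij_betw b {1..card D} D" using ex_bij_betw_nat_finite_1[OF D(2)] by blast
    then have bD: "b i \<in> M" if "1 \<le> i" "i \<le> card D" for i using that D(1) by (auto simp: bij_betw_def)
    show False
    proof (rule no_two_sided_hypersurface[of "space_form K" 0 \<Omega> M "card D" "UU \<circ> b" "PP \<circ> b" "QQ \<circ> b"])
      \<comment> \<open>Here n \<ge> 1 enters: the sphere has dimension n + 1 \<ge> 2 and is simply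
        connected.\<close>
      have "3 \<le> DIM(real \<times> (real^('n option)))"
        using finite_UNIV_card_ge_0[where 'a = 'n] by simp
      then show "simply_connected (space_form K :: (real \<times> (real^('n option))) set)"
        unfolding K1 space_form_1 by (rule simply_connected_sphere)
      show "locally path_connected (space_form K :: (real \<times> (real^('n option))) set)"
        unfolding K1 space_form_1 by (rule locally_path_connected_sphere)
      show "closed (space_form K :: (real \<times> (real^('n option))) set)" by (rule closed_space_form)
      show "0 \<notin> space_form K" by (simp add: space_form_iff)
      show "M = space_form K - \<Omega>" using S_eq M_disjoint by blast
      have "M \<subseteq> \<Union>(UU ` (b ` {1..card D}))" using D(3) bij_betw_imp_surj_on[OF b] by simp
      then show "M \<subseteq> (\<Union>i\<in>{1..card D}. (UU \<circ> b) i)" by (simp only: image_image o_apply)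
      show "\<exists>N' A B. N' \<subseteq> N \<and> open N' \<and> x \<in> N' \<and> connected A \<and> connected B \<and> \<Omega> \<inter> N' = A \<union> B"
        if x: "x \<in> M" "open N" "x \<in> N" for x N
      proof -
        obtain \<phi> W m U P Q where t: "tube K M \<phi> W m U P Q" and xW: "x \<in> \<phi> ` W" and UN: "U \<subseteq> N"
          using ex_tube[OF K hypersurface(1) M_subset x] by blast
        obtain u where u: "u \<in> W" "x = \<phi> u" using xW by blast
        have "P \<subseteq> \<Omega>" "Q \<subseteq> \<Omega>" using two_sided_tube[OF t u(1)] all x u(2) by auto
        then have "\<Omega> \<inter> U = P \<union> Q" by (rule tube_Int[OF t])
        then show ?thesis using t xW UN unfolding tube_def
          by (intro exI[of _ U] exI[of _ P] exI[of _ Q]) auto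
      qed
    qed (use domain S hypersurface UU bD in auto)
  qed
qed

text \<open>With two-sidedness excluded, one side of a tube misses the domain; flipping the tube if
  necessary makes it \<open>P\<close>.\<close>

lemma ex_inner_tube:
  assumes p: "p \<in> M"
  shows "\<exists>\<phi> W m U P Q. tube K M \<phi> W m U P Q \<and> p \<in> \<phi> ` W \<and> P \<inter> \<Omega> = {} \<and> Q \<subseteq> \<Omega>"
proof -
  obtain \<phi> W m U P Q where t: "tube K M \<phi> W m U P Q" and pW: "p \<in> \<phi> ` W"
    using ex_tube[OF K hypersurface(1) M_subset p open_UNIV UNIV_I] by blast
  have "\<not> two_sided p" using two_sided_all_or_none not_all_two_sided p by blast
  moreover have "two_sided p" if "P \<subseteq> \<Omega>" "Q \<subseteq> \<Omega>"
    using t pW that unfolding two_sided_def tube_def by (intro exI[of _ U]) auto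
  ultimately have "P \<inter> \<Omega> = {} \<or> Q \<inter> \<Omega> = {}" using tube_sides(3,4)[OF t] by blast
  then show ?thesis
  proof
    assume "P \<inter> \<Omega> = {}"
    then show ?thesis using t pW tube_sides(5)[OF t] by blast
  next
    assume Q: "Q \<inter> \<Omega> = {}"
    then have "P \<subseteq> \<Omega>" using pW tube_sides(5)[OF tube_flip[OF t]] by blast
    then show ?thesis using tube_flip[OF t] pW Q by blast
  qed
qed

text \<open>The orthogonal complement of the tangent space of M is a line, so a competitor is v or
  -v, and -v is excluded because its geodesic starts into the domain.\<close>

lemma outward_normal_unique:
  fixes v m :: "real \<times> (real^('n option))"
  assumes \<phi>: "local_parametrization M \<phi> W" and u: "u \<in> W"
    and v: "v \<in> sf_tangent K (\<phi> u)" "metric_K K v v = 1" "\<And>h. metric_K K v (frechet_derivative \<phi> (at u) (h :: real^'n)) = 0"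
       "\<exists>\<epsilon>>0. \<forall>t. 0 < t \<and> t < \<epsilon> \<longrightarrow> geodesic K (\<phi> u) v t \<notin> \<Omega> \<and> geodesic K (\<phi> u) v (- t) \<in> \<Omega>"
  shows "outward_normal K \<Omega> M (\<phi> u) = v"
  unfolding outward_normal_def
proof (rule the_equality)
  have pS: "\<phi> u \<in> space_form K" using local_parametrizationD(4)[OF \<phi>] u M_subset by auto
  have TM: "tangent_space M (\<phi> u) = range (frechet_derivative \<phi> (at u))" by (rule tangent_space_chart[OF \<phi> u])
  have TS: "tangent_space (space_form K) (\<phi> u) = sf_tangent K (\<phi> u)" by (rule tangent_space_space_form[OF K pS])
  show "v \<in> tangent_space (space_form K) (\<phi> u) \<and> metric_K K v v = 1 \<and> (\<forall>X\<in>tangent_space M (\<phi> u). metric_K K v X = 0) \<and>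
    (\<exists>\<epsilon>>0. \<forall>t. 0 < t \<and> t < \<epsilon> \<longrightarrow> geodesic K (\<phi> u) v t \<notin> \<Omega> \<and> geodesic K (\<phi> u) v (- t) \<in> \<Omega>)"
    using v by (auto simp: TM TS)
  fix w assume w: "w \<in> tangent_space (space_form K) (\<phi> u) \<and> metric_K K w w = 1 \<and> (\<forall>X\<in>tangent_space M (\<phi> u). metric_K K w X = 0) \<and>
    (\<exists>\<epsilon>>0. \<forall>t. 0 < t \<and> t < \<epsilon> \<longrightarrow> geodesic K (\<phi> u) w t \<notin> \<Omega> \<and> geodesic K (\<phi> u) w (- t) \<in> \<Omega>)"
  let ?D = "frechet_derivative \<phi> (at u)"
  have lin: "linear ?D" using local_parametrizationD(7)[OF \<phi> u] has_derivative_linear by blast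
  have "tangent_space M (\<phi> u) \<subseteq> tangent_space (space_form K) (\<phi> u)"
    using M_subset unfolding tangent_space_def by blast
  then have rD: "range ?D \<subseteq> sf_tangent K (\<phi> u)" using TM TS by simp
  obtain h b where wb: "w = ?D h + b *\<^sub>R v"
    using sf_tangent_decomp[OF K pS lin local_parametrizationD(8)[OF \<phi> u] rD v(1,2,3)] w TS by metis
  have "metric_K K (?D h) (?D h) = metric_K K w (?D h) - b * metric_K K v (?D h)"
    by (simp add: wb metric_K_bilinear)
  also have "\<dots> = 0" using w v(3) TM by simp
  finally have "?D h = 0" using metric_sf_tangent[OF K pS] rD by blast
  then have wv: "w = b *\<^sub>R v" using wb by simp
  then have "b * b = 1" using w v(2) by (simp add: metric_K_bilinear)
  then have "b = 1 \<or> b = -1" by (metis square_eq_1_iff)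
  moreover have False if "b = -1"
  proof -
    obtain e1 where e1: "e1 > 0" "\<And>t. 0 < t \<Longrightarrow> t < e1 \<Longrightarrow> geodesic K (\<phi> u) v (- t) \<in> \<Omega>" using v(4) by blast
    obtain e2 where e2: "e2 > 0" "\<And>t. 0 < t \<Longrightarrow> t < e2 \<Longrightarrow> geodesic K (\<phi> u) w t \<notin> \<Omega>" using w by blast
    define t where "t = min e1 e2 / 2"
    have "t > 0" "t < e1" "t < e2" using e1(1) e2(1) by (auto simp: t_def min_def)
    then have "geodesic K (\<phi> u) v (- t) \<in> \<Omega>" "geodesic K (\<phi> u) w t \<notin> \<Omega>" using e1(2) e2(2) by auto
    moreover have "w = - v" using wv that by simp
    ultimately show False by (simp add: geodesic_minus)
  qed
  ultimately show "w = v" using wv by auto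
qed

lemma outward_normal_tube:
  assumes t: "tube K M \<phi> W m U P Q" and P: "P \<inter> \<Omega> = {}" and Q: "Q \<subseteq> \<Omega>" and u: "u \<in> W"
  shows "outward_normal K \<Omega> M (\<phi> u) = m u"
proof (rule outward_normal_unique[OF _ u])
  show "local_parametrization M \<phi> W" "m u \<in> sf_tangent K (\<phi> u)" "metric_K K (m u) (m u) = 1"
    "\<And>h. metric_K K (m u) (frechet_derivative \<phi> (at u) h) = 0"
    using t u by (auto simp: tube_def)
  obtain e where "e > 0" "\<And>t. 0 < t \<and> t < e \<Longrightarrow> geodesic K (\<phi> u) (m u) t \<in> P \<and> geodesic K (\<phi> u) (m u) (- t) \<in> Q"
    using t u unfolding tube_def by blast
  then show "\<exists>\<epsilon>>0. \<forall>t. 0 < t \<and> t < \<epsilon> \<longrightarrow> geodesic K (\<phi> u) (m u) t \<notin> \<Omega> \<and> geodesic K (\<phi> u) (m u) (- t) \<in> \<Omega>"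
    using P Q by blast
qed

end

section \<open>Symmetric endomorphisms\<close>

definition orthonormal :: "'a::real_inner set \<Rightarrow> bool" where
  "orthonormal B \<longleftrightarrow> (\<forall>b\<in>B. \<forall>c\<in>B. b \<bullet> c = (if b = c then 1 else 0))"

lemma orthonormal_expansion:
  assumes B: "finite B" "orthonormal B" and x: "x \<in> span B"
  shows "x = (\<Sum>b\<in>B. (x \<bullet> b) *\<^sub>R b)"
proof -
  obtain c where c: "x = (\<Sum>b\<in>B. c b *\<^sub>R b)" using x by (auto simp: span_finite[OF B(1)])
  have "x \<bullet> b = c b" if "b \<in> B" for b
  proof -
    have "x \<bullet> b = (\<Sum>a\<in>B. c a * (a \<bullet> b))" unfolding c by (simp add: inner_sum_left)
    also have "\<dots> = (\<Sum>a\<in>B. if a = b then c a else 0)"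
      using B(2) that by (intro sum.cong) (auto simp: orthonormal_def)
    finally show ?thesis using that B(1) by simp
  qed
  then show ?thesis using c by simp
qed

lemma orthonormal_card:
  fixes B :: "'a::euclidean_space set"
  assumes B: "finite B" "orthonormal B" and sp: "span B = UNIV"
  shows "card B = DIM('a)"
proof -
  have "pairwise orthogonal B"
    using B(2) by (auto simp: orthonormal_def pairwise_def orthogonal_def)
  moreover have "0 \<notin> B" using B(2) unfolding orthonormal_def by (metis inner_zero_left zero_neq_one)
  ultimately have "independent B" by (rule pairwise_orthogonal_independent)
  then have "dim (span B) = card B" by (rule dim_span_eq_card_independent)
  then show ?thesis using sp by simp
qed

lemma sum_axis: "(\<Sum>i\<in>UNIV. (x $ i) *\<^sub>R axis i 1) = (x :: real^'n::finite)"
  by (simp add: vec_eq_iff axis_def if_distrib[of "(*) _"] cong: if_cong)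

lemma trace_orthonormal:
  fixes f :: "real^'n::finite \<Rightarrow> real^'n"
  assumes f: "linear f" and B: "finite B" "orthonormal B" "span B = UNIV"
  shows "(\<Sum>b\<in>B. f b \<bullet> b) = trace (matrix f)"
proof -
  have "(\<Sum>b\<in>B. f b \<bullet> b) = (\<Sum>b\<in>B. \<Sum>i\<in>UNIV. (b $ i) * (f (axis i 1) \<bullet> b))"
  proof (intro sum.cong refl)
    fix b
    have "f b = f (\<Sum>i\<in>UNIV. (b $ i) *\<^sub>R axis i 1)" by (simp add: sum_axis)
    also have "\<dots> = (\<Sum>i\<in>UNIV. (b $ i) *\<^sub>R f (axis i 1))" using f by (simp add: linear_sum linear_cmul)
    finally have "f b = (\<Sum>i\<in>UNIV. (b $ i) *\<^sub>R f (axis i 1))" .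
    then have "f b \<bullet> b = (\<Sum>i\<in>UNIV. (b $ i) *\<^sub>R f (axis i 1)) \<bullet> b" by simp
    then show "f b \<bullet> b = (\<Sum>i\<in>UNIV. (b $ i) * (f (axis i 1) \<bullet> b))" by (simp add: inner_sum_left)
  qed
  also have "\<dots> = (\<Sum>i\<in>UNIV. \<Sum>b\<in>B. (f (axis i 1) \<bullet> b) * (b $ i))"
    by (subst sum.swap) (simp add: mult.commute)
  also have "\<dots> = (\<Sum>i\<in>UNIV. f (axis i 1) $ i)"
  proof (intro sum.cong refl)
    fix i :: 'n
    have "f (axis i 1) = (\<Sum>b\<in>B. (f (axis i 1) \<bullet> b) *\<^sub>R b)"
      by (rule orthonormal_expansion[OF B(1,2)]) (simp add: B(3))
    from arg_cong[OF this, of "\<lambda>v. v $ i"]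
    show "(\<Sum>b\<in>B. (f (axis i 1) \<bullet> b) * (b $ i)) = f (axis i 1) $ i" by simp
  qed
  finally show ?thesis by (simp add: trace_def matrix_def)
qed

text \<open>Spectral theorem: a maximiser of the quadratic form on the unit sphere of
  \<open>T\<close> is an eigenvector, and its orthogonal complement in \<open>T\<close> is invariant
  and of smaller dimension.\<close>

lemma ex_orthonormal_eigenbasis:
  fixes f :: "'a::euclidean_space \<Rightarrow> 'a"
  assumes f: "linear f" and sym: "\<And>x y. f x \<bullet> y = x \<bullet> f y"
  shows "subspace T \<Longrightarrow> f ` T \<subseteq> T \<Longrightarrow>
    \<exists>B. finite B \<and> B \<subseteq> T \<and> orthonormal B \<and> span B = T \<and> (\<forall>b\<in>B. f b = (f b \<bullet> b) *\<^sub>R b)"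
proof (induction "dim T" arbitrary: T rule: less_induct)
  case less
  show ?case
  proof (cases "T \<subseteq> {0}")
    case True
    then have "T = {0}" using less.prems(1) subspace_0 by blast
    then show ?thesis by (intro exI[of _ "{}"]) (auto simp: orthonormal_def)
  next
    case False
    then obtain x0 where x0: "x0 \<in> T" "x0 \<noteq> 0" by blast
    have cf: "continuous_on A f" for A using f by (intro linear_continuous_on) (simp add: linear_conv_bounded_linear)
    have "closed T" using less.prems(1) by (rule closed_subspace)
    then have "compact (sphere 0 1 \<inter> T)" by (intro compact_Int_closed compact_sphere)
    moreover have "(1 / norm x0) *\<^sub>R x0 \<in> sphere 0 1 \<inter> T"
      using x0 less.prems(1) by (auto intro: subspace_scale)
    moreover have "continuous_on (sphere 0 1 \<inter> T) (\<lambda>x. f x \<bullet> x)" by (intro continuous_intros cf)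
    ultimately obtain v where v: "v \<in> sphere 0 1 \<inter> T" "\<And>y. y \<in> sphere 0 1 \<inter> T \<Longrightarrow> f y \<bullet> y \<le> f v \<bullet> v"
      using continuous_attains_sup[of "sphere 0 1 \<inter> T" "\<lambda>x. f x \<bullet> x"] by blast
    define l where "l = f v \<bullet> v"
    have vT: "v \<in> T" "v \<bullet> v = 1" using v(1) by (auto simp: norm_eq_sqrt_inner)
    have le: "f y \<bullet> y \<le> l * (y \<bullet> y)" if "y \<in> T" for y
    proof (cases "y = 0")
      case False
      have "f ((1 / norm y) *\<^sub>R y) \<bullet> ((1 / norm y) *\<^sub>R y) \<le> l"
        unfolding l_def using that False less.prems(1) by (intro v(2)) (auto intro: subspace_scale)
      then have "(f y \<bullet> y) / (norm y * norm y) \<le> l" using f by (simp add: linear_cmul)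
      then show ?thesis using False by (simp add: field_simps power2_norm_eq_inner[symmetric] power2_eq_square)
    qed (use f in \<open>simp add: linear_0\<close>)
    have orth: "w \<bullet> f v = 0" if w: "w \<in> T" "w \<bullet> v = 0" for w
    proof (rule ccontr)
      assume n: "w \<bullet> f v \<noteq> 0"
      define a where "a = w \<bullet> f v"
      define c where "c = l * (w \<bullet> w) - f w \<bullet> w"
      have c0: "c \<ge> 0" using le[OF w(1)] by (simp add: c_def)
      \<comment> \<open>Comparison of v + s w with the maximum, for every real s; this is possible
        only if the coefficient of the linear term vanishes.\<close>
      have q: "2 * s * a \<le> s\<^sup>2 * c" for s
      proof -
        have T: "v + s *\<^sub>R w \<in> T" using vT w less.prems(1) by (intro subspace_add subspace_scale) auto
        have "f (v + s *\<^sub>R w) = f v + s *\<^sub>R f w" using f by (simp add: linear_add linear_cmul)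
        then have "f (v + s *\<^sub>R w) \<bullet> (v + s *\<^sub>R w) = l + 2 * s * a + s\<^sup>2 * (f w \<bullet> w)"
          using sym[of w v] by (simp add: l_def a_def inner_simps inner_commute power2_eq_square algebra_simps)
        moreover have "(v + s *\<^sub>R w) \<bullet> (v + s *\<^sub>R w) = 1 + s\<^sup>2 * (w \<bullet> w)"
          using vT w(2) by (simp add: inner_simps inner_commute power2_eq_square)
        ultimately show ?thesis using le[OF T] by (simp add: c_def algebra_simps)
      qed
      show False
      proof (cases "c = 0")
        case True
        then have "a * a \<le> 0" using q[of a] by simp
        then show False using n by (metis a_def linorder_not_less not_real_square_gt_zero)
      next
        case False
        then have c: "c > 0" using c0 by simp
        have "2 * (a / c) * a \<le> (a / c)\<^sup>2 * c" by (rule q)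
        then have "2 * (a * a) / c \<le> (a * a) / c" using c by (simp add: power2_eq_square)
        then have "a * a \<le> 0" using c by (simp add: divide_le_cancel)
        then show False using n by (metis a_def linorder_not_less not_real_square_gt_zero)
      qed
    qed
    have fvT: "f v \<in> T" using less.prems(2) vT by auto
    have "f v - l *\<^sub>R v = 0"
    proof -
      have w: "f v - l *\<^sub>R v \<in> T" "(f v - l *\<^sub>R v) \<bullet> v = 0"
        using fvT vT less.prems(1) by (auto intro!: subspace_diff subspace_scale simp: inner_simps l_def)
      have "(f v - l *\<^sub>R v) \<bullet> (f v - l *\<^sub>R v) = (f v - l *\<^sub>R v) \<bullet> f v - l * ((f v - l *\<^sub>R v) \<bullet> v)"
        by (simp add: inner_simps)
      then show ?thesis using orth[OF w] w(2) by simp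
    qed
    then have eig: "f v = l *\<^sub>R v" by simp
    define T' where "T' = {x \<in> T. x \<bullet> v = 0}"
    have T': "subspace T'" using less.prems(1) by (auto simp: T'_def subspace_def inner_simps)
    have "v \<notin> T'" using vT by (simp add: T'_def)
    moreover have "T' \<subseteq> T" by (auto simp: T'_def)
    ultimately have "T' \<subset> T" using vT(1) by blast
    then have "dim T' < dim T"
      using T' less.prems(1) by (intro dim_psubset) (metis span_eq_iff)
    moreover have "f ` T' \<subseteq> T'"
      using less.prems(2) sym[of _ v] by (auto simp: T'_def eig)
    ultimately obtain B where B: "finite B" "B \<subseteq> T'" "orthonormal B" "span B = T'" "\<forall>b\<in>B. f b = (f b \<bullet> b) *\<^sub>R b"
      using less.hyps[OF _ T'] by blast
    have vB: "v \<bullet> b = 0" "b \<bullet> v = 0" if "b \<in> B" for b using that B(2) by (auto simp: T'_def inner_commute)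
    show ?thesis
    proof (intro exI[of _ "insert v B"] conjI)
      show "insert v B \<subseteq> T" using B(2) vT by (auto simp: T'_def)
      show "orthonormal (insert v B)"
        using B(3) vB vT by (auto simp: orthonormal_def)
      show "\<forall>b\<in>insert v B. f b = (f b \<bullet> b) *\<^sub>R b"
        using B(5) eig vT by (auto simp: l_def)
      show "span (insert v B) = T"
      proof
        show "span (insert v B) \<subseteq> T"
          using less.prems(1) B(2) vT by (intro span_minimal) (auto simp: T'_def)
        show "T \<subseteq> span (insert v B)"
        proof
          fix x assume x: "x \<in> T"
          have "x - (x \<bullet> v) *\<^sub>R v \<in> T'"
            using x vT less.prems(1) by (auto simp: T'_def inner_simps intro: subspace_diff subspace_scale)
          then have "x - (x \<bullet> v) *\<^sub>R v \<in> span B" using B(4) by simp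
          then show "x \<in> span (insert v B)" unfolding span_insert by blast
        qed
      qed
    qed (use B in auto)
  qed
qed

text \<open>The matrix Q of eigenvectors is orthogonal and f Q = Q L with L diagonal.\<close>

lemma det_eigenbasis:
  fixes f :: "real^'n::finite \<Rightarrow> real^'n"
  assumes f: "linear f" and B: "finite B" "orthonormal B" "span B = UNIV" and eig: "\<And>b. b \<in> B \<Longrightarrow> f b = l b *\<^sub>R b"
  shows "det (matrix f) = (\<Prod>b\<in>B. l b)"
proof -
  have "card B = CARD('n)" using orthonormal_card[OF B] by simp
  then obtain e :: "'n \<Rightarrow> real^'n" where e: "bij_betw e UNIV B"
    using finite_same_card_bij[of "UNIV :: 'n set" B] B(1) by auto
  have eB: "e i \<in> B" for i using e by (auto simp: bij_betw_def)
  have ee: "e i \<bullet> e j = (if i = j then 1 else 0)" for i j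
    using B(2) eB e by (auto simp: orthonormal_def bij_betw_def inj_on_eq_iff)
  define Q where "Q = (\<chi> i j. e j $ i)"
  define L where "L = (\<chi> i j. if i = j then l (e i) else 0)"
  have "transpose Q ** Q = mat 1"
    using ee by (simp add: vec_eq_iff matrix_matrix_mult_def transpose_def Q_def mat_def inner_vec_def)
  then have "det Q * det Q = 1" by (metis det_I det_mul det_transpose)
  then have dQ: "det Q \<noteq> 0" by auto
  have "matrix f ** Q = Q ** L"
  proof -
    have "(matrix f ** Q) $ i $ j = (Q ** L) $ i $ j" for i j
    proof -
      have "(matrix f ** Q) $ i $ j = (matrix f *v e j) $ i"
        by (simp add: matrix_matrix_mult_def matrix_vector_mult_def Q_def)
      also have "matrix f *v e j = f (e j)" using f by (simp add: matrix_vector_mul)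
      also have "f (e j) = l (e j) *\<^sub>R e j" by (rule eig[OF eB])
      also have "(l (e j) *\<^sub>R e j) $ i = (Q ** L) $ i $ j"
        by (simp add: matrix_matrix_mult_def Q_def L_def if_distrib[of "(*) _"] cong: if_cong)
      finally show ?thesis .
    qed
    then show ?thesis by (simp add: vec_eq_iff)
  qed
  then have "det (matrix f) * det Q = det Q * det L" by (metis det_mul)
  then have "det (matrix f) = det L" using dQ by simp
  also have "\<dots> = (\<Prod>i\<in>UNIV. l (e i))" by (subst det_diagonal) (auto simp: L_def)
  also have "\<dots> = (\<Prod>b\<in>B. l b)" by (rule prod.reindex_bij_betw[OF e])
  finally show ?thesis .
qed

lemma psd_eigenvalues:
  fixes f :: "real^'n::finite \<Rightarrow> real^'n"
  assumes f: "linear f" and sym: "\<And>x y. f x \<bullet> y = x \<bullet> f y" and psd: "\<And>x. 0 \<le> f x \<bullet> x"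
  obtains B where "finite B" "orthonormal B" "span B = UNIV" "card B = CARD('n)"
    "\<And>b. b \<in> B \<Longrightarrow> f b = (f b \<bullet> b) *\<^sub>R b"
    "det (matrix f) = (\<Prod>b\<in>B. f b \<bullet> b)" "trace (matrix f) = (\<Sum>b\<in>B. f b \<bullet> b)"
proof -
  obtain B where B: "finite B" "orthonormal B" "span B = UNIV" "\<And>b. b \<in> B \<Longrightarrow> f b = (f b \<bullet> b) *\<^sub>R b"
    using ex_orthonormal_eigenbasis[OF f sym subspace_UNIV] by auto
  show ?thesis
    by (rule that[OF B(1-3) _ B(4)])
       (use orthonormal_card[OF B(1-3)] det_eigenbasis[OF f B(1-3), of "\<lambda>b. f b \<bullet> b"] B(4)
          trace_orthonormal[OF f B(1-3)] in auto)
qed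

text \<open>The inequality of arithmetic and geometric means for the eigenvalues; nonnegative
  eigenvalues with sum 0 all vanish.\<close>

lemma det_psd_bounds:
  fixes f :: "real^'n::finite \<Rightarrow> real^'n"
  assumes f: "linear f" and sym: "\<And>x y. f x \<bullet> y = x \<bullet> f y" and psd: "\<And>x. 0 \<le> f x \<bullet> x"
  shows "0 \<le> det (matrix f)" "0 \<le> trace (matrix f)" "det (matrix f) \<le> (trace (matrix f) / CARD('n)) ^ CARD('n)"
    "trace (matrix f) = 0 \<Longrightarrow> f x = 0"
proof -
  obtain B where B: "finite B" "orthonormal B" "span B = UNIV" "card B = CARD('n)"
    "\<And>b. b \<in> B \<Longrightarrow> f b = (f b \<bullet> b) *\<^sub>R b"
    "det (matrix f) = (\<Prod>b\<in>B. f b \<bullet> b)" "trace (matrix f) = (\<Sum>b\<in>B. f b \<bullet> b)"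
    using psd_eigenvalues[OF assms] by blast
  have B0: "B \<noteq> {}" using B(4) by auto
  show d0: "0 \<le> det (matrix f)" unfolding B(6) using psd by (intro prod_nonneg) auto
  show t0: "0 \<le> trace (matrix f)" unfolding B(7) using psd by (intro sum_nonneg) auto
  have n: "CARD('n) > 0" by simp
  show "det (matrix f) \<le> (trace (matrix f) / CARD('n)) ^ CARD('n)"
  proof (cases "det (matrix f) = 0")
    case False
    then have "det (matrix f) > 0" using d0 by simp
    then have "root (CARD('n)) (det (matrix f)) \<le> trace (matrix f) / CARD('n)"
      using arith_geom_mean[OF B(1) B0, of "\<lambda>b. f b \<bullet> b"] psd unfolding B(6,7) B(4)
      by (simp add: root_powr_inverse sum_divide_distrib)
    then have "(root (CARD('n)) (det (matrix f))) ^ CARD('n) \<le> (trace (matrix f) / CARD('n)) ^ CARD('n)"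
      using d0 by (intro power_mono) auto
    then show ?thesis using d0 n by simp
  qed (use t0 in simp)
  show "f x = 0" if "trace (matrix f) = 0"
  proof -
    have "\<forall>b\<in>B. f b \<bullet> b = 0"
      using that psd B(1) unfolding B(7) by (subst (asm) sum_nonneg_eq_0_iff) auto
    then have fb: "f b = 0" if "b \<in> B" for b using B(5)[OF that] that by simp
    have "x = (\<Sum>b\<in>B. (x \<bullet> b) *\<^sub>R b)" by (rule orthonormal_expansion[OF B(1,2)]) (simp add: B(3))
    then have "f x = f (\<Sum>b\<in>B. (x \<bullet> b) *\<^sub>R b)" by simp
    also have "\<dots> = (\<Sum>b\<in>B. (x \<bullet> b) *\<^sub>R f b)" using f by (simp add: linear_sum linear_cmul)
    finally show ?thesis using fb by simp
  qed
qed

section \<open>Second derivatives\<close>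

text \<open>Schwarz's theorem in the form where the partial derivatives are differentiable at u
  only. The second difference over the parallelogram with sides s h and s k is symmetric in h and k,
  and the mean value theorem compares it with s^2 times either mixed derivative.\<close>

lemma symmetric_second_derivative:
  fixes F :: "'a::real_normed_vector \<Rightarrow> real"
  assumes W: "open W" "u \<in> W" and F: "\<And>x. x \<in> W \<Longrightarrow> (F has_derivative F' x) (at x)"
    and h: "((\<lambda>x. F' x h) has_derivative G h) (at u)" and k: "((\<lambda>x. F' x k) has_derivative G k) (at u)"
  shows "G h k = G k h"
proof -
  have lim: "\<exists>d>0. \<forall>s. 0 < s \<and> s < d \<longrightarrow>
      \<bar>(F (u + s *\<^sub>R h + s *\<^sub>R k) - F (u + s *\<^sub>R h) - F (u + s *\<^sub>R k) + F u) - s\<^sup>2 * G k h\<bar> \<le> e * s\<^sup>2"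
    if e: "e > 0" and Gk: "((\<lambda>x. F' x k) has_derivative G k) (at u)" for h k e
  proof -
    interpret Gk: bounded_linear "G k" using Gk has_derivative_bounded_linear by blast
    \<comment> \<open>Two error terms of size (e/c) s (|h| + |k|) will add up to at most e s; the
      added 1 keeps \<open>c\<close> positive.\<close>
    define c where "c = 2 * (norm h + norm k) + 1"
    have c: "c > 0" by (simp add: c_def add_nonneg_pos)
    obtain r where r: "r > 0" "ball u r \<subseteq> W" using W by (meson open_contains_ball)
    obtain d where d: "d > 0" "\<And>y. norm (y - u) < d \<Longrightarrow> norm (F' y k - F' u k - G k (y - u)) \<le> (e / c) * norm (y - u)"
      using Gk e c unfolding has_derivative_at_alt by (metis divide_pos_pos)
    define d0 where "d0 = min d r / c"
    have d0: "d0 > 0" using d r c by (simp add: d0_def)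
    show ?thesis
    proof (intro exI[of _ d0] conjI allI impI)
      fix s assume s: "0 < s \<and> s < d0"
      have small: "norm (a *\<^sub>R h + t *\<^sub>R k) < min d r" "norm (a *\<^sub>R h + t *\<^sub>R k) \<le> s * (norm h + norm k)"
        if "a \<in> {0..s}" "t \<in> {0..s}" for a t
      proof -
        have "norm (a *\<^sub>R h + t *\<^sub>R k) \<le> a * norm h + t * norm k"
          using that by (metis abs_of_nonneg atLeastAtMost_iff norm_scaleR norm_triangle_ineq)
        also have "\<dots> \<le> s * norm h + s * norm k"
          using that by (intro add_mono mult_right_mono) auto
        finally show le: "norm (a *\<^sub>R h + t *\<^sub>R k) \<le> s * (norm h + norm k)" by (simp add: distrib_left)
        also have "\<dots> \<le> s * c" using s by (intro mult_left_mono) (auto simp: c_def)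
        also have "\<dots> < d0 * c" using s c by (intro mult_strict_right_mono) auto
        also have "\<dots> = min d r" using c by (simp add: d0_def)
        finally show "norm (a *\<^sub>R h + t *\<^sub>R k) < min d r" .
      qed
      have inW: "u + (a *\<^sub>R h + t *\<^sub>R k) \<in> W" if "a \<in> {0..s}" "t \<in> {0..s}" for a t
      proof -
        have "u + (a *\<^sub>R h + t *\<^sub>R k) \<in> ball u r" using small(1)[OF that]
          by (metis add_diff_cancel_left' dist_commute dist_norm mem_ball min_less_iff_conj)
        then show ?thesis using r(2) by blast
      qed
      \<comment> \<open>The increment of F by s h as a function of the position t along k; the
        second difference is p(s) - p(0).\<close>
      define p where "p t = F (u + (s *\<^sub>R h + t *\<^sub>R k)) - F (u + (0 *\<^sub>R h + t *\<^sub>R k))" for t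
      define p' where "p' t = F' (u + (s *\<^sub>R h + t *\<^sub>R k)) k - F' (u + (0 *\<^sub>R h + t *\<^sub>R k)) k" for t
      have dF: "((\<lambda>t. F (u + (a *\<^sub>R h + t *\<^sub>R k))) has_real_derivative F' (u + (a *\<^sub>R h + t *\<^sub>R k)) k) (at t)"
        if "a \<in> {0..s}" "t \<in> {0..s}" for a t
      proof -
        have "((\<lambda>t. u + (a *\<^sub>R h + t *\<^sub>R k)) has_derivative (\<lambda>t. t *\<^sub>R k)) (at t)"
          by (auto intro!: derivative_eq_intros)
        from has_derivative_compose[OF this F[OF inW[OF that]]]
        have "((\<lambda>t. F (u + (a *\<^sub>R h + t *\<^sub>R k))) has_derivative (\<lambda>x. F' (u + (a *\<^sub>R h + t *\<^sub>R k)) (x *\<^sub>R k))) (at t)" .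
        moreover have "(\<lambda>x. F' (u + (a *\<^sub>R h + t *\<^sub>R k)) (x *\<^sub>R k)) = (*) (F' (u + (a *\<^sub>R h + t *\<^sub>R k)) k)"
          using has_derivative_linear[OF F[OF inW[OF that]]] by (auto simp: linear_cmul)
        ultimately show ?thesis by (simp add: has_field_derivative_def)
      qed
      have dp: "(p has_real_derivative p' t) (at t)" if "t \<in> {0..s}" for t
        unfolding p_def p'_def using s that by (intro DERIV_diff dF) auto
      obtain t where t: "0 < t" "t < s" "p s - p 0 = (s - 0) * p' t"
        using MVT2[of 0 s p p'] s dp by auto
      have est: "norm (F' (u + (a *\<^sub>R h + t *\<^sub>R k)) k - F' u k - G k (a *\<^sub>R h + t *\<^sub>R k)) \<le> (e / c) * (s * (norm h + norm k))"
        if a: "a \<in> {0..s}" for a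
      proof -
        have "t \<in> {0..s}" using t by simp
        note sm = small[OF a this]
        have "norm (F' (u + (a *\<^sub>R h + t *\<^sub>R k)) k - F' u k - G k (a *\<^sub>R h + t *\<^sub>R k)) \<le> (e / c) * norm (a *\<^sub>R h + t *\<^sub>R k)"
          using d(2)[of "u + (a *\<^sub>R h + t *\<^sub>R k)"] sm(1) by simp
        also have "\<dots> \<le> (e / c) * (s * (norm h + norm k))" using sm(2) e c by (intro mult_left_mono) auto
        finally show ?thesis .
      qed
      have "\<bar>p' t - s * G k h\<bar> \<le> 2 * ((e / c) * (s * (norm h + norm k)))"
      proof -
        define X where "X = F' (u + (s *\<^sub>R h + t *\<^sub>R k)) k - F' u k - G k (s *\<^sub>R h + t *\<^sub>R k)"
        define Y where "Y = F' (u + (0 *\<^sub>R h + t *\<^sub>R k)) k - F' u k - G k (0 *\<^sub>R h + t *\<^sub>R k)"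
        have "p' t - s * G k h = X - Y"
          by (simp add: p'_def X_def Y_def Gk.add Gk.scaleR)
        moreover have "\<bar>X\<bar> \<le> (e / c) * (s * (norm h + norm k))" "\<bar>Y\<bar> \<le> (e / c) * (s * (norm h + norm k))"
          using est[of s] est[of 0] s unfolding X_def Y_def real_norm_def by auto
        ultimately show ?thesis by linarith
      qed
      also have "\<dots> = (e * s) * ((c - 1) / c)" by (simp add: c_def)
      also have "\<dots> \<le> (e * s) * 1" using e s c by (intro mult_left_mono) (auto simp: divide_le_eq)
      finally have "s * \<bar>p' t - s * G k h\<bar> \<le> s * (e * s)" using s by (intro mult_left_mono) auto
      moreover have "s * \<bar>p' t - s * G k h\<bar> = \<bar>s * p' t - s\<^sup>2 * G k h\<bar>"
      proof -
        have "s * \<bar>p' t - s * G k h\<bar> = \<bar>s * (p' t - s * G k h)\<bar>" using s by (simp add: abs_mult)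
        also have "s * (p' t - s * G k h) = s * p' t - s\<^sup>2 * G k h" by (simp add: algebra_simps power2_eq_square)
        finally show ?thesis .
      qed
      moreover have "s * p' t = F (u + s *\<^sub>R h + s *\<^sub>R k) - F (u + s *\<^sub>R h) - F (u + s *\<^sub>R k) + F u"
        using t(3) by (simp add: p_def add.assoc)
      ultimately show "\<bar>(F (u + s *\<^sub>R h + s *\<^sub>R k) - F (u + s *\<^sub>R h) - F (u + s *\<^sub>R k) + F u) - s\<^sup>2 * G k h\<bar> \<le> e * s\<^sup>2"
        by (simp add: power2_eq_square mult.commute mult.left_commute)
    qed (rule d0)
  qed
  have "\<bar>G h k - G k h\<bar> \<le> 2 * e" if e: "e > 0" for e
  proof -
    obtain d1 where d1: "d1 > 0" "\<And>s. 0 < s \<and> s < d1 \<Longrightarrow>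
      \<bar>(F (u + s *\<^sub>R h + s *\<^sub>R k) - F (u + s *\<^sub>R h) - F (u + s *\<^sub>R k) + F u) - s\<^sup>2 * G k h\<bar> \<le> e * s\<^sup>2"
      using lim[OF e k, of h] by blast
    obtain d2 where d2: "d2 > 0" "\<And>s. 0 < s \<and> s < d2 \<Longrightarrow>
      \<bar>(F (u + s *\<^sub>R k + s *\<^sub>R h) - F (u + s *\<^sub>R k) - F (u + s *\<^sub>R h) + F u) - s\<^sup>2 * G h k\<bar> \<le> e * s\<^sup>2"
      using lim[OF e h, of k] by blast
    define s where "s = min d1 d2 / 2"
    have s: "0 < s" "s < d1" "s < d2" using d1(1) d2(1) by (auto simp: s_def min_def)
    have sw: "u + s *\<^sub>R k + s *\<^sub>R h = u + s *\<^sub>R h + s *\<^sub>R k" by (simp add: algebra_simps)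
    have "\<bar>s\<^sup>2 * G h k - s\<^sup>2 * G k h\<bar> \<le> e * s\<^sup>2 + e * s\<^sup>2"
      using d1(2)[of s] d2(2)[of s] s unfolding sw by linarith
    moreover have "\<bar>s\<^sup>2 * G h k - s\<^sup>2 * G k h\<bar> = s\<^sup>2 * \<bar>G h k - G k h\<bar>"
      unfolding right_diff_distrib[symmetric] abs_mult by simp
    ultimately have "s\<^sup>2 * \<bar>G h k - G k h\<bar> \<le> s\<^sup>2 * (2 * e)" by (simp add: mult.commute)
    then show ?thesis using s by simp
  qed
  then have "\<bar>G h k - G k h\<bar> \<le> 0" by (metis field_le_epsilon add_0 mult_2 field_sum_of_halves half_gt_zero)
  then show ?thesis by simp
qed

text \<open>A negative second derivative would make f' negative just after 0, and then f would fall
  below f(0).\<close>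

lemma second_derivative_nonneg_at_minimum:
  fixes f :: "real \<Rightarrow> real"
  assumes e: "e > 0" and f: "\<And>t. \<bar>t\<bar> < e \<Longrightarrow> (f has_real_derivative f' t) (at t)"
    and f': "(f' has_real_derivative d) (at 0)" and min: "\<And>t. \<bar>t\<bar> < e \<Longrightarrow> f 0 \<le> f t"
  shows "0 \<le> d"
proof (rule ccontr)
  assume "\<not> 0 \<le> d"
  then have "d < 0" by simp
  have f0: "f' 0 = 0" using DERIV_local_min[OF f[of 0] e] min e by auto
  obtain b where b: "b > 0" "\<And>h. 0 < h \<Longrightarrow> h < b \<Longrightarrow> f' h < 0"
    using DERIV_neg_dec_right[OF f' \<open>d < 0\<close>] f0 by auto
  define s where "s = min b e / 2"
  have s: "0 < s" "s < b" "s < e" using b e by (auto simp: s_def min_def)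
  obtain t where t: "0 < t" "t < s" "f s - f 0 = (s - 0) * f' t"
    using MVT2[of 0 s f f'] s f by auto
  then have "f s - f 0 < 0" using b(2)[of t] s by (simp add: mult_pos_neg)
  then show False using min[of s] s by simp
qed

section \<open>The shape operator and the normal map\<close>

text \<open>Polar decomposition with respect to \<open>metric_K\<close>: the isometry
  \<open>L\<close> transfers linear algebra on the tangent space to R^n, and \<open>J\<close> keeps
  the distortion of the chart.\<close>

lemma ex_isometric_factorization:
  fixes D :: "real^'n::finite \<Rightarrow> real \<times> 'v::euclidean_space"
  assumes K: "K \<in> {-1, 0, 1}" and p: "p \<in> space_form K"
    and D: "linear D" "inj D" "range D \<subseteq> sf_tangent K p"
  obtains L :: "real^'n \<Rightarrow> real \<times> 'v" and J Ji where "linear L" "linear J" "linear Ji"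
    "\<And>a b. metric_K K (L a) (L b) = a \<bullet> b" "\<And>h. D h = L (J h)" "\<And>h. Ji (J h) = h" "\<And>h. J (Ji h) = h"
    "\<And>a. L a \<in> range D"
proof -
  \<comment> \<open>\<open>J\<close> is the square root of the Gram matrix \<open>f\<close> of \<open>D\<close>.\<close>
  define f :: "real^'n \<Rightarrow> real^'n" where "f h = (\<chi> i. metric_K K (D h) (D (axis i 1)))" for h
  have fin: "f h \<bullet> k = metric_K K (D h) (D k)" for h k
  proof -
    have "f h \<bullet> k = (\<Sum>i\<in>UNIV. k $ i * metric_K K (D h) (D (axis i 1)))"
      by (simp add: f_def inner_vec_def mult.commute)
    also have "\<dots> = metric_K K (D h) (D (\<Sum>i\<in>UNIV. (k $ i) *\<^sub>R axis i 1))"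
      by (simp add: linear_sum[OF D(1)] linear_cmul[OF D(1)] metric_K_sum metric_K_bilinear)
    finally show ?thesis by (simp add: sum_axis)
  qed
  have lin: "linear f"
    by (rule linearI) (simp_all add: f_def vec_eq_iff linear_add[OF D(1)] linear_cmul[OF D(1)] metric_K_bilinear)
  have sym: "f x \<bullet> y = x \<bullet> f y" for x y
    using fin[of x y] fin[of y x] by (simp add: metric_K_commute inner_commute)
  obtain B where B: "finite B" "orthonormal B" "span B = UNIV" "\<And>b. b \<in> B \<Longrightarrow> f b = (f b \<bullet> b) *\<^sub>R b"
    using ex_orthonormal_eigenbasis[OF lin sym subspace_UNIV] by auto
  define l where "l b = sqrt (f b \<bullet> b)" for b
  have l: "l b > 0" "(l b)\<^sup>2 = f b \<bullet> b" if b: "b \<in> B" for b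
  proof -
    have "b \<bullet> b = 1" using B(2) b by (simp add: orthonormal_def)
    then have "b \<noteq> 0" by auto
    then have "D b \<noteq> 0" using D(1,2) by (metis injD linear_0)
    then have "f b \<bullet> b > 0"
      using metric_sf_tangent[OF K p, of "D b"] D(3) fin[of b b] by (metis less_eq_real_def range_subsetD)
    then show "l b > 0" "(l b)\<^sup>2 = f b \<bullet> b" by (auto simp: l_def)
  qed
  define L where "L a = (\<Sum>b\<in>B. ((a \<bullet> b) / l b) *\<^sub>R D b)" for a
  define J where "J a = (\<Sum>b\<in>B. ((a \<bullet> b) * l b) *\<^sub>R b)" for a
  define Ji where "Ji a = (\<Sum>b\<in>B. ((a \<bullet> b) / l b) *\<^sub>R b)" for a
  have exp: "(\<Sum>b\<in>B. (x \<bullet> b) *\<^sub>R b) = x" for x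
    using orthonormal_expansion[OF B(1,2)] B(3) by simp
  have coef: "(\<Sum>c\<in>B. g c *\<^sub>R c) \<bullet> b = g b" if b: "b \<in> B" for g b
  proof -
    have "(\<Sum>c\<in>B. g c *\<^sub>R c) \<bullet> b = (\<Sum>c\<in>B. if c = b then g c else 0)"
      using B(2) b by (auto simp: inner_sum_left orthonormal_def intro!: sum.cong)
    then show ?thesis using B(1) b by simp
  qed
  have "linear L" "linear J" "linear Ji"
    by (auto intro!: linearI simp: L_def J_def Ji_def inner_add_left add_divide_distrib distrib_right scaleR_add_left sum.distrib
        scaleR_sum_right mult.assoc)
  moreover have "metric_K K (L a) (L b) = a \<bullet> b" for a b
  proof -
    have "metric_K K (D c) (L b) = (b \<bullet> c) * l c" if c: "c \<in> B" for c
    proof -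
      have "metric_K K (D c) (L b) = f c \<bullet> (\<Sum>d\<in>B. ((b \<bullet> d) / l d) *\<^sub>R d)"
        unfolding fin L_def by (simp add: linear_sum[OF D(1)] linear_cmul[OF D(1)])
      also have "\<dots> = (f c \<bullet> c) * ((\<Sum>d\<in>B. ((b \<bullet> d) / l d) *\<^sub>R d) \<bullet> c)"
        by (subst B(4)[OF c]) (simp add: inner_commute)
      also have "\<dots> = (b \<bullet> c) * l c"
        using l[OF c] by (simp add: coef[OF c] power2_eq_square flip: l(2)[OF c])
      finally show ?thesis .
    qed
    then have "metric_K K (L a) (L b) = (\<Sum>c\<in>B. ((a \<bullet> c) / l c) * ((b \<bullet> c) * l c))"
      by (simp add: L_def[of a] metric_K_sum metric_K_bilinear)
    also have "\<dots> = (\<Sum>c\<in>B. (a \<bullet> c) * (b \<bullet> c))"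
      by (intro sum.cong) (use l in \<open>auto simp: less_imp_neq[symmetric]\<close>)
    also have "\<dots> = a \<bullet> (\<Sum>c\<in>B. (b \<bullet> c) *\<^sub>R c)" by (simp add: inner_sum_right mult.commute)
    finally show ?thesis by (simp add: exp)
  qed
  moreover have "D h = L (J h)" for h
  proof -
    have "L (J h) = (\<Sum>b\<in>B. (h \<bullet> b) *\<^sub>R D b)"
      unfolding L_def by (intro sum.cong) (use l in \<open>auto simp: J_def coef less_imp_neq[symmetric]\<close>)
    also have "\<dots> = D (\<Sum>b\<in>B. (h \<bullet> b) *\<^sub>R b)" by (simp add: linear_sum[OF D(1)] linear_cmul[OF D(1)])
    finally show ?thesis by (simp add: exp)
  qed
  moreover have "Ji (J h) = h" for h
  proof -
    have "Ji (J h) = (\<Sum>b\<in>B. (h \<bullet> b) *\<^sub>R b)"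
      unfolding Ji_def by (intro sum.cong) (use l in \<open>auto simp: J_def coef less_imp_neq[symmetric]\<close>)
    then show ?thesis by (simp add: exp)
  qed
  moreover have "J (Ji h) = h" for h
  proof -
    have "J (Ji h) = (\<Sum>b\<in>B. (h \<bullet> b) *\<^sub>R b)"
      unfolding J_def by (intro sum.cong) (use l in \<open>auto simp: Ji_def coef less_imp_neq[symmetric]\<close>)
    then show ?thesis by (simp add: exp)
  qed
  moreover have "L a \<in> range D" for a
  proof -
    have "L a = D (Ji a)" by (simp add: L_def Ji_def linear_sum[OF D(1)] linear_cmul[OF D(1)])
    then show ?thesis by simp
  qed
  ultimately show ?thesis by (rule that)
qed

text \<open>\<open>L\<close> identifies \<open>\<real>\<^sup>n\<close> isometrically with the tangent space of the hypersurface, and \<open>S\<close> is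
  the shape operator in this frame.\<close>

definition shape_frame ::
  "real \<Rightarrow> (real^'n::finite \<Rightarrow> real \<times> (real^('n option))) \<Rightarrow> (real^'n \<Rightarrow> real \<times> (real^('n option))) \<Rightarrow> real^'n \<Rightarrow>
   (real^'n \<Rightarrow> real \<times> (real^('n option))) \<Rightarrow> (real^'n \<Rightarrow> real^'n) \<Rightarrow> (real^'n \<Rightarrow> real^'n) \<Rightarrow> (real^'n \<Rightarrow> real^'n) \<Rightarrow> bool" where
  "shape_frame K \<phi> m u L J Ji S \<longleftrightarrow> linear L \<and> linear J \<and> linear Ji \<and> linear S \<and>
    (\<forall>a b. metric_K K (L a) (L b) = a \<bullet> b) \<and> (\<forall>h. frechet_derivative \<phi> (at u) h = L (J h)) \<and>
    (\<forall>h. frechet_derivative m (at u) h = L (S (J h))) \<and> (\<forall>h. Ji (J h) = h) \<and> (\<forall>h. J (Ji h) = h) \<and>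
    (\<forall>a b. S a \<bullet> b = a \<bullet> S b) \<and> (\<forall>a. L a \<in> sf_tangent K (\<phi> u)) \<and> (\<forall>a. metric_K K (m u) (L a) = 0)"

lemma tubeD:
  assumes "tube K M \<phi> W m U P Q"
  shows "local_parametrization M \<phi> W" "open W" "open U" "\<phi> ` W = M \<inter> U"
    "\<And>u. u \<in> W \<Longrightarrow> (\<phi> has_derivative frechet_derivative \<phi> (at u)) (at u)"
    "\<And>u. u \<in> W \<Longrightarrow> (m has_derivative frechet_derivative m (at u)) (at u)"
    "\<And>u. u \<in> W \<Longrightarrow> m u \<in> sf_tangent K (\<phi> u)" "\<And>u. u \<in> W \<Longrightarrow> metric_K K (m u) (m u) = 1"
    "\<And>u h. u \<in> W \<Longrightarrow> metric_K K (m u) (frechet_derivative \<phi> (at u) h) = 0"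
    "\<And>u. u \<in> W \<Longrightarrow> \<phi> u \<in> M"
proof -
  show lp: "local_parametrization M \<phi> W" using assms by (simp add: tube_def)
  show "open W" using lp by (rule local_parametrizationD(1))
  show "open U" "\<phi> ` W = M \<inter> U" "\<And>u. u \<in> W \<Longrightarrow> m u \<in> sf_tangent K (\<phi> u)" "\<And>u. u \<in> W \<Longrightarrow> metric_K K (m u) (m u) = 1"
    "\<And>u h. u \<in> W \<Longrightarrow> metric_K K (m u) (frechet_derivative \<phi> (at u) h) = 0"
    using assms unfolding tube_def by blast+
  show "\<And>u. u \<in> W \<Longrightarrow> (\<phi> has_derivative frechet_derivative \<phi> (at u)) (at u)"
    by (rule local_parametrizationD(7)[OF lp])
  show "\<And>u. u \<in> W \<Longrightarrow> (m has_derivative frechet_derivative m (at u)) (at u)"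
    using assms by (simp add: tube_def frechet_derivative_works)
  show "\<And>u. u \<in> W \<Longrightarrow> \<phi> u \<in> M" using local_parametrizationD(4)[OF lp] by auto
qed

lemma chart_second_derivative:
  assumes \<phi>: "local_parametrization N \<phi> W" and u: "u \<in> W"
  obtains G where "\<And>k. ((\<lambda>x. frechet_derivative \<phi> (at x) k) has_derivative G k) (at u)"
proof -
  have "Ck_on (Suc (Suc 0)) \<phi> W" using local_parametrizationD(2)[OF \<phi>] unfolding smooth_on_def by blast
  then have "(\<lambda>x. frechet_derivative \<phi> (at x) k) differentiable (at u)" for k using u by simp
  then show ?thesis
    by (intro that[of "\<lambda>k. frechet_derivative (\<lambda>x. frechet_derivative \<phi> (at x) k) (at u)"])
      (simp add: frechet_derivative_works[symmetric])
qed

text \<open>For differentiating identities that hold along a whole chart, such as the length of the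
  normal or its orthogonality to M.\<close>

lemma has_derivative_locally_const:
  assumes f: "(f has_derivative f') (at u)" and W: "open W" "u \<in> W" and c: "\<And>x. x \<in> W \<Longrightarrow> f x = c"
  shows "f' h = 0"
proof -
  have "(f has_derivative (\<lambda>h. 0)) (at u)"
    by (rule has_derivative_transform_within_open[OF has_derivative_const W]) (simp add: c)
  from fun_cong[OF has_derivative_unique[OF f this]] show ?thesis .
qed

text \<open>Weingarten map. Unit length of m and its tangency to the space form show that the
  derivative of m is tangent to M. Differentiating the orthogonality of m to M expresses it through
  the second derivatives of the chart, whose symmetry makes \<open>S\<close> symmetric.\<close>

lemma ex_shape_frame:
  fixes \<phi> :: "real^'n::finite \<Rightarrow> real \<times> (real^('n option))"
  assumes K: "K \<in> {-1, 0, 1}" and M: "M \<subseteq> space_form K"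
    and \<tau>: "tube K M \<phi> W m U P Q" and u: "u \<in> W"
  obtains L J Ji S where "shape_frame K \<phi> m u L J Ji S"
proof -
  note \<tau>D = tubeD[OF \<tau>]
  let ?D = "frechet_derivative \<phi> (at u)"
  let ?P = "frechet_derivative m (at u)"
  have pS: "\<phi> x \<in> space_form K" if "x \<in> W" for x using \<tau>D(10) M that by blast
  have lD: "linear ?D" and lP: "linear ?P"
    using \<tau>D(5,6)[OF u] has_derivative_linear by blast+
  have iD: "inj ?D" by (rule local_parametrizationD(8)[OF \<tau>D(1) u])
  have tan: "range ?D \<subseteq> sf_tangent K (\<phi> u)"
  proof -
    have "range ?D \<subseteq> tangent_space (space_form K) (\<phi> u)"
      using M unfolding tangent_space_chart[OF \<tau>D(1) u, symmetric] tangent_space_def by blast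
    then show ?thesis by (simp add: tangent_space_space_form[OF K pS[OF u]])
  qed
  note deriv_0 = has_derivative_locally_const[OF _ \<tau>D(2) u]
  have Pm: "metric_K K (?P h) (m u) = 0" for h
    using deriv_0[OF has_derivative_metric_K[OF \<tau>D(6)[OF u] \<tau>D(6)[OF u]] \<tau>D(8), of h]
    by (simp add: metric_K_commute)
  \<comment> \<open>For K = 0 the first coordinate of m is constant. Otherwise the orthogonality of
    \<phi> and m is differentiated, where the other term vanishes because m is normal to M.\<close>
  have Pt: "?P h \<in> sf_tangent K (\<phi> u)" for h
  proof (cases "K = 0")
    case True
    have "((\<lambda>x. fst (m x)) has_derivative (\<lambda>h. fst (?P h))) (at u)"
      by (intro has_derivative_fst \<tau>D(6) u)
    moreover have "fst (m x) = 0" if "x \<in> W" for x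
      using \<tau>D(7)[OF that] sf_tangent_0 pS[OF that] True by blast
    ultimately have "fst (?P h) = 0" by (rule deriv_0)
    then show ?thesis using sf_tangent_0 pS[OF u] True by blast
  next
    case False
    then have K': "K \<in> {-1, 1}" using K by auto
    have "metric_K K (\<phi> x) (m x) = 0" if "x \<in> W" for x
      using \<tau>D(7)[OF that] sf_tangent_metric[OF K'] by blast
    from deriv_0[OF has_derivative_metric_K[OF \<tau>D(5)[OF u] \<tau>D(6)[OF u]] this, of h]
    have "metric_K K (\<phi> u) (?P h) = 0" using \<tau>D(9)[OF u, of h] by (simp add: metric_K_commute)
    then show ?thesis using sf_tangent_metric[OF K'] by blast
  qed
  have PD: "\<exists>k. ?P h = ?D k" for h
  proof -
    obtain k b where kb: "?P h = ?D k + b *\<^sub>R m u"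
      using sf_tangent_decomp[OF K pS[OF u] lD iD tan \<tau>D(7,8)[OF u] \<tau>D(9)[OF u] Pt, of h] by blast
    have "metric_K K (?D k) (m u) = 0" using \<tau>D(9)[OF u, of k] by (simp add: metric_K_commute)
    then have "b = 0" using Pm[of h] \<tau>D(8)[OF u] by (simp add: kb metric_K_bilinear)
    then show ?thesis using kb by auto
  qed
  obtain L :: "real^'n \<Rightarrow> real \<times> (real^('n option))" and J Ji where L: "linear L" "linear J" "linear Ji" "\<And>a b. metric_K K (L a) (L b) = a \<bullet> b" "\<And>h. ?D h = L (J h)"
    "\<And>h. Ji (J h) = h" "\<And>h. J (Ji h) = h" "\<And>a. L a \<in> range ?D"
    by (rule ex_isometric_factorization[OF K pS[OF u] lD iD tan]) (rule that, assumption+)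
  define S where "S a = (\<chi> i. metric_K K (?P (Ji a)) (L (axis i 1)))" for a
  have PS: "?P h = L (S (J h))" for h
  proof -
    obtain k where k: "?P h = ?D k" using PD by blast
    have "S (J h) = J k" by (simp add: S_def L k vec_eq_iff inner_axis)
    then show ?thesis by (simp add: k L(5))
  qed
  have lS: "linear S"
    by (rule linearI) (simp_all add: S_def vec_eq_iff linear_add[OF L(3)] linear_cmul[OF L(3)] linear_add[OF lP]
        linear_cmul[OF lP] metric_K_bilinear)
  obtain G where G: "\<And>k. ((\<lambda>x. frechet_derivative \<phi> (at x) k) has_derivative G k) (at u)"
    using chart_second_derivative[OF \<tau>D(1) u] by blast
  have second: "metric_K K (?P h) (?D k) = - metric_K K (m u) (G k h)" for h k
    using deriv_0[OF has_derivative_metric_K[OF \<tau>D(6)[OF u] G] \<tau>D(9), of k h]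
    by (simp add: eq_neg_iff_add_eq_0 add.commute)
  have bl: "bounded_linear (metric_K K (m u))"
    by (rule bounded_bilinear.bounded_linear_right[OF bounded_bilinear_metric_K])
  have "metric_K K (m u) (G h k) = metric_K K (m u) (G k h)" for h k
    by (rule symmetric_second_derivative[OF \<tau>D(2) u, where F = "\<lambda>x. metric_K K (m u) (\<phi> x)"
          and F' = "\<lambda>x k. metric_K K (m u) (frechet_derivative \<phi> (at x) k)"])
      (use bounded_linear.has_derivative[OF bl] \<tau>D(5) G in blast)+
  then have sym0: "metric_K K (?P h) (?D k) = metric_K K (?D h) (?P k)" for h k
    using second[of h k] second[of k h] by (simp add: metric_K_commute)
  have "S a \<bullet> b = a \<bullet> S b" for a b
    using sym0[of "Ji a" "Ji b"] by (simp add: PS L)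
  moreover have "L a \<in> sf_tangent K (\<phi> u)" for a using L(8) tan by blast
  moreover have "metric_K K (m u) (L a) = 0" for a using L(8)[of a] \<tau>D(9)[OF u] by auto
  ultimately show ?thesis using that L lS PS unfolding shape_frame_def by blast
qed

lemma lin_density_isometric:
  fixes L :: "real^'k::finite \<Rightarrow> real \<times> 'v::euclidean_space"
  assumes "\<And>a b. metric_K K (L a) (L b) = a \<bullet> b"
  shows "lin_density K L = 1"
proof -
  have "(\<chi> i j. metric_K K (L (axis i 1)) (L (axis j 1)) :: real^'k^'k) = mat 1"
    by (simp add: assms vec_eq_iff mat_def inner_axis_axis)
  then show ?thesis by (simp add: lin_density_def)
qed

lemma shape_frame_volume_density:
  assumes "shape_frame K \<phi> m u L J Ji S"
  shows "volume_density K \<phi> u = \<bar>det (matrix J)\<bar>" "det (matrix J) \<noteq> 0"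
proof -
  have L: "linear L" "linear J" "linear Ji" "\<And>a b. metric_K K (L a) (L b) = a \<bullet> b"
    "\<And>h. frechet_derivative \<phi> (at u) h = L (J h)" "\<And>h. Ji (J h) = h"
    using assms by (auto simp: shape_frame_def)
  have "frechet_derivative \<phi> (at u) = (\<lambda>h. L (J h))" using L(5) by auto
  then show "volume_density K \<phi> u = \<bar>det (matrix J)\<bar>"
    by (simp add: volume_density_eq lin_density_comp[OF L(1,2)] lin_density_isometric L(4))
  have "inj J" using L(6) by (metis injI)
  then show "det (matrix J) \<noteq> 0" using det_nz_iff_inj[OF L(2)] by simp
qed


section \<open>The normal map: its Jacobian, and the second variation of the distance\<close>

lemma has_derivative_tail_vec: "(tail_vec has_derivative tail_vec) F"
  by (rule bounded_linear_imp_has_derivative[OF bounded_linear_tail_vec])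

text \<open>The last coordinate \<open>z $ None\<close> is the distance travelled along the inward normal.\<close>

definition normal_map ::
  "real \<Rightarrow> (real^'n::finite \<Rightarrow> real \<times> (real^('n option))) \<Rightarrow> (real^'n \<Rightarrow> real \<times> (real^('n option))) \<Rightarrow>
    real^('n option) \<Rightarrow> real \<times> (real^('n option))" where
  "normal_map K \<phi> m z = geodesic K (\<phi> (tail_vec z)) (m (tail_vec z)) (- (z $ None))"

text \<open>Product rule for c \<phi> - s m. In a frame the first two summands amount to L (c I - s
  S) J; the last is the velocity of the inward geodesic.\<close>

definition normal_map_deriv ::
  "real \<Rightarrow> (real^'n::finite \<Rightarrow> real \<times> (real^('n option))) \<Rightarrow> (real^'n \<Rightarrow> real \<times> (real^('n option))) \<Rightarrow>
    real^('n option) \<Rightarrow> real^('n option) \<Rightarrow> real \<times> (real^('n option))" where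
  "normal_map_deriv K \<phi> m z w =
     c_K K (z $ None) *\<^sub>R frechet_derivative \<phi> (at (tail_vec z)) (tail_vec w)
     - s_K K (z $ None) *\<^sub>R frechet_derivative m (at (tail_vec z)) (tail_vec w)
     + (w $ None) *\<^sub>R (- (K * s_K K (z $ None)) *\<^sub>R \<phi> (tail_vec z) - c_K K (z $ None) *\<^sub>R m (tail_vec z))"

lemma normal_map_has_derivative:
  assumes K: "K \<in> {-1, 0, 1}" and \<tau>: "tube K M \<phi> W m U P Q" and z: "tail_vec z \<in> W"
  shows "(normal_map K \<phi> m has_derivative normal_map_deriv K \<phi> m z) (at z)"
proof -
  note \<tau>D = tubeD[OF \<tau>]
  have s: "((\<lambda>z. s_K K (z $ None)) has_derivative (\<lambda>w. c_K K (z $ None) * (w $ None))) (at z)"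
  proof -
    have "((s_K K) has_derivative (*) (c_K K (z $ None))) (at (z $ None))"
      using has_real_derivative_s_K[OF DERIV_ident, of K "z $ None" UNIV] by (simp add: has_field_derivative_def)
    from has_derivative_compose[OF bounded_linear_imp_has_derivative[OF bounded_linear_vec_nth] this]
    show ?thesis .
  qed
  have c: "((\<lambda>z. c_K K (z $ None)) has_derivative (\<lambda>w. - K * s_K K (z $ None) * (w $ None))) (at z)"
  proof -
    have "((c_K K) has_derivative (*) (- K * s_K K (z $ None))) (at (z $ None))"
      using has_real_derivative_c_K[OF K DERIV_ident, of "z $ None" UNIV] by (simp add: has_field_derivative_def)
    from has_derivative_compose[OF bounded_linear_imp_has_derivative[OF bounded_linear_vec_nth] this]
    show ?thesis .
  qed
  have \<phi>: "((\<lambda>z. \<phi> (tail_vec z)) has_derivative (\<lambda>w. frechet_derivative \<phi> (at (tail_vec z)) (tail_vec w))) (at z)"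
    by (rule has_derivative_compose[OF has_derivative_tail_vec \<tau>D(5)[OF z]])
  have m: "((\<lambda>z. m (tail_vec z)) has_derivative (\<lambda>w. frechet_derivative m (at (tail_vec z)) (tail_vec w))) (at z)"
    by (rule has_derivative_compose[OF has_derivative_tail_vec \<tau>D(6)[OF z]])
  have "((\<lambda>z. c_K K (z $ None) *\<^sub>R \<phi> (tail_vec z) - s_K K (z $ None) *\<^sub>R m (tail_vec z)) has_derivative
    normal_map_deriv K \<phi> m z) (at z)"
    by (rule has_derivative_eq_rhs[OF has_derivative_diff[OF has_derivative_scaleR[OF c \<phi>] has_derivative_scaleR[OF s m]]])
      (auto simp: normal_map_deriv_def algebra_simps)
  then show ?thesis by (simp add: normal_map_def[abs_def] geodesic_def)
qed

text \<open>The velocity \<open>\<eta>\<close> of the inward geodesic is a unit vector orthogonal to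
  the range of \<open>L\<close>, so the derivative is an isometry \<open>L'\<close> composed with a
  block matrix with blocks (c I - s S) J and 1.\<close>

lemma normal_map_density:
  fixes \<phi> :: "real^'n::finite \<Rightarrow> real \<times> (real^('n option))"
  assumes K: "K \<in> {-1, 0, 1}" and M: "M \<subseteq> space_form K"
    and \<tau>: "tube K M \<phi> W m U P Q" and z: "tail_vec z \<in> W"
    and fr: "shape_frame K \<phi> m (tail_vec z) L J Ji S"
  shows "lin_density K (normal_map_deriv K \<phi> m z) =
    \<bar>det (matrix (\<lambda>a. c_K K (z $ None) *\<^sub>R a - s_K K (z $ None) *\<^sub>R S a))\<bar> * volume_density K \<phi> (tail_vec z)"
proof -
  note \<tau>D = tubeD[OF \<tau>]
  define c where "c = c_K K (z $ None)"
  define s where "s = s_K K (z $ None)"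
  define u where "u = tail_vec z"
  define T where "T a = c *\<^sub>R a - s *\<^sub>R S a" for a
  define \<eta> where "\<eta> = - (K * s) *\<^sub>R \<phi> u - c *\<^sub>R m u"
  define L' where "L' w = L (tail_vec w) + (w $ None) *\<^sub>R \<eta>" for w
  define J' where "J' w = cons_vec (T (J (tail_vec w))) (w $ None)" for w
  have u: "u \<in> W" using z by (simp add: u_def)
  have L: "linear L" "linear J" "linear S" "\<And>a b. metric_K K (L a) (L b) = a \<bullet> b"
    "\<And>h. frechet_derivative \<phi> (at u) h = L (J h)" "\<And>h. frechet_derivative m (at u) h = L (S (J h))"
    "\<And>a. L a \<in> sf_tangent K (\<phi> u)" "\<And>a. metric_K K (m u) (L a) = 0"
    using fr by (auto simp: shape_frame_def u_def)
  have pS: "\<phi> u \<in> space_form K" using \<tau>D(10)[OF u] M by blast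
  \<comment> \<open>The factor K makes these identities valid for K = 0 as well.\<close>
  have K\<phi>: "K * metric_K K (\<phi> u) (L a) = 0" "K * metric_K K (\<phi> u) (m u) = 0" "K * K * metric_K K (\<phi> u) (\<phi> u) = K" for a
  proof -
    show "K * metric_K K (\<phi> u) (L a) = 0" "K * metric_K K (\<phi> u) (m u) = 0" "K * K * metric_K K (\<phi> u) (\<phi> u) = K"
      using K sf_tangent_metric[of K "L a" "\<phi> u"] sf_tangent_metric[of K "m u" "\<phi> u"] L(7)[of a] \<tau>D(7)[OF u] space_form_metric[OF _ pS]
      by (cases "K = 0"; force)+
  qed
  have lT: "linear T"
    by (rule linearI) (simp_all add: T_def linear_add[OF L(3)] linear_cmul[OF L(3)] algebra_simps)
  have lt: "linear (tail_vec :: real^('n option) \<Rightarrow> real^'n)" by (rule bounded_linear.linear[OF bounded_linear_tail_vec])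
  have lL': "linear L'"
    by (rule linearI) (simp_all add: L'_def linear_add[OF L(1)] linear_cmul[OF L(1)] linear_add[OF lt] linear_cmul[OF lt] algebra_simps)
  have lJ': "linear J'"
  proof (rule linearI)
    show "J' (a + b) = J' a + J' b" "J' (r *\<^sub>R a) = r *\<^sub>R J' a" for a b r
      unfolding J'_def linear_add[OF lt] linear_cmul[OF lt] linear_add[OF L(2)] linear_cmul[OF L(2)] linear_add[OF lT] linear_cmul[OF lT]
      using linear_add[OF linear_cons_vec, of "(T (J (tail_vec a)), a $ None)" "(T (J (tail_vec b)), b $ None)"]
        linear_cmul[OF linear_cons_vec, of r "(T (J (tail_vec a)), a $ None)"] by simp_all
  qed
  have iso: "metric_K K (L' a) (L' b) = a \<bullet> b" for a b
  proof -
    have L\<eta>: "metric_K K (L x) \<eta> = 0" for x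
      using K\<phi>(1)[of x] L(8)[of x] by (auto simp: \<eta>_def metric_K_bilinear metric_K_commute[of K "L x"])
    then have \<eta>L: "metric_K K \<eta> (L x) = 0" for x by (simp add: metric_K_commute)
    have "metric_K K \<eta> \<eta> = s\<^sup>2 * (K * K * metric_K K (\<phi> u) (\<phi> u)) + 2 * s * c * (K * metric_K K (\<phi> u) (m u)) + c\<^sup>2"
      using \<tau>D(8)[OF u] by (simp add: \<eta>_def metric_K_bilinear metric_K_commute[of K "m u" "\<phi> u"] power2_eq_square algebra_simps)
    then have "metric_K K \<eta> \<eta> = 1"
      using cs_K_square[OF K, of "z $ None"] unfolding K\<phi> by (simp add: c_def s_def mult.commute)
    moreover have "a \<bullet> b = tail_vec a \<bullet> tail_vec b + a $ None * b $ None"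
      by (simp add: inner_vec_def UNIV_option_conv sum.reindex)
    ultimately show ?thesis
      by (simp add: L'_def metric_K_bilinear L(4) L\<eta> \<eta>L)
  qed
  have "normal_map_deriv K \<phi> m z = (\<lambda>w. L' (J' w))"
    unfolding normal_map_deriv_def[abs_def] c_def[symmetric] s_def[symmetric] u_def[symmetric] L(5,6) L'_def J'_def
    by (simp add: T_def \<eta>_def linear_diff[OF L(1)] linear_cmul[OF L(1)])
  then have "lin_density K (normal_map_deriv K \<phi> m z) = \<bar>det (matrix J')\<bar>"
    by (simp add: lin_density_comp[OF lL' lJ'] lin_density_isometric iso)
  also have "matrix J' = (\<chi> i j. case i of None \<Rightarrow> (if j = None then 1 else 0)
            | Some i' \<Rightarrow> (case j of None \<Rightarrow> 0 | Some j' \<Rightarrow> matrix (\<lambda>a. T (J a)) $ i' $ j'))"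
  proof -
    have t: "tail_vec (axis (Some j) 1) = axis j (1::real)" "tail_vec (axis None 1) = (0 :: real^'n)" for j :: 'n
      by (auto simp: vec_eq_iff axis_def)
    have axis_nth_None: "axis (Some j) 1 $ None = (0::real)" "axis None 1 $ None = (1::real)" for j :: 'n
      by (auto simp: axis_def)
    have T0: "T (J 0) = 0" by (simp add: linear_0[OF L(2)] linear_0[OF lT])
    show ?thesis
      by (auto simp: vec_eq_iff matrix_def J'_def t T0 axis_nth_None split: option.split)
  qed
  also have "det \<dots> = det (matrix (\<lambda>a. T (J a)))" by (rule det_cons_block)
  also have "matrix (\<lambda>a. T (J a)) = matrix T ** matrix J"
    using matrix_compose[OF L(2) lT] by (simp add: o_def)
  finally show ?thesis
    using shape_frame_volume_density(1)[OF fr] by (simp add: det_mul abs_mult T_def[abs_def] c_def s_def)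
qed

text \<open>Second derivative test for the squared chord to x along a straight line in the chart:
  half of the second derivative is |D h|^2 - <x - \<phi>, G h h>, with G the second derivative of
  the chart. The component of x - \<phi> along m contributes S, the one along \<phi> the factor 1 -
  c.\<close>

lemma normal_map_minimum_psd:
  assumes K: "K \<in> {-1, 0, 1}" and M: "M \<subseteq> space_form K"
    and \<tau>: "tube K M \<phi> W m U P Q" and u: "u \<in> W" and fr: "shape_frame K \<phi> m u L J Ji S"
    and min: "\<And>q. q \<in> M \<Longrightarrow> qdist K (geodesic K (\<phi> u) (m u) (- t)) (\<phi> u) \<le> qdist K (geodesic K (\<phi> u) (m u) (- t)) q"
  shows "0 \<le> (c_K K t *\<^sub>R a - s_K K t *\<^sub>R S a) \<bullet> a"
proof -
  note \<tau>D = tubeD[OF \<tau>]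
  have L: "linear L" "linear J" "linear S" "\<And>a b. metric_K K (L a) (L b) = a \<bullet> b"
    "\<And>h. frechet_derivative \<phi> (at u) h = L (J h)" "\<And>h. frechet_derivative m (at u) h = L (S (J h))"
    "\<And>h. Ji (J h) = h" "\<And>h. J (Ji h) = h"
    using fr by (auto simp: shape_frame_def)
  note deriv_0 = has_derivative_locally_const
  define c where "c = c_K K t"
  define s where "s = s_K K t"
  define h where "h = Ji a"
  define x where "x = geodesic K (\<phi> u) (m u) (- t)"
  define D where "D v = frechet_derivative \<phi> (at v)" for v
  have x: "x = c *\<^sub>R \<phi> u - s *\<^sub>R m u" by (simp add: x_def geodesic_def c_def s_def)
  obtain G where G: "\<And>k. ((\<lambda>x. D x k) has_derivative G k) (at u)"
    using chart_second_derivative[OF \<tau>D(1) u] unfolding D_def by blast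
  obtain e0 where e0: "e0 > 0" "ball u e0 \<subseteq> W" using \<tau>D(2) u by (meson open_contains_ball)
  \<comment> \<open>The added 1 covers the case h = 0.\<close>
  define e where "e = e0 / (norm h + 1)"
  have e: "e > 0" using e0 by (simp add: e_def add_nonneg_pos)
  have inW: "u + \<rho> *\<^sub>R h \<in> W" if "\<bar>\<rho>\<bar> < e" for \<rho>
  proof -
    have "\<bar>\<rho>\<bar> * norm h \<le> \<bar>\<rho>\<bar> * (norm h + 1)" by (intro mult_left_mono) auto
    also have "\<dots> < e0" using that by (simp add: e_def pos_less_divide_eq add_nonneg_pos)
    finally show ?thesis using e0(2) by (auto simp: dist_norm)
  qed
  have line: "((\<lambda>\<rho>. u + \<rho> *\<^sub>R h) has_derivative (\<lambda>\<rho>. \<rho> *\<^sub>R h)) (at \<rho>)" for \<rho>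
    by (auto intro!: derivative_eq_intros)
  define f where "f \<rho> = qdist K x (\<phi> (u + \<rho> *\<^sub>R h))" for \<rho>
  define f' where "f' \<rho> = - 2 * metric_K K (x - \<phi> (u + \<rho> *\<^sub>R h)) (D (u + \<rho> *\<^sub>R h) h)" for \<rho>
  have d\<phi>: "((\<lambda>\<rho>. x - \<phi> (u + \<rho> *\<^sub>R h)) has_derivative (\<lambda>\<sigma>. - (\<sigma> *\<^sub>R D (u + \<rho> *\<^sub>R h) h))) (at \<rho>)" if "\<bar>\<rho>\<bar> < e" for \<rho>
  proof -
    note d = \<tau>D(5)[OF inW[OF that]]
    have "((\<lambda>\<rho>. x - \<phi> (u + \<rho> *\<^sub>R h)) has_derivative (\<lambda>\<sigma>. 0 - D (u + \<rho> *\<^sub>R h) (\<sigma> *\<^sub>R h))) (at \<rho>)"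
      unfolding D_def by (intro has_derivative_diff has_derivative_const has_derivative_compose[OF line d])
    then show ?thesis using has_derivative_linear[OF d] by (simp add: D_def linear_cmul)
  qed
  have f: "(f has_real_derivative f' \<rho>) (at \<rho>)" if "\<bar>\<rho>\<bar> < e" for \<rho>
    unfolding has_field_derivative_def f_def qdist_def
    by (rule has_derivative_eq_rhs[OF has_derivative_metric_K[OF d\<phi>[OF that] d\<phi>[OF that]]])
      (auto simp: f'_def metric_K_bilinear metric_K_commute algebra_simps)
  have dD: "((\<lambda>\<rho>. D (u + \<rho> *\<^sub>R h) h) has_derivative (\<lambda>\<sigma>. \<sigma> *\<^sub>R G h h)) (at 0)"
  proof -
    have "((\<lambda>\<rho>. D (u + \<rho> *\<^sub>R h) h) has_derivative (\<lambda>\<sigma>. G h (\<sigma> *\<^sub>R h))) (at 0)"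
      using has_derivative_compose[OF line[of 0], of "\<lambda>x. D x h" "G h"] G by simp
    then show ?thesis using has_derivative_linear[OF G] by (simp add: linear_cmul)
  qed
  have "(f' has_real_derivative 2 * (metric_K K (D u h) (D u h) - metric_K K (x - \<phi> u) (G h h))) (at 0)"
  proof -
    have "(f' has_derivative (\<lambda>\<sigma>. - 2 * (metric_K K (x - \<phi> (u + 0 *\<^sub>R h)) (\<sigma> *\<^sub>R G h h) +
       metric_K K (- (\<sigma> *\<^sub>R D (u + 0 *\<^sub>R h) h)) (D (u + 0 *\<^sub>R h) h)))) (at 0)"
      unfolding f'_def[abs_def] using e
      by (intro has_derivative_mult_right has_derivative_metric_K d\<phi> dD) auto
    then show ?thesis
      unfolding has_field_derivative_def
      by (rule has_derivative_eq_rhs) (auto simp: metric_K_bilinear algebra_simps)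
  qed
  moreover have "f 0 \<le> f \<rho>" if "\<bar>\<rho>\<bar> < e" for \<rho>
    using min[OF \<tau>D(10)[OF inW[OF that]]] by (simp add: f_def x_def)
  ultimately have "0 \<le> 2 * (metric_K K (D u h) (D u h) - metric_K K (x - \<phi> u) (G h h))"
    using second_derivative_nonneg_at_minimum[OF e f] by blast
  moreover have "metric_K K (D u h) (D u h) = a \<bullet> a" by (simp add: D_def L h_def)
  moreover have "metric_K K (x - \<phi> u) (G h h) = (1 - c) * (a \<bullet> a) + s * (S a \<bullet> a)"
  proof -
    have m: "metric_K K (m u) (G h h) = - (S a \<bullet> a)"
    proof -
      have "metric_K K (m u) (G h h) + metric_K K (frechet_derivative m (at u) h) (D u h) = 0"
        by (rule deriv_0[OF has_derivative_metric_K[OF \<tau>D(6)[OF u] G] \<tau>D(2) u, where c = 0]) (simp add: D_def \<tau>D(9))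
      then show ?thesis by (simp add: D_def L h_def)
    qed
    \<comment> \<open>For K = 0 the factor 1 - c is 0. Otherwise \<phi> has constant square K, and
      two differentiations give <\<phi>, G h h> = - |D h|^2.\<close>
    have p: "(1 - c) * metric_K K (\<phi> u) (G h h) = - (1 - c) * (a \<bullet> a)"
    proof (cases "K = 0")
      case True
      then show ?thesis by (simp add: c_def c_K_def)
    next
      case False
      then have K': "K \<in> {-1, 1}" using K by auto
      have pS: "\<phi> v \<in> space_form K" if "v \<in> W" for v using \<tau>D(10)[OF that] M by blast
      have "metric_K K (\<phi> v) (D v h) = 0" if v: "v \<in> W" for v
      proof -
        have "metric_K K (\<phi> v) (D v h) + metric_K K (D v h) (\<phi> v) = 0"
          unfolding D_def
          by (rule deriv_0[OF has_derivative_metric_K[OF \<tau>D(5)[OF v] \<tau>D(5)[OF v]] \<tau>D(2) v, where c = K])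
            (simp add: space_form_metric[OF K' pS])
        then show ?thesis by (simp add: metric_K_commute)
      qed
      from this have "metric_K K (\<phi> u) (G h h) + metric_K K (D u h) (D u h) = 0"
        by (rule deriv_0[OF has_derivative_metric_K[OF \<tau>D(5)[OF u, folded D_def] G] \<tau>D(2) u, where c = 0])
      then have "metric_K K (\<phi> u) (G h h) = - (a \<bullet> a)" by (simp add: D_def L h_def)
      then show ?thesis by (simp add: algebra_simps)
    qed
    have "metric_K K (x - \<phi> u) (G h h) = - ((1 - c) * metric_K K (\<phi> u) (G h h)) - s * metric_K K (m u) (G h h)"
      by (simp add: x metric_K_bilinear algebra_simps)
    then show ?thesis unfolding p m by (simp add: algebra_simps)
  qed
  ultimately show ?thesis by (simp add: c_def s_def inner_diff_left algebra_simps)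
qed

section \<open>The second fundamental form of the boundary in frames\<close>

context bounded_domain
begin

text \<open>A tube oriented so that \<open>m\<close> is the outward normal; the neighbourhood and
  its sides are rarely needed and stay behind the quantifiers.\<close>

definition inner_tube where
  "inner_tube \<phi> W m \<longleftrightarrow> (\<exists>U P Q. tube K M \<phi> W m U P Q \<and> P \<inter> \<Omega> = {} \<and> Q \<subseteq> \<Omega>)"

lemma inner_tubeD:
  assumes "inner_tube \<phi> W m"
  shows "local_parametrization M \<phi> W" "open W"
    "\<And>u. u \<in> W \<Longrightarrow> (\<phi> has_derivative frechet_derivative \<phi> (at u)) (at u)"
    "\<And>u. u \<in> W \<Longrightarrow> (m has_derivative frechet_derivative m (at u)) (at u)"
    "\<And>u. u \<in> W \<Longrightarrow> m u \<in> sf_tangent K (\<phi> u)" "\<And>u. u \<in> W \<Longrightarrow> metric_K K (m u) (m u) = 1"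
    "\<And>u h. u \<in> W \<Longrightarrow> metric_K K (m u) (frechet_derivative \<phi> (at u) h) = 0"
    "\<And>u. u \<in> W \<Longrightarrow> \<phi> u \<in> M"
    "\<And>u. u \<in> W \<Longrightarrow> outward_normal K \<Omega> M (\<phi> u) = m u"
  using assms tubeD[of K M \<phi> W m] outward_normal_tube unfolding inner_tube_def by metis+

lemma inner_tube_shape_frame:
  assumes t: "inner_tube \<phi> W m" and u: "u \<in> W"
  obtains L J Ji S where "shape_frame K \<phi> m u L J Ji S"
  using t ex_shape_frame[OF K M_subset _ u] unfolding inner_tube_def by metis

text \<open>The derivative within M is an unspecified choice off the tangent space. Composition with
  the chart, where derivatives are unique, determines its values on tangent vectors.\<close>

lemma normal_derivative:
  assumes t: "inner_tube \<phi> W m" and u: "u \<in> W"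
  shows "frechet_derivative (outward_normal K \<Omega> M) (at (\<phi> u) within M) (frechet_derivative \<phi> (at u) h)
    = frechet_derivative m (at u) h"
proof -
  note tD = inner_tubeD[OF t]
  let ?\<nu> = "outward_normal K \<Omega> M"
  obtain U P Q where "tube K M \<phi> W m U P Q" using t unfolding inner_tube_def by metis
  note U = tubeD(3,4)[OF this]
  have W: "at u within W = at u" by (rule at_within_open[OF u tD(2)])
  have "\<phi> u \<in> M \<inter> U" unfolding U(2)[symmetric] using u by (rule imageI)
  then have "\<phi> u \<in> U" by (rule IntD2)
  then obtain d where d: "d > 0" "ball (\<phi> u) d \<subseteq> U" using openE[OF U(1)] by metis
  obtain l where l: "(chart_inv \<phi> W has_derivative l) (at (\<phi> u) within M)"
    by (rule chart_inv_has_derivative[OF tD(1) u])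
  have "((\<lambda>p. m (chart_inv \<phi> W p)) has_derivative (\<lambda>v. frechet_derivative m (at u) (l v))) (at (\<phi> u) within M)"
    using tD(4)[OF u] by (intro has_derivative_compose[OF l]) (simp add: chart_inv(1)[OF tD(1) u])
  moreover have "d > 0" by (rule d)
  moreover have "m (chart_inv \<phi> W p) = ?\<nu> p" if p: "p \<in> M" "dist p (\<phi> u) < d" for p
  proof -
    have "p \<in> \<phi> ` W" using p d(2) U(2) by (auto simp: dist_commute)
    then show ?thesis using tD(9)[OF chart_inv(3)[OF tD(1)]] chart_inv(2)[OF tD(1)] by simp
  qed
  ultimately have "(?\<nu> has_derivative (\<lambda>v. frechet_derivative m (at u) (l v))) (at (\<phi> u) within M)"
    by (rule has_derivative_transform_within[OF _ _ tD(8)[OF u]])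
  then have \<nu>: "(?\<nu> has_derivative frechet_derivative ?\<nu> (at (\<phi> u) within M)) (at (\<phi> u) within M)"
    using frechet_derivative_works by (auto simp: differentiable_def)
  have "((\<lambda>x. ?\<nu> (\<phi> x)) has_derivative (\<lambda>h. frechet_derivative ?\<nu> (at (\<phi> u) within M) (frechet_derivative \<phi> (at u) h))) (at u within W)"
    by (rule has_derivative_in_compose[OF has_derivative_at_withinI[OF tD(3)[OF u]] has_derivative_subset[OF \<nu>]])
      (use tD(8) in auto)
  then have "((\<lambda>x. ?\<nu> (\<phi> x)) has_derivative (\<lambda>h. frechet_derivative ?\<nu> (at (\<phi> u) within M) (frechet_derivative \<phi> (at u) h))) (at u)"
    unfolding W .
  then have "(m has_derivative (\<lambda>h. frechet_derivative ?\<nu> (at (\<phi> u) within M) (frechet_derivative \<phi> (at u) h))) (at u)"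
    by (rule has_derivative_transform_within_open[OF _ tD(2) u]) (simp add: tD(9))
  from fun_cong[OF has_derivative_unique[OF this tD(4)[OF u]]] show ?thesis .
qed

text \<open>The basis in \<open>trace_on\<close> is an unspecified choice; pulled back by the
  isometry \<open>L\<close> it is an orthonormal basis of R^n, where the trace does not depend on
  it. The projection \<open>tangential\<close> changes the derivative by a multiple of \<phi> u that
  pairs to 0 with tangent vectors.\<close>

lemma mean_curvature_shape_frame:
  assumes t: "inner_tube \<phi> W m" and u: "u \<in> W" and fr: "shape_frame K \<phi> m u L J Ji S"
  shows "mean_curvature K \<Omega> M (\<phi> u) = trace (matrix S) / CARD('n)"
proof -
  note tD = inner_tubeD[OF t]
  let ?D = "frechet_derivative \<phi> (at u)"
  let ?A = "second_fundamental_form K \<Omega> M (\<phi> u)"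
  have L: "linear L" "linear J" "linear S" "\<And>a b. metric_K K (L a) (L b) = a \<bullet> b"
    "\<And>h. ?D h = L (J h)" "\<And>h. frechet_derivative m (at u) h = L (S (J h))"
    "\<And>h. J (Ji h) = h" "\<And>a. L a \<in> sf_tangent K (\<phi> u)"
    using fr by (auto simp: shape_frame_def)
  have A: "?A (L a) (L b) = S a \<bullet> b" for a b
  proof -
    have "frechet_derivative (outward_normal K \<Omega> M) (at (\<phi> u) within M) (L a) = L (S a)"
      using normal_derivative[OF t u, of "Ji a"] by (simp add: L)
    moreover have "K * metric_K K (\<phi> u) (L b) = 0"
      using K L(8)[of b] sf_tangent_metric[of K "L b" "\<phi> u"] by (cases "K = 0") auto
    ultimately show ?thesis
      by (auto simp: second_fundamental_form_def covariant_derivative_def tangential_def metric_K_bilinear L(4))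
  qed
  have TM: "tangent_space M (\<phi> u) = range L"
  proof -
    have "range ?D = L ` range J" by (auto simp: L(5))
    moreover have "range J = UNIV" using L(7) by (metis surjI)
    ultimately show ?thesis by (simp add: tangent_space_chart[OF tD(1) u])
  qed
  define B where "B = (SOME B. orthonormal_basis K (range L) B)"
  have inj: "inj L"
  proof (subst linear_injective_0[OF L(1)], intro allI impI)
    fix v assume "L v = 0"
    then show "v = 0" using L(4)[of v v] by (simp add: metric_K_bilinear)
  qed
  have "orthonormal_basis K (range L) (L ` Basis)"
    unfolding orthonormal_basis_def
    by (auto simp: span_linear_image[OF L(1)] L(4) inner_Basis inj_eq[OF inj])
  then have "orthonormal_basis K (range L) B" unfolding B_def by (rule someI)
  then have B: "finite B" "span B = range L" "\<And>e f. e \<in> B \<Longrightarrow> f \<in> B \<Longrightarrow> metric_K K e f = (if e = f then 1 else 0)"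
    by (auto simp: orthonormal_basis_def)
  define C where "C = L -` B"
  have BC: "B = L ` C" using span_superset[of B] B(2) by (auto simp: C_def)
  have "finite C" unfolding C_def by (rule finite_vimageI[OF B(1) inj])
  moreover have "orthonormal C"
    unfolding orthonormal_def using B(3) by (auto simp: C_def inj_eq[OF inj] simp flip: L(4))
  moreover have "span C = UNIV"
  proof -
    have "L ` span C = range L" using B(2) unfolding BC span_linear_image[OF L(1)] .
    then show ?thesis using inj by (simp add: inj_image_eq_iff)
  qed
  ultimately have "(\<Sum>b\<in>C. S b \<bullet> b) = trace (matrix S)" by (rule trace_orthonormal[OF L(3)])
  moreover have "(\<Sum>e\<in>B. ?A e e) = (\<Sum>b\<in>C. S b \<bullet> b)"
    unfolding BC by (subst sum.reindex) (auto simp: A intro: inj_on_subset[OF inj])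
  ultimately show ?thesis by (simp add: mean_curvature_def trace_on_def TM B_def)
qed

end

section \<open>Nearest points on the boundary\<close>

text \<open>Velocity of the geodesic at time t; with it a geodesic can be restarted at any of its
  points.\<close>

definition geodesic_dir :: "real \<Rightarrow> real \<times> 'v::euclidean_space \<Rightarrow> real \<times> 'v \<Rightarrow> real \<Rightarrow> real \<times> 'v" where
  "geodesic_dir K p v t = (- (K * s_K K t)) *\<^sub>R p + c_K K t *\<^sub>R v"

lemma K_metric_point:
  assumes K: "K \<in> {-1, 0, 1}" and p: "p \<in> space_form K"
  shows "K * metric_K K p p = K\<^sup>2" "v \<in> sf_tangent K p \<Longrightarrow> K * metric_K K p v = 0"
    and "v \<in> sf_tangent K p \<Longrightarrow> K * metric_K K v p = 0"
  using K space_form_metric[OF _ p] sf_tangent_metric[of K v p]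
  by (auto simp: power2_eq_square metric_K_commute[of K v p])

lemma geodesic_dir:
  assumes K: "K \<in> {-1, 0, 1}" and p: "p \<in> space_form K" and v: "v \<in> sf_tangent K p" "metric_K K v v = 1"
  shows geodesic_dir_tangent: "geodesic_dir K p v t \<in> sf_tangent K (geodesic K p v t)"
    and geodesic_dir_unit: "metric_K K (geodesic_dir K p v t) (geodesic_dir K p v t) = 1"
    and geodesic_add: "geodesic K p v (t + a) = geodesic K (geodesic K p v t) (geodesic_dir K p v t) a"
proof -
  define s where "s = s_K K t"
  define c where "c = c_K K t"
  have cs: "c\<^sup>2 + K * s\<^sup>2 = 1" unfolding c_def s_def by (rule cs_K_square[OF K])
  note m = K_metric_point[OF K p]
  have "metric_K K (geodesic_dir K p v t) (geodesic_dir K p v t)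
    = K * s\<^sup>2 * (K * metric_K K p p) - 2 * s * c * (K * metric_K K p v) + c\<^sup>2 * metric_K K v v"
    by (simp add: geodesic_dir_def metric_K_bilinear s_def c_def metric_K_commute[of K v p] power2_eq_square algebra_simps)
  also have "\<dots> = 1" using cs K by (auto simp: m(1) m(2)[OF v(1)] v(2) power2_eq_square)
  finally show "metric_K K (geodesic_dir K p v t) (geodesic_dir K p v t) = 1" .
  show "geodesic_dir K p v t \<in> sf_tangent K (geodesic K p v t)"
  proof (cases "K = 0")
    case True
    then have "geodesic K p v t \<in> space_form 0" using geodesic_in_space_form[OF K p v] by simp
    moreover have "fst v = 0" using sf_tangent_0 p v(1) True by blast
    ultimately show ?thesis unfolding True by (simp add: sf_tangent_0 geodesic_dir_def)
  next
    case False
    then have K': "K \<in> {-1, 1}" using K by auto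
    have "metric_K K p v = 0" "metric_K K p p = K" using sf_tangent_metric[OF K'] v(1) space_form_metric[OF K' p] by blast+
    then have "metric_K K (geodesic K p v t) (geodesic_dir K p v t) = 0"
      using v(2) K' by (auto simp: geodesic_def geodesic_dir_def metric_K_bilinear metric_K_commute[of K v p] algebra_simps)
    then show ?thesis using sf_tangent_metric[OF K'] by blast
  qed
  show "geodesic K p v (t + a) = geodesic K (geodesic K p v t) (geodesic_dir K p v t) a"
    by (simp add: geodesic_def geodesic_dir_def s_K_add[OF K] c_K_add[OF K] algebra_simps)
qed

lemma tangent_space_mono:
  assumes "M \<subseteq> N"
  shows "tangent_space M p \<subseteq> tangent_space N p"
proof
  fix X assume "X \<in> tangent_space M p"
  then obtain \<gamma> where "\<forall>t :: real. \<gamma> t \<in> M" "\<gamma> 0 = p" "(\<gamma> has_vector_derivative X) (at 0)"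
    unfolding tangent_space_def mem_Collect_eq by metis
  then show "X \<in> tangent_space N p"
    using assms unfolding tangent_space_def mem_Collect_eq by (intro exI[of _ \<gamma>]) auto
qed

lemma qdist_geodesic_geodesic:
  assumes K: "K \<in> {-1, 0, 1}" and p: "p \<in> space_form K" and v: "v \<in> sf_tangent K p" "metric_K K v v = 1"
  shows "qdist K (geodesic K p v a) (geodesic K p v b) = 4 * (s_K K ((b - a) / 2))\<^sup>2"
proof -
  have "geodesic K p v b = geodesic K (geodesic K p v a) (geodesic_dir K p v a) (b - a)"
    using geodesic_add[OF K p v, of a "b - a"] by simp
  then show ?thesis
    using qdist_geodesic[OF K geodesic_in_space_form[OF K p v] geodesic_dir_tangent[OF K p v] geodesic_dir_unit[OF K p v]]
    by simp
qed

text \<open>Turns comparisons of lengths of geodesics into comparisons of \<open>qdist\<close>; on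
  the sphere this works only up to the antipode.\<close>

lemma s_K_half_sq_less:
  assumes K: "K \<in> {-1, 0, 1}" and "0 \<le> a" "a < b" "K = 1 \<Longrightarrow> b \<le> pi"
  shows "4 * (s_K K (a / 2))\<^sup>2 < 4 * (s_K K (b / 2))\<^sup>2"
proof -
  have "0 \<le> s_K K (a / 2)" using assms by (intro s_K_half_nonneg) auto
  moreover have "s_K K (a / 2) < s_K K (b / 2)" using assms by (intro s_K_half_less) auto
  ultimately show ?thesis by (simp add: power_strict_mono)
qed

lemma continuous_on_qdist:
  fixes f g :: "'a::topological_space \<Rightarrow> real \<times> 'v::euclidean_space"
  shows "continuous_on A f \<Longrightarrow> continuous_on A g \<Longrightarrow> continuous_on A (\<lambda>x. qdist K (f x) (g x))"
  unfolding qdist_def by (intro continuous_on_metric_K continuous_intros)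

context bounded_domain
begin

definition inward :: "real \<times> (real^('n option)) \<Rightarrow> real \<Rightarrow> real \<times> (real^('n option))" where
  "inward p t = geodesic K p (outward_normal K \<Omega> M p) (- t)"

text \<open>Ties are allowed: a point may have several feet, and counting it repeatedly does no harm
  to an upper bound for the volume.\<close>

definition foot :: "real \<times> (real^('n option)) \<Rightarrow> real \<Rightarrow> bool" where
  "foot p t \<longleftrightarrow> p \<in> M \<and> (\<forall>q\<in>M. qdist K (inward p t) p \<le> qdist K (inward p t) q)"

lemma ex_inner_tube_chart:
  assumes p: "p \<in> M"
  obtains \<phi> W m u where "inner_tube \<phi> W m" "u \<in> W" "\<phi> u = p"
  using ex_inner_tube[OF p] that unfolding inner_tube_def by (metis imageE)

lemma normal_vector:
  assumes p: "p \<in> M"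
  shows "outward_normal K \<Omega> M p \<in> sf_tangent K p"
    "metric_K K (outward_normal K \<Omega> M p) (outward_normal K \<Omega> M p) = 1"
    "\<exists>\<epsilon>>0. \<forall>t. 0 < t \<and> t < \<epsilon> \<longrightarrow> geodesic K p (outward_normal K \<Omega> M p) t \<notin> \<Omega>"
proof -
  obtain \<phi> W m u where t: "inner_tube \<phi> W m" and u: "u \<in> W" and p': "\<phi> u = p" by (rule ex_inner_tube_chart[OF p])
  note tD = inner_tubeD[OF t]
  show "outward_normal K \<Omega> M p \<in> sf_tangent K p"
    "metric_K K (outward_normal K \<Omega> M p) (outward_normal K \<Omega> M p) = 1"
    using tD(5,6,9)[OF u] p' by auto
  obtain U P Q where "tube K M \<phi> W m U P Q" and P: "P \<inter> \<Omega> = {}" using t unfolding inner_tube_def by metis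
  then have "\<exists>\<epsilon>>0. \<forall>t. 0 < t \<and> t < \<epsilon> \<longrightarrow> geodesic K (\<phi> u) (m u) t \<in> P \<and> geodesic K (\<phi> u) (m u) (- t) \<in> Q"
    using u unfolding tube_def by blast
  then show "\<exists>\<epsilon>>0. \<forall>t. 0 < t \<and> t < \<epsilon> \<longrightarrow> geodesic K p (outward_normal K \<Omega> M p) t \<notin> \<Omega>"
    using P tD(9)[OF u] unfolding p' by (metis disjoint_iff)
qed

lemma inward_in_space_form: "p \<in> M \<Longrightarrow> inward p t \<in> space_form K"
  unfolding inward_def using M_subset normal_vector by (intro geodesic_in_space_form[OF K]) auto

text \<open>After removal of the multiple of \<phi> u that makes x tangent to the space form, what
  remains is orthogonal to M as well, hence a multiple of the normal.\<close>

lemma inner_tube_critical: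
  assumes t: "inner_tube \<phi> W m" and u: "u \<in> W" and x: "x \<in> space_form K"
    and d0: "\<And>h. metric_K K (x - \<phi> u) (frechet_derivative \<phi> (at u) h) = 0"
  shows "\<exists>b. x = sf_coeff K (\<phi> u) x *\<^sub>R \<phi> u + b *\<^sub>R m u"
proof -
  note tD = inner_tubeD[OF t]
  let ?D = "frechet_derivative \<phi> (at u)"
  have pS: "\<phi> u \<in> space_form K" using tD(8)[OF u] M_subset by blast
  have tan: "range ?D \<subseteq> sf_tangent K (\<phi> u)"
  proof -
    have "range ?D \<subseteq> tangent_space (space_form K) (\<phi> u)"
      using tangent_space_mono[OF M_subset] unfolding tangent_space_chart[OF tD(1) u, symmetric] .
    then show ?thesis by (simp add: tangent_space_space_form[OF K pS])
  qed
  define a where "a = sf_coeff K (\<phi> u) x"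
  obtain k b where kb: "x - a *\<^sub>R \<phi> u = ?D k + b *\<^sub>R m u"
    using sf_tangent_decomp[OF K pS _ local_parametrizationD(8)[OF tD(1) u] tan tD(5,6)[OF u] tD(7)[OF u] sf_coeff[OF K pS x]]
      has_derivative_linear[OF tD(3)[OF u]] unfolding a_def by metis
  have "(a - 1) * metric_K K (\<phi> u) (?D k) = 0"
  proof (cases "K = 0")
    case True
    then show ?thesis by (simp add: a_def sf_coeff_def)
  next
    case False
    moreover have "?D k \<in> sf_tangent K (\<phi> u)" using tan by blast
    ultimately show ?thesis using K_metric_point(2)[OF K pS] by simp
  qed
  moreover have "metric_K K (x - a *\<^sub>R \<phi> u) (?D k) = metric_K K (x - \<phi> u) (?D k) - (a - 1) * metric_K K (\<phi> u) (?D k)"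
    by (simp add: metric_K_bilinear algebra_simps)
  ultimately have "metric_K K (?D k + b *\<^sub>R m u) (?D k) = 0" using d0[of k] by (simp add: kb)
  then have "metric_K K (?D k) (?D k) = 0" using tD(7)[OF u, of k] by (simp add: metric_K_bilinear)
  moreover have "?D k \<in> sf_tangent K (\<phi> u)" using tan by blast
  ultimately have "?D k = 0" using metric_sf_tangent(2)[OF K pS] by blast
  then have "x = a *\<^sub>R \<phi> u + b *\<^sub>R m u" using kb by (simp add: algebra_simps)
  then show ?thesis unfolding a_def by blast
qed

lemma has_derivative_chart_qdist:
  assumes t: "inner_tube \<phi> W m" and u: "u \<in> W"
  shows "((\<lambda>v. qdist K x (\<phi> v)) has_derivative (\<lambda>h. - 2 * metric_K K (x - \<phi> u) (frechet_derivative \<phi> (at u) h))) (at u)"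
proof -
  have d: "((\<lambda>v. x - \<phi> v) has_derivative (\<lambda>h. - frechet_derivative \<phi> (at u) h)) (at u)"
    using has_derivative_diff[OF has_derivative_const inner_tubeD(3)[OF t u]] by simp
  show ?thesis
    unfolding qdist_def
    by (rule has_derivative_eq_rhs[OF has_derivative_metric_K[OF d d]]) (auto simp: metric_K_bilinear metric_K_commute)
qed

text \<open>A nearest boundary point exists by compactness and is critical for \<open>qdist\<close>,
  so x lies on the normal geodesic through it. It is not on the outer half: the segment from p to x
  would avoid M after its start, although it leaves p outside the domain and ends inside.\<close>

lemma ex_foot:
  assumes x: "x \<in> \<Omega>"
  obtains p t where "foot p t" "x = inward p t" "0 < t" "K = 1 \<longrightarrow> t \<le> pi"
proof -
  have xS: "x \<in> space_form K" using x \<Omega>_subset by blast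
  have "continuous_on M (qdist K x)" by (intro continuous_on_qdist continuous_intros)
  then obtain p where p: "p \<in> M" "\<And>q. q \<in> M \<Longrightarrow> qdist K x p \<le> qdist K x q"
    using continuous_attains_inf[OF hypersurface(2,4)] by blast
  obtain \<phi> W m u where t: "inner_tube \<phi> W m" and u: "u \<in> W" and p': "\<phi> u = p" by (rule ex_inner_tube_chart[OF p(1)])
  note tD = inner_tubeD[OF t]
  let ?\<nu> = "outward_normal K \<Omega> M p"
  have pS: "p \<in> space_form K" using p(1) M_subset by blast
  note \<nu> = normal_vector[OF p(1)]
  have "metric_K K (x - \<phi> u) (frechet_derivative \<phi> (at u) h) = 0" for h
  proof -
    have "(\<lambda>h. - 2 * metric_K K (x - \<phi> u) (frechet_derivative \<phi> (at u) h)) = (\<lambda>v. 0)"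
      by (rule differential_zero_maxmin[OF u tD(2) has_derivative_chart_qdist[OF t u]])
        (use p(2) p' tD(8) in auto)
    from fun_cong[OF this, of h] show ?thesis by simp
  qed
  then obtain b where b: "x = sf_coeff K p x *\<^sub>R p + b *\<^sub>R ?\<nu>"
    using inner_tube_critical[OF t u xS] tD(9)[OF u] p' by metis
  then obtain t' where t': "sf_coeff K p x = c_K K t'" "b = s_K K t'" "K = 1 \<longrightarrow> \<bar>t'\<bar> \<le> pi"
    using ex_polar_angle[OF K pS \<nu>(1,2), of "sf_coeff K p x" b] xS by metis
  have x': "x = geodesic K p ?\<nu> t'" using b t' by (simp add: geodesic_def)
  have "t' \<noteq> 0" using x' x p(1) M_disjoint by auto
  moreover have "\<not> 0 < t'"
  proof
    assume pos: "0 < t'"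
    have conn: "connected (geodesic K p ?\<nu> ` {0<..t'})"
      by (intro connected_continuous_image continuous_on_geodesic) simp
    \<comment> \<open>Such a boundary point would be closer to x than p.\<close>
    have "geodesic K p ?\<nu> \<sigma> \<notin> M" if \<sigma>: "0 < \<sigma>" "\<sigma> \<le> t'" for \<sigma>
    proof
      assume "geodesic K p ?\<nu> \<sigma> \<in> M"
      from p(2)[OF this] have "4 * (s_K K (t' / 2))\<^sup>2 \<le> 4 * (s_K K ((t' - \<sigma>) / 2))\<^sup>2"
        using qdist_geodesic_geodesic[OF K pS \<nu>(1,2), of 0 t'] qdist_geodesic_geodesic[OF K pS \<nu>(1,2), of \<sigma> t']
        by (simp add: x' qdist_commute)
      moreover have "4 * (s_K K ((t' - \<sigma>) / 2))\<^sup>2 < 4 * (s_K K (t' / 2))\<^sup>2"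
        using \<sigma> t'(3) by (intro s_K_half_sq_less[OF K]) auto
      ultimately show False by simp
    qed
    then have "geodesic K p ?\<nu> ` {0<..t'} \<subseteq> \<Omega> \<or> geodesic K p ?\<nu> ` {0<..t'} \<inter> \<Omega> = {}"
      using geodesic_in_space_form[OF K pS \<nu>(1,2)] by (intro connected_dichotomy[OF conn]) auto
    moreover have "x \<in> geodesic K p ?\<nu> ` {0<..t'}" using x' pos by simp
    ultimately have sub: "geodesic K p ?\<nu> ` {0<..t'} \<subseteq> \<Omega>" using x by blast
    obtain e where e: "e > 0" "\<And>t. 0 < t \<and> t < e \<Longrightarrow> geodesic K p ?\<nu> t \<notin> \<Omega>" using \<nu>(3) by blast
    have "0 < min t' (e / 2)" "min t' (e / 2) < e" using pos e by auto
    then have "geodesic K p ?\<nu> (min t' (e / 2)) \<notin> \<Omega>" using e(2) by blast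
    moreover have "geodesic K p ?\<nu> (min t' (e / 2)) \<in> geodesic K p ?\<nu> ` {0<..t'}" using pos e(1) by (intro imageI) auto
    ultimately show False using sub by blast
  qed
  ultimately have t0: "0 < - t'" by simp
  have xi: "x = inward p (- t')" by (simp add: inward_def x')
  have "foot p (- t')" unfolding foot_def using p by (simp flip: xi)
  then show ?thesis using xi t0 t'(3) by (intro that) auto
qed

lemma normal_map_inward:
  "inner_tube \<phi> W m \<Longrightarrow> tail_vec z \<in> W \<Longrightarrow> normal_map K \<phi> m z = inward (\<phi> (tail_vec z)) (z $ None)"
  by (simp add: normal_map_def inward_def inner_tubeD(9))

lemma foot_psd:
  assumes t: "inner_tube \<phi> W m" and u: "u \<in> W" and fr: "shape_frame K \<phi> m u L J Ji S" and f: "foot (\<phi> u) t"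
  shows "0 \<le> (c_K K t *\<^sub>R a - s_K K t *\<^sub>R S a) \<bullet> a"
proof -
  obtain U P Q where \<tau>: "tube K M \<phi> W m U P Q" using t unfolding inner_tube_def by metis
  show ?thesis
    by (rule normal_map_minimum_psd[OF K M_subset \<tau> u fr])
      (use f in \<open>auto simp: foot_def inward_def inner_tubeD(9)[OF t u]\<close>)
qed

lemma shape_linear:
  fixes S :: "real^'n \<Rightarrow> real^'n"
  assumes fr: "shape_frame K \<phi> m u L J Ji S"
  shows "linear (\<lambda>a. c *\<^sub>R a - s *\<^sub>R S a)"
    "(c *\<^sub>R a - s *\<^sub>R S a) \<bullet> b = a \<bullet> (c *\<^sub>R b - s *\<^sub>R S b)"
    "trace (matrix (\<lambda>a. c *\<^sub>R a - s *\<^sub>R S a)) = c * CARD('n) - s * trace (matrix S)"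
proof -
  have S: "linear S" "\<And>a b. S a \<bullet> b = a \<bullet> S b" using fr by (auto simp: shape_frame_def)
  show "linear (\<lambda>a. c *\<^sub>R a - s *\<^sub>R S a)"
    by (rule linearI) (simp_all add: linear_add[OF S(1)] linear_cmul[OF S(1)] algebra_simps)
  show "(c *\<^sub>R a - s *\<^sub>R S a) \<bullet> b = a \<bullet> (c *\<^sub>R b - s *\<^sub>R S b)"
    by (simp add: inner_diff_left inner_diff_right S(2))
  show "trace (matrix (\<lambda>a. c *\<^sub>R a - s *\<^sub>R S a)) = c * CARD('n) - s * trace (matrix S)"
    by (simp add: trace_def matrix_def sum_subtractf sum_distrib_left)
qed

lemma shape_eq_scaleR:
  fixes S :: "real^'n \<Rightarrow> real^'n"
  assumes fr: "shape_frame K \<phi> m u L J Ji S"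
    and H: "trace (matrix S) = CARD('n) * cot_K K r" and r: "r \<in> radii K"
    and psd: "\<And>a. 0 \<le> (c_K K r *\<^sub>R a - s_K K r *\<^sub>R S a) \<bullet> a"
  shows "c_K K r *\<^sub>R a - s_K K r *\<^sub>R S a = 0"
proof (rule det_psd_bounds(4)[OF shape_linear(1,2)[OF fr] psd])
  show "trace (matrix (\<lambda>a. c_K K r *\<^sub>R a - s_K K r *\<^sub>R S a)) = 0"
    using s_K_pos[OF r] by (simp add: shape_linear(3)[OF fr] H cot_K_def)
qed

end

section \<open>Nearest points under constant mean curvature\<close>

locale constant_mean_curvature = bounded_domain K \<Omega> M
  for K :: real and \<Omega> M :: "(real \<times> (real^('n::finite option))) set" +
  fixes r :: real
  assumes r: "r \<in> radii K" and H: "\<And>p. p \<in> M \<Longrightarrow> mean_curvature K \<Omega> M p = cot_K K r"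
begin

lemma trace_shape:
  fixes S :: "real^'n \<Rightarrow> real^'n"
  assumes t: "inner_tube \<phi> W m" and u: "u \<in> W" and fr: "shape_frame K \<phi> m u L J Ji S"
  shows "trace (matrix S) = CARD('n) * cot_K K r"
    "trace (matrix (\<lambda>a. c_K K t *\<^sub>R a - s_K K t *\<^sub>R S a)) / CARD('n) = s_K K (r - t) / s_K K r"
proof -
  show *: "trace (matrix S) = CARD('n) * cot_K K r"
    using mean_curvature_shape_frame[OF t u fr] H[OF inner_tubeD(8)[OF t u]] by (simp add: field_simps)
  have "trace (matrix (\<lambda>a. c_K K t *\<^sub>R a - s_K K t *\<^sub>R S a)) / CARD('n) = c_K K t - cot_K K r * s_K K t"
    by (simp add: shape_linear(3)[OF fr] * field_simps)
  then show "trace (matrix (\<lambda>a. c_K K t *\<^sub>R a - s_K K t *\<^sub>R S a)) / CARD('n) = s_K K (r - t) / s_K K r"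
    by (simp add: cot_K_diff[OF K r])
qed

lemma foot_le:
  assumes f: "foot p t" and t: "K = 1 \<Longrightarrow> t \<le> pi"
  shows "t \<le> r"
proof (rule ccontr)
  assume "\<not> t \<le> r"
  \<comment> \<open>With t \<le> pi and r > 0, the difference t - r stays below pi on the
    sphere.\<close>
  then have "s_K K (t - r) > 0" using t radii_pos[OF r] by (intro s_K_pos) (auto simp: radii_def)
  then have neg: "s_K K (r - t) / s_K K r < 0"
    using s_K_pos[OF r] cs_K_minus(1)[of K "t - r"] by (simp add: divide_neg_pos)
  have "p \<in> M" using f by (simp add: foot_def)
  then obtain \<phi> W m u where tu: "inner_tube \<phi> W m" and u: "u \<in> W" and p: "\<phi> u = p" by (rule ex_inner_tube_chart)
  obtain L J Ji S where fr: "shape_frame K \<phi> m u L J Ji S" by (rule inner_tube_shape_frame[OF tu u])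
  have "0 \<le> trace (matrix (\<lambda>a. c_K K t *\<^sub>R a - s_K K t *\<^sub>R S a))"
    by (rule det_psd_bounds(2)[OF shape_linear(1,2)[OF fr] foot_psd[OF tu u fr]]) (use f p in simp)
  then have "0 \<le> s_K K (r - t) / s_K K r" unfolding trace_shape(2)[OF tu u fr, symmetric] by simp
  then show False using neg by simp
qed

text \<open>Upper bound for the Jacobian factor at distance t, the n-th power of the mean of the
  eigenvalues; its integral over (0, r) is \<open>h_K K CARD('n) r\<close>.\<close>

definition profile :: "real \<Rightarrow> real" where
  "profile t = (s_K K (r - t) / s_K K r) ^ CARD('n)"

lemma foot_density_le:
  assumes t: "inner_tube \<phi> W m" and z: "tail_vec z \<in> W" and f: "foot (\<phi> (tail_vec z)) (z $ None)"
  shows "lin_density K (normal_map_deriv K \<phi> m z) \<le> profile (z $ None) * volume_density K \<phi> (tail_vec z)"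
proof -
  obtain L J Ji S where fr: "shape_frame K \<phi> m (tail_vec z) L J Ji S" by (rule inner_tube_shape_frame[OF t z])
  let ?T = "\<lambda>a. c_K K (z $ None) *\<^sub>R a - s_K K (z $ None) *\<^sub>R S a"
  obtain U P Q where \<tau>: "tube K M \<phi> W m U P Q" using t unfolding inner_tube_def by metis
  note b = det_psd_bounds[OF shape_linear(1,2)[OF fr] foot_psd[OF t z fr f]]
  have "\<bar>det (matrix ?T)\<bar> \<le> profile (z $ None)"
    using b(1,3) unfolding trace_shape(2)[OF t z fr] profile_def by simp
  moreover have "0 \<le> volume_density K \<phi> (tail_vec z)" by (simp add: shape_frame_volume_density(1)[OF fr])
  ultimately show ?thesis
    unfolding normal_map_density[OF K M_subset \<tau> z fr] by (rule mult_right_mono)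
qed

text \<open>Feet are known only for t < r, so semidefiniteness at t = r is reached by continuity in
  t.\<close>

lemma all_foot_imp_umbilic:
  assumes foot: "\<And>p t. p \<in> M \<Longrightarrow> 0 < t \<Longrightarrow> t < r \<Longrightarrow> foot p t"
    and t: "inner_tube \<phi> W m" and u: "u \<in> W" and fr: "shape_frame K \<phi> m u L J Ji S"
  shows "c_K K r *\<^sub>R a - s_K K r *\<^sub>R S a = 0"
proof (rule shape_eq_scaleR[OF fr trace_shape(1)[OF t u fr] r])
  fix a
  have "0 \<le> c_K K \<tau> * (a \<bullet> a) - s_K K \<tau> * (S a \<bullet> a)" if "\<tau> \<in> {0<..<r}" for \<tau>
    using foot_psd[OF t u fr foot[OF inner_tubeD(8)[OF t u]], of \<tau> a] that by (simp add: inner_diff_left)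
  moreover have "r \<in> closure {0<..<r}" using radii_pos[OF r] by simp
  moreover have "continuous_on (closure {0<..<r}) (\<lambda>\<tau>. c_K K \<tau> * (a \<bullet> a) - s_K K \<tau> * (S a \<bullet> a))"
    by (intro continuous_intros)
  ultimately have "0 \<le> c_K K r * (a \<bullet> a) - s_K K r * (S a \<bullet> a)"
    using continuous_ge_on_closure[of "{0<..<r}" "\<lambda>\<tau>. c_K K \<tau> * (a \<bullet> a) - s_K K \<tau> * (S a \<bullet> a)" r 0] by blast
  then show "0 \<le> (c_K K r *\<^sub>R a - s_K K r *\<^sub>R S a) \<bullet> a" by (simp add: inner_diff_left)
qed

lemma all_foot_imp_focal_point:
  assumes foot: "\<And>p t. p \<in> M \<Longrightarrow> 0 < t \<Longrightarrow> t < r \<Longrightarrow> foot p t"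
  obtains x0 where "\<And>p. p \<in> M \<Longrightarrow> inward p r = x0"
proof -
  have "(\<lambda>p. inward p r) constant_on M"
  proof (rule locally_constant_imp_constant[OF hypersurface(3)])
    fix p assume "p \<in> M"
    then obtain \<phi> W m u where t: "inner_tube \<phi> W m" and u: "u \<in> W" and p: "\<phi> u = p" by (rule ex_inner_tube_chart)
    note tD = inner_tubeD[OF t]
    obtain e where e: "e > 0" "ball u e \<subseteq> W" using openE[OF tD(2) u] by metis
    have lp: "local_parametrization M \<phi> (ball u e)" by (rule local_parametrization_subset[OF tD(1) open_ball e(2)])
    define f where "f v = c_K K r *\<^sub>R \<phi> v - s_K K r *\<^sub>R m v" for v
    have f: "f v = inward (\<phi> v) r" if "v \<in> W" for v
      by (simp add: f_def inward_def geodesic_def tD(9)[OF that])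
    have "(f has_derivative (\<lambda>h. 0)) (at v within ball u e)" if v: "v \<in> ball u e" for v
    proof -
      have vW: "v \<in> W" using v e by blast
      obtain L J Ji S where fr: "shape_frame K \<phi> m v L J Ji S" by (rule inner_tube_shape_frame[OF t vW])
      have L: "linear L" "frechet_derivative \<phi> (at v) h = L (J h)" "frechet_derivative m (at v) h = L (S (J h))" for h
        using fr by (auto simp: shape_frame_def)
      have "(f has_derivative (\<lambda>h. c_K K r *\<^sub>R L (J h) - s_K K r *\<^sub>R L (S (J h)))) (at v)"
        unfolding f_def[abs_def] L(2,3)[symmetric]
        by (intro has_derivative_diff has_derivative_scaleR_right tD(3,4) vW)
      moreover have "c_K K r *\<^sub>R L (J h) - s_K K r *\<^sub>R L (S (J h)) = 0" for h
      proof -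
        have "c_K K r *\<^sub>R L (J h) - s_K K r *\<^sub>R L (S (J h)) = L (c_K K r *\<^sub>R J h - s_K K r *\<^sub>R S (J h))"
          by (simp add: linear_diff[OF L(1)] linear_cmul[OF L(1)])
        then show ?thesis by (simp only: all_foot_imp_umbilic[OF foot t vW fr] linear_0[OF L(1)])
      qed
      ultimately show ?thesis by (simp add: has_derivative_at_withinI)
    qed
    then obtain c where c: "\<And>v. v \<in> ball u e \<Longrightarrow> f v = c"
      using has_derivative_zero_constant[OF convex_ball, of u e f] by blast
    show "\<exists>T. openin (top_of_set M) T \<and> p \<in> T \<and> (\<forall>q\<in>T. inward q r = inward p r)"
    proof (intro exI[of _ "\<phi> ` ball u e"] conjI ballI)
      show "openin (top_of_set M) (\<phi> ` ball u e)" by (rule local_parametrizationD(3)[OF lp])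
      show "p \<in> \<phi> ` ball u e" using p e by force
      fix q assume "q \<in> \<phi> ` ball u e"
      then obtain v where v: "v \<in> ball u e" "q = \<phi> v" by blast
      have "f v = f u" using c v(1) e(1) by (metis centre_in_ball)
      then show "inward q r = inward p r" using f v e(2) u p by (metis subsetD)
    qed
  qed
  then show ?thesis using that unfolding constant_on_def by blast
qed

text \<open>The normal geodesic is restarted at the point reached after the inward distance r and
  run back towards p.\<close>

lemma inward_from_centre:
  assumes p: "p \<in> M"
  shows "inward p t = geodesic K (inward p r) (geodesic_dir K p (outward_normal K \<Omega> M p) (- r)) (r - t)"
    "geodesic_dir K p (outward_normal K \<Omega> M p) (- r) \<in> sf_tangent K (inward p r)"
    "metric_K K (geodesic_dir K p (outward_normal K \<Omega> M p) (- r)) (geodesic_dir K p (outward_normal K \<Omega> M p) (- r)) = 1"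
proof -
  have pS: "p \<in> space_form K" using p M_subset by blast
  note n = normal_vector(1,2)[OF p]
  show "inward p t = geodesic K (inward p r) (geodesic_dir K p (outward_normal K \<Omega> M p) (- r)) (r - t)"
    using geodesic_add[OF K pS n, of "- r" "r - t"] by (simp add: inward_def)
  show "geodesic_dir K p (outward_normal K \<Omega> M p) (- r) \<in> sf_tangent K (inward p r)"
    "metric_K K (geodesic_dir K p (outward_normal K \<Omega> M p) (- r)) (geodesic_dir K p (outward_normal K \<Omega> M p) (- r)) = 1"
    unfolding inward_def by (rule geodesic_dir_tangent[OF K pS n] geodesic_dir_unit[OF K pS n])+
qed

text \<open>One inclusion combines \<open>ex_foot\<close> with \<open>foot_le\<close>. For the
  other, every boundary point is at distance r from x0, so radial segments of length less than r
  avoid M and lie entirely inside or outside the domain. A single point of the domain shows that x0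
  is inside, and then so are all these segments.\<close>

lemma all_foot_imp_ball:
  assumes foot: "\<And>p t. p \<in> M \<Longrightarrow> 0 < t \<Longrightarrow> t < r \<Longrightarrow> foot p t"
  shows "is_geodesic_ball K \<Omega>"
proof -
  obtain x0 where x0: "\<And>p. p \<in> M \<Longrightarrow> inward p r = x0" using all_foot_imp_focal_point[OF foot] by blast
  obtain p0 where "p0 \<in> M" using hypersurface(4) by blast
  then have S0: "x0 \<in> space_form K" using x0 inward_in_space_form by metis
  note TS = tangent_space_space_form[OF K S0]
  have r0: "r > 0" by (rule radii_pos[OF r])
  have sub: "\<Omega> \<subseteq> geodesic_ball K x0 r"
  proof
    fix x assume "x \<in> \<Omega>"
    then obtain p t where pt: "foot p t" "x = inward p t" "0 < t" "K = 1 \<longrightarrow> t \<le> pi" by (rule ex_foot)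
    have "t \<le> r" by (rule foot_le[OF pt(1) pt(4)[rule_format]])
    have p: "p \<in> M" using pt(1) by (simp add: foot_def)
    then show "x \<in> geodesic_ball K x0 r"
      unfolding geodesic_ball_def TS mem_Collect_eq
      using inward_from_centre[OF p, unfolded x0[OF p]] \<open>t \<le> r\<close> pt(2,3)
      by (intro exI[of _ "r - t"] exI[of _ "geodesic_dir K p (outward_normal K \<Omega> M p) (- r)"]) auto
  qed
  have ball_M: "geodesic K x0 v \<tau> \<notin> M" if v: "v \<in> sf_tangent K x0" "metric_K K v v = 1" and \<tau>: "0 \<le> \<tau>" "\<tau> < r" for v \<tau>
  proof
    assume q: "geodesic K x0 v \<tau> \<in> M"
    have "qdist K x0 (geodesic K x0 v \<tau>) = 4 * (s_K K (r / 2))\<^sup>2"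
    proof -
      have "inward (geodesic K x0 v \<tau>) 0 = geodesic K x0 v \<tau>" by (simp add: inward_def)
      then show ?thesis
        using qdist_geodesic[OF K S0 inward_from_centre(2,3)[OF q, unfolded x0[OF q]], of r]
          inward_from_centre(1)[OF q, of 0, unfolded x0[OF q]] by simp
    qed
    moreover have "4 * (s_K K (\<tau> / 2))\<^sup>2 < 4 * (s_K K (r / 2))\<^sup>2"
      using \<tau> r by (intro s_K_half_sq_less[OF K]) (auto simp: radii_def)
    ultimately show False using qdist_geodesic[OF K S0 v, of \<tau>] by simp
  qed
  have seg: "geodesic K x0 v ` {0..t} \<subseteq> \<Omega> \<or> geodesic K x0 v ` {0..t} \<inter> \<Omega> = {}"
    if v: "v \<in> sf_tangent K x0" "metric_K K v v = 1" and t: "t < r" for v t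
  proof (rule connected_dichotomy)
    show "connected (geodesic K x0 v ` {0..t})"
      by (intro connected_continuous_image continuous_on_geodesic) simp
    show "geodesic K x0 v ` {0..t} \<subseteq> space_form K" using geodesic_in_space_form[OF K S0 v] by blast
    show "geodesic K x0 v ` {0..t} \<inter> M = {}" using ball_M[OF v] t by auto
  qed
  have x0in: "x0 \<in> \<Omega>"
  proof -
    obtain y where y: "y \<in> \<Omega>" using \<Omega>_nonempty by blast
    then obtain v t where vt: "y = geodesic K x0 v t" "v \<in> sf_tangent K x0" "metric_K K v v = 1" "0 \<le> t" "t < r"
      using sub unfolding geodesic_ball_def TS by blast
    have "y \<in> geodesic K x0 v ` {0..t}" using vt by simp
    then have "geodesic K x0 v ` {0..t} \<subseteq> \<Omega>" using seg[OF vt(2,3,5)] y by blast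
    moreover have "x0 \<in> geodesic K x0 v ` {0..t}" using vt(4) by (intro image_eqI[of _ _ 0]) auto
    ultimately show ?thesis by blast
  qed
  have "geodesic_ball K x0 r \<subseteq> \<Omega>"
  proof
    fix y assume "y \<in> geodesic_ball K x0 r"
    then obtain v t where vt: "y = geodesic K x0 v t" "v \<in> sf_tangent K x0" "metric_K K v v = 1" "0 \<le> t" "t < r"
      unfolding geodesic_ball_def TS by blast
    have "x0 \<in> geodesic K x0 v ` {0..t}" using vt(4) by (intro image_eqI[of _ _ 0]) auto
    then have "geodesic K x0 v ` {0..t} \<subseteq> \<Omega>" using seg[OF vt(2,3,5)] x0in by blast
    then show "y \<in> \<Omega>" using vt(1,4) by auto
  qed
  then show ?thesis unfolding is_geodesic_ball_def using sub S0 r0 by blast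
qed

end

section \<open>Geodesic balls\<close>

locale ball_domain = bounded_domain K \<Omega> M
  for K :: real and \<Omega> M :: "(real \<times> (real^('n::finite option))) set" +
  fixes x0 :: "real \<times> (real^('n option))" and r :: real
  assumes centre: "x0 \<in> space_form K" and radius: "r > 0" and ball: "\<Omega> = geodesic_ball K x0 r"
begin

lemma ball_iff: "y \<in> \<Omega> \<longleftrightarrow> (\<exists>v t. y = geodesic K x0 v t \<and> v \<in> sf_tangent K x0 \<and> metric_K K v v = 1 \<and> 0 \<le> t \<and> t < r)"
  unfolding ball geodesic_ball_def tangent_space_space_form[OF K centre] by blast

text \<open>A chart domain is a nonempty open subset of R^n with n \<ge> 1.\<close>

lemma M_infinite: "infinite M"
proof
  assume fin: "finite M"
  obtain p where "p \<in> M" using hypersurface(4) by blast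
  then obtain \<phi> W m u where t: "inner_tube \<phi> W m" and u: "u \<in> W" by (rule ex_inner_tube_chart)
  note lp = inner_tubeD(1)[OF t]
  have "finite W"
    using finite_subset[OF local_parametrizationD(4)[OF lp] fin] local_parametrizationD(6)[OF lp] by (rule finite_imageD)
  then have "W = {}" using inner_tubeD(2)[OF t] finite_imp_not_open by blast
  then show False using u by simp
qed

text \<open>A ball of radius at least pi on the sphere leaves out at most the antipode of its
  centre, but M is infinite.\<close>

lemma radius_in_radii: "r \<in> radii K"
proof (rule ccontr)
  assume "r \<notin> radii K"
  then have K1: "K = 1" and pi: "pi \<le> r" using radius by (auto simp: radii_def split: if_splits)
  have "M \<subseteq> {- x0}"
  proof
    fix p assume p: "p \<in> M"
    then have "p \<in> space_form K" using M_subset by blast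
    then obtain v t where vt: "v \<in> sf_tangent K x0" "metric_K K v v = 1" "0 \<le> t" "K = 1 \<longrightarrow> t \<le> pi" "p = geodesic K x0 v t"
      by (rule ex_geodesic[OF K centre]) (simp add: that)
    have "p \<notin> \<Omega>" using p M_disjoint by blast
    then have "\<not> t < r" using vt(1,2,3) unfolding ball_iff vt(5) by blast
    then have "t = pi" using vt(4) K1 pi by simp
    then show "p \<in> {- x0}" using vt(5) K1 by (simp add: geodesic_def c_K_def s_K_def)
  qed
  then show False using M_infinite finite_subset by blast
qed

lemma radius_pi: "K = 1 \<Longrightarrow> r < pi"
  using radius_in_radii by (simp add: radii_def)

text \<open>The distance is at least r because M misses the ball, and at most r because the closure
  of the ball lies in a closed sublevel set of \<open>qdist\<close>.\<close>

lemma qdist_boundary: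
  assumes p: "p \<in> M"
  obtains v where "v \<in> sf_tangent K x0" "metric_K K v v = 1" "p = geodesic K x0 v r"
proof -
  have pS: "p \<in> space_form K" using p M_subset by blast
  obtain v t where vt: "v \<in> sf_tangent K x0" "metric_K K v v = 1" "0 \<le> t" "K = 1 \<longrightarrow> t \<le> pi" "p = geodesic K x0 v t"
    by (rule ex_geodesic[OF K centre pS]) (simp add: that)
  have "p \<notin> \<Omega>" using p M_disjoint by blast
  then have ge: "\<not> t < r" using vt(1,2,3) unfolding ball_iff vt(5) by blast
  have "\<Omega> \<subseteq> {y. qdist K x0 y \<le> 4 * (s_K K (r / 2))\<^sup>2}"
  proof
    fix y assume "y \<in> \<Omega>"
    then obtain w \<tau> where w: "y = geodesic K x0 w \<tau>" "w \<in> sf_tangent K x0" "metric_K K w w = 1" "0 \<le> \<tau>" "\<tau> < r"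
      unfolding ball_iff by blast
    show "y \<in> {y. qdist K x0 y \<le> 4 * (s_K K (r / 2))\<^sup>2}"
      using s_K_half_sq_less[OF K w(4,5)] radius_pi unfolding w(1) mem_Collect_eq qdist_geodesic[OF K centre w(2,3)] by force
  qed
  moreover have "closed {y. qdist K x0 y \<le> 4 * (s_K K (r / 2))\<^sup>2}"
    by (intro closed_Collect_le continuous_on_qdist continuous_intros)
  ultimately have "closure \<Omega> \<subseteq> {y. qdist K x0 y \<le> 4 * (s_K K (r / 2))\<^sup>2}" by (rule closure_minimal)
  then have "4 * (s_K K (t / 2))\<^sup>2 \<le> 4 * (s_K K (r / 2))\<^sup>2"
    using p qdist_geodesic[OF K centre vt(1,2), of t] unfolding M_eq vt(5) by auto
  then have "\<not> r < t" using s_K_half_sq_less[OF K, of r t] radius vt(4) by fastforce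
  then have "t = r" using ge by simp
  then show ?thesis using that[OF vt(1,2)] vt(5) by simp
qed

text \<open>The normal is the radial velocity at time r. Expressed through p and the centre, without
  the direction \<open>v\<close>, it can be differentiated along M.\<close>

lemma outward_normal_ball:
  assumes p: "p \<in> M"
  shows "outward_normal K \<Omega> M p = (1 / s_K K r) *\<^sub>R (c_K K r *\<^sub>R p - x0)"
proof -
  obtain v where v: "v \<in> sf_tangent K x0" "metric_K K v v = 1" and p_eq: "p = geodesic K x0 v r" by (rule qdist_boundary[OF p])
  have pS: "p \<in> space_form K" using p M_subset by blast
  define n where "n = geodesic_dir K x0 v r"
  have s: "s_K K r > 0" by (rule s_K_pos[OF radius_in_radii])
  have n_eq: "n = (1 / s_K K r) *\<^sub>R (c_K K r *\<^sub>R p - x0)"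
  proof -
    have "c_K K r *\<^sub>R p - x0 = ((c_K K r)\<^sup>2 - 1) *\<^sub>R x0 + (s_K K r * c_K K r) *\<^sub>R v"
      by (simp add: p_eq geodesic_def power2_eq_square algebra_simps)
    also have "(c_K K r)\<^sup>2 - 1 = s_K K r * (- (K * s_K K r))"
      using cs_K_square[OF K, of r] by (simp add: power2_eq_square algebra_simps)
    finally have "c_K K r *\<^sub>R p - x0 = s_K K r *\<^sub>R n" by (simp add: n_def geodesic_dir_def algebra_simps)
    then show ?thesis using s by simp
  qed
  obtain \<phi> W m u where t: "inner_tube \<phi> W m" and u: "u \<in> W" and p': "\<phi> u = p" by (rule ex_inner_tube_chart[OF p])
  note tD = inner_tubeD[OF t]
  have "outward_normal K \<Omega> M (\<phi> u) = n"
  proof (rule outward_normal_unique[OF tD(1) u])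
    show "n \<in> sf_tangent K (\<phi> u)" "metric_K K n n = 1"
      unfolding p' n_def p_eq by (rule geodesic_dir_tangent[OF K centre v] geodesic_dir_unit[OF K centre v])+
    show "metric_K K n (frechet_derivative \<phi> (at u) h) = 0" for h
    proof -
      let ?Dh = "frechet_derivative \<phi> (at u) h"
      have "qdist K x0 (\<phi> w) = 4 * (s_K K (r / 2))\<^sup>2" if w: "w \<in> W" for w
      proof -
        obtain v' where "v' \<in> sf_tangent K x0" "metric_K K v' v' = 1" "\<phi> w = geodesic K x0 v' r"
          by (rule qdist_boundary[OF tD(8)[OF w]])
        then show ?thesis using qdist_geodesic[OF K centre] by simp
      qed
      then have "- 2 * metric_K K (x0 - \<phi> u) ?Dh = 0"
        by (rule has_derivative_locally_const[OF has_derivative_chart_qdist[OF t u] tD(2) u])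
      then have 1: "metric_K K (x0 - p) ?Dh = 0" by (simp add: p')
      have "?Dh \<in> tangent_space M p"
        unfolding p'[symmetric] tangent_space_chart[OF tD(1) u] by (rule rangeI)
      then have "?Dh \<in> tangent_space (space_form K) p" by (rule subsetD[OF tangent_space_mono[OF M_subset]])
      then have "?Dh \<in> sf_tangent K p" by (simp add: tangent_space_space_form[OF K pS])
      then have 2: "(c_K K r - 1) * metric_K K p ?Dh = 0"
        using K_metric_point(2)[OF K pS] by (cases "K = 0") (auto simp: c_K_def)
      have "metric_K K n ?Dh = (1 / s_K K r) * ((c_K K r - 1) * metric_K K p ?Dh - metric_K K (x0 - p) ?Dh)"
        by (simp add: n_eq metric_K_bilinear algebra_simps)
      then show ?thesis by (simp add: 1 2)
    qed
    \<comment> \<open>Keeps r - t \<ge> 0 and, on the sphere, r + t \<le> pi, the range in which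
      \<open>qdist\<close> is monotone.\<close>
    define e where "e = (if K = 1 then min r (pi - r) else r)"
    have e: "0 < e" "e \<le> r" "K = 1 \<Longrightarrow> e \<le> pi - r" using radius radius_pi by (auto simp: e_def)
    show "\<exists>\<epsilon>>0. \<forall>t. 0 < t \<and> t < \<epsilon> \<longrightarrow> geodesic K (\<phi> u) n t \<notin> \<Omega> \<and> geodesic K (\<phi> u) n (- t) \<in> \<Omega>"
    proof (intro exI[of _ e] conjI allI impI)
      fix t assume t: "0 < t \<and> t < e"
      have add: "geodesic K (\<phi> u) n a = geodesic K x0 v (r + a)" for a
        unfolding p' p_eq n_def by (rule geodesic_add[OF K centre v, symmetric])
      show "geodesic K (\<phi> u) n (- t) \<in> \<Omega>"
        unfolding add ball_iff using v t e(2) by (intro exI[of _ v] exI[of _ "r + - t"]) auto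
      show "geodesic K (\<phi> u) n t \<notin> \<Omega>"
      proof
        assume "geodesic K (\<phi> u) n t \<in> \<Omega>"
        then obtain w \<tau> where w: "geodesic K x0 v (r + t) = geodesic K x0 w \<tau>" "w \<in> sf_tangent K x0" "metric_K K w w = 1"
            "0 \<le> \<tau>" "\<tau> < r" unfolding add ball_iff by blast
        have "4 * (s_K K ((r + t) / 2))\<^sup>2 = 4 * (s_K K (\<tau> / 2))\<^sup>2"
          using qdist_geodesic[OF K centre v, of "r + t"] qdist_geodesic[OF K centre w(2,3), of \<tau>] w(1) by simp
        moreover have "4 * (s_K K (\<tau> / 2))\<^sup>2 < 4 * (s_K K ((r + t) / 2))\<^sup>2"
          using w t e by (intro s_K_half_sq_less[OF K]) auto
        ultimately show False by simp
      qed
    qed (rule e(1))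
  qed
  then show ?thesis by (simp add: p' n_eq)
qed

text \<open>In the formula for the normal the centre is constant, so dm = cot_K(r) d\<phi>.\<close>

lemma shape_ball:
  fixes S :: "real^'n \<Rightarrow> real^'n"
  assumes t: "inner_tube \<phi> W m" and u: "u \<in> W" and fr: "shape_frame K \<phi> m u L J Ji S"
  shows "S a = cot_K K r *\<^sub>R a"
proof -
  note tD = inner_tubeD[OF t]
  have L: "linear L" "\<And>a b. metric_K K (L a) (L b) = a \<bullet> b" "\<And>h. frechet_derivative \<phi> (at u) h = L (J h)"
    "\<And>h. frechet_derivative m (at u) h = L (S (J h))" "\<And>h. J (Ji h) = h"
    using fr by (auto simp: shape_frame_def)
  define n where "n v = (1 / s_K K r) *\<^sub>R (c_K K r *\<^sub>R \<phi> v - x0)" for v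
  have mn: "n v = m v" if "v \<in> W" for v
    using outward_normal_ball[OF tD(8)[OF that]] tD(9)[OF that] by (simp add: n_def)
  have "(n has_derivative (\<lambda>h. (1 / s_K K r) *\<^sub>R (c_K K r *\<^sub>R frechet_derivative \<phi> (at u) h - 0))) (at u)"
    unfolding n_def[abs_def]
    by (intro has_derivative_scaleR_right has_derivative_diff has_derivative_const tD(3) u)
  then have "(m has_derivative (\<lambda>h. (1 / s_K K r) *\<^sub>R (c_K K r *\<^sub>R frechet_derivative \<phi> (at u) h - 0))) (at u)"
    by (rule has_derivative_transform_within_open[OF _ tD(2) u mn])
  from fun_cong[OF has_derivative_unique[OF tD(4)[OF u] this], of "Ji a"]
  have "L (S a) = cot_K K r *\<^sub>R L a" by (simp add: L cot_K_def)
  then have "L (S a - cot_K K r *\<^sub>R a) = 0" by (simp add: linear_diff[OF L(1)] linear_cmul[OF L(1)])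
  then have "(S a - cot_K K r *\<^sub>R a) \<bullet> (S a - cot_K K r *\<^sub>R a) = 0"
    using L(2)[of "S a - cot_K K r *\<^sub>R a" "S a - cot_K K r *\<^sub>R a"] by (simp add: metric_K_bilinear)
  then show ?thesis by simp
qed

lemma mean_curvature_ball:
  assumes p: "p \<in> M"
  shows "mean_curvature K \<Omega> M p = cot_K K r"
proof -
  obtain \<phi> W m u where t: "inner_tube \<phi> W m" and u: "u \<in> W" and p': "\<phi> u = p" by (rule ex_inner_tube_chart[OF p])
  obtain L J Ji S where fr: "shape_frame K \<phi> m u L J Ji S" by (rule inner_tube_shape_frame[OF t u])
  have "S = (\<lambda>a. cot_K K r *\<^sub>R a)" using shape_ball[OF t u fr] by blast
  then have "trace (matrix S) = CARD('n) * cot_K K r" by (simp add: trace_def matrix_def)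
  then show ?thesis using mean_curvature_shape_frame[OF t u fr] by (simp add: p')
qed

text \<open>A ball is subject to the general estimate with its own radius, which yields the upper
  bound for its volume.\<close>

sublocale constant_mean_curvature K \<Omega> M r
  by unfold_locales (rule radius_in_radii mean_curvature_ball, assumption?)+

lemma inward_ball:
  assumes p: "p \<in> M"
  shows "inward p t = (s_K K (r - t) / s_K K r) *\<^sub>R p + (s_K K t / s_K K r) *\<^sub>R x0"
proof -
  have "inward p t = (c_K K t - cot_K K r * s_K K t) *\<^sub>R p + (s_K K t / s_K K r) *\<^sub>R x0"
    by (simp add: inward_def geodesic_def outward_normal_ball[OF p] cot_K_def algebra_simps)
  then show ?thesis by (simp add: cot_K_diff[OF K r])
qed

lemma inward_in_ball:
  assumes p: "p \<in> M" and t: "0 < t" "t \<le> r"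
  shows "inward p t \<in> \<Omega>" "qdist K x0 (inward p t) = 4 * (s_K K ((r - t) / 2))\<^sup>2"
proof -
  have x0: "inward p r = x0" using s_K_pos[OF r] by (simp add: inward_ball[OF p])
  note i = inward_from_centre[OF p, unfolded x0]
  show "inward p t \<in> \<Omega>" unfolding i(1)[of t] ball_iff
    by (rule exI[of _ "geodesic_dir K p (outward_normal K \<Omega> M p) (- r)"], rule exI[of _ "r - t"]) (use i(2,3) t in simp)
  show "qdist K x0 (inward p t) = 4 * (s_K K ((r - t) / 2))\<^sup>2"
    unfolding i(1)[of t] by (rule qdist_geodesic[OF K centre i(2,3)])
qed

text \<open>The distance to the centre determines t, and for fixed t < r the formula
  \<open>inward_ball\<close> can be solved for p.\<close>

lemma inward_inj:
  assumes p: "p \<in> M" "0 < t" "t < r" and q: "q \<in> M" "0 < t'" "t' < r" and eq: "inward p t = inward q t'"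
  shows "p = q \<and> t = t'"
proof -
  have d: "4 * (s_K K ((r - t) / 2))\<^sup>2 = 4 * (s_K K ((r - t') / 2))\<^sup>2"
    using inward_in_ball(2)[of p t] inward_in_ball(2)[of q t'] p q eq by simp
  have "r - t \<le> pi" "r - t' \<le> pi" if "K = 1" using radius_pi[OF that] p q by auto
  then have "\<not> r - t < r - t'" "\<not> r - t' < r - t"
    using s_K_half_sq_less[OF K, of "r - t" "r - t'"] s_K_half_sq_less[OF K, of "r - t'" "r - t"] p q d by auto
  then have tt: "t = t'" by simp
  have "0 < s_K K (r - t)" using p r by (intro s_K_pos radii_mono[OF r]) auto
  then have "p = q" using eq s_K_pos[OF r] unfolding inward_ball[OF p(1)] inward_ball[OF q(1)] tt by simp
  then show ?thesis using tt by blast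
qed

text \<open>Here c I - s S is a multiple of the identity, where the mean inequality is an
  equality.\<close>

lemma ball_density:
  assumes t: "inner_tube \<phi> W m" and z: "tail_vec z \<in> W" and z0: "0 < z $ None" "z $ None < r"
  shows "lin_density K (normal_map_deriv K \<phi> m z) = profile (z $ None) * volume_density K \<phi> (tail_vec z)"
proof -
  obtain L J Ji S where fr: "shape_frame K \<phi> m (tail_vec z) L J Ji S" by (rule inner_tube_shape_frame[OF t z])
  obtain U P Q where \<tau>: "tube K M \<phi> W m U P Q" using t unfolding inner_tube_def by metis
  define k where "k = s_K K (r - z $ None) / s_K K r"
  have "0 < s_K K (r - z $ None)" using z0 r by (intro s_K_pos radii_mono[OF r]) auto
  then have k: "k \<ge> 0" using s_K_pos[OF r] by (simp add: k_def)
  have "(\<lambda>a. c_K K (z $ None) *\<^sub>R a - s_K K (z $ None) *\<^sub>R S a) = (\<lambda>a. k *\<^sub>R a)"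
    using shape_ball[OF t z fr] by (simp add: k_def flip: cot_K_diff[OF K r]) (simp add: algebra_simps)
  moreover have "matrix (\<lambda>a. k *\<^sub>R a) = k *\<^sub>R (mat 1 :: real^'n^'n)"
    by (simp add: matrix_def mat_def vec_eq_iff axis_def)
  ultimately have "det (matrix (\<lambda>a. c_K K (z $ None) *\<^sub>R a - s_K K (z $ None) *\<^sub>R S a)) = k ^ CARD('n)"
    by (simp add: det_diagonal mat_def)
  then show ?thesis
    using k by (simp add: normal_map_density[OF K M_subset \<tau> z fr] profile_def k_def)
qed

end

section \<open>The Heintze--Karcher inequality and its equality case\<close>

text \<open>Locally closed sets. They are stable under intersections and continuous preimages, and
  their continuous images are Borel, as the images under the normal map have to be; images of
  general Borel sets need not be Borel.\<close>

definition open_Int_closed :: "'a::topological_space set \<Rightarrow> bool" where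
  "open_Int_closed X \<longleftrightarrow> (\<exists>U C. open U \<and> closed C \<and> X = U \<inter> C)"

lemma open_Int_closedI:
  "open U \<Longrightarrow> open_Int_closed U" "closed C \<Longrightarrow> open_Int_closed C"
  "open U \<Longrightarrow> closedin (top_of_set U) X \<Longrightarrow> open_Int_closed X"
  unfolding open_Int_closed_def closedin_closed by auto

lemma open_Int_closed_Int:
  assumes "open_Int_closed X" "open_Int_closed Y"
  shows "open_Int_closed (X \<inter> Y)"
proof -
  obtain U C U' C' where "open U" "closed C" "X = U \<inter> C" "open U'" "closed C'" "Y = U' \<inter> C'"
    using assms unfolding open_Int_closed_def by blast
  then show ?thesis
    unfolding open_Int_closed_def by (intro exI[of _ "U \<inter> U'"] exI[of _ "C \<inter> C'"]) auto
qed

lemma open_Int_closed_vimage: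
  assumes X: "open_Int_closed X" and f: "continuous_on UNIV f"
  shows "open_Int_closed (f -` X)"
proof -
  obtain U C where "open U" "closed C" "X = U \<inter> C" using X unfolding open_Int_closed_def by blast
  then show ?thesis
    unfolding open_Int_closed_def
    by (intro exI[of _ "f -` U"] exI[of _ "f -` C"]) (simp add: open_vimage closed_vimage f)
qed

lemma open_Int_closed_borel: "open_Int_closed X \<Longrightarrow> X \<in> sets borel"
  unfolding open_Int_closed_def by (auto intro: borel_open borel_closed)

text \<open>Such a set is \<open>\<sigma>\<close>-compact.\<close>

lemma open_Int_closed_image_borel:
  fixes f :: "'a::euclidean_space \<Rightarrow> 'b::t2_space"
  assumes X: "open_Int_closed X" and f: "continuous_on X f"
  shows "f ` X \<in> sets borel"
proof -
  obtain U C where U: "open U" "closed C" "X = U \<inter> C" using X unfolding open_Int_closed_def by blast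
  obtain k :: "nat \<Rightarrow> 'a set" where k: "\<And>n. compact (k n)" "\<Union>(range k) = U"
    using open_Union_compact_subsets[OF U(1)] by metis
  have "f ` X = (\<Union>n. f ` (k n \<inter> C))" unfolding U(3) k(2)[symmetric] by auto
  moreover have "f ` (k n \<inter> C) \<in> sets borel" for n
  proof -
    have "k n \<inter> C \<subseteq> X" using k(2) U(3) by auto
    then have "compact (f ` (k n \<inter> C))"
      using compact_Int_closed[OF k(1) U(2)] f continuous_on_subset by (blast intro: compact_continuous_image)
    then show ?thesis by (simp add: borel_closed compact_imp_closed)
  qed
  ultimately show ?thesis by simp
qed

text \<open>The piece arises from the open set \<open>W i\<close> by removing the preimages of
  finitely many relatively open chart images.\<close>

lemma open_Int_closed_atlas_piece:
  assumes a: "atlas N \<phi> W"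
  shows "open_Int_closed (atlas_piece \<phi> W i)"
proof -
  have lp: "local_parametrization N (\<phi> j) (W j)" for j using a by (simp add: atlas_def)
  have "closedin (top_of_set (W i)) (W i \<inter> \<phi> i -` (N - (\<Union>j<i. \<phi> j ` W j)))"
  proof (rule continuous_closedin_preimage_gen[OF local_parametrizationD(5)[OF lp]])
    show "\<phi> i \<in> W i \<rightarrow> N" using local_parametrizationD(4)[OF lp, of i] by auto
    have "openin (top_of_set N) (\<Union>j<i. \<phi> j ` W j)"
      by (intro openin_Union) (use local_parametrizationD(3)[OF lp] in auto)
    then show "closedin (top_of_set N) (N - (\<Union>j<i. \<phi> j ` W j))" by (metis closedin_diff closedin_subtopology_refl subtopology_topspace topspace_euclidean_subtopology closedin_topspace)
  qed
  moreover have "W i \<inter> \<phi> i -` (N - (\<Union>j<i. \<phi> j ` W j)) = atlas_piece \<phi> W i"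
    using local_parametrizationD(4)[OF lp, of i]
    by (auto simp: atlas_piece_def disjointed_def)
  ultimately show ?thesis using open_Int_closedI(3)[OF local_parametrizationD(1)[OF lp]] by metis
qed

lemma continuous_on_tail_vec: "continuous_on A tail_vec"
  by (rule linear_continuous_on[OF bounded_linear_tail_vec])

lemma nn_integral_pos_open:
  fixes f :: "'a::euclidean_space \<Rightarrow> real"
  assumes N: "open N" "N \<noteq> {}" and f: "\<And>x. x \<in> N \<Longrightarrow> 0 < f x"
    and meas: "(\<lambda>x. ennreal (f x) * indicator N x) \<in> borel_measurable borel"
  shows "0 < (\<integral>\<^sup>+x\<in>N. ennreal (f x) \<partial>lborel)"
proof (rule ccontr)
  assume "\<not> ?thesis"
  then have "emeasure lborel {x \<in> space lborel. ennreal (f x) * indicator N x \<noteq> 0} = 0"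
    using nn_integral_0_iff[of "\<lambda>x. ennreal (f x) * indicator N x" lborel] meas by simp
  moreover have "{x \<in> space lborel. ennreal (f x) * indicator N x \<noteq> 0} = N"
    using f by (force simp: indicator_def)
  ultimately have "N \<in> null_sets lborel" using N(1) by (auto intro!: null_setsI)
  then have "negligible N" by (simp add: negligible_iff_null_sets null_sets_completionI)
  then show False using N open_not_negligible by blast
qed

text \<open>Substitution t \<mapsto> r - t. The end points of \<open>T\<close> are left free because
  the inequality uses (0, r] and the ball (0, r).\<close>

lemma nn_integral_power_s_K:
  assumes K: "K \<in> {-1, 0, 1}" and r: "r \<in> radii K" and T: "{0<..<r} \<subseteq> T" "T \<subseteq> {0..r}"
  shows "(\<integral>\<^sup>+t\<in>T. ennreal ((s_K K (r - t) / s_K K r) ^ n) \<partial>lborel) = ennreal (h_K K n r)"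
proof -
  have r0: "0 < r" by (rule radii_pos[OF r])
  have s0: "0 < s_K K r" by (rule s_K_pos[OF r])
  define F where "F x = ennreal ((s_K K x / s_K K r) ^ n) * indicator {0..r} x" for x
  have sm: "s_K K \<in> borel_measurable borel"
    by (intro borel_measurable_continuous_onI continuous_intros)
  have F: "F \<in> borel_measurable borel" unfolding F_def[abs_def] using sm by measurable
  have "(\<integral>\<^sup>+t\<in>T. ennreal ((s_K K (r - t) / s_K K r) ^ n) \<partial>lborel) = (\<integral>\<^sup>+t. F (r + -1 * t) \<partial>lborel)"
  proof (rule nn_integral_cong_AE, use AE_lborel_singleton[of 0] AE_lborel_singleton[of r] in eventually_elim)
    fix t :: real assume t: "t \<noteq> 0" "t \<noteq> r"
    then have "indicator T t = (indicator {0..r} (r - t) :: ennreal)"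
      using T by (force simp: indicator_def)
    then show "ennreal ((s_K K (r - t) / s_K K r) ^ n) * indicator T t = F (r + -1 * t)" by (simp add: F_def)
  qed
  also have "\<dots> = (\<integral>\<^sup>+x. F x \<partial>lborel)"
    using nn_integral_real_affine[OF F, of "-1" r] by simp
  also have "\<dots> = ennreal (h_K K n r)"
    unfolding F_def
  proof (rule nn_integral_has_integral_lebesgue')
    show "0 \<le> (s_K K x / s_K K r) ^ n" if "x \<in> {0..r}" for x
    proof -
      have "0 \<le> s_K K x" using that s_K_pos[OF radii_mono[OF r, of x]] by (cases "x = 0") (auto simp: less_imp_le)
      then show ?thesis using s0 by simp
    qed
    have "((\<lambda>t. s_K K t ^ n / s_K K r ^ n) has_integral h_K K n r) {0..r}"
      unfolding h_K_def by (intro has_integral_divide integrable_integral integrable_continuous_real continuous_intros)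
    then show "((\<lambda>x. (s_K K x / s_K K r) ^ n) has_integral h_K K n r) {0..r}" by (simp add: power_divide)
  qed
  finally show ?thesis .
qed

section \<open>Volume and area as measures, and atlases adapted to the normal\<close>

context bounded_domain
begin

abbreviation volume_measure :: "(real \<times> (real^('n option))) measure" where
  "volume_measure \<equiv> riemannian_measure TYPE('n option) K (space_form K)"

abbreviation area_measure :: "(real \<times> (real^('n option))) measure" where
  "area_measure \<equiv> riemannian_measure TYPE('n) K M"

lemma ex_space_form_atlas:
  obtains \<phi> :: "nat \<Rightarrow> real^('n option) \<Rightarrow> real \<times> (real^('n option))" and W
  where "atlas (space_form K) \<phi> W" "volume_measure = atlas_measure K (space_form K) \<phi> W"
proof -
  obtain p where "p \<in> M" using hypersurface(4) by blast
  then have "p \<in> space_form K" using M_subset by blast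
  then obtain \<sigma> where ok: "ster_ok K \<sigma>" using ex_ster_chart[OF K] by blast
  obtain \<phi> :: "nat \<Rightarrow> real^('n option) \<Rightarrow> real \<times> (real^('n option))" and W where a: "atlas (space_form K) \<phi> W"
    by (rule ex_atlas_submanifold[OF smooth_submanifold_space_form[OF K] local_parametrization_ster[OF ok]])
  show ?thesis using a riemannian_measure_eq_atlas_measure[OF a] by (rule that)
qed

text \<open>Every chart carries a normal field, and the given one becomes chart 0, in which the loss
  in the case of equality is measured.\<close>

lemma ex_normal_atlas:
  assumes t: "inner_tube \<phi>0 W0 m0"
  obtains \<phi> W m where "atlas M \<phi> W" "\<forall>i. inner_tube (\<phi> i) (W i) (m i)" "\<phi> 0 = \<phi>0" "W 0 = W0"
proof -
  let ?R = "\<lambda>\<phi> W. \<exists>m. inner_tube \<phi> W m"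
  obtain \<phi> W where a: "atlas M \<phi> W" "\<And>i. ?R (\<phi> i) (W i)" "\<phi> 0 = \<phi>0" "W 0 = W0"
  proof (rule ex_atlas[of ?R M \<phi>0 W0])
    show "local_parametrization M \<phi> W" if "?R \<phi> W" for \<phi> W using that inner_tubeD(1) by blast
    show "\<exists>\<phi> W. ?R \<phi> W \<and> p \<in> \<phi> ` W" if "p \<in> M" for p
      using ex_inner_tube_chart[OF that] by (metis imageI)
    show "?R \<phi>0 W0" using t by blast
  qed blast
  from a(2) obtain m where "\<forall>i. inner_tube (\<phi> i) (W i) (m i)" by metis
  then show ?thesis using a that by blast
qed

text \<open>Being a foot is one closed condition for each q in M. Closedness makes the set of feet
  measurable and the set of exceptions open.\<close>

lemma normal_map_tube:
  assumes t: "inner_tube \<phi> W m"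
  shows "open (tail_vec -` W)" "\<And>z. z \<in> tail_vec -` W \<Longrightarrow> (normal_map K \<phi> m has_derivative normal_map_deriv K \<phi> m z) (at z)"
    "normal_map K \<phi> m ` (tail_vec -` W) \<subseteq> space_form K" "continuous_on (tail_vec -` W) (normal_map K \<phi> m)"
    "closedin (top_of_set (tail_vec -` W)) {z. tail_vec z \<in> W \<and> foot (\<phi> (tail_vec z)) (z $ None)}"
proof -
  obtain U P Q where \<tau>: "tube K M \<phi> W m U P Q" using t unfolding inner_tube_def by metis
  let ?U = "tail_vec -` W"
  show oU: "open ?U" by (rule open_vimage[OF inner_tubeD(2)[OF t] continuous_on_tail_vec])
  show der: "(normal_map K \<phi> m has_derivative normal_map_deriv K \<phi> m z) (at z)" if "z \<in> ?U" for z
    using that by (intro normal_map_has_derivative[OF K \<tau>]) simp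
  show "normal_map K \<phi> m ` ?U \<subseteq> space_form K"
  proof (rule image_subsetI)
    fix z assume "z \<in> ?U"
    then show "normal_map K \<phi> m z \<in> space_form K"
      using inward_in_space_form[OF inner_tubeD(8)[OF t]] by (simp add: normal_map_inward[OF t])
  qed
  show cG: "continuous_on ?U (normal_map K \<phi> m)"
    using der has_derivative_continuous continuous_at_imp_continuous_on by blast
  have "continuous_on ?U (\<phi> \<circ> tail_vec)"
    by (intro continuous_on_compose continuous_on_tail_vec continuous_on_subset[OF local_parametrizationD(5)[OF inner_tubeD(1)[OF t]]]) auto
  then have c\<phi>: "continuous_on ?U (\<lambda>z. \<phi> (tail_vec z))" by (simp add: o_def)
  define f where "f q z = qdist K (normal_map K \<phi> m z) (\<phi> (tail_vec z)) - qdist K (normal_map K \<phi> m z) q" for q z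
  have "closedin (top_of_set ?U) (\<Inter>q\<in>M. ?U \<inter> f q -` {..0})"
    unfolding f_def
    by (intro closedin_INT hypersurface(4) continuous_closedin_preimage closed_atMost continuous_on_diff continuous_on_qdist cG c\<phi>
        continuous_on_const)
  moreover have "(\<Inter>q\<in>M. ?U \<inter> f q -` {..0}) = {z. tail_vec z \<in> W \<and> foot (\<phi> (tail_vec z)) (z $ None)}"
    using hypersurface(4) inner_tubeD(8)[OF t] by (auto simp: f_def foot_def normal_map_inward[OF t])
  ultimately show "closedin (top_of_set ?U) {z. tail_vec z \<in> W \<and> foot (\<phi> (tail_vec z)) (z $ None)}"
    by (simp only:)
qed

lemma \<Omega>_sets: "\<Omega> \<in> sets (restrict_space borel (space_form K))"
  by (rule openin_sets_restrict[OF domain(1)])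

lemma area_finite: "emeasure area_measure M < \<infinity>"
  by (rule riemannian_measure_compact_finite[OF hypersurface(1,4,2)])

lemma volume_density_pos:
  assumes "inner_tube \<phi> W m" "u \<in> W"
  shows "0 < volume_density K \<phi> u"
proof -
  obtain L J Ji S where "shape_frame K \<phi> m u L J Ji S" by (rule inner_tube_shape_frame[OF assms])
  from shape_frame_volume_density[OF this] show ?thesis by simp
qed

lemma area_pos: "0 < emeasure area_measure M"
proof -
  obtain p where "p \<in> M" using hypersurface(4) by blast
  then obtain \<phi> W m u where t: "inner_tube \<phi> W m" and u: "u \<in> W" by (rule ex_inner_tube_chart)
  note lp = inner_tubeD(1)[OF t] and oW = inner_tubeD(2)[OF t]
  have Wb: "W \<in> sets borel" using oW by simp
  have "0 < (\<integral>\<^sup>+u\<in>W. ennreal (volume_density K \<phi> u) \<partial>lborel)"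
    using u by (intro nn_integral_pos_open oW volume_density_pos[OF t] volume_density_borel[OF lp Wb]) auto
  also have "\<dots> = emeasure area_measure (\<phi> ` W)"
    by (rule riemannian_measure_chart[OF hypersurface(1) lp Wb order_refl, symmetric])
  also have "\<dots> \<le> emeasure area_measure M"
    using openin_sets_restrict[OF openin_subtopology_self, of M]
    by (intro emeasure_mono local_parametrizationD(4)[OF lp]) (simp add: sets_riemannian_measure[OF hypersurface(1,4)])
  finally show ?thesis .
qed

end

section \<open>The inequality between volume and area\<close>

context constant_mean_curvature
begin

text \<open>The bound for the Jacobian in coordinates; the indicator makes it a Borel function on
  the whole coordinate space.\<close>

definition normal_density :: "(real^'n \<Rightarrow> real \<times> (real^('n option))) \<Rightarrow> (real^'n) set \<Rightarrow> real^('n option) \<Rightarrow> real" where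
  "normal_density \<phi> W z = profile (z $ None) * (indicator W (tail_vec z) * volume_density K \<phi> (tail_vec z))"

lemma profile_pos: "0 < t \<Longrightarrow> t < r \<Longrightarrow> 0 < profile t"
  and profile_nonneg: "0 < t \<Longrightarrow> t \<le> r \<Longrightarrow> 0 \<le> profile t"
proof -
  show *: "0 < profile t" if "0 < t" "t < r" for t
    unfolding profile_def using that s_K_pos[OF r] s_K_pos[OF radii_mono[OF r, of "r - t"]] by simp
  show "0 \<le> profile t" if "0 < t" "t \<le> r"
    using *[of t] that by (cases "t = r") (auto simp: profile_def)
qed

lemma profile_borel [measurable]: "profile \<in> borel_measurable borel"
  unfolding profile_def[abs_def]
  by (intro borel_measurable_continuous_onI continuous_intros) (use s_K_pos[OF r] in auto)

lemma borel_measurable_tail_vec [measurable]: "tail_vec \<in> borel_measurable borel"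
  by (rule borel_measurable_continuous_onI[OF continuous_on_tail_vec])

lemma normal_density_borel [measurable]:
  assumes t: "inner_tube \<phi> W m"
  shows "normal_density \<phi> W \<in> borel_measurable borel"
proof -
  have "(\<lambda>u. indicator W u *\<^sub>R volume_density K \<phi> u) \<in> borel_measurable borel"
    using inner_tubeD(1,2)[OF t] by (intro borel_measurable_continuous_on_indicator continuous_on_volume_density) auto
  then have "(\<lambda>u. indicator W u * volume_density K \<phi> u) \<in> borel_measurable borel" by simp
  from measurable_compose[OF borel_measurable_tail_vec this] show ?thesis
    unfolding normal_density_def[abs_def] by measurable
qed

text \<open>Tonelli: the density is a product, and the factor that depends on t integrates to
  \<open>h_K\<close> independently of the chart.\<close>

lemma nn_integral_normal_density:
  assumes t: "inner_tube \<phi> W m" and B: "B \<in> sets borel" "B \<subseteq> W" and T: "{0<..<r} \<subseteq> T" "T \<subseteq> {0<..r}" "T \<in> sets borel"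
  shows "(\<integral>\<^sup>+z\<in>{z. tail_vec z \<in> B \<and> z $ None \<in> T}. ennreal (normal_density \<phi> W z) \<partial>lborel)
    = (\<integral>\<^sup>+u\<in>B. ennreal (volume_density K \<phi> u) \<partial>lborel) * ennreal (h_K K CARD('n) r)"
proof -
  let ?v = "\<lambda>u. ennreal (volume_density K \<phi> u) * indicator B u"
  let ?p = "\<lambda>t. ennreal (profile t) * indicator T t"
  have v: "?v \<in> borel_measurable borel" by (rule volume_density_borel[OF inner_tubeD(1)[OF t] B])
  have p: "?p \<in> borel_measurable borel" using T(3) by measurable
  have eq: "ennreal (normal_density \<phi> W z) * indicator {z. tail_vec z \<in> B \<and> z $ None \<in> T} z = ?v (tail_vec z) * ?p (z $ None)" for z
  proof (cases "tail_vec z \<in> B \<and> z $ None \<in> T")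
    case True
    then have "0 \<le> profile (z $ None)" using T(2) by (intro profile_nonneg) auto
    then show ?thesis using True B(2) by (auto simp: normal_density_def ennreal_mult' mult.commute)
  qed (auto simp: indicator_def)
  have "(\<lambda>z. ?v (tail_vec z) * ?p (z $ None)) \<in> borel_measurable borel"
    by (intro borel_measurable_times_ennreal measurable_compose[OF borel_measurable_tail_vec v] measurable_compose[OF _ p])
      (auto intro: borel_measurable_continuous_onI continuous_intros)
  then have "(\<integral>\<^sup>+z. ?v (tail_vec z) * ?p (z $ None) \<partial>lborel) = (\<integral>\<^sup>+u. (\<integral>\<^sup>+t. ?v u * ?p t \<partial>lborel) \<partial>lborel)"
    by (subst nn_integral_cons_vec) simp_all
  also have "\<dots> = (\<integral>\<^sup>+u. ?v u \<partial>lborel) * (\<integral>\<^sup>+t. ?p t \<partial>lborel)"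
    using v p by (simp add: nn_integral_cmult nn_integral_multc)
  also have "(\<integral>\<^sup>+t. ?p t \<partial>lborel) = ennreal (h_K K CARD('n) r)"
    unfolding profile_def using T by (intro nn_integral_power_s_K[OF K r]) auto
  finally show ?thesis unfolding eq .
qed

text \<open>The Heintze--Karcher inequality is the case \<open>N = {}\<close>; nonempty \<open>N\<close> serve to settle the case
  of equality.\<close>

lemma volume_le_area:
  assumes a: "atlas M \<phi> W" and t: "\<And>i. inner_tube (\<phi> i) (W i) (m i)"
    and N: "N \<in> sets borel" "N \<subseteq> {z. tail_vec z \<in> W 0 \<and> z $ None \<in> {0<..r}}"
    and nf: "\<And>z. z \<in> N \<Longrightarrow> \<not> foot (\<phi> 0 (tail_vec z)) (z $ None)"
  shows "emeasure volume_measure \<Omega> + (\<integral>\<^sup>+z\<in>N. ennreal (normal_density (\<phi> 0) (W 0) z) \<partial>lborel)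
    \<le> emeasure area_measure M * ennreal (h_K K CARD('n) r)"
proof -
  obtain \<chi>' :: "nat \<Rightarrow> real^('n option) \<Rightarrow> real \<times> (real^('n option))" and Y
    where sa: "atlas (space_form K) \<chi>' Y" and V: "volume_measure = atlas_measure K (space_form K) \<chi>' Y"
    by (rule ex_space_form_atlas)
  let ?d = "\<lambda>i z. ennreal (normal_density (\<phi> i) (W i) z)"
  let ?G = "\<lambda>i. normal_map K (\<phi> i) (m i)"
  define P where "P i = atlas_piece \<phi> W i" for i
  define B where "B i = {z. tail_vec z \<in> P i \<and> z $ None \<in> {0<..r}}" for i
  \<comment> \<open>The pairs that suffice to cover the domain. The Jacobian estimate holds only on
    them, and discarding the others leaves room for \<open>N\<close>.\<close>
  define Z where "Z i = B i \<inter> {z. tail_vec z \<in> W i \<and> foot (\<phi> i (tail_vec z)) (z $ None)}" for i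
  define I where "I = (\<integral>\<^sup>+z\<in>N. ?d 0 z \<partial>lborel)"
  have PW: "P i \<subseteq> W i" "P i \<in> sets borel" for i
    unfolding P_def by (rule atlas_piece_subset[OF a] atlas_pieces(6)[OF a])+
  have oB: "open_Int_closed (B i)" for i
  proof -
    have "B i = (tail_vec -` P i \<inter> {z. 0 < z $ None}) \<inter> {z. z $ None \<le> r}" by (auto simp: B_def)
    then show ?thesis
      unfolding P_def
      by (simp only:) (intro open_Int_closed_Int open_Int_closed_vimage[OF open_Int_closed_atlas_piece[OF a] continuous_on_tail_vec]
          open_Int_closedI(1)[OF open_Collect_less] open_Int_closedI(2)[OF closed_Collect_le] continuous_intros)
  qed
  have oZ: "open_Int_closed (Z i)" for i
    unfolding Z_def by (rule open_Int_closed_Int[OF oB open_Int_closedI(3)[OF normal_map_tube(1,5)[OF t]]])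
  have ZU: "Z i \<subseteq> tail_vec -` W i" for i by (auto simp: Z_def)
  have GZ: "?G i ` Z i \<in> sets borel" for i
    by (rule open_Int_closed_image_borel[OF oZ continuous_on_subset[OF normal_map_tube(4)[OF t] ZU]])
  have A: "\<Omega> \<inter> ?G i ` Z i \<in> sets (restrict_space borel (space_form K))" for i
  proof -
    have "\<Omega> \<inter> (space_form K \<inter> ?G i ` Z i) \<in> sets (restrict_space borel (space_form K))"
      by (rule sets.Int[OF \<Omega>_sets]) (unfold sets_restrict_space, rule imageI[OF GZ])
    moreover have "\<Omega> \<inter> (space_form K \<inter> ?G i ` Z i) = \<Omega> \<inter> ?G i ` Z i" using \<Omega>_subset by blast
    ultimately show ?thesis by simp
  qed
  have "emeasure volume_measure (\<Omega> \<inter> ?G i ` Z i) \<le> (\<integral>\<^sup>+z\<in>Z i. ?d i z \<partial>lborel)" for i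
    unfolding V
  proof (rule atlas_measure_image_le[OF sa normal_map_tube(1,3,2)[OF t] open_Int_closed_borel[OF oZ] ZU normal_density_borel[OF t] A])
    show "lin_density K (normal_map_deriv K (\<phi> i) (m i) z) \<le> normal_density (\<phi> i) (W i) z" if "z \<in> Z i" for z
      using that foot_density_le[OF t, of z i] by (auto simp: Z_def normal_density_def)
  qed auto
  \<comment> \<open>\<open>N\<close> is disjoint from \<open>Z 0\<close> and contained in
    \<open>B 0\<close>, because piece 0 is all of \<open>W 0\<close>; so its integral can be added
    on the left.\<close>
  moreover have "(\<integral>\<^sup>+z\<in>Z i. ?d i z \<partial>lborel) + (if i = 0 then I else 0) \<le> (\<integral>\<^sup>+z\<in>B i. ?d i z \<partial>lborel)" for i
  proof (cases "i = 0")
    case True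
    have m: "(\<lambda>z. ?d 0 z * indicator X z) \<in> borel_measurable lborel" if "X \<in> sets borel" for X
      using normal_density_borel[OF t] that by measurable
    have "P 0 = W 0" using a by (auto simp: P_def atlas_piece_def)
    then have NB: "N \<subseteq> B 0" using N(2) by (auto simp: B_def)
    have NZ: "N \<inter> Z 0 = {}" using nf by (auto simp: Z_def)
    have "(\<integral>\<^sup>+z\<in>Z 0. ?d 0 z \<partial>lborel) + I = (\<integral>\<^sup>+z. ?d 0 z * indicator (Z 0) z + ?d 0 z * indicator N z \<partial>lborel)"
      unfolding I_def by (rule nn_integral_add[symmetric]) (intro m N(1) open_Int_closed_borel[OF oZ])+
    also have "\<dots> \<le> (\<integral>\<^sup>+z\<in>B 0. ?d 0 z \<partial>lborel)"
      using NB NZ by (intro nn_integral_mono) (auto simp: Z_def indicator_def)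
    finally show ?thesis using True by simp
  next
    case False
    then show ?thesis by (auto intro!: nn_integral_mono simp: Z_def indicator_def)
  qed
  ultimately have le: "emeasure volume_measure (\<Omega> \<inter> ?G i ` Z i) + (if i = 0 then I else 0) \<le> (\<integral>\<^sup>+z\<in>B i. ?d i z \<partial>lborel)" for i
    by (meson add_mono order_refl order_trans)
  \<comment> \<open>A foot p of x lies in one of the pieces; its chart coordinates and the distance
    form the required \<open>z\<close>.\<close>
  have cover: "\<Omega> = (\<Union>i. \<Omega> \<inter> ?G i ` Z i)"
  proof (intro equalityI subsetI)
    fix x assume x: "x \<in> \<Omega>"
    then obtain p \<tau> where p: "foot p \<tau>" "x = inward p \<tau>" "0 < \<tau>" "K = 1 \<longrightarrow> \<tau> \<le> pi" by (rule ex_foot)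
    have "\<tau> \<le> r" by (rule foot_le[OF p(1) p(4)[rule_format]])
    have "p \<in> (\<Union>i. disjointed (\<lambda>i. \<phi> i ` W i) i)" using p(1) unfolding atlas_piece_UN[OF a] by (simp add: foot_def)
    then obtain i u where u: "u \<in> P i" "p = \<phi> i u" unfolding P_def atlas_piece_image[OF a, symmetric] by blast
    define z where "z = cons_vec u \<tau>"
    have "z \<in> Z i" using p \<open>\<tau> \<le> r\<close> u PW(1)[of i] by (auto simp: z_def Z_def B_def)
    moreover have "?G i z = x" using u PW(1)[of i] by (subst normal_map_inward[OF t]) (auto simp: z_def p)
    ultimately show "x \<in> (\<Union>i. \<Omega> \<inter> ?G i ` Z i)" using x by blast
  qed blast
  have "emeasure volume_measure \<Omega> \<le> (\<Sum>i. emeasure volume_measure (\<Omega> \<inter> ?G i ` Z i))"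
  proof -
    have "range (\<lambda>i. \<Omega> \<inter> ?G i ` Z i) \<subseteq> sets volume_measure"
      using A unfolding V sets_atlas_measure[OF sa] by blast
    from emeasure_subadditive_countably[OF this] show ?thesis using cover by simp
  qed
  moreover have "(\<Sum>i. if i = (0::nat) then I else 0) = I"
    by (subst suminf_finite[of "{0}"]) auto
  ultimately have "emeasure volume_measure \<Omega> + I
    \<le> (\<Sum>i. emeasure volume_measure (\<Omega> \<inter> ?G i ` Z i)) + (\<Sum>i. if i = (0::nat) then I else 0)"
    by (simp add: add_mono)
  also have "\<dots> = (\<Sum>i. emeasure volume_measure (\<Omega> \<inter> ?G i ` Z i) + (if i = 0 then I else 0))"
    by (intro suminf_add) auto
  also have "\<dots> \<le> (\<Sum>i. \<integral>\<^sup>+z\<in>B i. ?d i z \<partial>lborel)" by (intro suminf_le le) auto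
  also have "\<dots> = (\<Sum>i. (\<integral>\<^sup>+u\<in>P i. ennreal (volume_density K (\<phi> i) u) \<partial>lborel) * ennreal (h_K K CARD('n) r))"
    unfolding B_def by (subst nn_integral_normal_density[OF t PW(2,1)]) auto
  also have "\<dots> = emeasure area_measure M * ennreal (h_K K CARD('n) r)"
    by (simp add: emeasure_riemannian_measure_UN_chart[OF a] P_def)
  finally show ?thesis unfolding I_def .
qed

lemma equality_imp_ball:
  assumes eq: "emeasure volume_measure \<Omega> = emeasure area_measure M * ennreal (h_K K CARD('n) r)"
  shows "is_geodesic_ball K \<Omega>"
proof (rule all_foot_imp_ball, rule ccontr)
  fix p0 t0 assume p0: "p0 \<in> M" and t0: "0 < t0" "t0 < r" and nf: "\<not> foot p0 t0"
  obtain \<phi>0 W0 m0 u0 where t: "inner_tube \<phi>0 W0 m0" and u0: "u0 \<in> W0" "\<phi>0 u0 = p0" by (rule ex_inner_tube_chart[OF p0])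
  \<comment> \<open>The chart around the exceptional point becomes chart 0, so that all of it is
    available for \<open>N\<close>.\<close>
  obtain \<phi> W m where a: "atlas M \<phi> W" and "\<forall>i. inner_tube (\<phi> i) (W i) (m i)" and 0: "\<phi> 0 = \<phi>0" "W 0 = W0"
    by (rule ex_normal_atlas[OF t])
  then have ti: "inner_tube (\<phi> i) (W i) (m i)" for i by blast
  define N where "N = (tail_vec -` W0 \<inter> {z. 0 < z $ None} \<inter> {z. z $ None < r}) - {z. tail_vec z \<in> W0 \<and> foot (\<phi>0 (tail_vec z)) (z $ None)}"
  obtain C where C: "closed C" "{z. tail_vec z \<in> W0 \<and> foot (\<phi>0 (tail_vec z)) (z $ None)} = tail_vec -` W0 \<inter> C"
    using normal_map_tube(5)[OF t] unfolding closedin_closed by metis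
  have "N = (tail_vec -` W0 \<inter> {z. 0 < z $ None} \<inter> {z. z $ None < r}) - C" unfolding N_def C(2) by blast
  then have oN: "open N"
    using C(1) normal_map_tube(1)[OF t] by (auto intro!: open_Diff open_Int open_Collect_less continuous_intros)
  have "cons_vec u0 t0 \<in> N" using u0 t0 nf by (simp add: N_def)
  then have N0: "N \<noteq> {}" by blast
  have "0 < (\<integral>\<^sup>+z\<in>N. ennreal (normal_density \<phi>0 W0 z) \<partial>lborel)"
  proof (rule nn_integral_pos_open[OF oN N0])
    show "0 < normal_density \<phi>0 W0 z" if "z \<in> N" for z
      using that profile_pos[of "z $ None"] volume_density_pos[OF t] by (auto simp: N_def normal_density_def)
    show "(\<lambda>z. ennreal (normal_density \<phi>0 W0 z) * indicator N z) \<in> borel_measurable borel"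
    proof -
      note [measurable] = normal_density_borel[OF t] borel_open[OF oN]
      show ?thesis by measurable
    qed
  qed
  moreover have "emeasure volume_measure \<Omega> + (\<integral>\<^sup>+z\<in>N. ennreal (normal_density \<phi>0 W0 z) \<partial>lborel) \<le> emeasure volume_measure \<Omega>"
  proof (rule volume_le_area[OF a ti, of N, unfolded 0, folded eq])
    show "N \<in> sets borel" using oN by simp
    show "N \<subseteq> {z. tail_vec z \<in> W0 \<and> z $ None \<in> {0<..r}}" by (auto simp: N_def)
    show "\<not> foot (\<phi>0 (tail_vec z)) (z $ None)" if "z \<in> N" for z using that by (auto simp: N_def)
  qed
  \<comment> \<open>Finiteness allows the volume to be cancelled from the inequality.\<close>
  moreover have "emeasure volume_measure \<Omega> < \<infinity>"
    unfolding eq using area_finite by (simp add: ennreal_mult_less_top)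
  ultimately show False
    using ennreal_add_left_cancel_le[of "emeasure volume_measure \<Omega>" "\<integral>\<^sup>+z\<in>N. ennreal (normal_density \<phi>0 W0 z) \<partial>lborel" 0]
    by auto
qed

end

section \<open>The volume of a geodesic ball\<close>

context ball_domain
begin

text \<open>The upper bound is the general inequality. For the lower bound, the normal map is
  injective for 0 < t < r, has values in the ball and Jacobian equal to the profile; the end point t
  = r, where everything collapses to the centre, is left out.\<close>

lemma volume_ball: "emeasure volume_measure \<Omega> = emeasure area_measure M * ennreal (h_K K CARD('n) r)"
proof (rule antisym)
  obtain p where "p \<in> M" using hypersurface(4) by blast
  then obtain \<phi>0 W0 m0 u0 where t0: "inner_tube \<phi>0 W0 m0" and u0: "u0 \<in> W0" by (rule ex_inner_tube_chart)
  obtain \<phi> W m where a: "atlas M \<phi> W" and "\<forall>i. inner_tube (\<phi> i) (W i) (m i)"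
    by (rule ex_normal_atlas[OF t0])
  then have t: "inner_tube (\<phi> i) (W i) (m i)" for i by blast
  show "emeasure volume_measure \<Omega> \<le> emeasure area_measure M * ennreal (h_K K CARD('n) r)"
    using volume_le_area[OF a t, of "{}"] by simp
  obtain \<chi>' :: "nat \<Rightarrow> real^('n option) \<Rightarrow> real \<times> (real^('n option))" and Y
    where sa: "atlas (space_form K) \<chi>' Y" and V: "volume_measure = atlas_measure K (space_form K) \<chi>' Y"
    by (rule ex_space_form_atlas)
  let ?d = "\<lambda>i z. ennreal (normal_density (\<phi> i) (W i) z)"
  let ?G = "\<lambda>i. normal_map K (\<phi> i) (m i)"
  define P where "P i = atlas_piece \<phi> W i" for i
  define B where "B i = {z. tail_vec z \<in> P i \<and> z $ None \<in> {0<..<r}}" for i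
  have PW: "P i \<subseteq> W i" "P i \<in> sets borel" for i
    unfolding P_def by (rule atlas_piece_subset[OF a] atlas_pieces(6)[OF a])+
  have oB: "open_Int_closed (B i)" for i
  proof -
    have "B i = (tail_vec -` P i \<inter> {z. 0 < z $ None}) \<inter> {z. z $ None < r}" by (auto simp: B_def)
    then show ?thesis
      unfolding P_def
      by (simp only:) (intro open_Int_closed_Int open_Int_closed_vimage[OF open_Int_closed_atlas_piece[OF a] continuous_on_tail_vec]
          open_Int_closedI(1)[OF open_Collect_less] continuous_intros)
  qed
  have BU: "B i \<subseteq> tail_vec -` W i" for i using PW(1)[of i] by (auto simp: B_def)
  have G: "?G i z = inward (\<phi> i (tail_vec z)) (z $ None)" "\<phi> i (tail_vec z) \<in> M" if "z \<in> B i" for i z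
    using BU[of i] that normal_map_inward[OF t] inner_tubeD(8)[OF t] by auto
  have G\<Omega>: "?G i ` B i \<subseteq> \<Omega>" for i
    using G inward_in_ball(1) by (fastforce simp: B_def)
  have GB: "?G i ` B i \<in> sets (restrict_space borel (space_form K))" for i
  proof -
    have "?G i ` B i \<in> sets borel"
      by (rule open_Int_closed_image_borel[OF oB continuous_on_subset[OF normal_map_tube(4)[OF t] BU]])
    moreover have "?G i ` B i = space_form K \<inter> ?G i ` B i" using G\<Omega> \<Omega>_subset by blast
    ultimately show ?thesis unfolding sets_restrict_space by blast
  qed
  have eqG: "\<phi> i (tail_vec z) = \<phi> j (tail_vec w) \<and> z $ None = w $ None" if "z \<in> B i" "w \<in> B j" "?G i z = ?G j w" for i j z w
    using that G[OF that(1)] G[OF that(2)] by (intro inward_inj) (auto simp: B_def)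
  have vol: "emeasure volume_measure (?G i ` B i) = (\<integral>\<^sup>+z\<in>B i. ?d i z \<partial>lborel)" for i
    unfolding V
  proof (rule atlas_measure_image_eq[OF sa normal_map_tube(1,3,2)[OF t] open_Int_closed_borel[OF oB] BU normal_density_borel[OF t] GB])
    show "inj_on (?G i) (B i)"
    proof (rule inj_onI)
      fix z w assume zw: "z \<in> B i" "w \<in> B i" "?G i z = ?G i w"
      have "tail_vec z = tail_vec w"
        using eqG[OF zw] BU[of i] zw local_parametrizationD(6)[OF inner_tubeD(1)[OF t]] by (auto dest: inj_onD)
      then show "z = w" using eqG[OF zw] by (metis cons_tail_vec)
    qed
    show "lin_density K (normal_map_deriv K (\<phi> i) (m i) z) = normal_density (\<phi> i) (W i) z" if "z \<in> B i" for z
      using that BU[of i] ball_density[OF t, of z i] by (auto simp: B_def normal_density_def)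
  qed auto
  \<comment> \<open>By injectivity a common point has the same boundary point in both charts, but
    the images of the pieces are disjoint.\<close>
  have "disjoint_family (\<lambda>i. ?G i ` B i)"
    unfolding disjoint_family_on_def
  proof (intro ballI impI)
    fix i j :: nat assume ij: "i \<noteq> j"
    show "?G i ` B i \<inter> ?G j ` B j = {}"
    proof (rule ccontr)
      assume "?G i ` B i \<inter> ?G j ` B j \<noteq> {}"
      then obtain z w where zw: "z \<in> B i" "w \<in> B j" "?G i z = ?G j w" by blast
      have "\<phi> i (tail_vec z) \<in> \<phi> i ` P i" "\<phi> j (tail_vec w) \<in> \<phi> j ` P j" using zw by (auto simp: B_def)
      then have "\<phi> i (tail_vec z) \<in> disjointed (\<lambda>i. \<phi> i ` W i) i \<inter> disjointed (\<lambda>i. \<phi> i ` W i) j"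
        using eqG[OF zw] unfolding P_def atlas_piece_image[OF a] by simp
      then show False using disjoint_family_disjointed[of "\<lambda>i. \<phi> i ` W i"] ij unfolding disjoint_family_on_def by blast
    qed
  qed
  then have "(\<Sum>i. emeasure volume_measure (?G i ` B i)) = emeasure volume_measure (\<Union>i. ?G i ` B i)"
    using GB by (intro suminf_emeasure) (auto simp: V sets_atlas_measure[OF sa])
  also have "\<dots> \<le> emeasure volume_measure \<Omega>"
    using G\<Omega> \<Omega>_sets by (intro emeasure_mono) (auto simp: V sets_atlas_measure[OF sa])
  finally have "(\<Sum>i. \<integral>\<^sup>+z\<in>B i. ?d i z \<partial>lborel) \<le> emeasure volume_measure \<Omega>" unfolding vol .
  moreover have "(\<Sum>i. \<integral>\<^sup>+z\<in>B i. ?d i z \<partial>lborel) = (\<Sum>i. (\<integral>\<^sup>+u\<in>P i. ennreal (volume_density K (\<phi> i) u) \<partial>lborel) * ennreal (h_K K CARD('n) r))"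
    unfolding B_def by (subst nn_integral_normal_density[OF t PW(2,1)]) auto
  moreover have "\<dots> = emeasure area_measure M * ennreal (h_K K CARD('n) r)"
    by (simp add: emeasure_riemannian_measure_UN_chart[OF a] P_def)
  ultimately show "emeasure area_measure M * ennreal (h_K K CARD('n) r) \<le> emeasure volume_measure \<Omega>" by simp
qed

end

section \<open>Reduction of the theorem to the case of equality\<close>

lemma (in constant_mean_curvature) h_K_nonneg: "0 \<le> h_K K n r"
proof -
  have "0 \<le> s_K K t" if "t \<in> {0..r}" for t
    using that s_K_pos[OF radii_mono[OF r, of t]] by (cases "t = 0") (auto simp: less_imp_le)
  then show ?thesis
    unfolding h_K_def using s_K_pos[OF r] by (intro divide_nonneg_nonneg integral_nonneg integrable_continuous_real continuous_intros) auto
qed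

text \<open>\<open>measure\<close> sends infinite values to 0 and division by 0 gives 0, so volume
  and area must be known to be finite and the area positive; finiteness of the volume comes from the
  inequality itself.\<close>

lemma (in constant_mean_curvature) volume_eq_iff:
  "h_K K CARD('n) r = domain_volume K \<Omega> / boundary_area K M \<longleftrightarrow>
    emeasure volume_measure \<Omega> = emeasure area_measure M * ennreal (h_K K CARD('n) r)"
proof -
  obtain p where "p \<in> M" using hypersurface(4) by blast
  then obtain \<phi>0 W0 m0 u0 where t0: "inner_tube \<phi>0 W0 m0" and u0: "u0 \<in> W0" by (rule ex_inner_tube_chart)
  obtain \<phi> W m where a: "atlas M \<phi> W" and "\<forall>i. inner_tube (\<phi> i) (W i) (m i)"
    by (rule ex_normal_atlas[OF t0])
  then have t: "inner_tube (\<phi> i) (W i) (m i)" for i by blast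
  have "emeasure volume_measure \<Omega> \<le> emeasure area_measure M * ennreal (h_K K CARD('n) r)"
    using volume_le_area[OF a t, of "{}"] by simp
  also have "\<dots> < \<infinity>" using area_finite by (simp add: ennreal_mult_less_top)
  finally have V: "emeasure volume_measure \<Omega> = ennreal (domain_volume K \<Omega>)"
    unfolding domain_volume_def by (intro emeasure_eq_ennreal_measure) auto
  have A: "emeasure area_measure M = ennreal (boundary_area K M)"
    unfolding boundary_area_def using area_finite by (intro emeasure_eq_ennreal_measure) auto
  have "boundary_area K M > 0" using area_pos unfolding A by simp
  moreover have "0 \<le> domain_volume K \<Omega>" by (simp add: domain_volume_def)
  ultimately show ?thesis
    unfolding V A using h_K_nonneg by (auto simp: field_simps ennreal_mult'[symmetric])
qed

theorem theorem25:
  fixes K :: real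
    and \<Omega> M :: "(real \<times> (real^('n::finite option))) set"
  assumes K: "K \<in> {-1, 0, 1}"
    and domain: "openin (top_of_set (space_form K)) \<Omega>" "connected \<Omega>" "bounded \<Omega>"
    and boundary: "M = (top_of_set (space_form K)) frontier_of \<Omega>"
    and hypersurface: "smooth_submanifold TYPE('n) M" "compact M" "connected M" "M \<noteq> {}"
  shows "is_geodesic_ball K \<Omega> \<longleftrightarrow>
    (\<exists>c. (\<forall>p\<in>M. mean_curvature K \<Omega> M p = c) \<and>
         c \<in> arccot_dom K \<and> v_K K CARD('n) c = domain_volume K \<Omega> / boundary_area K M)"
proof -
  interpret bounded_domain K \<Omega> M by unfold_locales (fact assms)+
  show ?thesis
  proof
    assume "is_geodesic_ball K \<Omega>"
    then obtain x0 r where "x0 \<in> space_form K" "r > 0" "\<Omega> = geodesic_ball K x0 r"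
      unfolding is_geodesic_ball_def by blast
    then interpret ball_domain K \<Omega> M x0 r by unfold_locales
    show "\<exists>c. (\<forall>p\<in>M. mean_curvature K \<Omega> M p = c) \<and> c \<in> arccot_dom K \<and>
        v_K K CARD('n) c = domain_volume K \<Omega> / boundary_area K M"
      using mean_curvature_ball arccot_K_cot_K[OF K r] volume_ball volume_eq_iff
      by (intro exI[of _ "cot_K K r"]) (simp add: v_K_def)
  next
    assume "\<exists>c. (\<forall>p\<in>M. mean_curvature K \<Omega> M p = c) \<and> c \<in> arccot_dom K \<and>
        v_K K CARD('n) c = domain_volume K \<Omega> / boundary_area K M"
    then obtain c where c: "\<And>p. p \<in> M \<Longrightarrow> mean_curvature K \<Omega> M p = c" "c \<in> arccot_dom K"
      "v_K K CARD('n) c = domain_volume K \<Omega> / boundary_area K M" by blast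
    \<comment> \<open>Membership of \<open>c\<close> in \<open>arccot_dom K\<close> makes it the
      cotangent of an admissible radius.\<close>
    interpret constant_mean_curvature K \<Omega> M "arccot_K K c"
      by unfold_locales (simp_all add: cot_K_arccot_K[OF K c(2)] c(1))
    show "is_geodesic_ball K \<Omega>"
      using c(3) by (intro equality_imp_ball) (simp add: v_K_def volume_eq_iff)
  qed
qed


end
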